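(* Fix $L\ge 0$ and a set $\tilde\Omega$ with $\Omega^L\subseteq\tilde\Omega\subseteq C([0,T],H)$. Let $w$ be a viscosity $L$-subsolution of the doubled equation $$\partial_t w(t,x,y)-\langle A(t,x(t)),\partial_x w(t,x,y)\rangle-\langle A(t,y(t)),\partial_y w(t,x,y)\rangle+F(t,x,\partial_x w(t,x,y))-F(t,y,-\partial_y w(t,x,y))=0$$ on $[0,T]\times\tilde\Omega\times\tilde\Omega$ with $w(T,x,x)\le 0$ for all $x\in\tilde\Omega$. Then $w(t,x,x)\le 0$ for all $(t,x)\in[0,T]\times\tilde\Omega$.
   Context: Spaces. Let $T>0$. $H$ is a real Hilbert space with inner product $(\cdot,\cdot)$ and norm $|\cdot|$; $V$ is a separable reflexive Banach space with norm $\|\cdot\|$, continuously, densely and compactly embedded into $H$; $V^\ast$ is its dual with norm $\|\cdot\|_\ast$ and duality pairing $\langle x^\ast,x\rangle=x^\ast(x)$. With the usual identifications, $V\subseteq H\subseteq V^\ast$ and $\langle x,y\rangle=(x,y)$ for $x\in H$, $y\in V$. Fix $p\ge 2$, $q>1$ with $1/p+1/q=1$. For $t_0\in[0,T)$, $W_{pq}(t_0,T)$ is the space of all $\mathbf{x}\in L^p(t_0,T;V)$ possessing a generalized derivative $\mathbf{x}'\in L^q(t_0,T;V^\ast)$. Operator. $A:[0,T]\times V\to V^\ast$ is fixed and satisfies: (i) $t\mapsto\langle A(t,x),v\rangle$ is measurable for all $x,v\in V$; (ii) for a.e. $t$ and all $x,y\in V$, $\langle A(t,x)-A(t,y),x-y\rangle\ge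 0$; (iii) for a.e. $t$ and all $x,y,v\in V$, $s\mapsto\langle A(t,x+sy),v\rangle$ is continuous on $[0,1]$; (iv) there are $a_1\in L^q(0,T)$, $c_1\ge0$ with $\|A(t,x)\|_\ast\le a_1(t)+c_1\|x\|^{p-1}$ for all $x\in V$ and a.e. $t$; (v) there is $c_2>0$ with $\langle A(t,x),x\rangle\ge c_2\|x\|^p$ for all $x\in V$ and a.e. $t$. Paths and continuity. $C([0,T],H)$ carries the sup norm. On $[0,T]\times C([0,T],H)$ and its subsets use the pseudo-metric $\mathbf{d}_\infty((t,x),(s,y))=|t-s|+\sup_{r\in[0,T]}|x(r\wedge t)-y(r\wedge s)|$, and on $[0,T]\times C([0,T],H)^2$ the analogous pseudo-metric with the pair of stopped paths; (semi-)continuity in $(t,x)$ or $(t,x,y)$ is meant with respect to these (so such functions are non-anticipating). USC denotes real-valued upper semicontinuous functions. Trajectories. For $L\ge 0$ and $(t_0,x_0)\in[0,T)\times C([0,T],H)$, $\mathcal{X}^L(t_0,x_0)$ is the set of all $x\in C([0,T],H)$ with $x=x_0$ on $[0,t_0]$ for which there exist $\mathbf{x}\in W_{pq}(t_0,T)$ and $f^x\in L^2(t_0,T;H)$ with $x=\mathbf{x}$ a.e. on $(t_0,T)$, $\mathbf{x}'(t)+A(t,\mathbf{x}(t))=f^x(t)$ a.e. on $(t_0,T)$, and $|f^x(t)|\le L(1+\sup_{0\le s\le t}|x(s)|)$ a.e. on $(t_0,T)$ ($\mathbf{x}$, $f^x$ are uniquely determined by $x$). Fix $x_\ast\in H$,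 regarded as a constant path, and put $\Omega^L:=\mathcal{X}^L(0,x_\ast)$. Hypotheses on $F:[0,T]\times C([0,T],H)\times H\to\mathbb{R}$: (i) $F$ is continuous; (ii) there is $L_0\ge0$ with $|F(t,x,z)-F(t,x,\tilde z)|\le L_0(1+\sup_{0\le s\le t}|x(s)|)|z-\tilde z|$ for all $t,x,z,\tilde z$; (iii) for every $L\ge0$ and $(t_0,x_0)\in[0,T)\times C([0,T],H)$ there is a modulus of continuity $m_{L,t_0,x_0}$ such that for all $\varepsilon>0$, $t\in[t_0,T]$, $x,y\in\mathcal{X}^L(t_0,x_0)$: $F(t,x,\varepsilon^{-1}[x(t)-y(t)])-F(t,y,\varepsilon^{-1}[x(t)-y(t)])\le m_{L,t_0,x_0}(\varepsilon^{-1}|x(t)-y(t)|^2+\sup_{s\le t}|x(s)-y(s)|)$. Test functions. For $t_\ast\in[0,T)$, $\mathcal{C}^{1,1}_V([t_\ast,T]\times C([0,T],H)^2)$ is the set of continuous $\varphi:[t_\ast,T]\times C([0,T],H)^2\to\mathbb{R}$ for which there exist continuous functions (path derivatives) $\partial_t\varphi$ (real-valued) and $\partial_x\varphi,\partial_y\varphi$ ($H$-valued) on the same domain such that: (a) for every pair $(x,y)$, $x(t)\in V$ implies $\partial_x\varphi(t,x,y)\in V$, and $y(t)\in V$ implies $\partial_y\varphi(t,x,y)\in V$, for a.e. $t\in(t_\ast,T)$; (b) for every $t_0\in[t_\ast,T)$, $x_0,y_0,x,y\in C([0,T],H)$ and $\mathbf{x},\mathbf{y}\in W_{pq}(t_0,T)$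 with $x=x_0$, $y=y_0$ on $[0,t_0]$ and $x=\mathbf{x}$, $y=\mathbf{y}$ a.e. on $(t_0,T)$, and every $t\in[t_0,T]$, $\varphi(t,x,y)-\varphi(t_0,x_0,y_0)=\int_{t_0}^t\partial_t\varphi(s,x,y)+\langle\mathbf{x}'(s),\partial_x\varphi(s,x,y)\rangle+\langle\mathbf{y}'(s),\partial_y\varphi(s,x,y)\rangle\,ds$. Viscosity subsolution. For $\Omega^L\subseteq\tilde\Omega\subseteq C([0,T],H)$ and $(t_0,x_0,y_0)\in[0,T)\times\tilde\Omega\times\tilde\Omega$, let $\underline{\mathcal{A}}^Lw(t_0,x_0,y_0)$ be the set of $\varphi\in\mathcal{C}^{1,1}_V([t_0,T]\times C([0,T],H)^2)$ for which there is $T_0\in(t_0,T]$ with $0=(\varphi-w)(t_0,x_0,y_0)=\inf(\varphi-w)$, the infimum being over $[t_0,T_0]\times\mathcal{X}^L(t_0,x_0)\times\mathcal{X}^L(t_0,y_0)$. (This presupposes that $w$ is defined along these trajectories, i.e. $\mathcal{X}^L(t_0,x_0)\subseteq\tilde\Omega$ for all $(t_0,x_0)\in[0,T)\times\tilde\Omega$.) A function $w\in\mathrm{USC}([0,T]\times\tilde\Omega\times\tilde\Omega)$ is a viscosity $L$-subsolution of the doubled equation on $[0,T]\times\tilde\Omega\times\tilde\Omega$ if for every $(t_0,x_0,y_0)\in[0,T)\times\tilde\Omega\times\tilde\Omega$ and every $\varphi\in\underline{\mathcal{A}}^Lw(t_0,x_0,y_0)$ there is $(x,y)\in\mathcal{X}^L(t_0,x_0)\times\mathcal{X}^L(t_0,y_0)$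 with $$\partial_t\varphi(t_0,x_0,y_0)+\limsup_{\delta\downarrow0}\frac1\delta\int_{t_0}^{t_0+\delta}\left[-\langle A(t,\mathbf{x}(t)),\partial_x\varphi(t,x,y)\rangle-\langle A(t,\mathbf{y}(t)),\partial_y\varphi(t,x,y)\rangle\right]dt+F(t_0,x_0,\partial_x\varphi(t_0,x_0,y_0))-F(t_0,y_0,-\partial_y\varphi(t_0,x_0,y_0))\ge0.$$ *)

theory Defs
  imports "HOL-Analysis.Analysis"
begin

section \<open>The evolution triple\<close>

text \<open>The inclusion of \<open>V\<close> into \<open>H\<close> is an embedding \<open>j\<close> of the type \<open>'v\<close> into the type \<open>'h\<close>;
  the dual of \<open>V\<close> is the normed space of bounded linear functionals on \<open>'v\<close>. Separability of
  \<open>V\<close> is the class \<open>second_countable_topology\<close>, which is the same thing in a metric space.\<close>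

definition reflexive_space :: "'v::real_normed_vector itself \<Rightarrow> bool" where
  "reflexive_space _ \<longleftrightarrow>
    (\<forall>\<Lambda> :: ('v \<Rightarrow>\<^sub>L real) \<Rightarrow>\<^sub>L real. \<exists>v::'v. \<forall>l. blinfun_apply \<Lambda> l = blinfun_apply l v)"

definition dense_compact_embedding ::
    "('v::real_normed_vector \<Rightarrow>\<^sub>L 'h::real_normed_vector) \<Rightarrow> bool" where
  "dense_compact_embedding j \<longleftrightarrow>
    inj (blinfun_apply j) \<and> closure (range (blinfun_apply j)) = UNIV \<and>
    (\<forall>S. bounded S \<longrightarrow> compact (closure (blinfun_apply j ` S)))"

text \<open>The identification of an element \<open>z\<close> of \<open>H\<close> with the functional \<open>v \<mapsto> (z, v)\<close> on \<open>V\<close>.\<close>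

definition to_dual ::
    "('v::real_normed_vector \<Rightarrow>\<^sub>L 'h::real_inner) \<Rightarrow> 'h \<Rightarrow> 'v \<Rightarrow>\<^sub>L real" where
  "to_dual j z = blinfun_inner_right z o\<^sub>L j"

text \<open>An element of \<open>H\<close> that belongs to \<open>V\<close>, read as an element of \<open>V\<close>; meaningful only on
  the range of \<open>j\<close>.\<close>

definition in_V :: "('v::real_normed_vector \<Rightarrow>\<^sub>L 'h::real_normed_vector) \<Rightarrow> 'h \<Rightarrow> 'v" where
  "in_V j z = inv (blinfun_apply j) z"


section \<open>Lebesgue--Bochner spaces and generalized derivatives\<close>

text \<open>Bochner's notion of measurability, which needs no separability of the values: the
  dual of \<open>V\<close> is not an instance of \<open>second_countable_topology\<close>, so that
  \<open>borel_measurable\<close> and the library's Bochner integral are not suitable for it.\<close>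

definition strongly_measurable :: "real set \<Rightarrow> (real \<Rightarrow> 'a::real_normed_vector) \<Rightarrow> bool" where
  "strongly_measurable S f \<longleftrightarrow>
    (\<exists>s. (\<forall>n::nat. simple_function (lebesgue_on S) (s n)) \<and>
         (AE t in lebesgue_on S. (\<lambda>n. s n t) \<longlonglongrightarrow> f t))"

definition Lp :: "real \<Rightarrow> real set \<Rightarrow> (real \<Rightarrow> 'a::real_normed_vector) set" where
  "Lp r S = {f. strongly_measurable S f \<and> integrable (lebesgue_on S) (\<lambda>t. norm (f t) powr r)}"

definition scalar_test_functions :: "real \<Rightarrow> real \<Rightarrow> (real \<Rightarrow> real) set" where
  "scalar_test_functions a b =
    {\<psi>. (\<forall>n t. ((deriv ^^ n) \<psi>) differentiable (at t)) \<and>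
        (\<exists>K. compact K \<and> K \<subseteq> {a<..<b} \<and> (\<forall>t. t \<notin> K \<longrightarrow> \<psi> t = 0))}"

text \<open>The identity \<open>\<integral> \<psi>' X = - \<integral> \<psi> X'\<close> in the dual of \<open>V\<close>, evaluated at each \<open>v\<close>; evaluation
  commutes with the Bochner integral.\<close>

definition generalized_derivative ::
    "('v::real_normed_vector \<Rightarrow>\<^sub>L 'h::real_inner) \<Rightarrow> real \<Rightarrow> real \<Rightarrow>
     (real \<Rightarrow> 'v) \<Rightarrow> (real \<Rightarrow> 'v \<Rightarrow>\<^sub>L real) \<Rightarrow> bool" where
  "generalized_derivative j a b X X' \<longleftrightarrow>
    (\<forall>\<psi>\<in>scalar_test_functions a b. \<forall>v.
      (LINT t|lebesgue_on {a<..<b}. deriv \<psi> t * blinfun_apply (to_dual j (blinfun_apply j (X t))) v) =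
      - (LINT t|lebesgue_on {a<..<b}. \<psi> t * blinfun_apply (X' t) v))"

text \<open>\<open>X\<close> belongs to \<open>W\<^sub>p\<^sub>q(a,b)\<close> and \<open>X'\<close> is (a version of) its generalized derivative.\<close>

definition W_pq ::
    "('v::real_normed_vector \<Rightarrow>\<^sub>L 'h::real_inner) \<Rightarrow> real \<Rightarrow> real \<Rightarrow> real \<Rightarrow> real \<Rightarrow>
     (real \<Rightarrow> 'v) \<Rightarrow> (real \<Rightarrow> 'v \<Rightarrow>\<^sub>L real) \<Rightarrow> bool" where
  "W_pq j p q a b X X' \<longleftrightarrow>
    X \<in> Lp p {a<..<b} \<and> X' \<in> Lp q {a<..<b} \<and> generalized_derivative j a b X X'"


section \<open>The operator\<close>

definition admissible_operator ::
    "real \<Rightarrow> real \<Rightarrow> real \<Rightarrow> (real \<Rightarrow> 'v::real_normed_vector \<Rightarrow> 'v \<Rightarrow>\<^sub>L real) \<Rightarrow> bool" where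
  "admissible_operator T p q A \<longleftrightarrow>
    (\<forall>x v. (\<lambda>t. blinfun_apply (A t x) v) \<in> borel_measurable (lebesgue_on {0..T})) \<and>
    (AE t in lebesgue_on {0..T}. \<forall>x y. 0 \<le> blinfun_apply (A t x - A t y) (x - y)) \<and>
    (AE t in lebesgue_on {0..T}. \<forall>x y v.
        continuous_on {0..1} (\<lambda>s::real. blinfun_apply (A t (x + s *\<^sub>R y)) v)) \<and>
    (\<exists>a\<^sub>1 c\<^sub>1. (a\<^sub>1 :: real \<Rightarrow> real) \<in> Lp q {0..T} \<and> 0 \<le> c\<^sub>1 \<and>
        (AE t in lebesgue_on {0..T}. \<forall>x. norm (A t x) \<le> a\<^sub>1 t + c\<^sub>1 * norm x powr (p - 1))) \<and>
    (\<exists>c\<^sub>2>0. AE t in lebesgue_on {0..T}. \<forall>x. c\<^sub>2 * norm x powr p \<le> blinfun_apply (A t x) x)"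


section \<open>Paths and semicontinuity\<close>

text \<open>\<open>C([0,T],H)\<close>. Requiring \<open>extensional\<close> makes every continuous path on \<open>[0,T]\<close> correspond to
  exactly one element.\<close>

definition paths :: "real \<Rightarrow> (real \<Rightarrow> 'h::real_normed_vector) set" where
  "paths T = {x \<in> extensional {0..T}. continuous_on {0..T} x}"

definition running_sup :: "(real \<Rightarrow> 'h::real_normed_vector) \<Rightarrow> real \<Rightarrow> real" where
  "running_sup x t = (SUP s\<in>{0..t}. norm (x s))"

definition d_infty ::
    "real \<Rightarrow> real \<times> (real \<Rightarrow> 'h::real_normed_vector) \<Rightarrow> real \<times> (real \<Rightarrow> 'h) \<Rightarrow> real" where
  "d_infty T = (\<lambda>(t, x) (s, y). \<bar>t - s\<bar> + (SUP r\<in>{0..T}. norm (x (min r t) - y (min r s))))"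

definition d_infty_pair ::
    "real \<Rightarrow> real \<times> (real \<Rightarrow> 'h::real_normed_vector) \<times> (real \<Rightarrow> 'h) \<Rightarrow>
     real \<times> (real \<Rightarrow> 'h) \<times> (real \<Rightarrow> 'h) \<Rightarrow> real" where
  "d_infty_pair T = (\<lambda>(t, x, y) (s, x', y').
    d_infty T (t, \<lambda>r. (x r, y r)) (s, \<lambda>r. (x' r, y' r)))"

definition pm_continuous_on ::
    "('a \<Rightarrow> 'a \<Rightarrow> real) \<Rightarrow> 'a set \<Rightarrow> ('a \<Rightarrow> 'b::metric_space) \<Rightarrow> bool" where
  "pm_continuous_on d S f \<longleftrightarrow>
    (\<forall>a\<in>S. \<forall>\<epsilon>>0. \<exists>\<delta>>0. \<forall>b\<in>S. d a b < \<delta> \<longrightarrow> dist (f b) (f a) < \<epsilon>)"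

definition pm_usc_on :: "('a \<Rightarrow> 'a \<Rightarrow> real) \<Rightarrow> 'a set \<Rightarrow> ('a \<Rightarrow> real) \<Rightarrow> bool" where
  "pm_usc_on d S f \<longleftrightarrow>
    (\<forall>a\<in>S. \<forall>\<epsilon>>0. \<exists>\<delta>>0. \<forall>b\<in>S. d a b < \<delta> \<longrightarrow> f b < f a + \<epsilon>)"


section \<open>Trajectories\<close>

definition trajectory ::
    "real \<Rightarrow> real \<Rightarrow> real \<Rightarrow> ('v::real_normed_vector \<Rightarrow>\<^sub>L 'h::real_inner) \<Rightarrow>
     (real \<Rightarrow> 'v \<Rightarrow> 'v \<Rightarrow>\<^sub>L real) \<Rightarrow> real \<Rightarrow> real \<Rightarrow> (real \<Rightarrow> 'h) \<Rightarrow>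
     (real \<Rightarrow> 'h) \<Rightarrow> (real \<Rightarrow> 'v) \<Rightarrow> (real \<Rightarrow> 'v \<Rightarrow>\<^sub>L real) \<Rightarrow> (real \<Rightarrow> 'h) \<Rightarrow> bool" where
  "trajectory T p q j A L t\<^sub>0 x\<^sub>0 x X X' f \<longleftrightarrow>
    x \<in> paths T \<and> (\<forall>t\<in>{0..t\<^sub>0}. x t = x\<^sub>0 t) \<and>
    W_pq j p q t\<^sub>0 T X X' \<and> f \<in> Lp 2 {t\<^sub>0<..<T} \<and>
    (AE t in lebesgue_on {t\<^sub>0<..<T}. x t = blinfun_apply j (X t)) \<and>
    (AE t in lebesgue_on {t\<^sub>0<..<T}. X' t + A t (X t) = to_dual j (f t)) \<and>
    (AE t in lebesgue_on {t\<^sub>0<..<T}. norm (f t) \<le> L * (1 + running_sup x t))"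

definition trajectories ::
    "real \<Rightarrow> real \<Rightarrow> real \<Rightarrow> ('v::real_normed_vector \<Rightarrow>\<^sub>L 'h::real_inner) \<Rightarrow>
     (real \<Rightarrow> 'v \<Rightarrow> 'v \<Rightarrow>\<^sub>L real) \<Rightarrow> real \<Rightarrow> real \<Rightarrow> (real \<Rightarrow> 'h) \<Rightarrow> (real \<Rightarrow> 'h) set" where
  "trajectories T p q j A L t\<^sub>0 x\<^sub>0 = {x. \<exists>X X' f. trajectory T p q j A L t\<^sub>0 x\<^sub>0 x X X' f}"


section \<open>The Hamiltonian\<close>

definition modulus_of_continuity :: "(real \<Rightarrow> real) \<Rightarrow> bool" where
  "modulus_of_continuity m \<longleftrightarrow> m 0 = 0 \<and> mono_on {0..} m \<and> (m \<longlongrightarrow> 0) (at_right 0)"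

definition admissible_hamiltonian ::
    "real \<Rightarrow> real \<Rightarrow> real \<Rightarrow> ('v::real_normed_vector \<Rightarrow>\<^sub>L 'h::real_inner) \<Rightarrow>
     (real \<Rightarrow> 'v \<Rightarrow> 'v \<Rightarrow>\<^sub>L real) \<Rightarrow> (real \<Rightarrow> (real \<Rightarrow> 'h) \<Rightarrow> 'h \<Rightarrow> real) \<Rightarrow> bool" where
  "admissible_hamiltonian T p q j A F \<longleftrightarrow>
    pm_continuous_on (\<lambda>(t, x, z) (s, y, z'). d_infty T (t, x) (s, y) + dist z z')
      ({0..T} \<times> paths T \<times> UNIV) (\<lambda>(t, x, z). F t x z) \<and>
    (\<exists>L\<^sub>0\<ge>0. \<forall>t\<in>{0..T}. \<forall>x\<in>paths T. \<forall>z z'.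
      \<bar>F t x z - F t x z'\<bar> \<le> L\<^sub>0 * (1 + running_sup x t) * norm (z - z')) \<and>
    (\<forall>L\<ge>0. \<forall>t\<^sub>0\<in>{0..<T}. \<forall>x\<^sub>0\<in>paths T. \<exists>m. modulus_of_continuity m \<and>
      (\<forall>\<epsilon>>0. \<forall>t\<in>{t\<^sub>0..T}.
        \<forall>x\<in>trajectories T p q j A L t\<^sub>0 x\<^sub>0. \<forall>y\<in>trajectories T p q j A L t\<^sub>0 x\<^sub>0.
          F t x ((1 / \<epsilon>) *\<^sub>R (x t - y t)) - F t y ((1 / \<epsilon>) *\<^sub>R (x t - y t))
          \<le> m ((norm (x t - y t))\<^sup>2 / \<epsilon> + running_sup (\<lambda>s. x s - y s) t)))"


section \<open>Test functions and viscosity subsolutions\<close>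

text \<open>The chain rule is stated with \<open>has_bochner_integral\<close>, so it includes the integrability of
  the integrand. Path derivatives are unique on their domain, as are the \<open>V\<close>-valued version of
  a path and its generalized derivative almost everywhere.\<close>

definition path_derivatives ::
    "real \<Rightarrow> real \<Rightarrow> real \<Rightarrow> ('v::real_normed_vector \<Rightarrow>\<^sub>L 'h::real_inner) \<Rightarrow> real \<Rightarrow>
     (real \<Rightarrow> (real \<Rightarrow> 'h) \<Rightarrow> (real \<Rightarrow> 'h) \<Rightarrow> real) \<Rightarrow>
     (real \<Rightarrow> (real \<Rightarrow> 'h) \<Rightarrow> (real \<Rightarrow> 'h) \<Rightarrow> real) \<Rightarrow>
     (real \<Rightarrow> (real \<Rightarrow> 'h) \<Rightarrow> (real \<Rightarrow> 'h) \<Rightarrow> 'h) \<Rightarrow>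
     (real \<Rightarrow> (real \<Rightarrow> 'h) \<Rightarrow> (real \<Rightarrow> 'h) \<Rightarrow> 'h) \<Rightarrow> bool" where
  "path_derivatives T p q j t' \<phi> \<phi>t \<phi>x \<phi>y \<longleftrightarrow>
    (let D = {t'..T} \<times> paths T \<times> paths T in
      pm_continuous_on (d_infty_pair T) D (\<lambda>(t, x, y). \<phi>t t x y) \<and>
      pm_continuous_on (d_infty_pair T) D (\<lambda>(t, x, y). \<phi>x t x y) \<and>
      pm_continuous_on (d_infty_pair T) D (\<lambda>(t, x, y). \<phi>y t x y)) \<and>
    (\<forall>x\<in>paths T. \<forall>y\<in>paths T. AE t in lebesgue_on {t'<..<T}.
      (x t \<in> range (blinfun_apply j) \<longrightarrow> \<phi>x t x y \<in> range (blinfun_apply j)) \<and>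
      (y t \<in> range (blinfun_apply j) \<longrightarrow> \<phi>y t x y \<in> range (blinfun_apply j))) \<and>
    (\<forall>t\<^sub>0\<in>{t'..<T}. \<forall>x\<^sub>0\<in>paths T. \<forall>y\<^sub>0\<in>paths T. \<forall>x\<in>paths T. \<forall>y\<in>paths T. \<forall>X X' Y Y'.
      W_pq j p q t\<^sub>0 T X X' \<and> W_pq j p q t\<^sub>0 T Y Y' \<and>
      (\<forall>t\<in>{0..t\<^sub>0}. x t = x\<^sub>0 t \<and> y t = y\<^sub>0 t) \<and>
      (AE t in lebesgue_on {t\<^sub>0<..<T}. x t = blinfun_apply j (X t)) \<and>
      (AE t in lebesgue_on {t\<^sub>0<..<T}. y t = blinfun_apply j (Y t)) \<longrightarrow>
      (\<forall>t\<in>{t\<^sub>0..T}. has_bochner_integral (lebesgue_on {t\<^sub>0..t})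
        (\<lambda>s. \<phi>t s x y + blinfun_apply (X' s) (in_V j (\<phi>x s x y))
                     + blinfun_apply (Y' s) (in_V j (\<phi>y s x y)))
        (\<phi> t x y - \<phi> t\<^sub>0 x\<^sub>0 y\<^sub>0)))"

definition C11V ::
    "real \<Rightarrow> real \<Rightarrow> real \<Rightarrow> ('v::real_normed_vector \<Rightarrow>\<^sub>L 'h::real_inner) \<Rightarrow> real \<Rightarrow>
     (real \<Rightarrow> (real \<Rightarrow> 'h) \<Rightarrow> (real \<Rightarrow> 'h) \<Rightarrow> real) set" where
  "C11V T p q j t' =
    {\<phi>. pm_continuous_on (d_infty_pair T) ({t'..T} \<times> paths T \<times> paths T) (\<lambda>(t, x, y). \<phi> t x y) \<and>
        (\<exists>\<phi>t \<phi>x \<phi>y. path_derivatives T p q j t' \<phi> \<phi>t \<phi>x \<phi>y)}"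

text \<open>The infimum is taken in the extended reals, so that it is genuine also for functions
  unbounded from below and for an empty index set.\<close>

definition touching_functions ::
    "real \<Rightarrow> real \<Rightarrow> real \<Rightarrow> ('v::real_normed_vector \<Rightarrow>\<^sub>L 'h::real_inner) \<Rightarrow>
     (real \<Rightarrow> 'v \<Rightarrow> 'v \<Rightarrow>\<^sub>L real) \<Rightarrow> real \<Rightarrow>
     (real \<Rightarrow> (real \<Rightarrow> 'h) \<Rightarrow> (real \<Rightarrow> 'h) \<Rightarrow> real) \<Rightarrow> real \<Rightarrow> (real \<Rightarrow> 'h) \<Rightarrow> (real \<Rightarrow> 'h) \<Rightarrow>
     (real \<Rightarrow> (real \<Rightarrow> 'h) \<Rightarrow> (real \<Rightarrow> 'h) \<Rightarrow> real) set" where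
  "touching_functions T p q j A L w t\<^sub>0 x\<^sub>0 y\<^sub>0 =
    {\<phi> \<in> C11V T p q j t\<^sub>0.
      \<phi> t\<^sub>0 x\<^sub>0 y\<^sub>0 - w t\<^sub>0 x\<^sub>0 y\<^sub>0 = 0 \<and>
      (\<exists>T\<^sub>0\<in>{t\<^sub>0<..T}.
        (INF (t, x, y)\<in>{t\<^sub>0..T\<^sub>0} \<times> trajectories T p q j A L t\<^sub>0 x\<^sub>0 \<times> trajectories T p q j A L t\<^sub>0 y\<^sub>0.
          ereal (\<phi> t x y - w t x y)) = 0)}"

definition viscosity_subsolution ::
    "real \<Rightarrow> real \<Rightarrow> real \<Rightarrow> ('v::real_normed_vector \<Rightarrow>\<^sub>L 'h::real_inner) \<Rightarrow>
     (real \<Rightarrow> 'v \<Rightarrow> 'v \<Rightarrow>\<^sub>L real) \<Rightarrow> (real \<Rightarrow> (real \<Rightarrow> 'h) \<Rightarrow> 'h \<Rightarrow> real) \<Rightarrow> real \<Rightarrow>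
     (real \<Rightarrow> 'h) set \<Rightarrow> (real \<Rightarrow> (real \<Rightarrow> 'h) \<Rightarrow> (real \<Rightarrow> 'h) \<Rightarrow> real) \<Rightarrow> bool" where
  "viscosity_subsolution T p q j A F L \<Omega> w \<longleftrightarrow>
    pm_usc_on (d_infty_pair T) ({0..T} \<times> \<Omega> \<times> \<Omega>) (\<lambda>(t, x, y). w t x y) \<and>
    (\<forall>t\<^sub>0\<in>{0..<T}. \<forall>x\<^sub>0\<in>\<Omega>. \<forall>y\<^sub>0\<in>\<Omega>. \<forall>\<phi>\<in>touching_functions T p q j A L w t\<^sub>0 x\<^sub>0 y\<^sub>0. \<forall>\<phi>t \<phi>x \<phi>y.
      path_derivatives T p q j t\<^sub>0 \<phi> \<phi>t \<phi>x \<phi>y \<longrightarrow>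
      (\<exists>x X X' f y Y Y' g.
        trajectory T p q j A L t\<^sub>0 x\<^sub>0 x X X' f \<and> trajectory T p q j A L t\<^sub>0 y\<^sub>0 y Y Y' g \<and>
        0 \<le> ereal (\<phi>t t\<^sub>0 x\<^sub>0 y\<^sub>0)
            + Limsup (at_right 0) (\<lambda>\<delta>. ereal (1 / \<delta> *
                (LINT t|lebesgue_on {t\<^sub>0..t\<^sub>0 + \<delta>}.
                  - blinfun_apply (A t (X t)) (in_V j (\<phi>x t x y))
                  - blinfun_apply (A t (Y t)) (in_V j (\<phi>y t x y)))))
            + ereal (F t\<^sub>0 x\<^sub>0 (\<phi>x t\<^sub>0 x\<^sub>0 y\<^sub>0) - F t\<^sub>0 y\<^sub>0 (- \<phi>y t\<^sub>0 x\<^sub>0 y\<^sub>0))))"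

end

theory Submission
  imports Defs
begin

text \<open>If \<open>w t0 x0 x0 > 0\<close>, then \<open>w - k * (|x(t) - y(t)|^2 + \<integral> |x - y|^2) - l * (|x(t)|^2 + |y(t)|^2) + c * t + sg t\<close>
 attains its maximum over the compact set of trajectories, for large \<open>k\<close> before \<open>T\<close> and close to the diagonal.
 There \<open>|x - y|^2\<close> lies below \<open>2 * |x - m|^2 + 2 * |y - m|^2\<close>, \<open>m\<close> the midpoint of the endpoints, which yields a
 test function with gradients in \<open>V\<close>; monotonicity and coercivity make the \<open>A\<close>-terms small. The clock \<open>sg\<close> is
 infinitely steep on a null set of bad times, and along trajectories starting outside of \<open>V\<close> the energy drops
 infinitely fast, so that functions of time alone exclude these maxima. Compactness of the trajectories rests on an
 energy identity for weak limits, proved by averaging over time shifts, and on Minty's argument; the implicit Euler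
 scheme shows that they exist.\<close>

text \<open>The gradient of a test function with respect to one path must lie in \<open>V\<close> as
  soon as that path does, whatever the other path is; the gradient \<open>2 (x - y)\<close> of the
  doubling penalty violates this. Splitting at \<open>m\<close> preserves the gradients at the
  touching point, since \<open>4 (x1 - m) = 2 (x1 - y1)\<close>, and the discarded term
  \<open>|x + y - 2 m|^2\<close> has the sign that preserves touching. The viscosity inequality
  contains averages of \<open>A\<close> over shrinking intervals while \<open>A\<close> is merely
  measurable in time, so the touching time has to be a Lebesgue point of countably many functions; a
  maximum point cannot be moved there, hence the clock. The integral in the penalty answers the
  modulus of \<open>F\<close>, which contains the supremum of \<open>|x - y|\<close> over the past:
  it forces the limits of the two paths to agree on the whole past. In the energy identity the
  derivatives \<open>G n\<close> are merely bounded, yet they are paired with the limit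
  \<open>X\<close>; therefore the product rule is applied to time differences, where
  \<open>G n\<close> is paired with shifts of \<open>X\<close>, and the shifts are removed by
  approximating \<open>X\<close> in \<open>L^p\<close> by a continuous function.\<close>

abbreviation leb :: "real => real => real measure" where "leb a b == lebesgue_on {a..b}"

abbreviation mbl :: "real set => (real => 'a::topological_space) set" where "mbl S == borel_measurable (lebesgue_on S)"

abbreviation lint :: "'c measure => ('c => 'a::{banach, second_countable_topology}) => 'a" where
 "lint M f == integral\<^sup>L M f"

abbreviation meas :: "real => real => (real => 'a::topological_space) set" where "meas a b == borel_measurable (leb a b)"

abbreviation intg :: "real => real => (real => 'a::{banach, second_countable_topology}) => bool" where
 "intg a b == integrable (leb a b)"

abbreviation (input) seq_limit (infix "---->" 60) where "X ----> l == LIMSEQ X l"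

abbreviation cont :: "real => real => (real => 'a::topological_space) => bool" where "cont a b == continuous_on {a..b}"

type_synonym 'a dual = "('a, real) blinfun"

abbreviation evn :: "(nat => bool) => bool" (binder "EVN " 10) where "evn P == eventually P sequentially"

abbreviation (input) scaled (infixr "*." 75) where "c*.x == c *\<^sub>R x"

abbreviation nsq :: "'a::real_normed_vector => real" where "nsq x == (norm x)^2"

abbreviation (input) equivalent (infixr "<->" 25) where "P <-> Q == (P::bool) = Q"

lemmas meas_intg = borel_measurable_integrable and intg_diff = Bochner_Integration.integrable_diff
 and intg_cong = Bochner_Integration.integrable_cong and intg_bound = Bochner_Integration.integrable_bound
 and LI_diff = Bochner_Integration.integral_diff and LI_cong = Bochner_Integration.integral_cong
 and bl_diff_left = blinfun.diff_left and bl_diff_right = blinfun.diff_right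

section \<open>Linear functionals\<close>

definition sublinear :: "('a::real_vector => real) => bool" where
 "sublinear q <-> (ALL x y. q (x + y) <= q x + q y) & (ALL x. ALL c>=0. q (c*.x) = c*q x)"

lemma sublinear_add: "sublinear q ==> q (x + y) <= q x + q y" and sublinear_scale: "sublinear q ==> 0 <= c ==> q (c*.x) = c*q x"
 by (auto simp: sublinear_def)

lemma sublinear_zero: "sublinear q ==> q 0 = 0" using sublinear_scale[of q 0 0] by simp

lemma sublinear_uminus: "sublinear q ==> - q (- x) <= q x" using sublinear_add[of q x "- x"] sublinear_zero[of q] by simp

text \<open>The tilted functional, the lower bound of a chain and the distance to a subspace are all
  infima of this form. For homogeneity one inequality suffices: applied with \<open>1/c\<close> it
  gives its converse.\<close>

lemma sublinear_INF:
 fixes f :: "'i => 'a::real_vector => real" assumes I: "I ~= {}" and bdd: "!!x. bdd_below ((%i. f i x) ` I)"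
  and add: "!!i k x y. i : I ==> k : I ==> EX m:I. f m (x + y) <= f i x + f k y"
  and scale: "!!i c x. i : I ==> 0 < c ==> EX m:I. f m (c*.x) <= c*f i x" shows "sublinear (%x. INF i\<in>I. f i x)"
proof -
 define q where "q x = (INF i\<in>I. f i x)" for x
 have low: "q x <= f i x" if "i : I" for i x unfolding q_def by (rule cINF_lower[OF bdd that])
 have near: "EX i:I. f i x < q x + e" if "0 < e" for x e
  using cInf_lessD[of "(%i. f i x) ` I" "q x + e"] I that by (auto simp: q_def)
 have ad: "q (x + y) <= q x + q y" for x y
 proof (rule field_le_epsilon)
  fix e :: real assume "0 < e"
  then obtain i k where ik: "i : I" "f i x < q x + e/2" "k : I" "f k y < q y + e/2"
   using near[of "e/2" x] near[of "e/2" y] by auto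
  obtain m where "m : I" "f m (x + y) <= f i x + f k y" using add ik by blast
  thus "q (x + y) <= q x + q y + e" using low[of m "x + y"] ik by linarith
 qed
 have sc: "q (c*.x) <= c*q x" if c: "0 < c" for c x
 proof -
  have "q (c*.x)/c <= f i x" if i: "i : I" for i
  proof -
   obtain m where "m : I" "f m (c*.x) <= c*f i x" using scale[OF i c] by blast
   thus ?thesis using low[of m "c*.x"] c by (simp add: divide_le_eq mult.commute)
  qed
  hence "q (c*.x)/c <= q x" unfolding q_def[of x] using I by (intro cINF_greatest)
  thus ?thesis using c by (simp add: divide_le_eq mult.commute)
 qed
 have z: "q 0 = 0" using sc[of 2 0] sc[of "1/2" 0] by simp
 have "q (c*.x) = c*q x" if "0 <= c" for c x
 proof (cases "c = 0")
  case False
  hence c: "0 < c" using that by simp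
  have "q (inverse c*.(c*.x)) <= inverse c*q (c*.x)" using c by (intro sc) simp
  hence "c*q x <= q (c*.x)" using c by (simp add: field_simps)
  thus ?thesis using sc[OF c, of x] by simp
 qed (simp add: z)
 thus ?thesis using ad unfolding sublinear_def q_def by blast
qed

text \<open>The auxiliary functional of the Hahn-Banach theorem: it lies below \<open>q\<close> and
  is at most \<open>- q z\<close> at \<open>- z\<close>, so a linear functional below it takes the
  value \<open>q z\<close> at \<open>z\<close>.\<close>

definition tilt :: "('a::real_vector => real) => 'a => 'a => real" where "tilt q z y = (INF t\<in>{0..}. q (y + t*.z) - t*q z)"

lemma tilt_bdd_below: assumes "sublinear q" shows "bdd_below ((%t. q (y + t*.z) - t*q z) ` {0..})"
proof (rule bdd_belowI2)
 fix t :: real assume "t : {0..}"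
 thus "- q (- y) <= q (y + t*.z) - t*q z"
  using sublinear_add[OF assms, of "y + t*.z" "- y"] sublinear_scale[OF assms, of t z] by simp
qed

lemma tilt_le: assumes "sublinear q" "0 <= t" shows "tilt q z y <= q (y + t*.z) - t*q z"
 unfolding tilt_def using tilt_bdd_below[OF assms(1)] assms(2) by (intro cINF_lower) auto

lemma sublinear_tilt: assumes q: "sublinear q" shows "sublinear (tilt q z)" unfolding tilt_def
proof (rule sublinear_INF[OF _ tilt_bdd_below[OF q]])
 fix s :: real and x y assume s: "s : {0..}"
 show "EX m:{0..}. q (x + y + m*.z) - m*q z <= q (x + s*.z) - s*q z + (q (y + t*.z) - t*q z)" if "t : {0..}" for t
  using sublinear_add[OF q, of "x + s*.z" "y + t*.z"] s that by (intro bexI[of _ "s + t"]) (auto simp: algebra_simps)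
 show "EX m:{0..}. q (c*.x + m*.z) - m*q z <= c*(q (x + s*.z) - s*q z)" if "0 < c" for c
  using sublinear_scale[OF q, of c "x + s*.z"] s that by (intro bexI[of _ "c * s"]) (auto simp: algebra_simps)
qed simp

lemma tilt_le_self: "sublinear q ==> tilt q z y <= q y" using tilt_le[of q 0 z y] by simp

text \<open>Zorn's lemma for the reversed pointwise order. A chain is bounded by its pointwise
  infimum, which is finite because every member lies above \<open>- p (- x)\<close>.\<close>

lemma minimal_sublinear_exists:
 fixes p :: "'a::real_vector => real" assumes p: "sublinear p"
 obtains l where "sublinear l" "l <= p" "!!q. sublinear q ==> q <= l ==> q = l"
proof -
 define A where "A = {q. sublinear q & q <= p}"
 define P where "P = (%a b :: 'a => real. b <= a)"
 have "EX m:A. ALL a:A. P m a --> a = m"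
 proof (rule predicate_Zorn)
  show "partial_order_on A (relation_of P A)" by (rule partial_order_on_relation_ofI) (auto simp: P_def)
 next
  fix C assume C: "C : Chains (relation_of P A)"
  have CA: "C <= A" using C by (auto simp: Chains_def relation_of_def)
  have tot: "a <= b | b <= a" if "a : C" "b : C" for a b using C that by (auto simp: Chains_def relation_of_def P_def)
  show "EX u:A. ALL a:C. P a u"
  proof (cases "C = {}")
   case True
   thus ?thesis using p by (auto simp: A_def)
  next
   case False
   define u where "u x = (INF q\<in>C. q x)" for x
   have bdd: "bdd_below ((%q. q x) ` C)" for x
   proof (rule bdd_belowI2)
    fix q assume "q : C"
    hence "sublinear q" "q <= p" using CA by (auto simp: A_def)
    thus "- p (- x) <= q x" using sublinear_uminus[of q x] le_funD[of q p "- x"] by linarith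
   qed
   have low: "u x <= q x" if "q : C" for q x unfolding u_def using bdd that by (rule cINF_lower)
   have "sublinear u" unfolding u_def[abs_def]
   proof (rule sublinear_INF[OF False bdd])
    fix a x and y assume a: "a : C"
    hence sl: "sublinear c" if "c : C" for c using that CA by (auto simp: A_def)
    show "EX m:C. m (x + y) <= a x + b y" if b: "b : C" for b
     using tot[OF a b] sublinear_add[OF sl[OF a], of x y] sublinear_add[OF sl[OF b], of x y] a b
     by (meson add_left_mono add_right_mono le_funD order_trans)
    show "EX m:C. m (c*.x) <= c*a x" if "0 < c" for c
     using sublinear_scale[OF sl[OF a], of c x] that a by (intro bexI[of _ a]) auto
   qed
   moreover have "u <= p"
   proof -
    obtain q where q: "q : C" using False by blast
    hence "q <= p" using CA by (auto simp: A_def)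
    hence "u x <= p x" for x using low[OF q, of x] le_funD[of q p x] by simp
    thus ?thesis by (simp add: le_fun_def)
   qed
   ultimately show ?thesis using low by (auto simp: A_def P_def le_fun_def)
  qed
 qed
 then obtain m where m: "m : A" "!!a. a : A ==> a <= m ==> a = m" by (auto simp: P_def)
 show ?thesis
 proof (rule that)
  show "sublinear m" "m <= p" using m by (auto simp: A_def)
  show "q = m" if "sublinear q" "q <= m" for q using that m by (auto simp: A_def intro: order_trans)
 qed
qed

text \<open>A minimal sublinear functional is linear, and tilting \<open>p\<close> along \<open>z\<close> before minimising
 forces the value \<open>p z\<close> at \<open>z\<close>.\<close>

theorem Hahn_Banach_at_point:
 fixes p :: "'a::real_vector => real" assumes p: "sublinear p" obtains l where "linear l" "!!x. l x <= p x" "l z = p z"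
proof -
 obtain l where l: "sublinear l" "l <= tilt p z" "!!q. sublinear q ==> q <= l ==> q = l"
  using minimal_sublinear_exists[OF sublinear_tilt[OF p]] by blast
 have lp: "l x <= p x" for x using l(2) tilt_le_self[OF p, of z x] by (meson le_funD order_trans)
 \<comment> \<open>Minimality makes \<open>l\<close> a fixed point of every tilt; the choice
   \<open>t = 1\<close> in the infimum then gives superadditivity.\<close>
 have eq: "tilt l x = l" for x by (rule l(3)[OF sublinear_tilt[OF l(1)]]) (simp add: le_fun_def tilt_le_self[OF l(1)])
 have add: "l (x + y) = l x + l y" for x y using tilt_le[OF l(1), of 1 y x] sublinear_add[OF l(1), of x y] by (simp add: eq)
 have neg: "l (- x) = - l x" for x using add[of x "- x"] sublinear_zero[OF l(1)] by simp
 have "linear l"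
 proof (rule linearI[OF add])
  fix r :: real and b
  show "l (r*.b) = r*.l b"
  proof (cases "0 <= r")
   case True
   thus ?thesis by (simp add: sublinear_scale[OF l(1)])
  next
   case False
   hence "l ((- r)*.b) = (- r)*l b" by (intro sublinear_scale[OF l(1)]) simp
   thus ?thesis using neg[of "r*.b"] by simp
  qed
 qed
 moreover have "l z = p z"
 proof -
  have "l (- z) <= - p z" using le_funD[OF l(2), of "- z"] tilt_le[OF p, of 1 z "- z"] sublinear_zero[OF p] by simp
  thus ?thesis using neg[of z] lp[of z] by simp
 qed
 ultimately show ?thesis using that lp by blast
qed

lemma norming_functional:
 fixes v :: "'a::real_normed_vector" obtains l :: "'a dual" where "norm l <= 1" "l v = norm v"
proof -
 have "sublinear (norm :: 'a => real)" by (simp add: sublinear_def norm_triangle_ineq)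
 then obtain l where l: "linear l" "!!x. l x <= norm x" "l v = norm v" using Hahn_Banach_at_point[where z=v] by blast
 have b: "abs(l x) <= norm x" for x using l(2)[of x] l(2)[of "- x"] linear_neg[OF l(1), of x] by auto
 have bl: "bounded_linear l" using l(1) b by (auto simp: bounded_linear_def bounded_linear_axioms_def intro: exI[of _ 1])
 show ?thesis
 proof (rule that[of "Blinfun l"])
  show "norm (Blinfun l) <= 1" by (rule norm_blinfun_bound) (use b bl in "auto simp: bounded_linear_Blinfun_apply")
  show "Blinfun l v = norm v" using bl l by (simp add: bounded_linear_Blinfun_apply)
 qed
qed

lemma sublinear_infdist:
 fixes S :: "'a::real_normed_vector set" assumes S: "subspace S" shows "sublinear (%x. infdist x S)"
proof -
 have ne: "S ~= {}" using subspace_0[OF S] by auto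
 have "sublinear (%x. INF s\<in>S. dist x s)"
 proof (rule sublinear_INF[OF ne])
  fix s x y assume s: "s : S"
  show "EX m:S. dist (x + y) m <= dist x s + dist y t" if "t : S" for t
   by (intro bexI[of _ "s + t"] dist_triangle_add subspace_add[OF S s that])
  show "EX m:S. dist (c*.x) m <= c*dist x s" if "0 < c" for c
   using that by (intro bexI[of _ "c*.s"] subspace_scale[OF S s]) (simp add: dist_norm flip: scaleR_diff_right)
 qed auto
 thus ?thesis using ne by (simp add: infdist_def)
qed

section \<open>The evolution triple\<close>

lemma to_dual_apply [simp]: "to_dual j z v = inner z (j v)" by (simp add: to_dual_def inner_commute)

lemma norm_to_dual_le: "norm (to_dual j z) <= norm z*norm j" by (rule norm_blinfun_bound)
  (use norm_blinfun[of j] in "auto intro!: order_trans[OF Cauchy_Schwarz_ineq2] mult_left_mono simp: mult.assoc")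

lemma to_dual_add: "to_dual j (x + y) = to_dual j x + to_dual j y"
 and to_dual_diff: "to_dual j (x - y) = to_dual j x - to_dual j y" and to_dual_scaleR: "to_dual j (c*.x) = c*.to_dual j x"
 by (rule blinfun_eqI, simp add: blinfun.add_left bl_diff_left blinfun.scaleR_left
   inner_add_left inner_diff_left)+

text \<open>The uniform bound carries the Cauchy property from \<open>D\<close> to every vector. For
  functionals on the dual of \<open>V\<close> this is combined with reflexivity, for functionals on
  \<open>H\<close> with Riesz' theorem.\<close>

lemma bounded_limit_functional:
 fixes f :: "nat => 'a::real_normed_vector => real" assumes lin: "!!n. linear (f n)" and bd: "!!n h. abs(f n h) <= norm h*C"
  and D: "closure D = UNIV" and c: "!!d. d : D ==> convergent (%n. f n d)"
 obtains ph where "bounded_linear ph" "!!h. (%n. f n h) ----> ph h" "!!h. abs(ph h) <= norm h*C"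
proof -
 define r where "r = abs(C) + 1"
 have r: "0 < r" "C <= r" by (auto simp: r_def)
 have conv: "convergent (%n. f n h)" for h
 proof -
  have "Cauchy (%n. f n h)"
  proof (rule metric_CauchyI)
   fix e :: real assume e: "0 < e"
   have "h : closure D" using D by simp
   moreover have "0 < e/(4*r)" using e r by simp
   ultimately obtain d where d: "d : D" "dist d h < e/(4*r)" unfolding closure_approachable by blast
   obtain N where N: "!!m n. m >= N ==> n >= N ==> dist (f m d) (f n d) < e/2"
    using metric_CauchyD[of "%n. f n d" "e/2"] c[OF d(1)] e by (auto simp: Cauchy_convergent_iff)
   have app: "abs(f n h - f n d) <= e/4" for n
   proof -
    have "abs(f n (h - d)) <= norm (h - d)*C" by (rule bd)
    also have "... <= e/(4*r)*r"
     using d r by (intro order_trans[OF mult_left_mono[OF r(2)]] mult_right_mono) (auto simp: dist_norm norm_minus_commute)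
    also have "... = e/4" using r by simp
    finally show ?thesis by (simp add: linear_diff[OF lin])
   qed
   show "EX M. ALL m>=M. ALL n>=M. dist (f m h) (f n h) < e"
   proof (intro exI allI impI)
    fix m n assume "N <= m" "N <= n"
    thus "dist (f m h) (f n h) < e" using N[of m n] app[of m] app[of n] e unfolding dist_real_def by linarith
   qed
  qed
  thus ?thesis by (simp add: Cauchy_convergent_iff)
 qed
 define ph where "ph h = lim (%n. f n h)" for h
 have lim: "(%n. f n h) ----> ph h" for h unfolding ph_def using conv[of h] by (simp add: convergent_LIMSEQ_iff)
 have phC: "abs(ph h) <= norm h*C" for h using tendsto_rabs[OF lim[of h]] bd by (intro LIMSEQ_le_const2) auto
 have "bounded_linear ph"
 proof
  show "ph (x + y) = ph x + ph y" for x y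
   using tendsto_add[OF lim[of x] lim[of y]] lim[of "x + y"] by (simp add: linear_add[OF lin] LIMSEQ_unique)
  show "ph (c*.x) = c*.ph x" for c x
   using tendsto_mult_left[OF lim[of x], of c] lim[of "c*.x"] by (simp add: linear_scale[OF lin] LIMSEQ_unique)
  show "EX K. ALL x. norm (ph x) <= norm x*K" using phC by auto
 qed
 thus ?thesis using that lim phC by blast
qed

locale evolution_triple =
 fixes j :: "'a::{banach, second_countable_topology} \<Rightarrow>\<^sub>L 'b::{real_inner, complete_space}"
 assumes reflexive: "reflexive_space TYPE('a)" and embedding: "dense_compact_embedding j"
begin

lemma inj_j: "inj j" and dense_j: "closure (range j) = UNIV" and compact_j: "bounded S ==> compact (closure (j ` S))"
 using embedding by (auto simp: dense_compact_embedding_def)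

lemma j_eq_iff: "j u = j v <-> u = v" using inj_j by (auto dest: injD)

lemma in_V_j [simp]: "in_V j (j v) = v" by (simp add: in_V_def inj_j)

lemma reflexive_functional:
 fixes La :: "'a dual => real" assumes "bounded_linear La" obtains v where "!!l. La l = l v"
 using reflexive assms unfolding reflexive_space_def by (metis bounded_linear_Blinfun_apply)

text \<open>Otherwise Hahn-Banach gives a nonzero functional that is at most zero on the image of
  \<open>H\<close>. By reflexivity it is evaluation at some \<open>v\<close>, and the element
  \<open>h = j v\<close> forces \<open>v = 0\<close>.\<close>

lemma to_dual_dense: "closure (range (to_dual j)) = UNIV"
proof -
 let ?R = "range (to_dual j)"
 have sub: "subspace ?R" by (rule subspaceI)
   (auto simp: image_iff intro: exI[of _ 0] simp: to_dual_add[symmetric] to_dual_scaleR[symmetric]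
    intro!: blinfun_eqI)
 have "infdist l ?R = 0" for l
 proof (rule ccontr)
  assume ne: "infdist l ?R ~= 0"
  obtain La where L: "linear La" "!!x. La x <= infdist x ?R" "La l = infdist l ?R"
   using Hahn_Banach_at_point[OF sublinear_infdist[OF sub]] by blast
  have le: "infdist x ?R <= norm x" for x :: "'a dual" using infdist_le[of 0 ?R x] subspace_0[OF sub] by simp
  have b: "abs(La x) <= norm x" for x using L(2)[of x] L(2)[of "- x"] linear_neg[OF L(1), of x] le[of x] le[of "- x"] by auto
  have "bounded_linear La" using L(1) b by (auto simp: bounded_linear_def bounded_linear_axioms_def intro: exI[of _ 1])
  then obtain v where v: "!!l. La l = l v" using reflexive_functional by blast
  have "La (to_dual j h) <= 0" for h using L(2)[of "to_dual j h"] by simp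
  from this[of "j v"] have "j v = 0" by (metis inner_gt_zero_iff not_less to_dual_apply v)
  hence "v = 0" using j_eq_iff[of v 0] by simp
  thus False using ne L(3) v by simp
 qed
 thus ?thesis using in_closure_iff_infdist_zero[of ?R] by auto
qed

text \<open>Balls of \<open>V\<close> are weakly closed in \<open>H\<close>: evaluation at
  \<open>v n\<close> converges on the image of \<open>H\<close>, hence on the whole dual, and
  reflexivity turns the limit functional into a vector.\<close>

lemma bounded_weak_limit_in_range: assumes b: "!!n. norm (v n) <= r" and w: "!!h. (%n. inner h (j (v n))) ----> inner h z"
 obtains u where "j u = z" "norm u <= r" "!!l :: 'a dual. (%n. l (v n)) ----> l u"
proof -
 have r: "0 <= r" using b[of 0] norm_ge_zero order_trans by blast
 obtain La :: "'a dual => real" where La: "bounded_linear La" and lim: "!!l. (%n. blinfun_apply l (v n)) ----> La l" and bd: "!!l. abs(La l) <= norm l*r"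
 proof (rule bounded_limit_functional[OF _ _ to_dual_dense, where f="%n l. l (v n)" and C=r])
  show "linear (%l :: 'a dual. l (v n))" for n by (intro linearI) (simp_all add: blinfun.add_left blinfun.scaleR_left)
  show "abs(l (v n)) <= norm l*r" for n and l :: "'a dual"
   using norm_blinfun[of l "v n"] mult_left_mono[OF b[of n] norm_ge_zero[of l]] by simp
  show "convergent (%n. d (v n))" if "d : range (to_dual j)" for d using that by (auto intro: convergentI[OF w])
 qed blast
 obtain u where u: "!!l. La l = l u" using reflexive_functional[OF La] by blast
 have "inner h (j u) = inner h z" for h using lim[of "to_dual j h"] w[of h] u[of "to_dual j h"] by (simp add: LIMSEQ_unique)
 from this[of "j u - z"] have "inner (j u - z) (j u - z) = 0" by (simp add: inner_diff_right)
 hence "j u = z" by simp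
 moreover have "norm u <= r"
 proof -
  obtain l :: "'a dual" where l: "norm l <= 1" "l u = norm u" by (rule norming_functional)
  hence "norm u <= norm l*r" using bd[of l] u[of l] by auto
  also have "... <= 1*r" using l r by (intro mult_right_mono) auto
  finally show ?thesis by simp
 qed
 ultimately show ?thesis using that lim u by simp
qed

lemma weak_limit_in_range: assumes "!!n. norm (v n) <= r" and "(%n. j (v n)) ----> z" obtains u where "j u = z" "norm u <= r"
 using bounded_weak_limit_in_range[where v=v and z=z and r=r, OF assms(1)]
  tendsto_inner[OF tendsto_const assms(2)] by blast

text \<open>Reflexivity makes the image of a closed ball closed, hence compact and not just
  relatively compact. The finite intersection argument in \<open>Minty_on_ball\<close> rests on
  this.\<close>

lemma compact_j_cball: "compact (j ` cball 0 r)"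
proof -
 have "closed (j ` cball 0 r)" unfolding closed_sequential_limits
 proof (intro allI impI, elim conjE)
  fix f z assume f: "ALL n. f n : j ` cball 0 r" and z: "f ----> z"
  have "EX v. ALL n. v n : cball 0 r & f n = j (v n)" using f by (intro choice) (force simp: image_iff)
  then obtain v where v: "!!n. v n : cball 0 r" "!!n. f n = j (v n)" by blast
  have "!!n. norm (v n) <= r" using v(1) by simp
  moreover have "(%n. j (v n)) ----> z" using z by (simp add: v(2)[symmetric])
  ultimately obtain u where "j u = z" "norm u <= r" by (rule weak_limit_in_range)
  thus "z : j ` cball 0 r" by auto
 qed
 thus ?thesis using compact_j[of "cball 0 r"] by (simp add: closure_closed)
qed

lemma closed_j_cball: "closed (j ` cball c r)"
proof -
 have "(%x. c + x) ` cball 0 r = cball c r" by (simp add: image_add_cball)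
 hence "j ` cball c r = (+) (j c) ` (j ` cball 0 r)" by (metis (no_types, lifting) blinfun.add_right image_cong image_image)
 thus ?thesis using compact_imp_closed[OF compact_translation[OF compact_j_cball]] by simp
qed

text \<open>A subsequence bounded away from zero would have a norm limit by compactness of the
  embedding, and weak convergence identifies that limit as zero.\<close>

lemma weakly_null_imp_null: assumes b: "!!n. norm (v n) <= r" and w: "!!h. (%n. inner h (j (v n))) ----> 0"
 shows "(%n. j (v n)) ----> 0"
proof (rule ccontr)
 assume "~ (%n. j (v n)) ----> 0"
 then obtain e where e: "e > 0" "!!N. EX n>=N. e <= norm (j (v n))" by (auto simp: LIMSEQ_iff not_less)
 hence "infinite {n. e <= norm (j (v n))}" by (auto simp: infinite_nat_iff_unbounded_le)
 then obtain s :: "nat => nat" where s: "strict_mono s" "!!n. e <= norm (j (v (s n)))"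
  using infinite_enumerate by (metis mem_Collect_eq)
 have "ALL n. j (v (s n)) : j ` cball 0 r" using b by auto
 then obtain z and t :: "nat => nat" where t: "strict_mono t" "((%n. j (v (s n))) \<circ> t) ----> z"
  using compact_j_cball[of r] unfolding compact_def by meson
 have "inner z z = 0"
 proof (rule LIMSEQ_unique)
  show "(%n. inner z (j (v (s (t n))))) ----> inner z z" using tendsto_inner[OF tendsto_const t(2)] by (simp add: o_def)
  show "(%n. inner z (j (v (s (t n))))) ----> 0"
   using LIMSEQ_subseq_LIMSEQ[OF w[of z] strict_mono_o[OF s(1) t(1)]] by (simp add: o_def)
 qed
 hence "z = 0" by simp
 hence "(%n. norm (j (v (s (t n))))) ----> 0" using tendsto_norm[OF t(2)] by (simp add: o_def)
 hence "e <= 0" by (rule LIMSEQ_le_const) (use s in auto)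
 thus False using e by simp
qed

text \<open>The \<open>v n\<close> may be unbounded in \<open>V\<close>; division by
  \<open>1 + norm (v n)\<close> makes them bounded and keeps them weakly null. These quotients are
  the pointwise input of \<open>weak_product_limit\<close>.\<close>

lemma weakly_null_ratios:
 fixes l :: "'a dual" assumes w: "!!h. (%n. inner h (j (v n))) ----> 0" shows "(%n. norm (j (v n))/(1 + norm (v n))) ----> 0"
  and "(%n. l (v n)/(1 + norm (v n))) ----> 0"
proof -
 define u where "u n = inverse (1 + norm (v n))*.v n" for n
 have pos: "0 < 1 + norm (v n)" for n by (simp add: add_pos_nonneg)
 have b: "norm (u n) <= 1" for n using pos[of n] by (simp add: u_def field_simps)
 have w': "(%n. inner h (j (u n))) ----> 0" for h
 proof (rule Lim_null_comparison[OF always_eventually])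
  show "(%n. abs(inner h (j (v n)))) ----> 0" using tendsto_rabs[OF w[of h]] by simp
  show "ALL n. norm (inner h (j (u n))) <= abs(inner h (j (v n)))"
  proof
   fix n
   have "norm (inner h (j (u n))) = inverse (1 + norm (v n))*abs(inner h (j (v n)))"
    using pos[of n] by (simp add: u_def blinfun.scaleR_right abs_mult)
   also have "... <= 1*abs(inner h (j (v n)))" using pos[of n] by (intro mult_right_mono) (auto simp: field_simps)
   finally show "norm (inner h (j (u n))) <= abs(inner h (j (v n)))" by simp
  qed
 qed
 show "(%n. norm (j (v n))/(1 + norm (v n))) ----> 0"
 proof -
  have "norm (j (u n)) = norm (j (v n))/(1 + norm (v n))" for n
   using pos[of n] by (simp add: u_def blinfun.scaleR_right field_simps)
  thus ?thesis using tendsto_norm_zero[OF weakly_null_imp_null[OF b w']] by simp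
 qed
 have "!!h. (%n. inner h (j (u n))) ----> inner h 0" using w' by simp
 with b obtain z where z: "j z = 0" "!!l :: 'a dual. (%n. l (u n)) ----> l z" using bounded_weak_limit_in_range[of u 1 0] by blast
 have "z = 0" using z(1) j_eq_iff[of z 0] by simp
 hence "(%n. l (u n)) ----> 0" using z(2)[of l] by simp
 moreover have "l (u n) = l (v n)/(1 + norm (v n))" for n using pos[of n] by (simp add: u_def blinfun.scaleR_right field_simps)
 ultimately show "(%n. l (v n)/(1 + norm (v n))) ----> 0" by simp
qed

lemma countable_dense_V: obtains D :: "'a set" where "countable D" "closure D = UNIV"
proof -
 obtain D :: "'a set" where D: "countable D" "!!X. open X ==> X ~= {} ==> EX d:D. d : X" using countable_dense_setE by blast
 have "closure D = UNIV" using D(2)[of "- closure D"] closure_subset[of D] by (auto simp: open_Compl)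
 thus ?thesis using D that by blast
qed

lemma countable_dense_H: obtains D :: "'b set" where "countable D" "closure D = UNIV"
proof -
 obtain E :: "'a set" where E: "countable E" "closure E = UNIV" by (rule countable_dense_V)
 have "range j <= closure (j ` E)" using image_closure_subset[of E "j" "closure (j ` E)"] E
  by (simp add: linear_continuous_on blinfun.bounded_linear_right closure_subset)
 hence "closure (range j) <= closure (j ` E)" by (rule closure_minimal) simp
 thus ?thesis using dense_j E(1) by (intro that[of "j ` E"]) auto
qed

text \<open>Separability of the dual of \<open>V\<close>, inherited from \<open>H\<close>. It serves
  twice: weak measurability becomes strong, and Lebesgue points of the operator can be taken for
  countably many functionals at once.\<close>

lemma countable_dense_dual: obtains D :: "'b set" where "countable D" "closure (to_dual j ` D) = UNIV"
proof -
 obtain E :: "'b set" where E: "countable E" "closure E = UNIV" by (rule countable_dense_H)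
 have "bounded_linear (to_dual j)"
  by unfold_locales (auto simp: to_dual_add to_dual_scaleR intro: exI[of _ "norm j"] norm_to_dual_le)
 hence "range (to_dual j) <= closure (to_dual j ` E)" using image_closure_subset[of E "to_dual j" "closure (to_dual j ` E)"] E
  by (simp add: linear_continuous_on closure_subset)
 hence "UNIV <= closure (to_dual j ` E)"
  using to_dual_dense closure_minimal[of "range (to_dual j)" "closure (to_dual j ` E)"] by simp
 thus ?thesis using E(1) by (intro that[of E]) auto
qed

end

text \<open>The representing vector is the minimiser of \<open>norm z ^ 2 / 2 - ph z\<close>.\<close>

lemma Riesz_representation:
 fixes ph :: "'b::{real_inner, complete_space} => real" assumes bl: "bounded_linear ph" obtains z where "!!h. ph h = inner h z"
proof -
 interpret ph: bounded_linear ph by (rule bl)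
 obtain K where K: "0 <= K" "!!h. norm (ph h) <= norm h*K" using ph.nonneg_bounded by blast
 define J where "J h = inner h h/2 - ph h" for h
 have low: "- (K^2)/2 <= J h" for h
 proof -
  have "0 <= (norm h - K)^2" by simp
  moreover have "ph h <= norm h*K" using K(2)[of h] by simp
  ultimately show ?thesis by (simp add: J_def power2_eq_square algebra_simps dot_square_norm)
 qed
 define m where "m = (INF h. J h)"
 have bdd: "bdd_below (range J)" using low by (intro bdd_belowI2) auto
 have mle: "m <= J h" for h unfolding m_def using bdd by (intro cINF_lower) auto
 have "EX h. J h < m + 1/Suc n" for n using cInf_lessD[of "range J" "m + 1/Suc n"] by (auto simp: m_def)
 then obtain z where z: "!!n. J (z n) < m + 1/Suc n" by metis
 \<comment> \<open>The parallelogram identity: vectors that almost minimise \<open>J\<close> are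
   close to each other.\<close>
 have para: "inner (x - y) (x - y)/4 = J x + J y - 2*J ((1/2)*.(x + y))" for x y
  by (simp add: J_def ph.add ph.scaleR ph.diff inner_add_left inner_add_right inner_diff_left inner_diff_right
    inner_commute field_simps)
 have cau: "norm (z k - z n) ^ 2 <= 4*(1/Suc k + 1/Suc n)" for k n
  using para[of "z k" "z n"] z[of k] z[of n] mle[of "(1/2)*.(z k + z n)"] by (simp add: power2_norm_eq_inner)
 have "Cauchy z"
 proof (rule metric_CauchyI)
  fix e :: real assume e: "0 < e"
  obtain N where N: "1/real (Suc N) < e^2/8" using nat_approx_posE[of "e^2/8"] e by auto
  show "EX M. ALL m>=M. ALL n>=M. dist (z m) (z n) < e"
  proof (intro exI allI impI)
   fix k n assume "N <= k" "N <= n"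
   hence "1/real (Suc k) <= 1/Suc N" "1/real (Suc n) <= 1/Suc N" by (auto intro!: divide_left_mono)
   hence "norm (z k - z n) ^ 2 < e^2" using cau[of k n] N by simp
   thus "dist (z k) (z n) < e" using e by (simp add: dist_norm power2_less_imp_less)
  qed
 qed
 then obtain w where w: "z ----> w" by (metis Cauchy_convergent_iff convergent_def)
 have "J w <= m"
 proof (rule LIMSEQ_le)
  show "(%n. J (z n)) ----> J w" unfolding J_def by (intro tendsto_intros ph.tendsto w) auto
  show "(%n. m + 1/Suc n) ----> m"
   using tendsto_add[OF tendsto_const[of m] LIMSEQ_inverse_real_of_nat] by (simp add: inverse_eq_divide)
  show "EX N. ALL n>=N. J (z n) <= m + 1/real (Suc n)" using z less_imp_le by blast
 qed
 have "ph h = inner h w" for h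
 proof -
  have q: "0 <= t*(inner h w - ph h) + t^2*inner h h/2" for t :: real using mle[of "w + t*.h"] `J w <= m`
   by (simp add: J_def ph.add ph.scaleR inner_add_left inner_add_right inner_commute power2_eq_square algebra_simps)
  define d where "d = inner h w - ph h"
  have "d = 0"
  proof (rule ccontr)
   assume "d ~= 0"
   \<comment> \<open>Nearly the minimiser \<open>- d / inner h h\<close> of the quadratic polynomial
     in \<open>t\<close>; the summand 1 covers \<open>h = 0\<close>.\<close>
   define t where "t = - d/(inner h h + 1)"
   have p: "0 < inner h h + 1" by (simp add: add_nonneg_pos)
   have "t*d + t^2*inner h h/2 = d^2*(- 1/(inner h h + 1) + inner h h/(2*(inner h h + 1)^2))"
    using p by (simp add: t_def power2_eq_square field_simps)
   also have "... < 0"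
   proof -
    have "inner h h/(2*(inner h h + 1)^2) < 1/(inner h h + 1)"
     using p by (simp add: divide_simps power2_eq_square algebra_simps add_pos_nonneg)
    thus ?thesis using `d ~= 0` by (simp add: mult_less_0_iff)
   qed
   finally show False using q[of t] by (simp add: d_def)
  qed
  thus ?thesis by (simp add: d_def)
 qed
 thus ?thesis using that by blast
qed

text \<open>The counterpart of \<open>bounded_weak_limit_in_range\<close> in \<open>H\<close>, with
  Riesz' theorem in the role of reflexivity.\<close>

lemma weak_limit_exists:
 fixes z :: "nat => 'b::{real_inner, complete_space}" assumes b: "!!n. norm (z n) <= C" and D: "closure D = UNIV"
  and c: "!!d. d : D ==> convergent (%n. inner d (z n))" obtains w where "!!h. (%n. inner h (z n)) ----> inner h w"
proof -
 have "linear (%h. inner h (z n))" for n by (intro linearI) (simp_all add: inner_add_left)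
 moreover have "abs(inner h (z n)) <= norm h*C" for n h
  using Cauchy_Schwarz_ineq2[of h "z n"] mult_left_mono[OF b[of n] norm_ge_zero[of h]] by linarith
 ultimately obtain ph where ph: "bounded_linear ph" and lim: "!!h. (%n. inner h (z n)) ----> ph h"
  by (rule bounded_limit_functional[where f="%n h. inner h (z n)", OF _ _ D]) (auto intro: c that)
 obtain w where w: "!!h. ph h = inner h w" using Riesz_representation[OF ph] by blast
 show ?thesis by (rule that[of w]) (use lim w in simp)
qed

section \<open>Integration on intervals\<close>

abbreviation LI :: "real => real => (real => real) => real" where "LI a b g == lint (leb a b) g"

lemma AE_on_iff: "S : sets lebesgue ==> (AE t in lebesgue_on S. P t) <-> (AE t in lebesgue. t : S --> P t)"
 by (simp add: AE_restrict_space_iff)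

lemma AE_on_subset: assumes "AE t in lebesgue_on S. P t" "R <= S" "S : sets lebesgue" "R : sets lebesgue"
 shows "AE t in lebesgue_on R. P t"
proof -
 have "AE t in lebesgue. t : S --> P t" using assms by (simp add: AE_on_iff)
 hence "AE t in lebesgue. t : R --> P t" by eventually_elim (use assms in auto)
 thus ?thesis using assms by (simp add: AE_on_iff)
qed

lemma AE_lebesgue_neq: "AE t in lebesgue. t ~= (c::real)"
proof -
 have "AE t in lborel. t ~= c" by (rule AE_lborel_singleton)
 thus ?thesis by (rule AE_completion)
qed

text \<open>Trajectories and generalized derivatives are defined on open intervals, while the
  integral calculus below lives on closed ones. This lemma, \<open>meas_open_iff\<close> and
  \<open>intg_open_iff\<close> translate by discarding two points.\<close>

lemma AE_open_iff: "(AE t in lebesgue_on {a<..<b}. P t) <-> (AE t in leb a b. P t)"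
proof -
 have "(AE t in lebesgue. t : {a<..<b} --> P t) <-> (AE t in lebesgue. t : {a..b} --> P t)"
 proof
  assume "AE t in lebesgue. t : {a<..<b} --> P t"
  with AE_lebesgue_neq[of a] AE_lebesgue_neq[of b] show "AE t in lebesgue. t : {a..b} --> P t" by eventually_elim auto
 next
  assume "AE t in lebesgue. t : {a..b} --> P t"
  thus "AE t in lebesgue. t : {a<..<b} --> P t" by eventually_elim auto
 qed
 thus ?thesis by (simp add: AE_on_iff)
qed

lemma AE_sub: assumes "AE t in leb a b. P t" "a <= s" "t <= (b::real)" shows "AE t in leb s t. P t"
 using assms by (intro AE_on_subset[OF assms(1)]) auto

text \<open>Completeness of Lebesgue measure: the part of a preimage inside the exceptional null set
  is measurable, whatever it is.\<close>

lemma measurable_AE: assumes f: "f : measurable (lebesgue_on S) M" and S: "S : sets lebesgue"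
  and ae: "AE t in lebesgue_on S. f t = g t" and g: "!!t. t : S ==> g t : space M" shows "g : measurable (lebesgue_on S) M"
proof (rule measurableI)
 show "g t : space M" if "t : space (lebesgue_on S)" for t using that g by simp
next
 fix A assume A: "A : sets M"
 have "AE t in lebesgue. t : S --> f t = g t" using ae S by (simp add: AE_on_iff)
 then obtain N where N: "N : null_sets lebesgue" "{t. ~ (t : S --> f t = g t)} <= N" by (auto simp: eventually_ae_filter)
 have fg: "f t = g t" if "t : S" "t ~: N" for t using N(2) that by auto
 have Nsub: "B : sets lebesgue" if "B <= N" for B using null_sets_completion_subset[OF that N(1)] by auto
 have eq: "g -` A Int S = ((f -` A Int S) - N) Un (g -` A Int S Int N)" using fg by auto
 have "f -` A Int S : sets lebesgue" using measurable_sets[OF f A] S by (simp add: sets_restrict_space_iff)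
 moreover have "N : sets lebesgue" using N(1) by (rule null_setsD2)
 moreover have "g -` A Int S Int N : sets lebesgue" by (rule Nsub) blast
 ultimately have "(f -` A Int S - N) Un (g -` A Int S Int N) : sets lebesgue" by (intro sets.Un sets.Diff)
 hence "g -` A Int S : sets lebesgue" using eq by simp
 thus "g -` A Int space (lebesgue_on S) : sets (lebesgue_on S)" using S by (auto simp: sets_restrict_space)
qed

lemma meas_AE: assumes "f : mbl S" "S : sets lebesgue" "AE t in lebesgue_on S. f t = g t" shows "g : mbl S"
 by (rule measurable_AE[OF assms]) simp

lemma meas_sub: assumes "f : measurable (lebesgue_on S) M" "R <= S" shows "f : measurable (lebesgue_on R) M"
 using measurable_restrict_mono[OF assms] .

lemma meas_open_iff:
 fixes f :: "real => 'a::topological_space" shows "f : mbl {a<..<b} <-> f : meas a b"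
proof
 assume f: "f : mbl {a<..<b}"
 show "f : meas a b"
 proof (rule borel_measurableI)
  fix U :: "'a set" assume "open U"
  hence "f -` U Int {a<..<b} : sets lebesgue" using measurable_sets[OF f, of U] by (simp add: sets_restrict_space_iff)
  moreover have "f -` U Int {a..b} Int {a, b} : sets lebesgue"
   by (rule sets_completionI_sub[of "{a, b}"]) (auto intro: finite_imp_null_set_lborel)
  moreover have "f -` U Int {a..b} = (f -` U Int {a<..<b}) Un (f -` U Int {a..b} Int {a, b})" by force
  ultimately have "f -` U Int {a..b} : sets lebesgue" by (metis sets.Un)
  thus "f -` U Int space (leb a b) : sets (leb a b)" by (auto simp: sets_restrict_space)
 qed
qed (auto intro: meas_sub)

lemma intg_open_iff:
 fixes g :: "real => 'a::{banach, second_countable_topology}" shows "integrable (lebesgue_on {a<..<b}) g <-> intg a b g"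
  and "lint (lebesgue_on {a<..<b}) g = lint (leb a b) g"
proof -
 have ae: "AE t in lebesgue. indicat_real {a<..<b} t*.g t = indicat_real {a..b} t*.g t"
  using AE_lebesgue_neq[of a] AE_lebesgue_neq[of b] by eventually_elim (auto simp: indicator_def)
 note bm = borel_measurable_restrict_space_iff[of "{a<..<b}" lebesgue g]
  borel_measurable_restrict_space_iff[of "{a..b}" lebesgue g]
 have m: "(%t. indicat_real {a<..<b} t*.g t) : borel_measurable lebesgue <->
   (%t. indicat_real {a..b} t*.g t) : borel_measurable lebesgue" using bm meas_open_iff[of g a b] by simp
 have ir: "integrable (lebesgue_on S) g <-> integrable lebesgue (%t. indicat_real S t*.g t)"
  "lint (lebesgue_on S) g = lint lebesgue (%t. indicat_real S t*.g t)" if "S : sets lebesgue" for S :: "real set"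
  using that by (simp_all add: integrable_restrict_space integral_restrict_space)
 have S: "{a<..<b} : sets lebesgue" "{a..b} : sets lebesgue" by simp_all
 show "integrable (lebesgue_on {a<..<b}) g <-> intg a b g"
 proof (cases "(%t. indicat_real {a..b} t*.g t) : borel_measurable lebesgue")
  case True
  thus ?thesis unfolding ir(1)[OF S(1)] ir(1)[OF S(2)] using m ae by (intro integrable_cong_AE) blast+
 next
  case False
  thus ?thesis unfolding ir(1)[OF S(1)] ir(1)[OF S(2)] using m by (auto dest: meas_intg)
 qed
 show "lint (lebesgue_on {a<..<b}) g = lint (leb a b) g"
 proof (cases "(%t. indicat_real {a..b} t*.g t) : borel_measurable lebesgue")
  case True
  thus ?thesis unfolding ir(2)[OF S(1)] ir(2)[OF S(2)] using m ae by (intro integral_cong_AE) blast+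
 next
  case False
  hence "~ integrable lebesgue (%t. indicat_real {a..b} t*.g t)" "~ integrable lebesgue (%t. indicat_real {a<..<b} t*.g t)"
   using m by (blast dest: meas_intg)+
  thus ?thesis unfolding ir(2)[OF S(1)] ir(2)[OF S(2)] by (simp add: not_integrable_integral_eq)
 qed
qed

lemma intg_sub:
 fixes g :: "real => 'a::{banach, second_countable_topology}" assumes g: "intg a b g" and "a <= s" "t <= b" shows "intg s t g"
proof -
 have iff: "intg x y g <-> set_integrable lebesgue {x..y} g" for x y
  unfolding set_integrable_def by (rule integrable_restrict_space) simp
 have "set_integrable lebesgue {s..t} g" by (rule set_integrable_subset[of lebesgue "{a..b}"]) (use assms iff in auto)
 thus ?thesis by (simp add: iff)
qed

lemma LI_eq_integral: "intg a b g ==> LI a b g = integral {a..b} g" by (simp add: lebesgue_integral_eq_integral)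

lemma interval_combine:
 fixes u :: "real => 'a::{banach, second_countable_topology}" and w :: "real => 'b::topological_space"
 assumes "a <= b" "b <= (c::real)" shows "AE t in leb a b. P t ==> AE t in leb b c. P t ==> AE t in leb a c. P t"
  and "w : meas a b ==> w : meas b c ==> w : meas a c" and "intg a b u ==> intg b c u ==> intg a c u"
proof -
 have un: "{a..b} Un {b..c} = {a..c}" using assms by auto
 show "AE t in leb a c. P t" if "AE t in leb a b. P t" "AE t in leb b c. P t"
 proof -
  from that have "AE t in lebesgue. t : {a..b} --> P t" "AE t in lebesgue. t : {b..c} --> P t" by (simp_all add: AE_on_iff)
  hence "AE t in lebesgue. t : {a..c} --> P t" by eventually_elim auto
  thus ?thesis by (simp add: AE_on_iff)
 qed
 show "w : meas a c" if w: "w : meas a b" "w : meas b c"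
 proof (rule measurable_piecewise_restrict[of "{{a..b}, {b..c}}"])
  fix S assume "S : {{a..b}, {b..c}}"
  hence "S = {a..b} | S = {b..c}" and S: "S <= {a..c}" using assms by auto
  thus "w : borel_measurable (restrict_space (leb a c) S)" "S Int space (leb a c) : sets (leb a c)"
   using w by (auto simp: restrict_restrict_space Int_absorb1 sets_restrict_space_iff)
 qed (use un in auto)
 show "intg a c u" if "intg a b u" "intg b c u" using set_integrable_Un[of lebesgue "{a..b}" u "{b..c}"] that
  by (simp add: set_integrable_def integrable_restrict_space un)
qed

lemma LI_combine: assumes "intg a c g" "a <= b" "b <= c" shows "LI a b g + LI b c g = LI a c g"
proof -
 have "intg a b g" "intg b c g" using assms by (auto intro: intg_sub)
 thus ?thesis using assms Henstock_Kurzweil_Integration.integral_combine[of a b c g]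
  by (simp add: LI_eq_integral integrable_on_lebesgue_on)
qed

lemma LI_same [simp]: "lint (lebesgue_on {a}) g = (0::real)" for a :: real
 by (rule integral_eq_zero_null_sets) (auto intro!: null_sets_completionI)

lemma LI_continuous: assumes "intg a b g" shows "cont a b (%t. LI a t g)"
proof -
 have "cont a b (%t. integral {a..t} g)" using assms by (intro indefinite_integral_continuous_1 integrable_on_lebesgue_on) auto
 thus ?thesis by (rule continuous_on_eq) (use assms in "auto simp: LI_eq_integral intg_sub")
qed

lemma finite_measure_interval: "finite_measure (leb a b)" by (rule finite_measure_lebesgue_on) simp

lemma measure_lebesgue_on_interval [simp]: "a <= b ==> measure (leb a b) {a..b} = b - (a::real)"
 by (simp add: measure_restrict_space)

lemma LI_const: "a <= b ==> LI a b (%_. c) = c*(b - a)" by simp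

lemma intg_const [simp]: "intg a b (%_. c :: real)" using finite_measure.integrable_const[OF finite_measure_interval] by simp

lemma cont_intg:
 fixes g :: "real => real" assumes "cont a b g" shows "intg a b g"
 by (rule absolutely_integrable_imp_integrable[OF absolutely_integrable_continuous_real[OF assms]]) simp

lemma intg_bounded:
 fixes g :: "real => real" assumes "g : meas a b" "AE t in leb a b. abs(g t) <= C" shows "intg a b g"
 using assms by (intro finite_measure.integrable_const_bound[OF finite_measure_interval, of _ C]) auto

lemma intg_AE_le:
 fixes g h :: "real => real" assumes "intg a b h" "g : meas a b" "AE t in leb a b. abs(g t) <= h t" shows "intg a b g"
 using assms by (intro intg_bound[of _ h g]) auto

lemma LI_mono_AE: assumes "intg a b f" "intg a b g" "AE t in leb a b. f t <= g t" shows "LI a b f <= LI a b g"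
 using assms by (rule integral_mono_AE)

lemma LI_mono_subset: assumes "intg a b g" "AE t in leb a b. 0 <= g t" "a <= s" "t <= b" shows "LI s t g <= LI a b g"
 using assms by (intro integral_mono_lebesgue_on_AE) auto

lemma LI_abs_le: assumes "AE t in leb a b. abs(f t) <= g t" "intg a b g" "intg a b f" shows "abs(LI a b f) <= LI a b g"
proof -
 have "abs(LI a b f) <= LI a b (%t. abs(f t))" using integral_norm_bound[of "leb a b" f] by simp
 also have "... <= LI a b g" using assms by (intro LI_mono_AE) auto
 finally show ?thesis .
qed

section \<open>Strong measurability\<close>

text \<open>Pettis' argument. Enumerate \<open>D\<close>; the simple function \<open>s n\<close>
  picks a point nearest to \<open>f t\<close> among the first \<open>n + 1\<close>, replacing the
  old choice only by a strictly closer one. Measurable distances make this selection measurable, and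
  density makes it converge.\<close>

lemma strongly_measurableI:
 fixes f :: "real => 'a::real_normed_vector" assumes D: "countable D" "closure D = UNIV"
  and m: "!!d. d : D ==> (%t. norm (f t - d)) : mbl S" shows "strongly_measurable S f"
proof -
 have ne: "D ~= {}" using D(2) by auto
 define e where "e = from_nat_into D"
 have eD: "e n : D" for n using ne by (simp add: e_def from_nat_into)
 define s where "s = rec_nat (%t. e 0) (%n g t. if norm (f t - e (Suc n)) < norm (f t - g t) then e (Suc n) else g t)"
 have s0: "s 0 t = e 0" and sS: "s (Suc n) t = (if norm (f t - e (Suc n)) < norm (f t - s n t) then e (Suc n) else s n t)"
  for n t by (simp_all add: s_def)
 have meas: "simple_function (lebesgue_on S) (s n) & (%t. norm (f t - s n t)) : mbl S" for n
 proof (induction n)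
  case 0
  thus ?case using m[OF eD[of 0]] by (simp add: s0[abs_def])
 next
  case (Suc n)
  note [measurable] = m[OF eD[of "Suc n"]]
  have [measurable]: "(%t. norm (f t - s n t)) : mbl S" using Suc by blast
  have P: "{t : space (lebesgue_on S). norm (f t - e (Suc n)) < norm (f t - s n t)} : sets (lebesgue_on S)" by measurable
  have "simple_function (lebesgue_on S) (s (Suc n))" unfolding sS[abs_def] using Suc P by (intro simple_function_If) auto
  moreover have "(%t. norm (f t - s (Suc n) t)) : mbl S"
  proof -
   have "(%t. norm (f t - s (Suc n) t)) =
     (%t. if norm (f t - e (Suc n)) < norm (f t - s n t) then norm (f t - e (Suc n)) else norm (f t - s n t))" by (auto simp: sS)
   thus ?thesis by simp
  qed
  ultimately show ?case by blast
 qed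
 have le: "norm (f t - s n t) <= norm (f t - e k)" if "k <= n" for n k t using that
 proof (induction n)
  case 0
  thus ?case by (simp add: s0)
 next
  case (Suc n)
  thus ?case by (cases "k = Suc n") (auto simp: sS)
 qed
 have "(%n. s n t) ----> f t" for t
 proof (rule metric_LIMSEQ_I)
  fix r :: real assume "0 < r"
  then obtain d where d: "d : D" "dist d (f t) < r" using D(2) closure_approachable[of "f t" D] by blast
  then obtain k where k: "e k = d" using from_nat_into_surj[OF D(1)] by (auto simp: e_def)
  show "EX N. ALL n>=N. dist (s n t) (f t) < r"
  proof (intro exI allI impI)
   fix n assume "k <= n"
   thus "dist (s n t) (f t) < r" using le[of k n t] d k by (simp add: dist_norm norm_minus_commute)
  qed
 qed
 thus ?thesis unfolding strongly_measurable_def using meas by (intro exI[of _ s]) auto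
qed

lemma strongly_measurable_imp_borel:
 fixes f :: "real => 'a::{banach, second_countable_topology}" assumes "strongly_measurable S f" "S : sets lebesgue"
 shows "f : mbl S"
proof -
 obtain s where s: "!!n. simple_function (lebesgue_on S) (s n)" "AE t in lebesgue_on S. (%n. s n t) ----> f t"
  using assms(1) by (auto simp: strongly_measurable_def)
 have [measurable]: "s n : mbl S" for n using s(1) by (rule borel_measurable_simple_function)
 have "(%t. lim (%n. s n t)) : mbl S" by measurable
 moreover have "AE t in lebesgue_on S. lim (%n. s n t) = f t" using s(2) by eventually_elim (simp add: limI)
 ultimately show ?thesis using assms(2) meas_AE by blast
qed

lemma strongly_measurable_compose:
 fixes f :: "real => 'a::real_normed_vector" and ph :: "'a => 'b::real_normed_vector"
 assumes "strongly_measurable S f" "!!x. isCont ph x" shows "strongly_measurable S (%t. ph (f t))"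
proof -
 obtain s where s: "!!n. simple_function (lebesgue_on S) (s n)" "AE t in lebesgue_on S. (%n. s n t) ----> f t"
  using assms(1) by (auto simp: strongly_measurable_def)
 have "AE t in lebesgue_on S. (%n. ph (s n t)) ----> ph (f t)"
  using s(2) by eventually_elim (use assms(2) isCont_tendsto_compose in blast)
 thus ?thesis
  unfolding strongly_measurable_def using s(1) by (intro exI[of _ "%n t. ph (s n t)"]) (auto intro: simple_function_compose1)
qed

lemma strongly_measurable_inner:
 fixes f :: "real => 'b::real_inner" assumes "strongly_measurable S f" "S : sets lebesgue" shows "(%t. inner h (f t)) : mbl S"
 by (rule strongly_measurable_imp_borel[OF strongly_measurable_compose[OF assms(1)] assms(2)]) simp

lemma strongly_measurable_blinfun_apply:
 fixes f :: "real => 'a::real_normed_vector \<Rightarrow>\<^sub>L real" assumes "strongly_measurable S f" "S : sets lebesgue"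
 shows "(%t. f t v) : mbl S" by (rule strongly_measurable_imp_borel[OF strongly_measurable_compose[OF assms(1)] assms(2)])
  (simp add: blinfun.isCont)

text \<open>Along a simple function the composition is a finite sum of measurable pieces, and
  continuity in the second argument passes to the limit. Applied to pairings and, by demicontinuity,
  to the nonlinear operator tested with a fixed vector.\<close>

lemma Caratheodory_measurable:
 fixes ph :: "real => 'a::{banach, second_countable_topology} => real" assumes S: "S : sets lebesgue"
  and m: "!!v. (%t. ph t v) : mbl S" and c: "AE t in lebesgue_on S. ALL u v. u ----> v --> (%n. ph t (u n)) ----> ph t v"
  and X: "X : mbl S" shows "(%t. ph t (X t)) : mbl S"
proof -
 obtain s where s: "!!n. simple_function (lebesgue_on S) (s n)" "!!t. t : S ==> (%n. s n t) ----> X t"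
  using borel_measurable_implies_sequence_metric[OF X, of 0] by auto
 have meas: "(%t. ph t (s n t)) : mbl S" for n
 proof -
  have fin: "finite (s n ` S)" using simple_functionD(1)[OF s(1)] by simp
  have "(%t. SUM v:s n ` S. indicator (s n -` {v} Int S) t*ph t v) : mbl S" using m simple_functionD(2)[OF s(1)[of n]]
   by (intro borel_measurable_sum borel_measurable_times borel_measurable_indicator) auto
  moreover have "(SUM v:s n ` S. indicator (s n -` {v} Int S) t*ph t v) = ph t (s n t)" if "t : S" for t
  proof -
   have "(SUM v:s n ` S. indicator (s n -` {v} Int S) t*ph t v) = (SUM v:{s n t}. ph t v)"
    using fin that by (intro sum.mono_neutral_cong_right) (auto simp: indicator_def)
   thus ?thesis by simp
  qed
  ultimately show ?thesis by (subst measurable_lebesgue_cong[symmetric]) auto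
 qed
 hence m: "(%t. lim (%n. ph t (s n t))) : mbl S" by measurable
 have ae: "AE t in lebesgue_on S. lim (%n. ph t (s n t)) = ph t (X t)" using c AE_space
 proof eventually_elim
  case (elim t)
  hence "(%n. ph t (s n t)) ----> ph t (X t)" using s(2)[of t] by simp
  thus ?case by (rule limI)
 qed
 show ?thesis by (rule meas_AE[OF m S ae])
qed

lemma norm_le_iff_dense:
 fixes B :: "'b => 'a::real_normed_vector => real"
 assumes D: "closure D = UNIV" and c: "continuous_on UNIV (B x)" and r: "!!d. d : D ==> abs(B x d) <= r*norm d"
 shows "abs(B x v) <= r*norm v"
proof -
 have "closed {v. abs(B x v) <= r*norm v}" by (intro closed_Collect_le continuous_intros c)
 hence "closure D <= {v. abs(B x v) <= r*norm v}" using r by (intro closure_minimal) auto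
 thus ?thesis using D by auto
qed

text \<open>A bound on the norm of a functional is a countable family of conditions, one for each
  vector of the dense set.\<close>

lemma meas_norm_blinfun:
 fixes D :: "'a::real_normed_vector set" and G :: "real => 'a dual"
 assumes D: "countable D" "closure D = UNIV" and m: "!!v. (%t. G t v) : mbl S" shows "(%t. norm (G t)) : mbl S"
proof -
 have iff: "norm l <= r <-> 0 <= r & (ALL d:D. abs(l d) <= r*norm d)" for l :: "'a dual" and r
 proof
  assume "norm l <= r"
  thus "0 <= r & (ALL d:D. abs(l d) <= r*norm d)" using norm_blinfun[of l] order_trans[OF norm_ge_zero[of l]]
   by (auto intro!: order_trans[OF norm_blinfun[of l, unfolded real_norm_def]] mult_right_mono)
 next
  assume r: "0 <= r & (ALL d:D. abs(l d) <= r*norm d)"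
  have "abs(l v) <= r*norm v" for v by (rule norm_le_iff_dense[OF D(2), where B="blinfun_apply"])
    (use r in "auto intro: linear_continuous_on blinfun.bounded_linear_right")
  thus "norm l <= r" using r by (intro norm_blinfun_bound) auto
 qed
 show ?thesis unfolding borel_measurable_iff_le
 proof
  fix r :: real
  note [measurable] = m
  have "{t : space (lebesgue_on S). norm (G t) <= r} =
   {t : space (lebesgue_on S). 0 <= r & (ALL d:D. abs(G t d) <= r*norm d)}" using iff by blast
  also have "... : sets (lebesgue_on S)" using D(1) by measurable
  finally show "{t : space (lebesgue_on S). norm (G t) <= r} : sets (lebesgue_on S)" .
 qed
qed

context evolution_triple
begin

lemma meas_norm_dual:
 fixes G :: "real => 'a dual" assumes m: "!!v. (%t. G t v) : mbl S" shows "(%t. norm (G t)) : mbl S"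
 by (rule countable_dense_V) (rule meas_norm_blinfun[OF _ _ m])

lemma meas_norm_H:
 fixes f :: "real => 'b" assumes m: "!!h. (%t. inner h (f t)) : mbl S" shows "(%t. norm (f t)) : mbl S"
proof -
 have eq: "norm (blinfun_inner_right x) = norm x" for x :: 'b
 proof (rule antisym)
  show "norm (blinfun_inner_right x) <= norm x" by (rule norm_blinfun_bound) (simp_all add: Cauchy_Schwarz_ineq2)
  have "norm x*norm x <= norm (blinfun_inner_right x)*norm x"
   using norm_blinfun[of "blinfun_inner_right x" x] by (simp add: dot_square_norm power2_eq_square)
  thus "norm x <= norm (blinfun_inner_right x)" by (cases "x = 0") auto
 qed
 have "(%t. norm (blinfun_inner_right (f t))) : mbl S"
  by (rule countable_dense_H) (rule meas_norm_blinfun, assumption+, use m in "simp add: inner_commute")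
 thus ?thesis by (simp add: eq)
qed

lemma strongly_measurable_dual:
 fixes G :: "real => 'a dual" assumes m: "!!v. (%t. G t v) : mbl S" shows "strongly_measurable S G"
proof -
 obtain D :: "'b set" where D: "countable D" "closure (to_dual j ` D) = UNIV" by (rule countable_dense_dual)
 have "(%t. norm (G t - l)) : mbl S" for l by (rule meas_norm_dual) (use m in "auto simp: bl_diff_left")
 thus ?thesis using D by (intro strongly_measurableI[of "to_dual j ` D"]) auto
qed

lemma strongly_measurable_H:
 fixes f :: "real => 'b" assumes m: "!!h. (%t. inner h (f t)) : mbl S" shows "strongly_measurable S f"
proof -
 obtain D :: "'b set" where D: "countable D" "closure D = UNIV" by (rule countable_dense_H)
 have "(%t. norm (f t - l)) : mbl S" for l by (rule meas_norm_H) (use m in "auto simp: inner_diff_right")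
 thus ?thesis using D by (intro strongly_measurableI[of D]) auto
qed

lemma strongly_measurable_V:
 fixes X :: "real => 'a" assumes [measurable]: "X : mbl S" shows "strongly_measurable S X"
proof -
 obtain D :: "'a set" where D: "countable D" "closure D = UNIV" by (rule countable_dense_V)
 show ?thesis using D by (rule strongly_measurableI) measurable
qed

lemma pairing_measurable:
 fixes G :: "real => 'a dual" assumes "S : sets lebesgue" "!!v. (%t. G t v) : mbl S" "X : mbl S" shows "(%t. G t (X t)) : mbl S"
 by (rule Caratheodory_measurable[OF assms(1,2) _ assms(3)]) (auto intro!: tendsto_intros)

text \<open>Polarisation reduces the product of two varying vectors to three norms.\<close>

lemma inner_measurable:
 fixes f g :: "real => 'b" assumes "!!h. (%t. inner h (f t)) : mbl S" "!!h. (%t. inner h (g t)) : mbl S"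
 shows "(%t. inner (f t) (g t)) : mbl S"
proof -
 have "(%t. norm (f t + g t)) : mbl S" by (rule meas_norm_H) (use assms in "auto simp: inner_add_right")
 moreover note meas_norm_H[OF assms(1)] meas_norm_H[OF assms(2)]
 ultimately have "(%t. (nsq (f t + g t) - nsq (f t) - nsq (g t))/2)
   : mbl S" by simp
 moreover have "(nsq (f t + g t) - nsq (f t) - nsq (g t))/2 = inner (f t) (g t)" for t
  by (simp add: power2_norm_eq_inner inner_add_left inner_add_right inner_commute)
 ultimately show ?thesis by simp
qed
end

section \<open>Young's inequality\<close>

lemma Young_scaled:
 fixes p q th :: real assumes "1 < p" "1 < q" "1/p + 1/q = 1" "0 < th"
 obtains C where "0 <= C" "!!x y. 0 <= x ==> 0 <= y ==> x*y <= th*x powr q + C*y powr p"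
proof
 \<comment> \<open>The factor moved from one variable to the other, chosen such that its
   \<open>q\<close>-th power is the prescribed weight \<open>th\<close>.\<close>
 define c where "c = th powr (1/q)"
 have c: "0 < c" "c powr q = th" using assms by (auto simp: c_def powr_powr)
 show "0 <= (1 / c) powr p" by simp
 fix x y :: real assume xy: "0 <= x" "0 <= y"
 have "x*y = (y / c)*(c*x)" using c by simp
 also have "... <= (y / c) powr p/p + (c*x) powr q/q" using assms xy c by (intro Youngs_inequality) auto
 also have "... <= (y / c) powr p + (c*x) powr q"
  using assms mult_right_mono[of 1 p "(y / c) powr p"] mult_right_mono[of 1 q "(c*x) powr q"]
  by (intro add_mono) (simp_all add: divide_le_eq mult.commute)
 also have "... = th*x powr q + (1 / c) powr p*y powr p" using c xy by (simp add: powr_mult powr_divide)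
 finally show "x*y <= th*x powr q + (1 / c) powr p*y powr p" .
qed

lemma powr_sum_le:
 fixes x y p :: real assumes "0 <= x" "0 <= y" "0 <= p" shows "(x + y) powr p <= 2 powr p*(x powr p + y powr p)"
proof -
 have "(x + y) powr p <= (2*max x y) powr p" using assms by (intro powr_mono2) auto
 also have "... = 2 powr p*max x y powr p" using assms by (simp add: powr_mult)
 also have "... <= 2 powr p*(x powr p + y powr p)" by (intro mult_left_mono) (auto simp: max_def)
 finally show ?thesis .
qed

lemma powr_ge_bound: "0 <= x ==> 1 <= p ==> x <= 1 + x powr (p::real)"
proof (cases "1 <= x")
 case True
 assume "1 <= p"
 hence "x powr 1 <= x powr p" using True by (intro powr_mono) auto
 thus ?thesis using True by simp
qed (simp add: add_increasing2)

lemma product_integrable: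
 fixes f g :: "'a => real" assumes "1 < p" "1 < q" "1/p + 1/q = 1"
  and "integrable M (%t. abs(f t) powr q)" "integrable M (%t. abs(g t) powr p)"
  and "h : borel_measurable M" "AE t in M. abs(h t) <= abs(f t)*abs(g t)" shows "integrable M h"
proof -
 obtain C where C: "0 <= C" "!!x y. 0 <= x ==> 0 <= y ==> x*y <= 1*x powr q + C*y powr p"
  using Young_scaled[OF assms(1-3), of 1] by auto
 show ?thesis
 proof (rule intg_bound[where f="%t. abs(f t) powr q + C*abs(g t) powr p"])
  show "integrable M (%t. abs(f t) powr q + C*abs(g t) powr p)" using assms by simp
  show "AE t in M. norm (h t) <= norm (abs(f t) powr q + C*abs(g t) powr p)" using assms(7)
  proof eventually_elim
   case (elim t)
   thus ?case using C(2)[of "abs(f t)" "abs(g t)"] by simp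
  qed
 qed fact
qed

text \<open>The substitute for the weak convergence of \<open>U\<^sub>n\<close>: the quotients \<open>s\<^sub>n / (1 + U\<^sub>n)\<close> are
 dominated by \<open>N\<close>, hence tend to zero in the \<open>q\<close>-th mean.\<close>

lemma weak_product_limit:
 fixes N :: "'a => real" and U s :: "nat => 'a => real" assumes pq: "1 < p" "1 < q" "1/p + 1/q = 1" and M: "finite_measure M"
  and N: "integrable M (%t. N t powr q)" "!!t. 0 <= N t" "N : borel_measurable M"
  and U: "!!n. U n : borel_measurable M" "!!n t. 0 <= U n t" "!!n. integrable M (%t. U n t powr p)"
   "!!n. lint M (%t. U n t powr p) <= C" and s: "!!n. s n : borel_measurable M" "!!n. AE t in M. abs(s n t) <= N t*U n t"
   "AE t in M. (%n. s n t/(1 + U n t)) ----> 0" shows "!!n. integrable M (s n)" and "(%n. lint M (%t. abs(s n t))) ----> 0"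
proof -
 interpret finite_measure M by (rule M)
 note [measurable] = N(3) U(1) s(1)
 show int_s: "integrable M (s n)" for n by (rule product_integrable[OF pq, where f=N and g="U n"]) (use N U s in auto)
 define r where "r n t = abs(s n t)/(1 + U n t)" for n t
 have pos: "0 < 1 + U n t" for n t using U(2)[of n t] by simp
 have r0: "0 <= r n t" for n t using pos[of n t] by (simp add: r_def)
 have [measurable]: "r n : borel_measurable M" for n unfolding r_def by measurable
 have rN: "AE t in M. r n t <= N t" for n using s(2)[of n]
 proof eventually_elim
  case (elim t)
  have "abs(s n t) <= N t*(1 + U n t)" using elim N(2)[of t] by (simp add: algebra_simps)
  thus ?case using pos[of n t] by (simp add: r_def divide_le_eq)
 qed
 have rq: "(%n. lint M (%t. r n t powr q)) ----> lint M (%t. 0)" and rqi: "!!n. integrable M (%t. r n t powr q)"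
 proof -
  have lim: "AE t in M. (%n. r n t powr q) ----> 0" using s(3)
  proof eventually_elim
   case (elim t)
   have "(%n. abs(s n t/(1 + U n t))) ----> 0" using tendsto_rabs[OF elim] by simp
   moreover have "abs(s n t/(1 + U n t)) = r n t" for n using pos[of n t] by (simp add: r_def)
   ultimately have "(%n. r n t) ----> 0" by simp
   thus ?case using pq r0 tendsto_zero_powrI[of "%n. r n t" sequentially "%_. q" q] by auto
  qed
  have bd: "AE t in M. norm (r n t powr q) <= N t powr q" for n
   using rN[of n] by eventually_elim (use r0 pq in "auto intro: powr_mono2")
  show "(%n. lint M (%t. r n t powr q)) ----> lint M (%t. 0)" by (rule integral_dominated_convergence[OF _ _ N(1) lim bd]) auto
  show "integrable M (%t. r n t powr q)" for n by (rule intg_bound[OF N(1)]) (use bd in auto)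
 qed
 show "(%n. lint M (%t. abs(s n t))) ----> 0"
 proof (rule LIMSEQ_I)
  fix e :: real assume e: "0 < e"
  define K where "K = 2 powr p*(measure M (space M) + C)"
  have "0 <= lint M (%t. U 0 t powr p)" by (rule integral_nonneg_AE) auto
  hence "0 <= C" using U(4)[of 0] by linarith
  hence K: "0 <= K" by (simp add: K_def)
  define th where "th = e/(2*(K + 1))"
  have th: "0 < th" using e K by (simp add: th_def)
  have qp: "1/q + 1/p = 1" using pq by simp
  obtain D where D: "0 <= D" "!!x y. 0 <= x ==> 0 <= y ==> x*y <= th*x powr p + D*y powr q"
   using Young_scaled[OF pq(2,1) qp th] by blast
  have le: "lint M (%t. abs(s n t)) <= th*K + D*lint M (%t. r n t powr q)" for n
  proof -
   have "lint M (%t. abs(s n t)) <=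
    lint M (%t. th*(2 powr p*(1 + U n t powr p)) + D*r n t powr q)"
   proof (rule integral_mono_AE)
    show "AE t in M. abs(s n t) <= th*(2 powr p*(1 + U n t powr p)) + D*r n t powr q"
    proof (rule AE_I2)
     fix t
     \<comment> \<open>The first factor is bounded in the \<open>p\<close>-th mean and receives the
       small weight \<open>th\<close>; the second tends to zero in the \<open>q\<close>-th mean, so
       its large constant \<open>D\<close> is harmless.\<close>
     have "abs(s n t) = (1 + U n t)*r n t" using pos[of n t] by (simp add: r_def)
     also have "... <= th*(1 + U n t) powr p + D*r n t powr q" using D(2) r0 pos[of n t] by simp
     also have "... <= th*(2 powr p*(1 + U n t powr p)) + D*r n t powr q" using powr_sum_le[of 1 "U n t" p] U(2) pq th by simp
     finally show "abs(s n t) <= th*(2 powr p*(1 + U n t powr p)) + D*r n t powr q" .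
    qed
   qed (use int_s U(3) rqi in auto)
   also have "... = th*(2 powr p*(measure M (space M) + lint M (%t. U n t powr p))) +
     D*lint M (%t. r n t powr q)" using U(3)[of n] rqi[of n] by simp
   also have "... <= th*K + D*lint M (%t. r n t powr q)" using U(4)[of n] th by (simp add: K_def)
   finally show ?thesis .
  qed
  have "(%n. D*lint M (%t. r n t powr q)) ----> D*lint M (%t. 0)" by (intro tendsto_mult_left rq)
  hence "(%n. D*lint M (%t. r n t powr q)) ----> 0" by simp
  then obtain n0 where n0: "!!n. n >= n0 ==> abs(D*lint M (%t. r n t powr q)) < e/2" using e LIMSEQ_D[of _ 0 "e/2"] by fastforce
  have "th*K < e/2" using e K by (simp add: th_def field_simps)
  show "EX no. ALL n>=no. norm (lint M (%t. abs(s n t)) - 0) < e"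
  proof (intro exI allI impI)
   fix n assume "n0 <= n"
   have "0 <= lint M (%t. abs(s n t))" by (rule integral_nonneg_AE) auto
   thus "norm (lint M (%t. abs(s n t)) - 0) < e" using le[of n] n0[OF `n0 <= n`] `th * K < e / 2` by auto
  qed
 qed
qed

section \<open>Differentiation of integrals\<close>

text \<open>The bad set at scale \<open>k\<close> is covered, up to a null set, by disjoint bad intervals
 \<open>{t..t + d}\<close> that are fine for a gauge; Henstock's lemma bounds their total length.\<close>

lemma negligible_bad_difference_quotients:
 fixes g :: "real => real" assumes g: "g integrable_on {a..b}" and k: "0 < k"
 shows "negligible {t : {a<..<b}. ALL r>0. EX d>0. d < r & t + d < b & abs(integral {t..t + d} g - g t*d) > k*d}"
  (is "negligible ?B") unfolding negligible_outer_le
proof (intro allI impI)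
 fix e :: real assume e: "0 < e"
 hence "0 < k*e" using k by simp
 then obtain ga where ga: "gauge ga" and fine: "!!p. p tagged_partial_division_of (cbox a b) ==> ga fine p ==>
       sum (%(x,K). norm (measure lborel K*.g x - integral K g)) p < k*e" using Henstock_lemma[of g a b "k*e"] g by auto
 define I where "I = {(t, d). t : ?B & 0 < d & t + d < b & {t..t + d} <= ga t & abs(integral {t..t + d} g - g t*d) > k*d}"
 \<comment> \<open>Vitali's covering theorem speaks of balls: midpoint and half length represent the
   one-sided interval from \<open>t\<close> to \<open>t + d\<close>, which contains its tag
   \<open>t\<close> as an endpoint.\<close>
 define c where "c = (%(t, d). t + d/2 :: real)"
 define rh where "rh = (%(t :: real, d). d/2 :: real)"
 have cb: "cball (c i) (rh i) = {fst i .. fst i + snd i}" for i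
  by (cases i) (auto simp: c_def rh_def cball_def dist_real_def abs_le_iff field_simps)
 have cover: "EX i. i : I & x : cball (c i) (rh i) & rh i < de" if x: "x : ?B" and de: "0 < de" for x de
 proof -
  have "open (ga x)" "x : ga x" using ga by (auto simp: gauge_def)
  then obtain r where r: "0 < r" "ball x r <= ga x" using open_contains_ball by blast
  have "0 < min r de" using r de by simp
  then obtain d where d: "0 < d" "d < min r de" "x + d < b" "abs(integral {x..x + d} g - g x*d) > k*d" using x by blast
  have "{x..x + d} <= ball x r" using d by (auto simp: dist_real_def)
  hence "(x, d) : I" using x d r unfolding I_def by blast
  moreover have "x : cball (c (x, d)) (rh (x, d))" using d by (simp add: cb)
  moreover have "rh (x, d) < de" using d by (simp add: rh_def)
  ultimately show ?thesis by blast
 qed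
 have pos: "0 < rh i" if "i : I" for i using that by (auto simp: I_def rh_def)
 obtain C where C: "countable C" "C <= I" "pairwise (%i j. disjnt (cball (c i) (rh i)) (cball (c j) (rh j))) C"
  "negligible (?B - (\<Union>i\<in>C. cball (c i) (rh i)))"
  using Vitali_covering_theorem_cballs[of I rh ?B c, OF pos cover] by blast
 have fin: "measure lebesgue (\<Union>i\<in>F. cball (c i) (rh i)) <= e" if F: "F <= C" "finite F" for F
 proof -
  define p where "p = (%(t, d). (t, {t..t + d})) ` F"
  have FI: "i : I" if "i : F" for i using F C that by blast
  have inj: "inj_on (%(t :: real, d). (t, {t..t + d})) F"
  proof (rule inj_onI)
   fix x y assume "x : F" "y : F" "(%(t :: real, d). (t, {t..t + d})) x = (%(t, d). (t, {t..t + d})) y"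
   thus "x = y" using FI[of x] FI[of y] by (cases x; cases y) (auto simp: I_def)
  qed
  have "p tagged_partial_division_of (cbox a b)" unfolding tagged_partial_division_of_def
  proof (intro conjI allI impI)
   show "finite p" using F by (simp add: p_def)
  next
   fix x K assume "(x, K) : p"
   then obtain d where d: "(x, d) : F" "K = {x..x + d}" by (auto simp: p_def)
   thus "x : K" "K <= cbox a b" "EX a b. K = cbox a b" using FI[OF d(1)] by (auto simp: I_def)
  next
   fix x1 K1 x2 K2 assume A: "(x1, K1) : p & (x2, K2) : p & (x1, K1) ~= (x2, K2)"
   then obtain d1 d2 where d: "(x1, d1) : F" "K1 = {x1..x1 + d1}" "(x2, d2) : F" "K2 = {x2..x2 + d2}" by (auto simp: p_def)
   hence "(x1, d1) ~= (x2, d2)" using A by auto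
   hence "disjnt (cball (c (x1, d1)) (rh (x1, d1))) (cball (c (x2, d2)) (rh (x2, d2)))"
    using d F(1) by (intro pairwiseD[OF C(3)]) blast+
   hence "K1 Int K2 = {}" using d by (simp add: cb disjnt_def)
   thus "interior K1 Int interior K2 = {}" using interior_subset by blast
  qed
  moreover have "ga fine p" using FI by (auto simp: fine_def p_def I_def)
  ultimately have less: "sum (%(x,K). norm (measure lborel K*.g x - integral K g)) p < k*e" by (rule fine)
  have "k*(SUM i:F. snd i) <= (SUM i:F. norm (measure lborel {fst i..fst i + snd i}*.g (fst i) - integral {fst i..fst i + snd i} g))"
   unfolding sum_distrib_left
  proof (rule sum_mono)
   fix i assume "i : F"
   thus "k * snd i <= norm (measure lborel {fst i..fst i + snd i}*.g (fst i) - integral {fst i..fst i + snd i} g)"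
    using FI[of i] by (auto simp: I_def abs_minus_commute mult.commute)
  qed
  also have "... = sum (%(x,K). norm (measure lborel K*.g x - integral K g)) p"
   unfolding p_def by (subst sum.reindex[OF inj]) (auto intro!: sum.cong)
  finally have "k*(SUM i:F. snd i) < k*e" using less by linarith
  hence "(SUM i:F. snd i) <= e" using k by simp
  moreover have "measure lebesgue (\<Union>i\<in>F. cball (c i) (rh i)) <= (SUM i:F. measure lebesgue (cball (c i) (rh i)))"
   using F by (intro measure_UNION_le) auto
  moreover have "(SUM i:F. measure lebesgue (cball (c i) (rh i))) = (SUM i:F. snd i)"
  proof (intro sum.cong refl)
   fix i assume "i : F"
   hence "0 < snd i" using FI[of i] by (auto simp: I_def)
   thus "measure lebesgue (cball (c i) (rh i)) = snd i" by (simp add: cb)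
  qed
  ultimately show ?thesis by linarith
 qed
 let ?U = "\<Union>i\<in>C. cball (c i) (rh i)"
 let ?N = "?B - ?U"
 have U: "?U : lmeasurable" "measure lebesgue ?U <= e"
  using fmeasurable_UN_bound[OF C(1) _ fin] measure_UN_bound[OF C(1) _ fin] by auto
 show "EX T. ?B <= T & T : lmeasurable & measure lebesgue T <= e"
 proof (intro exI conjI)
  show "?B <= ?U Un ?N" by blast
  show "?U Un ?N : lmeasurable" using fmeasurable.Un[OF U(1) negligible_imp_measurable[OF C(4)]] .
  have "measure lebesgue (?U Un ?N) <= measure lebesgue ?U + measure lebesgue ?N"
   using fmeasurableD[OF U(1)] negligible_imp_sets[OF C(4)] by (rule measure_Un_le)
  thus "measure lebesgue (?U Un ?N) <= e" using U negligible_imp_measure0[OF C(4)] by simp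
 qed
qed

theorem Lebesgue_diff:
 fixes g :: "real => real" assumes g: "intg a b g"
 shows "AE t in leb a b. ((%d. LI t (t + d) g/d) \<longlongrightarrow> g t) (at_right 0)"
proof -
 let ?B = "%k. {t : {a<..<b}. ALL r>0. EX d>0. d < r & t + d < b & abs(integral {t..t + d} g - g t*d) > k*d}"
 have "AE t in lebesgue. t ~: ?B (1/Suc n)" for n using negligible_bad_difference_quotients[of g a b "1/Suc n"] g
  by (intro AE_not_in) (auto simp: integrable_on_lebesgue_on negligible_iff_null_sets[symmetric])
 hence "AE t in lebesgue. ALL n::nat. t ~: ?B (1/Suc n)" by (subst AE_all_countable) blast
 with AE_lebesgue_neq[of a] AE_lebesgue_neq[of b]
 have "AE t in lebesgue. t : {a..b} --> ((%d. LI t (t + d) g/d) \<longlongrightarrow> g t) (at_right 0)"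
 proof eventually_elim
  case (elim t)
  show ?case
  proof
   assume "t : {a..b}"
   hence t: "a < t" "t < b" using elim by auto
   show "((%d. LI t (t + d) g/d) \<longlongrightarrow> g t) (at_right 0)"
   proof (rule tendstoI)
    fix e :: real assume "0 < e"
    then obtain n where n: "1/Suc n < e" using nat_approx_posE by blast
    obtain r where r: "0 < r" "!!d. 0 < d ==> d < r ==> t + d < b ==> abs(integral {t..t + d} g - g t*d) <= 1/Suc n*d"
     using elim(3) t by (auto simp: not_less) (meson not_less)
    have "\<forall>\<^sub>F d in at_right 0. 0 < d & d < min r (b - t)"
     using r(1) t by (intro eventually_conj) (auto simp: eventually_at_right_less eventually_at_right_field intro: exI[of _ "min r (b - t)"])
    thus "\<forall>\<^sub>F d in at_right 0. dist (LI t (t + d) g/d) (g t) < e"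
    proof eventually_elim
     case (elim d)
     have i: "intg t (t + d) g" using elim t by (intro intg_sub[OF g]) auto
     have "abs(LI t (t + d) g - g t*d) <= 1/Suc n*d" using r(2)[of d] elim by (simp add: LI_eq_integral[OF i])
     hence "abs(LI t (t + d) g/d - g t) <= 1/Suc n"
     proof -
      have "abs(LI t (t + d) g/d - g t) = abs(LI t (t + d) g - g t*d)/d"
       using elim by (simp add: diff_divide_distrib[symmetric] abs_divide flip: abs_divide) (simp add: field_simps)
      thus ?thesis using \<open>\<bar>LI t (t + d) g - g t * d\<bar> <= 1 / Suc n * d\<close> elim by (simp add: divide_le_eq)
     qed
     thus ?case using n by (simp add: dist_real_def)
    qed
   qed
  qed
 qed
 thus ?thesis by (simp add: AE_on_iff)
qed

section \<open>Absolutely continuous functions\<close>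

lemma Icc_bounded:
 fixes u :: "real => 'a::real_normed_vector" assumes "cont a b u" obtains B where "!!t. t : {a..b} ==> norm (u t) <= B" "0 <= B"
proof -
 have "bounded (u ` {a..b})" by (intro compact_imp_bounded compact_continuous_image assms compact_Icc)
 then obtain B where "!!t. t : {a..b} ==> norm (u t) <= B" unfolding bounded_iff by blast
 thus ?thesis using that[of "max B 0"] by (meson max.cobounded1 max.cobounded2 order_trans)
qed

text \<open>If the increments of \<open>E\<close> are arbitrarily small multiples of those of a
  monotone \<open>G\<close> on short intervals, a telescoping sum over a fine partition gives zero.
  This proves a product rule without differentiating absolutely continuous functions
  pointwise.\<close>

lemma increments_vanish:
 fixes E G :: "real => real" assumes ab: "a <= b" and G: "!!s t. a <= s ==> s <= t ==> t <= b ==> G s <= G t"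
  and E: "!!et. 0 < et ==> EX de>0. ALL s t. a <= s --> s <= t --> t <= b --> t - s < de --> abs(E t - E s) <= et*(G t - G s)"
 shows "E a = E b"
proof -
 have "abs(E b - E a) <= 0"
 proof (rule field_le_epsilon)
  fix e :: real assume e: "0 < e"
  define et where "et = e/(G b - G a + 1)"
  have Gab: "0 <= G b - G a" using G[of a b] ab by simp
  hence et: "0 < et" using e by (simp add: et_def)
  then obtain de where de: "0 < de" "!!s t. a <= s ==> s <= t ==> t <= b ==> t - s < de ==> abs(E t - E s) <= et*(G t - G s)"
   using E by blast
  obtain n :: nat where n: "(b - a)/de < real n" using reals_Archimedean2 by blast
  have n0: "0 < n" using n de ab by (cases n) (auto simp: divide_less_0_iff)
  define ta where "ta k = a + real k*((b - a)/n)" for k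
  have tan: "ta n = b" "ta 0 = a" using n0 by (auto simp: ta_def)
  have step: "ta (Suc k) - ta k = (b - a)/n" for k using n0 by (simp add: ta_def field_simps)
  have small: "(b - a)/n < de" using n n0 de by (simp add: field_simps)
  have rng: "a <= ta k" "k <= n ==> ta k <= b" for k
  proof -
   show "a <= ta k" using ab by (simp add: ta_def)
   assume "k <= n"
   hence "real k*((b - a)/n) <= real n*((b - a)/n)" using ab by (intro mult_right_mono) auto
   thus "ta k <= b" using n0 by (simp add: ta_def)
  qed
  have "abs(E b - E a) = abs(\<Sum>k<n. E (ta (Suc k)) - E (ta k))" by (subst sum_lessThan_telescope) (simp add: tan)
  also have "... <= (\<Sum>k<n. abs(E (ta (Suc k)) - E (ta k)))" by (rule sum_abs)
  also have "... <= (\<Sum>k<n. et*(G (ta (Suc k)) - G (ta k)))"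
  proof (rule sum_mono)
   fix k assume "k : {..<n}"
   moreover have "ta k <= ta (Suc k)" using step[of k] ab by (simp add: algebra_simps)
   ultimately show "abs(E (ta (Suc k)) - E (ta k)) <= et*(G (ta (Suc k)) - G (ta k))"
    using de(2)[of "ta k" "ta (Suc k)"] rng(1)[of k] rng(2)[of "Suc k"] step[of k] small by simp
  qed
  also have "... = et*(G b - G a)" unfolding sum_distrib_left[symmetric] by (subst sum_lessThan_telescope) (simp add: tan)
  also have "... <= e" using Gab e by (simp add: et_def field_simps)
  finally show "abs(E b - E a) <= 0 + e" by simp
 qed
 thus ?thesis by simp
qed

text \<open>The difference \<open>E\<close> of both sides has increments that are small compared
  with those of \<open>G\<close>, by uniform continuity of \<open>u\<close> and \<open>ps\<close>;
  then \<open>increments_vanish\<close> applies.\<close>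

lemma product_with_C1:
 fixes u g ps ps' :: "real => real" assumes ab: "a <= b" and g: "intg a b g"
  and u: "!!s t. a <= s ==> s <= t ==> t <= b ==> u t - u s = LI s t g"
  and ps: "!!t. (ps has_real_derivative ps' t) (at t)" and c: "cont a b ps'" shows "intg a b (%t. ps' t*u t + ps t*g t)"
  and "LI a b (%t. ps' t*u t + ps t*g t) = ps b*u b - ps a*u a"
proof -
 have cu: "cont a b u"
 proof -
  have "cont a b (%t. u a + LI a t g)" by (intro continuous_intros LI_continuous g)
  moreover have "u a + LI a t g = u t" if "t : {a..b}" for t using u[of a t] that by simp
  ultimately show ?thesis by (rule continuous_on_eq)
 qed
 have cps: "cont a b ps" using ps by (meson DERIV_isCont continuous_at_imp_continuous_on)
 have i1: "intg a b (%t. ps' t*u t)" by (intro cont_intg continuous_intros c cu)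
 have i2: "intg a b (%t. ps t*g t)"
 proof -
  obtain B where B: "!!t. t : {a..b} ==> abs(ps t) <= B" using Icc_bounded[OF cps] unfolding real_norm_def by blast
  have "ps : meas a b" using cont_intg[OF cps] by auto
  moreover have "g : meas a b" using g by (rule meas_intg)
  ultimately have m: "(%t. ps t*g t) : meas a b" by (rule borel_measurable_times)
  have ae: "AE t in leb a b. abs(ps t*g t) <= B*abs(g t)" using B by (intro AE_I2) (simp add: abs_mult mult_right_mono)
  have "intg a b (%t. B*abs(g t))" using g by simp
  thus ?thesis using m ae by (rule intg_AE_le)
 qed
 show int: "intg a b (%t. ps' t*u t + ps t*g t)" using i1 i2 by simp
 define E where "E t = ps t*u t - LI a t (%t. ps' t*u t + ps t*g t)" for t
 obtain B where B: "!!t. t : {a..b} ==> abs(ps' t) <= B" "0 <= B" using Icc_bounded[OF c] unfolding real_norm_def by blast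
 \<comment> \<open>Dominates both parts of an increment of \<open>E\<close>: the length of the
   interval, weighted by the bound of \<open>ps'\<close>, and the mass of \<open>g\<close>.\<close>
 define G where "G t = B*t + LI a t (%t. abs(g t))" for t
 have ga: "intg s t (%t. abs(g t))" "intg s t g" "intg s t (%t. ps' t*u t)" "intg s t (%t. ps t*g t)" "intg s t ps'"
  if "a <= s" "t <= b" for s t using that g i1 i2 cont_intg[OF c] by (auto intro: intg_sub)
 have Gd: "G t - G s = B*(t - s) + LI s t (%t. abs(g t))" if "a <= s" "s <= t" "t <= b" for s t
  using LI_combine[of a t "%t. abs(g t)" s] ga[of a t] that by (simp add: G_def algebra_simps)
 have "E a = E b"
 proof (rule increments_vanish[OF ab, where G=G])
  fix s t assume st: "a <= s" "s <= t" "t <= b"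
  have "0 <= LI s t (%t. abs(g t))" by (rule integral_nonneg_AE) auto
  moreover have "0 <= B*(t - s)" using B(2) st by simp
  ultimately show "G s <= G t" using Gd[OF st] by linarith
 next
  fix et :: real assume et: "0 < et"
  have uu: "uniformly_continuous_on {a..b} u" "uniformly_continuous_on {a..b} ps"
   using cu cps by (auto intro: compact_uniformly_continuous)
  obtain d1 where d1: "0 < d1" "!!x y. x : {a..b} ==> y : {a..b} ==> abs(y - x) < d1 ==> abs(u y - u x) < et"
   using uu(1) et unfolding uniformly_continuous_on_def dist_real_def by blast
  obtain d2 where d2: "0 < d2" "!!x y. x : {a..b} ==> y : {a..b} ==> abs(y - x) < d2 ==> abs(ps y - ps x) < et"
   using uu(2) et unfolding uniformly_continuous_on_def dist_real_def by blast
  show "EX de>0. ALL s t. a <= s --> s <= t --> t <= b --> t - s < de --> abs(E t - E s) <= et*(G t - G s)"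
  proof (intro exI conjI allI impI)
   show "0 < min d1 d2" using d1 d2 by simp
   fix s t assume st: "a <= s" "s <= t" "t <= b" "t - s < min d1 d2"
   note ga' = ga[OF st(1,3)]
   have ft: "ps t - ps s = LI s t ps'"
   proof -
    have "(ps' has_integral (ps t - ps s)) {s..t}" by (rule fundamental_theorem_of_calculus)
      (use st ps in "auto simp: has_real_derivative_iff_has_vector_derivative[symmetric] intro: has_field_derivative_at_within")
    thus ?thesis using ga' by (simp add: LI_eq_integral integral_unique)
   qed
   have "E t - E s = ps t*u t - ps s*u s - LI s t (%r. ps' r*u r + ps r*g r)"
    using LI_combine[of a t "%t. ps' t*u t + ps t*g t" s] intg_sub[OF int, of a t] st by (simp add: E_def)
   also have "... = u t*(ps t - ps s) + ps s*(u t - u s) - LI s t (%r. ps' r*u r + ps r*g r)" by (simp add: algebra_simps)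
   also have "... = LI s t (%r. ps' r*(u t - u r) + (ps s - ps r)*g r)"
    unfolding ft u[OF st(1-3)] using ga' by (simp add: algebra_simps)
   finally have eq: "E t - E s = LI s t (%r. ps' r*(u t - u r) + (ps s - ps r)*g r)" .
   have "abs(E t - E s) <= LI s t (%r. B*et + et*abs(g r))" unfolding eq
   proof (rule LI_abs_le)
    show "AE r in leb s t. abs(ps' r*(u t - u r) + (ps s - ps r)*g r) <= B*et + et*abs(g r)"
    proof (rule AE_I2)
     fix r assume "r : space (leb s t)"
     hence r: "s <= r" "r <= t" by auto
     have "abs(ps' r*(u t - u r)) <= B*et" unfolding abs_mult using B(1)[of r] B(2) d1(2)[of r t] st r by (intro mult_mono) auto
     moreover have "abs((ps s - ps r)*g r) <= et*abs(g r)"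
      unfolding abs_mult using d2(2)[of r s] st r by (intro mult_right_mono) auto
     ultimately show "abs(ps' r*(u t - u r) + (ps s - ps r)*g r) <= B*et + et*abs(g r)" by linarith
    qed
   qed (use ga' in "auto simp: algebra_simps")
   also have "... = et*(G t - G s)" using ga' st by (subst Gd) (auto simp: LI_const algebra_simps)
   finally show "abs(E t - E s) <= et*(G t - G s)" .
  qed
 qed
 thus "LI a b (%t. ps' t*u t + ps t*g t) = ps b*u b - ps a*u a" by (simp add: E_def)
qed

text \<open>With the weight \<open>exp (2*k*(t - a))\<close> the integral operator \<open>u\<close>
  to \<open>k * LI a t u\<close> contracts by the factor one half in the weighted supremum norm;
  solving \<open>Z <= c + Z/2\<close> explains the factor 2 in the bound.\<close>

lemma Gronwall:
 fixes u :: "real => real" assumes k: "0 < k" and c: "0 <= c" and u: "intg a b u"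
  and bd: "!!t. t : {a..b} ==> 0 <= u t & u t <= B" and le: "!!t. t : {a..b} ==> u t <= c + k*LI a t u" and t: "t : {a..b}"
 shows "u t <= 2 * c*exp (2*k*(b - a))"
proof -
 define h where "h t = exp (2*k*(t - a))" for t
 define Z where "Z = (SUP t\<in>{a..b}. u t/h t)"
 have h1: "1 <= h t" if "t : {a..b}" for t using that k by (simp add: h_def)
 have bdd: "bdd_above ((%t. u t/h t) ` {a..b})"
 proof (rule bdd_aboveI2)
  fix t assume t: "t : {a..b}"
  have "u t/h t <= u t/1" using h1[OF t] bd[OF t] by (intro divide_left_mono) auto
  thus "u t/h t <= B" using bd[OF t] by simp
 qed
 have uZ: "u s <= Z*h s" if "s : {a..b}" for s using cSUP_upper[OF that bdd] h1[OF that] by (simp add: Z_def divide_le_eq)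
 have ch: "cont a s h" for s unfolding h_def by (intro continuous_intros)
 have Lh: "LI a s h <= h s/(2*k)" if "s : {a..b}" for s
 proof -
  have "(h has_integral (h s/(2*k) - h a/(2*k))) {a..s}" by (rule fundamental_theorem_of_calculus)
    (use that k in "auto simp: h_def has_real_derivative_iff_has_vector_derivative[symmetric] intro!: derivative_eq_intros")
  thus ?thesis using cont_intg[OF ch[of s]] k by (simp add: LI_eq_integral integral_unique h_def)
 qed
 have Z0: "0 <= Z" using uZ[OF t] bd[OF t] h1[OF t] by (metis mult_less_0_iff not_le order_less_le_trans zero_less_one order_trans)
 have "u s/h s <= c + Z/2" if s: "s : {a..b}" for s
 proof -
  have "LI a s u <= LI a s (%r. Z*h r)" using s uZ cont_intg[OF ch[of s]]
   by (intro LI_mono_AE intg_sub[OF u]) (auto intro!: AE_I2)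
  also have "... <= Z*(h s/(2*k))" using mult_left_mono[OF Lh[OF s] Z0] by simp
  finally have "k*LI a s u <= k*(Z*(h s/(2*k)))" using k by (intro mult_left_mono) auto
  also have "... = Z/2*h s" using k by simp
  finally have "u s <= c + Z/2*h s" using le[OF s] by simp
  also have "... <= (c + Z/2)*h s" using c h1[OF s] by (simp add: algebra_simps mult_le_cancel_left1)
  finally show ?thesis using h1[OF s] by (simp add: divide_le_eq)
 qed
 hence "Z <= c + Z/2" unfolding Z_def using t by (intro cSUP_least) auto
 hence "Z <= 2 * c" by simp
 have "u t <= Z*h t" by (rule uZ[OF t])
 also have "... <= 2 * c*exp (2*k*(b - a))" using `Z <= 2 * c` c k t by (intro mult_mono) (auto simp: h_def)
 finally show ?thesis .
qed

section \<open>Test functions on an interval\<close>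

text \<open>The standard bump on the unit interval multiplied by a polynomial and a power of
  \<open>1/(t (1 - t))\<close>. The class is closed under differentiation, so a single derivative
  rule yields all derivatives.\<close>

definition bump :: "real poly => nat => real => real" where "bump P n t = (if 0 < t & t < 1
  then poly P t*inverse (t*(1 - t)) ^ n*exp (- inverse (t*(1 - t))) else 0)"

text \<open>The polynomial factor of the derivative of \<open>bump P n\<close>, whose second index is \<open>n + 2\<close>.\<close>

definition bump_next :: "real poly => nat => real poly" where
 "bump_next P n = pderiv P*[:0, 1, -1:]\<^sup>2 - smult (real n) (P*[:1, -2:]*[:0, 1, -1:]) + P*[:1, -2:]"

lemma power_times_exp_le: assumes "0 < (y::real)" shows "y ^ m*exp (- y) <= real m ^ m"
proof (cases "m = 0")
 case False
 have "(y/m) ^ m <= (exp (y/m)) ^ m"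
 proof (intro power_mono)
  show "y/m <= exp (y/m)" using exp_ge_add_one_self[of "y/m"] by linarith
 qed (use assms in auto)
 also have "... = exp y" using False by (simp add: exp_of_nat_mult[symmetric])
 finally have "y ^ m <= exp y*real m ^ m" using False by (simp add: power_divide divide_le_eq)
 thus ?thesis by (simp add: exp_minus field_simps)
qed (use assms in simp)

text \<open>Quadratic decay at the endpoints 0 and 1 is what makes the derivative exist there and
  vanish.\<close>

lemma bump_quadratic: obtains K where "!!t c. c : {0, 1} ==> abs(bump P n t) <= K*(t - c)^2"
proof -
 obtain B where B: "!!t. t : {0..1} ==> abs(poly P t) <= B" "0 <= B"
  using Icc_bounded[of 0 1 "poly P", OF continuous_on_poly[OF continuous_on_id]] unfolding real_norm_def by blast
 show ?thesis
 proof (rule that)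
  fix t c :: real assume c: "c : {0, 1}"
  show "abs(bump P n t) <= B*real (n + 2) ^ (n + 2)*(t - c)^2"
  proof (cases "0 < t & t < 1")
   case True
   define s where "s = t*(1 - t)"
   have s: "0 < s" using True by (simp add: s_def)
   have sc: "s <= abs(t - c)" using True c by (auto simp: s_def mult_le_cancel_left1 mult_le_cancel_right1)
   have "inverse s ^ n*exp (- inverse s) = s^2*(inverse s ^ (n + 2)*exp (- inverse s))"
    using s by (simp add: power2_eq_square field_simps)
   also have "... <= s^2*real (n + 2) ^ (n + 2)" using s power_times_exp_le[of "inverse s" "n + 2"] by (intro mult_left_mono) auto
   also have "... <= (t - c)^2*real (n + 2) ^ (n + 2)"
    using s sc by (intro mult_right_mono) (auto simp: abs_le_square_iff[symmetric])
   finally have le: "inverse s ^ n*exp (- inverse s) <= (t - c)^2*real (n + 2) ^ (n + 2)" .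
   have "abs(bump P n t) = abs(poly P t)*(inverse s ^ n*exp (- inverse s))"
    using True s by (simp add: bump_def s_def[symmetric] abs_mult)
   also have "... <= B*((t - c)^2*real (n + 2) ^ (n + 2))" using B True s le by (intro mult_mono[OF _ le]) auto
   finally show ?thesis by (simp add: mult_ac)
  next
   case False
   hence "bump P n t = 0" by (auto simp: bump_def)
   thus ?thesis using B by simp
  qed
 qed
qed

lemma bump_has_derivative: "(bump P n has_real_derivative bump (bump_next P n) (n + 2) t) (at t)"
proof -
 consider "0 < t & t < 1" | "t < 0 | 1 < t" | "t : {0, 1}" by force
 thus ?thesis
 proof cases
  case 1
  define s where "s = t*(1 - t)"
  have s: "0 < s" using 1 by (simp add: s_def)
  have "((%t. poly P t*inverse (t*(1 - t)) ^ n*exp (- inverse (t*(1 - t)))) has_real_derivative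
    poly (bump_next P n) t*inverse s ^ (n + 2)*exp (- inverse s)) (at t)"
  proof -
   have "((%t. poly P t*inverse (t*(1 - t)) ^ n*exp (- inverse (t*(1 - t)))) has_real_derivative
    (poly (pderiv P) t*inverse s ^ n + poly P t*(real n*inverse s ^ (n - 1)*(- (1 - 2*t)*inverse s ^ 2)))*exp (- inverse s)
     + poly P t*inverse s ^ n*(exp (- inverse s)*((1 - 2*t)*inverse s ^ 2))) (at t)" using s unfolding s_def
    by (auto intro!: derivative_eq_intros poly_DERIV simp: power2_eq_square[of "inverse _"] algebra_simps)
   moreover have "(poly (pderiv P) t*inverse s ^ n + poly P t*(real n*inverse s ^ (n - 1)*(- (1 - 2*t)*inverse s ^ 2)))*exp (- inverse s)
     + poly P t*inverse s ^ n*(exp (- inverse s)*((1 - 2*t)*inverse s ^ 2))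
     = poly (bump_next P n) t*inverse s ^ (n + 2)*exp (- inverse s)"
   proof -
    define i where "i = inverse s ^ (n + 2)"
    have e1: "s^2*i = inverse s ^ n" using s by (simp add: i_def power2_eq_square field_simps)
    have e2: "real n * s*i = real n*inverse s ^ (n - 1)*inverse s ^ 2" using s by (cases n) (auto simp: i_def power2_eq_square)
    have e3: "i = inverse s ^ n*inverse s ^ 2" by (simp add: i_def power_add power2_eq_square)
    have ps: "poly [:0, 1, -1:] t = s" "poly [:1, -2:] t = 1 - 2*t" by (simp_all add: s_def algebra_simps)
    have "poly (bump_next P n) t = poly (pderiv P) t * s^2 - real n*(poly P t*(1 - 2*t) * s) + poly P t*(1 - 2*t)"
     unfolding bump_next_def by (simp only: poly_add poly_diff poly_mult poly_smult poly_power ps)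
    hence "poly (bump_next P n) t*i =
      poly (pderiv P) t*(s^2*i) - poly P t*(1 - 2*t)*(real n * s*i)
      + poly P t*(1 - 2*t)*i" by (simp only: ring_distribs mult_ac)
    also have "... = poly (pderiv P) t*inverse s ^ n - poly P t*(1 - 2*t)*(real n*inverse s ^ (n - 1)*inverse s ^ 2)
      + poly P t*(1 - 2*t)*(inverse s ^ n*inverse s ^ 2)" unfolding e1 e2 by (simp only: e3)
    finally have "poly (bump_next P n) t*i*exp (- inverse s) = (poly (pderiv P) t*inverse s ^ n
      - poly P t*(1 - 2*t)*(real n*inverse s ^ (n - 1)*inverse s ^ 2)
      + poly P t*(1 - 2*t)*(inverse s ^ n*inverse s ^ 2))*exp (- inverse s)" by (rule arg_cong)
    thus ?thesis unfolding i_def[symmetric] by (simp add: algebra_simps)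
   qed
   ultimately show ?thesis by simp
  qed
  hence "((%t. poly P t*inverse (t*(1 - t)) ^ n*exp (- inverse (t*(1 - t)))) has_real_derivative
    bump (bump_next P n) (n + 2) t) (at t)" using 1 by (simp add: bump_def s_def)
  thus ?thesis
  proof (rule has_field_derivative_transform_within_open[where S="{0<..<1}"])
   fix x :: real assume "x : {0<..<1}"
   thus "poly P x*inverse (x*(1 - x)) ^ n*exp (- inverse (x*(1 - x))) = bump P n x" by (simp add: bump_def)
  qed (use 1 in auto)
 next
  case 2
  have "((%_. 0) has_real_derivative 0) (at t)" by simp
  hence "(bump P n has_real_derivative 0) (at t)"
  proof (rule has_field_derivative_transform_within_open[where S="{..<0} Un {1<..}"])
   fix x :: real assume "x : {..<0} Un {1<..}"
   thus "0 = bump P n x" by (auto simp: bump_def)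
  qed (use 2 in auto)
  thus ?thesis using 2 by (auto simp: bump_def)
 next
  case 3
  obtain K where K: "!!x c. c : {0, 1} ==> abs(bump P n x) <= K*(x - c)^2" using bump_quadratic by blast
  have "(%h. (bump P n (t + h) - bump P n t)/h) \<midarrow>0\<rightarrow> 0"
  proof (rule Lim_null_comparison)
   show "\<forall>\<^sub>F h in at 0. norm ((bump P n (t + h) - bump P n t)/h) <= K*abs(h)" unfolding eventually_at_filter
   proof (rule always_eventually, intro allI impI)
    fix h :: real assume "h ~= 0"
    thus "norm ((bump P n (t + h) - bump P n t)/h) <= K*abs(h)"
     using K[OF 3, of "t + h"] 3 by (auto simp: bump_def[of _ _ t] divide_le_eq power2_eq_square abs_mult_self_eq mult.assoc)
   qed
   show "(%h. K*abs(h)) \<midarrow>0\<rightarrow> 0" by (auto intro!: tendsto_eq_intros)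
  qed
  hence "(bump P n has_real_derivative 0) (at t)" by (simp add: DERIV_def)
  thus ?thesis using 3 by (auto simp: bump_def[of _ _ t])
 qed
qed

definition smooth :: "(real => real) => bool" where "smooth f <-> (ALL n t. ((deriv ^^ n) f) differentiable (at t))"

lemma smooth_coinduct: assumes "P f" and "!!g. P g ==> (EX g'. P g' & (ALL t. (g has_real_derivative g' t) (at t)))"
 shows "smooth f"
proof -
 have "P ((deriv ^^ n) f)" for n
 proof (induction n)
  case (Suc n)
  then obtain g' where "P g'" "ALL t. ((deriv ^^ n) f has_real_derivative g' t) (at t)" using assms(2) by blast
  hence "deriv ((deriv ^^ n) f) = g'" by (auto intro: DERIV_imp_deriv)
  thus ?case using `P g'` by simp
 qed (use assms(1) in simp)
 thus ?thesis unfolding smooth_def using assms(2) real_differentiable_def by blast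
qed

text \<open>The lower limit -1 lies strictly to the left of the support, so the fundamental theorem
  gives two-sided derivatives at 0 as well.\<close>

definition bump_int :: "real => real" where "bump_int t = integral {- 1..t} (bump 1 0)"

lemma bump_continuous: "continuous_on S (bump P n)"
 using bump_has_derivative by (meson DERIV_isCont continuous_at_imp_continuous_on)

lemma bump_int_derivative: "-1 < t ==> (bump_int has_real_derivative bump 1 0 t) (at t)"
proof -
 assume t: "-1 < t"
 have "(bump_int has_vector_derivative bump 1 0 t) (at t within {-1..t+1})"
  unfolding bump_int_def by (rule integral_has_vector_derivative) (use t bump_continuous in auto)
 hence "(bump_int has_vector_derivative bump 1 0 t) (at t)" using t by (subst (asm) at_within_interior) auto
 thus ?thesis by (simp add: has_real_derivative_iff_has_vector_derivative)
qed

lemma bump_nonneg: "0 <= bump 1 0 t" by (simp add: bump_def)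

lemma bump_int_zero: "t <= 0 ==> bump_int t = 0" unfolding bump_int_def
 by (rule integral_unique, rule has_integral_is_0) (auto simp: bump_def)

lemma bump_int_one: "1 <= t ==> bump_int t = bump_int 1"
proof -
 assume t: "1 <= t"
 have "integral {-1..1} (bump 1 0) + integral {1..t} (bump 1 0) = integral {-1..t} (bump 1 0)"
  using t bump_continuous by (intro Henstock_Kurzweil_Integration.integral_combine integrable_continuous_real) auto
 moreover have "integral {1..t} (bump 1 0) = 0" by (rule integral_unique, rule has_integral_is_0) (auto simp: bump_def)
 ultimately show ?thesis by (simp add: bump_int_def)
qed

lemma bump_int_has_derivative: "(bump_int has_real_derivative bump 1 0 t) (at t)"
proof (cases "-1 < t")
 case True
 thus ?thesis by (rule bump_int_derivative)
next
 case False
 have "((%_. 0) has_real_derivative 0) (at t)" by simp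
 hence "(bump_int has_real_derivative 0) (at t)" by (rule has_field_derivative_transform_within_open[where S="{..<0}"])
   (use False in "auto simp: bump_int_zero")
 thus ?thesis using False by (simp add: bump_def)
qed

lemma bump_int_pos: "0 < bump_int 1"
proof -
 have "0 < bump_int 1 - bump_int 0"
 proof -
  obtain z where z: "0 < z" "z < 1" "bump_int 1 - bump_int 0 = (1 - 0)*bump 1 0 z"
   using MVT2[of 0 1 bump_int "bump 1 0"] bump_int_has_derivative by auto
  thus ?thesis by (simp add: bump_def)
 qed
 thus ?thesis by (simp add: bump_int_zero)
qed

lemma chain_scaled: assumes "!!t. (f has_real_derivative f' t) (at t)" and e: "e ~= 0"
 shows "((%t. c*(f ((t - s)/e) - f ((t - s')/e))) has_real_derivative
   (c/e)*(f' ((t - s)/e) - f' ((t - s')/e))) (at t)"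
proof -
 have d: "((%t. f ((t - s)/e)) has_real_derivative f' ((t - s)/e)*(1/e)) (at t)" for s
  by (rule DERIV_chain2[OF assms(1)]) (use e in "auto intro!: derivative_eq_intros")
 show ?thesis by (rule derivative_eq_intros d refl)+ (simp add: algebra_simps)
qed

text \<open>A smooth step up at \<open>s\<close> followed by a smooth step down at
  \<open>s'\<close>. Its derivative is a difference of two mollifiers, which is how
  \<open>du_Bois_Reymond\<close> compares two values of a function.\<close>

lemma plateau_test_function: assumes "a < s" "s < s'" "s' + e < b" "0 < e"
 shows "(%t. bump_int ((t - s)/e) - bump_int ((t - s')/e)) : scalar_test_functions a b"
  (is "?ps : _")
proof -
 \<comment> \<open>\<open>Q\<close> describes all derivatives of order at least one; only the
   function itself involves \<open>bump_int\<close>.\<close>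
 define Q where "Q f <-> (EX c P n. f = (%t. c*(bump P n ((t - s)/e) - bump P n ((t - s')/e))))" for f
 have "smooth ?ps"
 proof (rule smooth_coinduct[where P="%f. f = ?ps | Q f"])
  fix g assume g: "g = ?ps | Q g"
  show "EX g'. (g' = ?ps | Q g') & (ALL t. (g has_real_derivative g' t) (at t))"
  proof (cases "g = ?ps")
   case True
   have "Q (%t. (1/e)*(bump 1 0 ((t - s)/e) - bump 1 0 ((t - s')/e)))" unfolding Q_def by blast
   moreover have "(?ps has_real_derivative (1/e)*(bump 1 0 ((t - s)/e) - bump 1 0 ((t - s')/e))) (at t)" for t
    using chain_scaled[OF bump_int_has_derivative, of e 1 s s' t] assms by simp
   ultimately show ?thesis using True by blast
  next
   case False
   then obtain c P n where "g = (%t. c*(bump P n ((t - s)/e) - bump P n ((t - s')/e)))" using g by (auto simp: Q_def)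
   hence "(g has_real_derivative (c/e)*(bump (bump_next P n) (n + 2) ((t - s)/e)
      - bump (bump_next P n) (n + 2) ((t - s')/e))) (at t)" for t using chain_scaled[OF bump_has_derivative, of e] assms by simp
   moreover have "Q (%t. (c/e)*(bump (bump_next P n) (n + 2) ((t - s)/e) - bump (bump_next P n) (n + 2) ((t - s')/e)))"
    unfolding Q_def by blast
   ultimately show ?thesis by blast
  qed
 qed simp
 moreover have "?ps t = 0" if "t ~: {s..s' + e}" for t
 proof (cases "t < s")
  case True
  thus ?thesis using assms by (simp add: bump_int_zero divide_le_0_iff)
 next
  case False
  hence "s' + e < t" using that by auto
  hence "1 <= (t - s)/e" "1 <= (t - s')/e" using assms by (auto simp: le_divide_eq)
  thus ?thesis using bump_int_one[of "(t - s)/e"] bump_int_one[of "(t - s')/e"] by simp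
 qed
 moreover have "{s..s' + e} <= {a<..<b}" using assms by auto
 ultimately show ?thesis unfolding scalar_test_functions_def smooth_def by (auto intro!: exI[of _ "{s..s' + e}"])
qed

text \<open>Testing with a plateau equates the mollified values of \<open>w\<close> at
  \<open>s\<close> and at \<open>s'\<close>; the mollifiers have the common mass \<open>m\<close>,
  and uniform continuity of \<open>w\<close> removes the mollification.\<close>

lemma du_Bois_Reymond: assumes w: "cont a b w" and z: "!!ps. ps : scalar_test_functions a b ==> LI a b (%t. deriv ps t*w t) = 0"
  and st: "a < s" "s < s'" "s' < b" shows "w s = w s'"
proof -
 define m where "m = bump_int 1"
 have m: "0 < m" by (simp add: m_def bump_int_pos)
 have "abs(w s - w s') <= 0"
 proof (rule field_le_epsilon)
  fix et :: real assume et: "0 < et"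
  have u: "uniformly_continuous_on {a..b} w" using w by (auto intro: compact_uniformly_continuous)
  obtain d where d: "0 < d" "!!x y. x : {a..b} ==> y : {a..b} ==> abs(y - x) < d ==> abs(w y - w x) < et/2"
   using u et unfolding uniformly_continuous_on_def dist_real_def by (meson half_gt_zero)
  \<comment> \<open>The first entry keeps the mollifier within the modulus of continuity, the second
    keeps the support to the left of \<open>b\<close>.\<close>
  define e where "e = min (d/2) ((b - s')/2)"
  have e: "0 < e" "e < d" "s' + e < b" using d st by (auto simp: e_def min_def field_simps)
  define rh where "rh c t = (1/e)*bump 1 0 ((t - c)/e)" for c t
  have crh: "continuous_on S (rh c)" for S c
   unfolding rh_def by (intro continuous_intros continuous_on_compose2[OF bump_continuous[of UNIV]]) (use e in auto)
  have rh0: "0 <= rh c t" for c t using e bump_nonneg by (simp add: rh_def)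
  have supp: "rh c t = 0" if "t ~: {c..c + e}" for c t
  proof -
   have "~ (0 < (t - c)/e & (t - c)/e < 1)" using that e by (auto simp: divide_less_eq zero_less_divide_iff)
   thus ?thesis by (auto simp: rh_def bump_def)
  qed
  have intrh: "LI a b (rh c) = m" if c: "a < c" "c + e < b" for c
  proof -
   have "((%t. bump_int ((t - c)/e)) has_real_derivative bump 1 0 ((t - c)/e)*(1/e)) (at t)" for t
    by (rule DERIV_chain2[OF bump_int_has_derivative]) (use e in "auto intro!: derivative_eq_intros")
   hence "(rh c has_integral (bump_int ((b - c)/e) - bump_int ((a - c)/e))) {a..b}"
    using c e by (intro fundamental_theorem_of_calculus)
     (auto simp: rh_def has_real_derivative_iff_has_vector_derivative[symmetric] intro: has_field_derivative_at_within)
   moreover have "bump_int ((b - c)/e) = m" unfolding m_def using c e by (intro bump_int_one) (simp add: le_divide_eq)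
   moreover have "bump_int ((a - c)/e) = 0" using c e by (intro bump_int_zero) (simp add: divide_le_0_iff)
   ultimately show ?thesis using cont_intg[OF crh] by (simp add: LI_eq_integral integral_unique)
  qed
  have near: "abs(LI a b (%t. rh c t*w t) - m*w c) <= m*(et/2)" if c: "a < c" "c + e < b" for c
  proof -
   have i: "intg a b (%t. rh c t*w t)" "intg a b (rh c)" by (intro cont_intg continuous_intros w crh)+
   have "LI a b (%t. rh c t*w t) - m*w c = LI a b (%t. rh c t*(w t - w c))" using i intrh[OF c] by (simp add: algebra_simps)
   also have "abs(...) <= LI a b (%t. rh c t*(et/2))"
   proof (rule LI_abs_le[OF AE_I2])
    fix t assume "t : space (leb a b)"
    hence t: "t : {a..b}" by simp
    show "abs(rh c t*(w t - w c)) <= rh c t*(et/2)"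
    proof (cases "t : {c..c + e}")
     case True
     hence "abs(w t - w c) <= et/2" using d(2)[of c t] c t e by auto
     thus ?thesis using mult_left_mono[of "abs(w t - w c)" "et/2" "rh c t"] rh0[of c t] by (simp add: abs_mult)
    qed (simp add: supp)
   qed (use i in "auto simp: algebra_simps")
   also have "... = m*(et/2)" using intrh[OF c] by simp
   finally show ?thesis .
  qed
  let ?ps = "%t. bump_int ((t - s)/e) - bump_int ((t - s')/e)"
  have "(?ps has_real_derivative rh s t - rh s' t) (at t)" for t
   using chain_scaled[OF bump_int_has_derivative, of e 1 s s' t] e by (simp add: rh_def algebra_simps diff_divide_distrib)
  hence "deriv ?ps = (%t. rh s t - rh s' t)" by (intro ext DERIV_imp_deriv)
  hence "LI a b (%t. (rh s t - rh s' t)*w t) = 0" using z[OF plateau_test_function[of a s s' e b]] st e by simp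
  moreover have "intg a b (%t. rh c t*w t)" for c by (intro cont_intg continuous_intros w crh)
  ultimately have "LI a b (%t. rh s t*w t) = LI a b (%t. rh s' t*w t)" by (simp add: left_diff_distrib)
  hence "abs(m*w s - m*w s') <= m*et" using near[of s] near[of s'] st e by argo
  hence "m*abs(w s - w s') <= m*et" using m by (simp add: abs_mult flip: right_diff_distrib)
  thus "abs(w s - w s') <= 0 + et" using m by simp
 qed
 thus ?thesis by simp
qed

lemma test_function_by_parts: assumes ab: "a < b" and ps: "ps : scalar_test_functions a b" and g: "intg a b g"
  and u: "!!s t. a <= s ==> s <= t ==> t <= b ==> u t - u s = LI s t g"
 shows "intg a b (%t. deriv ps t*u t)" "intg a b (%t. ps t*g t)" and "LI a b (%t. deriv ps t*u t) = - LI a b (%t. ps t*g t)"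
proof -
 obtain K where K: "K <= {a<..<b}" "!!t. t ~: K ==> ps t = 0" and d: "!!n t. ((deriv ^^ n) ps) differentiable (at t)"
  using ps by (auto simp: scalar_test_functions_def)
 have D0: "(ps has_real_derivative deriv ps t) (at t)" for t using d[of 0 t] by (simp add: DERIV_deriv_iff_real_differentiable)
 have D1: "(deriv ps has_real_derivative deriv (deriv ps) t) (at t)" for t
  using d[of 1 t] by (simp add: DERIV_deriv_iff_real_differentiable)
 have c: "cont a b (deriv ps)" using D1 by (meson DERIV_isCont continuous_at_imp_continuous_on)
 have c0: "cont a b ps" using D0 by (meson DERIV_isCont continuous_at_imp_continuous_on)
 have "a ~: K" "b ~: K" using K(1) by auto
 hence z: "ps a = 0" "ps b = 0" using K(2) by simp_all
 have "cont a b (%t. u a + LI a t g)" by (intro continuous_intros LI_continuous g)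
 moreover have "u a + LI a t g = u t" if "t : {a..b}" for t using u[of a t] that by simp
 ultimately have cu: "cont a b u" by (rule continuous_on_eq)
 show i1: "intg a b (%t. deriv ps t*u t)" by (intro cont_intg continuous_intros c cu)
 note pr = product_with_C1[OF less_imp_le[OF ab] g u D0 c]
 show i2: "intg a b (%t. ps t*g t)" using intg_diff[OF pr(1) i1] by simp
 show "LI a b (%t. deriv ps t*u t) = - LI a b (%t. ps t*g t)" using pr(2) i1 i2 z by simp
qed

context evolution_triple
begin

text \<open>The pairing of \<open>x\<close> with \<open>j v\<close> and the primitive of the pairing
  of \<open>X'\<close> with \<open>v\<close> have the same weak derivative, so their difference is
  constant inside the interval; continuity of \<open>x\<close> carries this to the
  endpoints.\<close>

lemma generalized_derivative_increment:
 fixes X' :: "real => 'a dual" assumes ab: "a < b" and gd: "generalized_derivative j a b X X'" and X': "intg a b (%t. X' t v)"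
  and x: "cont a b x" and ae: "AE t in leb a b. x t = j (X t)" and X: "(%t. inner (j (X t)) (j v)) : meas a b"
  and st: "a <= s" "s <= t" "t <= b" shows "inner (x t - x s) (j v) = LI s t (%r. X' r v)"
proof -
 define g where "g = (%t. X' t v)"
 define u where "u t = inner (x t) (j v)" for t
 define G where "G t = LI a t g" for t
 have g: "intg a b g" using X' by (simp add: g_def)
 have cu: "cont a b u" unfolding u_def by (intro continuous_intros x)
 have cG: "cont a b G" unfolding G_def by (rule LI_continuous[OF g])
 have Ginc: "G t - G s = LI s t g" if "a <= s" "s <= t" "t <= b" for s t
  using LI_combine[of a t g s] intg_sub[OF g, of a t] that by (simp add: G_def)
 have zero: "LI a b (%t. deriv ps t*(u t - G t)) = 0" if ps: "ps : scalar_test_functions a b" for ps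
 proof -
  note parts = test_function_by_parts[OF ab ps g Ginc]
  have c: "cont a b (deriv ps)"
  proof -
   have "((deriv ^^ 1) ps) differentiable (at t)" for t using ps unfolding scalar_test_functions_def by blast
   thus ?thesis by (auto intro!: continuous_at_imp_continuous_on differentiable_imp_continuous_within)
  qed
  have iu: "intg a b (%t. deriv ps t*u t)" by (intro cont_intg continuous_intros c cu)
  have "LI a b (%t. deriv ps t*u t) = LI a b (%t. deriv ps t*inner (j (X t)) (j v))"
  proof (rule integral_cong_AE)
   show "(%t. deriv ps t*u t) : meas a b" using iu by auto
   show "(%t. deriv ps t*inner (j (X t)) (j v)) : meas a b" by (intro borel_measurable_times X meas_intg[OF cont_intg[OF c]])
   show "AE t in leb a b. deriv ps t*u t = deriv ps t*inner (j (X t)) (j v)" using ae by eventually_elim (simp add: u_def)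
  qed
  also have "... = - LI a b (%t. ps t*g t)" using gd ps unfolding generalized_derivative_def g_def by (simp add: intg_open_iff)
  finally show ?thesis using parts iu by (simp add: right_diff_distrib)
 qed
 have const: "u s - G s = u t - G t" if "a < s" "s < t" "t < b" for s t
  by (rule du_Bois_Reymond[of a b "%t. u t - G t"]) (use that zero cu cG in "auto intro!: continuous_intros")
 define c where "c = (a + b)/2"
 have cc: "a < c" "c < b" using ab by (auto simp: c_def)
 have int: "u t - G t = u c - G c" if "t : {a<..<b}" for t
 proof (cases t c rule: linorder_cases)
  case less
  thus ?thesis using const[of t c] that cc by simp
 next
  case greater
  thus ?thesis using const[of c t] that cc by simp
 qed simp
 have "u t - G t = u c - G c" if "t : {a..b}" for t
 proof -
  have "closure {a<..<b} <= {a..b}" using ab by simp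
  hence "continuous_on (closure {a<..<b}) (%t. u t - G t)"
   using ab by (intro continuous_intros) (auto intro: continuous_on_subset[OF cu] continuous_on_subset[OF cG])
  thus ?thesis by (rule continuous_constant_on_closure) (use int that ab in auto)
 qed
 from this[of s] this[of t] have "u t - u s = G t - G s" using st by simp
 thus ?thesis using Ginc[OF st] by (simp add: u_def g_def inner_diff_left)
qed

lemma generalized_derivativeI:
 fixes X' :: "real => 'a dual" assumes ab: "a < b" and X': "!!v. intg a b (%t. X' t v)" and ae: "AE t in leb a b. x t = j (X t)"
  and X: "!!v. (%t. inner (j (X t)) (j v)) : meas a b" and inc: "!!s t v. a <= s ==> s <= t ==> t <= b ==>
   inner (x t - x s) (j v) = LI s t (%r. X' r v)" shows "generalized_derivative j a b X X'" unfolding generalized_derivative_def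
proof (intro ballI allI)
 fix ps v assume ps: "ps : scalar_test_functions a b"
 define u where "u t = inner (x t) (j v)" for t
 have ui: "u t - u s = LI s t (%r. X' r v)" if "a <= s" "s <= t" "t <= b" for s t
  using inc[OF that] by (simp add: u_def inner_diff_left)
 note parts = test_function_by_parts[OF ab ps X' ui]
 have c: "cont a b (deriv ps)"
 proof -
  have "((deriv ^^ 1) ps) differentiable (at t)" for t using ps unfolding scalar_test_functions_def by blast
  thus ?thesis by (auto intro!: continuous_at_imp_continuous_on differentiable_imp_continuous_within)
 qed
 have "LI a b (%t. deriv ps t*inner (j (X t)) (j v)) = LI a b (%t. deriv ps t*u t)"
 proof (rule integral_cong_AE)
  show "(%t. deriv ps t*u t) : meas a b" using parts(1) by auto
  show "(%t. deriv ps t*inner (j (X t)) (j v)) : meas a b" by (intro borel_measurable_times X meas_intg[OF cont_intg[OF c]])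
  show "AE t in leb a b. deriv ps t*inner (j (X t)) (j v) = deriv ps t*u t" using ae by eventually_elim (simp add: u_def)
 qed
 thus "(LINT t|lebesgue_on {a<..<b}. deriv ps t*to_dual j (j (X t)) v) =
   - (LINT t|lebesgue_on {a<..<b}. ps t*X' t v)" using parts(3) by (simp add: intg_open_iff)
qed

end

section \<open>Approximation by continuous functions\<close>

lemma LI_shift:
 fixes f :: "real => real" assumes "intg (a + h) (b + h) f"
 shows "intg a b (%t. f (t + h))" and "LI a b (%t. f (t + h)) = LI (a + h) (b + h) f"
proof -
 let ?i = "LI (a + h) (b + h) f"
 have "has_bochner_integral (leb (a + h) (b + h)) f ?i" using assms by (simp add: has_bochner_integral_iff)
 hence "has_bochner_integral lebesgue (%t. indicat_real {a + h..b + h} t*.f t) ?i"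
  by (subst (asm) has_bochner_integral_restrict_space) auto
 hence "has_bochner_integral lebesgue (%t. indicat_real {a + h..b + h} (h + 1*t)*.f (h + 1*t)) ?i"
  by (subst (asm) has_bochner_integral_lebesgue_real_affine_iff[of 1 _ _ h]) auto
 moreover have "indicat_real {a + h..b + h} (h + 1*t)*.f (h + 1*t) = indicat_real {a..b} t*.f (t + h)" for t
  by (auto simp: indicator_def add.commute)
 ultimately have "has_bochner_integral lebesgue (%t. indicat_real {a..b} t*.f (t + h)) ?i" by simp
 hence "has_bochner_integral (leb a b) (%t. f (t + h)) ?i" by (subst has_bochner_integral_restrict_space) auto
 thus "intg a b (%t. f (t + h))" "LI a b (%t. f (t + h)) = ?i" by (simp_all add: has_bochner_integral_iff)
qed

lemma AE_shift:
 fixes a b h :: real assumes "AE t in leb (a + h) (b + h). P t" shows "AE t in leb a b. P (t + h)"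
proof -
 have "AE t in lebesgue. t : {a + h..b + h} --> P t" using assms AE_on_iff[of "{a + h..b + h}" P] by simp
 then obtain N where N: "N : null_sets lebesgue" "{t. ~ (t : {a + h..b + h} --> P t)} <= N" by (auto simp: eventually_ae_filter)
 have "(%t. - h + t) ` N : null_sets lebesgue" using N(1) negligible_translation[of N "- h"]
  by (simp only: negligible_iff_null_sets)
 moreover have "{t. ~ (t : {a..b} --> P (t + h))} <= (%t. - h + t) ` N"
 proof
  fix t assume "t : {t. ~ (t : {a..b} --> P (t + h))}"
  hence "t + h : N" using N(2) by auto
  thus "t : (%t. - h + t) ` N" by (auto intro!: image_eqI[of _ _ "t + h"])
 qed
 ultimately have "AE t in lebesgue. t : {a..b} --> P (t + h)" by (intro AE_I'[of "(%t. - h + t) ` N"]) auto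
 thus ?thesis using AE_on_iff[of "{a..b}" "%t. P (t + h)"] by simp
qed

lemma measurable_shift:
 fixes a b h :: real and f :: "real => 'a::topological_space" assumes f: "f : meas (a + h) (b + h)"
 shows "(%t. f (t + h)) : meas a b"
proof (rule borel_measurableI)
 fix U :: "'a set" assume "open U"
 hence "f -` U Int {a + h..b + h} : sets lebesgue" using measurable_sets[OF f, of U] by (simp add: sets_restrict_space_iff)
 hence "(+) (- h) ` (f -` U Int {a + h..b + h}) : sets lebesgue" by (rule lebesgue_sets_translation)
 moreover have "(%t. f (t + h)) -` U Int {a..b} = (+) (- h) ` (f -` U Int {a + h..b + h})"
 proof (intro equalityI subsetI)
  fix t assume "t : (%t. f (t + h)) -` U Int {a..b}"
  thus "t : (+) (- h) ` (f -` U Int {a + h..b + h})" by (intro image_eqI[of _ _ "t + h"]) auto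
 qed auto
 ultimately have "(%t. f (t + h)) -` U Int {a..b} : sets lebesgue" by simp
 thus "(%t. f (t + h)) -` U Int space (leb a b) : sets (leb a b)" by (simp add: sets_restrict_space_iff)
qed

lemma Lp_dominated_convergence:
 fixes f :: "nat => 'c => 'a::{banach, second_countable_topology}"
 assumes p: "0 < p" and f[measurable]: "!!n. f n : borel_measurable M" "g : borel_measurable M"
  and lim: "AE t in M. (%n. f n t) ----> g t"
  and bd: "!!n. AE t in M. norm (f n t - g t) <= w t" and w: "integrable M (%t. w t powr p)"
 shows "(%n. lint M (%t. norm (f n t - g t) powr p)) ----> 0" and "!!n. integrable M (%t. norm (f n t - g t) powr p)"
proof -
 have l: "AE t in M. (%n. norm (f n t - g t) powr p) ----> 0" using lim
 proof eventually_elim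
  case (elim t)
  have "(%n. norm (f n t - g t)) ----> 0" using elim by (simp add: LIM_zero tendsto_norm_zero)
  thus ?case using p tendsto_zero_powrI[of "%n. norm (f n t - g t)" sequentially "%_. p" p] by auto
 qed
 have b: "AE t in M. norm (norm (f n t - g t) powr p) <= w t powr p" for n
  using bd[of n] by eventually_elim (use p in "auto intro: powr_mono2")
 have "(%n. lint M (%t. norm (f n t - g t) powr p)) ----> lint M (%t. 0)"
  by (rule integral_dominated_convergence[OF _ _ w l b]) auto
 thus "(%n. lint M (%t. norm (f n t - g t) powr p)) ----> 0" by simp
 show "integrable M (%t. norm (f n t - g t) powr p)" for n by (rule intg_bound[OF w]) (use b in auto)
qed

text \<open>One-sided averages are continuous and, by Lebesgue's theorem, converge almost everywhere.\<close>

lemma indicator_continuous_approximation: assumes E: "E : sets lebesgue"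
 obtains c :: "nat => real => real" where "!!n. cont a b (c n)" "!!n t. t : {a..b} ==> c n t : {0..1}"
  "AE t in leb a b. (%n. c n t) ----> indicator E t"
proof
 define g :: "real => real" where "g = indicator E"
 define h where "h n = 1/real (Suc n)" for n
 have h: "0 < h n" "h n <= 1" for n by (auto simp: h_def)
 define c where "c n t = LI t (t + h n) g/h n" for n t
 have gm: "g : meas s t" for s t unfolding g_def using E by (intro measurable_restrict_space1 borel_measurable_indicator)
 have gi: "intg s t g" for s t by (rule intg_bounded[of _ _ _ 1]) (use gm in "auto simp: g_def indicator_def")
 show "cont a b (c n)" for n
 proof -
  have c1: "cont a (b + 1) (%t. LI a t g)" by (rule LI_continuous[OF gi])
  have "cont a b (%t. (LI a (t + h n) g - LI a t g)/h n)"
   using h[of n] by (intro continuous_intros continuous_on_compose2[OF c1] continuous_on_subset[OF c1])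
    (auto intro: order_trans[of _ "b + 1"] add_mono simp: add_increasing2 less_imp_le)
  thus ?thesis
  proof (rule continuous_on_eq)
   fix t assume "t : {a..b}"
   thus "(LI a (t + h n) g - LI a t g)/h n = c n t" using LI_combine[of a "t + h n" g t] gi h[of n] by (simp add: c_def)
  qed
 qed
 show "c n t : {0..1}" if "t : {a..b}" for n t
 proof -
  have "0 <= LI t (t + h n) g" by (rule integral_nonneg_AE) (auto simp: g_def)
  moreover have "LI t (t + h n) g <= LI t (t + h n) (%_. 1)" using gi by (intro LI_mono_AE) (auto simp: g_def indicator_def)
  ultimately show ?thesis using h[of n] by (simp add: c_def LI_const divide_le_eq)
 qed
 have "AE t in leb a b. ((%d. LI t (t + d) g/d) \<longlongrightarrow> g t) (at_right 0)" by (rule Lebesgue_diff[OF gi])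
 thus "AE t in leb a b. (%n. c n t) ----> indicator E t"
 proof eventually_elim
  case (elim t)
  have "filterlim h (at_right 0) sequentially"
   unfolding filterlim_at using h LIMSEQ_inverse_real_of_nat by (auto simp: h_def[abs_def] inverse_eq_divide)
  thus ?case using filterlim_compose[OF elim] by (simp add: c_def g_def)
 qed
qed

lemma simple_function_continuous_approximation:
 fixes s :: "real => 'a::{banach, second_countable_topology}"
 assumes s: "simple_function (leb a b) s" and p: "0 < p" and e: "0 < e"
 obtains S where "cont a b S" "intg a b (%t. norm (S t - s t) powr p)" "LI a b (%t. norm (S t - s t) powr p) < e"
proof -
 define R where "R = s ` {a..b}"
 have fin: "finite R" using simple_functionD(1)[OF s] by (simp add: R_def)
 have E: "s -` {v} Int {a..b} : sets lebesgue" for v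
  using simple_functionD(2)[OF s, of "{v}"] by (simp add: sets_restrict_space_iff)
 have "EX c :: nat => real => real. (ALL n. cont a b (c n)) & (ALL n t. t : {a..b} --> c n t : {0..1}) \<and>
  (AE t in leb a b. (%n. c n t) ----> indicator (s -` {v} Int {a..b}) t)" for v
  by (rule indicator_continuous_approximation[OF E[of v], of a b]) blast
 hence "EX c :: 'a => nat => real => real. ALL v. (ALL n. cont a b (c v n)) & (ALL n t. t : {a..b} --> c v n t : {0..1}) \<and>
  (AE t in leb a b. (%n. c v n t) ----> indicator (s -` {v} Int {a..b}) t)" by (intro choice allI)
 then obtain c :: "'a => nat => real => real" where c: "!!v n. cont a b (c v n)" "!!v n t. t : {a..b} ==> c v n t : {0..1}"
  "!!v. AE t in leb a b. (%n. c v n t) ----> indicator (s -` {v} Int {a..b}) t" by blast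
 define S where "S n t = (SUM v:R. c v n t*.v)" for n t
 define B where "B = (SUM v:R. norm v)"
 have cS: "cont a b (S n)" for n unfolding S_def by (intro continuous_intros c)
 have mS: "S n : meas a b" for n by (rule continuous_imp_measurable_on_sets_lebesgue[OF cS]) simp
 have ms: "s : meas a b" by (rule borel_measurable_simple_function[OF s])
 have "AE t in leb a b. ALL v:R. (%n. c v n t) ----> indicator (s -` {v} Int {a..b}) t"
  using fin c(3) by (intro AE_finite_allI) auto
 hence lim: "AE t in leb a b. (%n. S n t) ----> s t" using AE_space
 proof eventually_elim
  case (elim t)
  have "(%n. S n t) ----> (SUM v:R. indicat_real (s -` {v} Int {a..b}) t*.v)"
   unfolding S_def using elim by (intro tendsto_intros) auto
  moreover have "(SUM v:R. indicat_real (s -` {v} Int {a..b}) t*.v) = (SUM v:{s t}. v)"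
   using fin elim(2) by (intro sum.mono_neutral_cong_right) (auto simp: indicator_def R_def)
  ultimately show ?case by simp
 qed
 have bd: "AE t in leb a b. norm (S n t - s t) <= 2*B" for n
 proof (rule AE_I2)
  fix t assume "t : space (leb a b)"
  hence t: "t : {a..b}" by simp
  have "norm (S n t) <= (SUM v:R. norm (c v n t*.v))" unfolding S_def by (rule norm_sum)
  also have "... <= B" unfolding B_def using c(2)[OF t] by (intro sum_mono) (auto simp: mult_left_le_one_le)
  finally have "norm (S n t) <= B" .
  moreover have "norm (s t) <= B" unfolding B_def using t fin by (intro member_le_sum) (auto simp: R_def)
  ultimately show "norm (S n t - s t) <= 2*B" using norm_triangle_ineq4[of "S n t" "s t"] by linarith
 qed
 have w: "intg a b (%t. (2*B) powr p)" by (rule intg_const)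
 note conv = Lp_dominated_convergence[OF p mS ms lim bd w]
 have "EVN n. LI a b (%t. norm (S n t - s t) powr p) < e" using order_tendstoD(2)[OF conv(1) e] .
 then obtain n where "LI a b (%t. norm (S n t - s t) powr p) < e" by (auto simp: eventually_sequentially)
 thus ?thesis using that cS conv(2) by blast
qed

text \<open>Supplies the uniformly continuous function that makes small time shifts of
  \<open>X\<close> small in \<open>L^p\<close> in the energy argument.\<close>

lemma Lp_approx:
 fixes X :: "real => 'a::{banach, second_countable_topology}" assumes X: "X : meas a b" "intg a b (%t. norm (X t) powr p)"
  and p: "0 < p" and e: "0 < e" obtains S where "cont a b S" "intg a b (%t. norm (X t - S t) powr p)"
  "LI a b (%t. norm (X t - S t) powr p) < e"
proof -
 obtain s where s': "ALL n. simple_function (leb a b) (s n)"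
  "ALL t:{a..b}. (%n. s n t) ----> X t" "ALL n. ALL t:{a..b}. dist (s n t) 0 <= 2*dist (X t) 0"
  using borel_measurable_implies_sequence_metric[OF X(1), of 0] unfolding space_lebesgue_on by blast
 have s: "!!n. simple_function (leb a b) (s n)" "!!t. t : {a..b} ==> (%n. s n t) ----> X t"
  "!!n t. t : {a..b} ==> norm (s n t) <= 2*norm (X t)" using s' by simp_all
 have ms: "s n : meas a b" for n by (rule borel_measurable_simple_function[OF s(1)])
 have bd: "AE t in leb a b. norm (s n t - X t) <= 3*norm (X t)" for n
 proof (rule AE_I2)
  fix t assume "t : space (leb a b)"
  thus "norm (s n t - X t) <= 3*norm (X t)" using s(3)[of t n] norm_triangle_ineq4[of "s n t" "X t"] by simp
 qed
 have w: "intg a b (%t. (3*norm (X t)) powr p)" using X(2) by (simp add: powr_mult)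
 have lim: "AE t in leb a b. (%n. s n t) ----> X t" using s(2) by (intro AE_I2) simp
 note conv = Lp_dominated_convergence[OF p ms X(1) lim bd w]
 define e' where "e' = e/(2*2 powr p)"
 have e': "0 < e'" using e by (simp add: e'_def)
 have "EVN n. LI a b (%t. norm (s n t - X t) powr p) < e'" using order_tendstoD(2)[OF conv(1) e'] .
 then obtain n where n: "LI a b (%t. norm (s n t - X t) powr p) < e'" by (auto simp: eventually_sequentially)
 obtain S where S: "cont a b S" "intg a b (%t. norm (S t - s n t) powr p)" "LI a b (%t. norm (S t - s n t) powr p) < e'"
  by (rule simple_function_continuous_approximation[OF s(1)[of n] p e'])
 have mS: "S : meas a b" by (rule continuous_imp_measurable_on_sets_lebesgue[OF S(1)]) simp
 define k where "k t = 2 powr p*(norm (s n t - X t) powr p + norm (S t - s n t) powr p)" for t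
 have k: "norm (X t - S t) powr p <= k t" for t
 proof -
  have "norm (X t - S t) <= norm (s n t - X t) + norm (S t - s n t)"
   using norm_triangle_ineq[of "X t - s n t" "s n t - S t"] by (simp add: norm_minus_commute)
  hence "norm (X t - S t) powr p <= (norm (s n t - X t) + norm (S t - s n t)) powr p" using p by (intro powr_mono2) auto
  also have "... <= k t" unfolding k_def using p by (intro powr_sum_le) auto
  finally show ?thesis .
 qed
 have ik: "intg a b k" unfolding k_def using conv(2) S(2) by simp
 have m: "(%t. norm (X t - S t) powr p) : meas a b" using X(1) mS by simp
 have i: "intg a b (%t. norm (X t - S t) powr p)" by (rule intg_AE_le[OF ik m]) (use k in auto)
 have "LI a b (%t. norm (X t - S t) powr p) <= LI a b k" using i ik k by (intro LI_mono_AE) auto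
 also have "... = 2 powr p*(LI a b (%t. norm (s n t - X t) powr p) + LI a b (%t. norm (S t - s n t) powr p))"
  unfolding k_def using conv(2) S(2) by simp
 also have "... < 2 powr p*(e' + e')" using n S(3) by (intro mult_strict_left_mono add_strict_mono) auto
 also have "... = e" by (simp add: e'_def)
 finally show ?thesis using that S(1) i by blast
qed

lemma add_powr_integrable:
 fixes X Y :: "real => 'c::real_normed_vector"
 assumes r: "0 <= r" and i: "intg a b (%t. norm (X t) powr r)" "intg a b (%t. norm (Y t) powr r)"
  and m: "(%t. norm (X t + Y t)) : meas a b" shows "intg a b (%t. norm (X t + Y t) powr r)"
  and "LI a b (%t. norm (X t + Y t) powr r) <= 2 powr r*(LI a b (%t. norm (X t) powr r) + LI a b (%t. norm (Y t) powr r))"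
proof -
 have le: "norm (X t + Y t) powr r <= 2 powr r*(norm (X t) powr r + norm (Y t) powr r)" for t
  using powr_mono2[of r "norm (X t + Y t)" "norm (X t) + norm (Y t)"] powr_sum_le[of "norm (X t)" "norm (Y t)" r] r
   norm_triangle_ineq[of "X t" "Y t"] by fastforce
 have i2: "intg a b (%t. 2 powr r*(norm (X t) powr r + norm (Y t) powr r))" using i by simp
 show ii: "intg a b (%t. norm (X t + Y t) powr r)" by (rule intg_AE_le[OF i2]) (use le m in auto)
 have "LI a b (%t. norm (X t + Y t) powr r) <= LI a b (%t. 2 powr r*(norm (X t) powr r + norm (Y t) powr r))"
  by (rule LI_mono_AE[OF ii i2]) (use le in auto)
 thus "LI a b (%t. norm (X t + Y t) powr r) <= 2 powr r*(LI a b (%t. norm (X t) powr r) + LI a b (%t. norm (Y t) powr r))"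
  using i by simp
qed

section \<open>The cross energy identity\<close>

locale evolution_exponents = evolution_triple +
 fixes p q :: real assumes p2: "2 <= p" and q1: "1 < q" and pq: "1/p + 1/q = 1"
begin

lemma p1: "1 < p" and p0: "0 < p" and q0: "0 < q" and qp: "1/q + 1/p = 1" using p2 q1 pq by auto

definition Vfun :: "real => real => (real => 'a) => bool" where "Vfun a b X <-> X : meas a b & intg a b (%t. norm (X t) powr p)"

text \<open>The space \<open>L^q\<close> with values in the dual of \<open>V\<close>. Measurability
  is stated weakly, a form that passes through pointwise limits;
  \<open>strongly_measurable_dual\<close> recovers Bochner measurability.\<close>

definition Dfun :: "real => real => (real => 'a dual) => bool" where "Dfun a b G <-> (ALL v. (%t. G t v) : meas a b) \<and>
  intg a b (%t. norm (G t) powr q)"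

lemma Vfun_measurable: "Vfun a b X ==> X : meas a b" and Vfun_intg: "Vfun a b X ==> intg a b (%t. norm (X t) powr p)"
 and Dfun_measurable: "Dfun a b G ==> (%t. G t v) : meas a b" and Dfun_intg: "Dfun a b G ==> intg a b (%t. norm (G t) powr q)"
 by (auto simp: Vfun_def Dfun_def)

lemma Dfun_norm_measurable: "Dfun a b G ==> (%t. norm (G t)) : meas a b" by (intro meas_norm_dual Dfun_measurable)

lemma Vfun_subinterval: "Vfun a b X ==> a <= s ==> t <= b ==> Vfun s t X"
 unfolding Vfun_def by (auto intro: intg_sub meas_sub[where S="{a..b}"])

lemma Dfun_subinterval: "Dfun a b X ==> a <= s ==> t <= b ==> Dfun s t X"
 unfolding Dfun_def by (auto intro: intg_sub meas_sub[where S="{a..b}"])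

lemma Vfun_const: "Vfun a b (%_. v)" by (simp add: Vfun_def)

lemma Vfun_add: assumes "Vfun a b X" "Vfun a b Y" shows "Vfun a b (%t. X t + Y t)"
proof -
 have "(%t. X t + Y t) : meas a b" using assms[THEN Vfun_measurable] by simp
 thus ?thesis using assms add_powr_integrable(1)[of p a b X Y] p0 by (simp add: Vfun_def)
qed

lemma Vfun_scaleR: "Vfun a b X ==> Vfun a b (%t. c*.X t)"
 unfolding Vfun_def by (auto simp: powr_mult intro: borel_measurable_scaleR borel_measurable_const)

lemma Vfun_diff: "Vfun a b X ==> Vfun a b Y ==> Vfun a b (%t. X t - Y t)"
 using Vfun_add[of a b X "%t. (-1)*.Y t"] Vfun_scaleR[of a b Y "-1"] by simp

lemma Dfun_add: assumes "Dfun a b G" "Dfun a b H" shows "Dfun a b (%t. G t + H t)"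
proof -
 have w: "(%t. (G t + H t) v) : meas a b" for v using assms[THEN Dfun_measurable] by (simp add: blinfun.add_left)
 thus ?thesis using assms add_powr_integrable(1)[of q a b G H, OF _ _ _ meas_norm_dual[OF w]] q0 by (simp add: Dfun_def)
qed

lemma Dfun_scaleR: "Dfun a b G ==> Dfun a b (%t. c*.G t)"
 unfolding Dfun_def by (auto simp: powr_mult blinfun.scaleR_left intro: borel_measurable_times borel_measurable_const)

lemma Dfun_diff: "Dfun a b G ==> Dfun a b H ==> Dfun a b (%t. G t - H t)"
 using Dfun_add[of a b G "%t. (-1)*.H t"] Dfun_scaleR[of a b H "-1"] by simp

lemma pair_intg: assumes G: "Dfun a b G" and X: "Vfun a b X" shows "intg a b (%t. G t (X t))"
proof (rule product_integrable[OF p1 q1 pq, where f="%t. norm (G t)" and g="%t. norm (X t)"])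
 show "(%t. G t (X t)) : meas a b" by (rule pairing_measurable[OF _ Dfun_measurable[OF G] Vfun_measurable[OF X]]) simp
 show "AE t in leb a b. abs(G t (X t)) <= abs(norm (G t))*abs(norm (X t))" using norm_blinfun[of "G _"] by (intro AE_I2) simp
qed (use G X in "auto simp: Vfun_intg Dfun_intg")

lemma Dfun_apply: "Dfun a b G ==> intg a b (%t. G t v)" by (rule pair_intg[OF _ Vfun_const])

lemma Dfun_norm_intg: assumes G: "Dfun a b G" and X: "Vfun a b X"
 shows "intg a b (%t. norm (G t)*norm (X t))" "intg a b (%t. norm (G t))"
proof -
 note [measurable] = Dfun_norm_measurable[OF G] Vfun_measurable[OF X]
 show "intg a b (%t. norm (G t)*norm (X t))"
  by (rule product_integrable[OF p1 q1 pq, where f="%t. norm (G t)" and g="%t. norm (X t)"])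
   (use G X in "auto simp: Vfun_intg Dfun_intg")
 show "intg a b (%t. norm (G t))" by (rule product_integrable[OF p1 q1 pq, where f="%t. norm (G t)" and g="%t. 1"])
   (use G in "auto simp: Dfun_intg")
qed

lemma Young: assumes "0 < th" obtains D where "0 <= D" "!!x y. 0 <= x ==> 0 <= y ==> x*y <= th*x powr q + D*y powr p"
 using Young_scaled[OF p1 q1 pq assms] by blast

text \<open>Equi-integrability with constants: the bound of \<open>G\<close> in the
  \<open>q\<close>-th mean costs \<open>th*Cq\<close>, with \<open>th\<close> as small as desired,
  and the remaining term is small on short intervals uniformly in \<open>G\<close>.\<close>

lemma LI_Dfun_le: assumes G: "Dfun a b G" "LI a b (%t. norm (G t) powr q) <= Cq"
  and u: "u : meas a b" "intg a b (%t. u t powr p)" "!!t. 0 <= u t"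
  and D: "!!x y. 0 <= x ==> 0 <= y ==> x*y <= th*x powr q + D*y powr p" and th: "0 <= th" and st: "a <= s" "t <= b"
 shows "intg s t (%r. norm (G r)*u r)" and "LI s t (%r. norm (G r)*u r) <= th*Cq + D*LI s t (%r. u r powr p)"
proof -
 note [measurable] = Dfun_norm_measurable[OF G(1)] u(1)
 have Gu: "intg a b (%r. norm (G r)*u r)" by (rule product_integrable[OF p1 q1 pq, where f="%t. norm (G t)" and g=u])
   (use G u in "auto simp: Dfun_intg")
 thus i: "intg s t (%r. norm (G r)*u r)" using st by (rule intg_sub)
 have ig: "intg s t (%r. norm (G r) powr q)" "intg s t (%r. u r powr p)"
  using intg_sub[OF Dfun_intg[OF G(1)] st] intg_sub[OF u(2) st] by auto
 have "LI s t (%r. norm (G r)*u r) <= LI s t (%r. th*norm (G r) powr q + D*u r powr p)"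
  using i ig D u(3) by (intro LI_mono_AE) auto
 also have "... = th*LI s t (%r. norm (G r) powr q) + D*LI s t (%r. u r powr p)" using ig by simp
 also have "LI s t (%r. norm (G r) powr q) <= LI a b (%r. norm (G r) powr q)"
  using Dfun_intg[OF G(1)] st by (intro LI_mono_subset) auto
 hence "th*LI s t (%r. norm (G r) powr q) + D*LI s t (%r. u r powr p)
   <= th*Cq + D*LI s t (%r. u r powr p)" using G(2) th by (simp add: mult_left_mono)
 finally show "LI s t (%r. norm (G r)*u r) <= th*Cq + D*LI s t (%r. u r powr p)" .
qed

end

lemma LI_small: assumes g: "intg a b g" and th: "0 < th"
 obtains de where "0 < de" "!!s t. a <= s ==> s <= t ==> t <= b ==> t - s < de ==> abs(LI s t g) <= th"
proof -
 have "uniformly_continuous_on {a..b} (%t. LI a t g)" by (rule compact_uniformly_continuous[OF LI_continuous[OF g] compact_Icc])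
 then obtain de where de: "0 < de" "!!s t. s : {a..b} ==> t : {a..b} ==> abs(t - s) < de ==> abs(LI a t g - LI a s g) < th"
  using th unfolding uniformly_continuous_on_def dist_real_def by blast
 show ?thesis
 proof (rule that[OF de(1)])
  fix s t assume st: "a <= s" "s <= t" "t <= b" "t - s < de"
  have "LI a s g + LI s t g = LI a t g" using st intg_sub[OF g, of a t] by (intro LI_combine) auto
  thus "abs(LI s t g) <= th" using de(2)[of s t] st by auto
 qed
qed

lemma LI_difference_shift: assumes f: "intg al (be + h) f" and h: "0 <= h" and ab: "al <= be"
 shows "LI al be (%t. f (t + h) - f t) = LI be (be + h) f - LI al (al + h) f" and "intg al be (%t. f (t + h) - f t)"
proof -
 have i: "intg s t f" if "al <= s" "t <= be + h" for s t using f that by (rule intg_sub)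
 have sh: "intg al be (%t. f (t + h))" "LI al be (%t. f (t + h)) = LI (al + h) (be + h) f"
  using LI_shift[of al h be f] i h by auto
 thus "intg al be (%t. f (t + h) - f t)" using i[of al be] h by simp
 have "LI al be (%t. f (t + h) - f t) = LI (al + h) (be + h) f - LI al be f" using sh i[of al be] h by simp
 moreover have "LI al (al + h) f + LI (al + h) (be + h) f = LI al be f + LI be (be + h) f"
  using LI_combine[of al "be + h" f "al + h"] LI_combine[of al "be + h" f be] f h ab by simp
 ultimately show "LI al be (%t. f (t + h) - f t) = LI be (be + h) f - LI al (al + h) f" by simp
qed

text \<open>The window integral is a time difference of the primitive \<open>LI a t f\<close>, so
  integration in \<open>t\<close> telescopes to two boundary windows.\<close>

lemma LI_window: assumes f: "intg a b f" and h: "0 <= h" and ab: "a <= al" "al <= be" "be + h <= b"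
 shows "intg al be (%t. LI t (t + h) f)"
  and "LI al be (%t. LI t (t + h) f) = LI be (be + h) (%t. LI a t f) - LI al (al + h) (%t. LI a t f)"
proof -
 have c: "cont al (be + h) (%t. LI a t f)" by (rule continuous_on_subset[OF LI_continuous[OF f]]) (use ab in auto)
 have eq: "LI t (t + h) f = LI a (t + h) f - LI a t f" if "t : {al..be}" for t
  using LI_combine[of a "t + h" f t] intg_sub[OF f, of a "t + h"] that ab h by simp
 note d = LI_difference_shift[OF cont_intg[OF c] h ab(2)]
 have "intg al be (%t. LI t (t + h) f) <-> intg al be (%t. LI a (t + h) f - LI a t f)" by (rule intg_cong) (use eq in auto)
 thus "intg al be (%t. LI t (t + h) f)" using d by simp
 have "LI al be (%t. LI t (t + h) f) = LI al be (%t. LI a (t + h) f - LI a t f)" by (rule LI_cong) (use eq in auto)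
 thus "LI al be (%t. LI t (t + h) f) = LI be (be + h) (%t. LI a t f) - LI al (al + h) (%t. LI a t f)" using d by simp
qed

lemma LI_window_le: assumes ph: "intg a b ph" "!!t. 0 <= ph t" and h: "0 <= h" and ab: "a <= al" "al <= be" "be + h <= b"
 shows "LI al be (%t. LI t (t + h) ph) <= h*LI a b ph"
proof -
 have c: "cont be (be + h) (%t. LI a t ph)" by (rule continuous_on_subset[OF LI_continuous[OF ph(1)]]) (use ab in auto)
 have "LI al be (%t. LI t (t + h) ph) = LI be (be + h) (%t. LI a t ph) - LI al (al + h) (%t. LI a t ph)"
  by (rule LI_window(2)[OF ph(1) h ab])
 also have "... <= LI be (be + h) (%_. LI a b ph) - 0"
 proof (rule diff_mono)
  show "LI be (be + h) (%t. LI a t ph) <= LI be (be + h) (%_. LI a b ph)"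
   using ph ab h cont_intg[OF c] by (intro LI_mono_AE AE_I2) (auto intro!: LI_mono_subset)
  show "0 <= LI al (al + h) (%t. LI a t ph)" using ph(2) by (intro integral_nonneg_AE AE_I2) simp
 qed
 finally show "LI al be (%t. LI t (t + h) ph) <= h*LI a b ph" using h by (simp add: LI_const mult.commute)
qed

lemma powr_sum3_le:
 fixes x y z p :: real assumes "0 <= x" "0 <= y" "0 <= z" "0 <= p"
 shows "(x + y + z) powr p <= 4 powr p*(x powr p + y powr p + z powr p)"
proof -
 have "(x + y + z) powr p <= 2 powr p*(2 powr p*(x powr p + y powr p) + z powr p)"
  using powr_sum_le[of "x + y" z p] powr_sum_le[of x y p] assms
  by (intro order_trans[OF powr_sum_le[of "x + y" z p]] mult_left_mono add_right_mono) auto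
 also have "... <= 2 powr p*(2 powr p*(x powr p + y powr p) + 2 powr p*z powr p)"
  using assms mult_right_mono[of 1 "2 powr p" "z powr p"] by (intro mult_left_mono add_left_mono) (auto simp: ge_one_powr_ge_zero)
 also have "... = (2 powr p*2 powr p)*(x powr p + y powr p + z powr p)" by (simp add: algebra_simps)
 also have "2 powr p*2 powr p = (4::real) powr p" using powr_mult[of 2 2 p] by simp
 finally show ?thesis .
qed

abbreviation increments :: "('a::real_normed_vector \<Rightarrow>\<^sub>L 'b::real_inner) => real => real => (nat => real => 'b) => (nat => real => 'a dual) => real => bool" where
 "increments j a b xn G et == EX n0. ALL n>=n0. ALL s t v. a <= s --> s <= t --> t <= b -->
  abs(inner (xn n t - xn n s) (j v) - LI s t (%r. G n r v)) <= et*norm v"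

text \<open>The derivatives \<open>G n\<close> belong to the approximations, whereas
  \<open>X\<close> represents the weak limit \<open>x\<close>. The goal is that twice the integral
  of \<open>G n\<close> paired with \<open>X\<close> tends to the increment of \<open>|x|^2\<close>;
  for constant sequences this is the chain rule.\<close>

locale cross_energy = evolution_exponents +
 fixes a b C0 Cq :: real and X :: "real => 'a::{banach, second_countable_topology}" and x :: "real => 'b::{real_inner, complete_space}"
  and xn :: "nat => real => 'b" and G :: "nat => real => 'a dual" assumes ab: "a < b"
  and X: "Vfun a b X" and xX: "AE t in leb a b. x t = j (X t)"
  and G: "!!n. Dfun a b (G n)" and Gb: "!!n. LI a b (%t. norm (G n t) powr q) <= Cq"
  and xb: "!!n t. t : {a..b} ==> norm (xn n t) <= C0" and xm: "!!n h. (%t. inner h (xn n t)) : meas a b"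
  and weak: "!!t h. t : {a..b} ==> (%n. inner h (xn n t)) ----> inner h (x t)"
  and app: "!!et. 0 < et ==> increments j a b xn G et"
begin

lemma Cq0: "0 <= Cq"
proof -
 have "0 <= LI a b (%t. norm (G 0 t) powr q)" by (rule integral_nonneg_AE) auto
 thus ?thesis using Gb[of 0] by linarith
qed

lemma C00: "0 <= C0" using order_trans[OF norm_ge_zero xb[of a 0]] ab by simp

lemma x_bound: assumes "t : {a..b}" shows "norm (x t) <= C0"
proof -
 have "norm (x t)*norm (x t) <= norm (x t)*C0"
 proof (rule LIMSEQ_le_const2)
  show "(%n. inner (x t) (xn n t)) ----> norm (x t)*norm (x t)"
   using weak[OF assms, of "x t"] by (simp add: dot_square_norm power2_eq_square)
  have "inner (x t) (xn n t) <= norm (x t)*C0" for n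
   using norm_cauchy_schwarz[of "x t" "xn n t"] mult_left_mono[OF xb[OF assms, of n] norm_ge_zero[of "x t"]] by linarith
  thus "EX N. ALL n>=N. inner (x t) (xn n t) <= norm (x t)*C0" by blast
 qed
 thus ?thesis using C00 by (cases "x t = 0") auto
qed

lemma x_measurable: "(%t. inner h (x t)) : meas a b" by (rule borel_measurable_LIMSEQ_real[OF _ xm]) (use weak in simp)

lemma G_small: assumes "0 < th"
 obtains de where "0 < de" "!!n s t. a <= s ==> s <= t ==> t <= b ==> t - s < de ==> LI s t (%r. norm (G n r)) <= th"
  "!!n s t. a <= s ==> s <= t ==> t <= b ==> t - s < de ==> abs(LI s t (%r. G n r (X r))) <= th"
proof -
 define th' where "th' = th/(2*(Cq + 1))"
 have th': "0 < th'" "th'*Cq <= th/2" using assms Cq0 by (auto simp: th'_def field_simps)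
 obtain D where D: "0 <= D" "!!x y. 0 <= x ==> 0 <= y ==> x*y <= th'*x powr q + D*y powr p" using Young[OF th'(1)] by blast
 have "0 < th/(2*(D + 1))" using assms D by simp
 then obtain de1 where de1: "0 < de1" "!!s t. a <= s ==> s <= t ==> t <= b ==> t - s < de1 ==>
   abs(LI s t (%r. norm (X r) powr p)) <= th/(2*(D + 1))" by (rule LI_small[OF Vfun_intg[OF X]]) blast
 define de where "de = min de1 (th/(2*(D + 1)))"
 have D': "D*y <= th/2" if "y <= th/(2*(D + 1))" for y
 proof -
  have "D*y <= D*(th/(2*(D + 1)))" using that D by (intro mult_left_mono) auto
  also have "... <= th/2" using D assms by (simp add: field_simps)
  finally show ?thesis .
 qed
 show ?thesis
 proof (rule that[of de])
  show "0 < de" using de1 D assms by (simp add: de_def)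
  fix n s t assume st: "a <= s" "s <= t" "t <= b" "t - s < de"
  have "LI s t (%r. norm (G n r)*1) <= th'*Cq + D*LI s t (%r. 1 powr p)" using D th' st by (intro LI_Dfun_le[OF G Gb]) auto
  also have "D*LI s t (%r. 1 powr p) <= th/2" using D'[of "t - s"] st by (simp add: LI_const de_def)
  finally show "LI s t (%r. norm (G n r)) <= th" using th' by simp
  have Xn: "(%r. norm (X r)) : meas a b" using Vfun_measurable[OF X] by simp
  note gx = LI_Dfun_le[OF G Gb Xn Vfun_intg[OF X] norm_ge_zero D(2) less_imp_le[OF th'(1)] st(1,3)]
  have "abs(LI s t (%r. G n r (X r))) <= LI s t (%r. norm (G n r)*norm (X r))"
   using norm_blinfun[of "G n _"] pair_intg[OF G X] st gx(1) by (intro LI_abs_le AE_I2) (auto intro: intg_sub)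
  also have "... <= th'*Cq + D*LI s t (%r. norm (X r) powr p)" by (rule gx(2))
  also have "D*LI s t (%r. norm (X r) powr p) <= th/2"
   using D'[of "LI s t (%r. norm (X r) powr p)"] de1(2)[of s t] st by (auto simp: de_def)
  finally show "abs(LI s t (%r. G n r (X r))) <= th" using th' by simp
 qed
qed

text \<open>No limit of \<open>G n\<close> is available yet, so the increments of \<open>x\<close>
  inherit a bound only through a common bound on the mass of \<open>G n\<close>.\<close>

lemma increment_bound: assumes st: "a <= c" "c <= d" "d <= b" "s : {c..d}" "t : {c..d}"
  and L: "!!n. LI c d (%r. norm (G n r))*norm v <= B" shows "abs(inner (x t - x s) (j v)) <= B"
proof -
 have main: "abs(inner (x t - x s) (j v)) <= B" if st': "s <= t" "s : {c..d}" "t : {c..d}" for s t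
 proof (rule field_le_epsilon)
  fix e :: real assume e: "0 < e"
  define et where "et = e/(norm v + 1)"
  have et: "0 < et" "et*norm v <= e" using e by (auto simp: et_def add_nonneg_pos pos_divide_le_eq mult_left_mono)
  obtain n0 where n0: "!!n s t v. n0 <= n ==> a <= s ==> s <= t ==> t <= b ==>
   abs(inner (xn n t - xn n s) (j v) - LI s t (%r. G n r v)) <= et*norm v" using app[OF et(1)] by blast
  have bd: "abs(inner (xn n t - xn n s) (j v)) <= B + e" if "n0 <= n" for n
  proof -
   have Gs: "Dfun s t (G n)" "Dfun c d (G n)" by (rule Dfun_subinterval[OF G]; use st st' in simp)+
   have gi: "intg s t (%r. norm (G n r))" "intg c d (%r. norm (G n r))"
    using Dfun_norm_intg(2)[OF Gs(1) Vfun_const] Dfun_norm_intg(2)[OF Gs(2) Vfun_const] by auto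
   have "abs(LI s t (%r. G n r v)) <= LI s t (%r. norm (G n r)*norm v)" using norm_blinfun[of "G n _"] Dfun_apply[OF Gs(1)] gi
    by (intro LI_abs_le AE_I2) auto
   also have "... = LI s t (%r. norm (G n r))*norm v" by simp
   also have "... <= LI c d (%r. norm (G n r))*norm v" using gi st' by (intro mult_right_mono LI_mono_subset) auto
   also have "... <= B" by (rule L)
   finally show ?thesis using n0[OF that, of s t v] et(2) st st' by auto
  qed
  have "(%n. abs(inner (xn n t - xn n s) (j v))) ----> abs(inner (x t - x s) (j v))" unfolding inner_diff_left
   using weak[of t "j v"] weak[of s "j v"] st st' by (intro tendsto_rabs tendsto_diff) (auto simp: inner_commute)
  thus "abs(inner (x t - x s) (j v)) <= B + e" by (rule LIMSEQ_le_const2) (use bd in blast)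
 qed
 show ?thesis
 proof (cases "s <= t")
  case True
  thus ?thesis using main st by blast
 next
  case False
  hence "abs(inner (x s - x t) (j v)) <= B" using main[of t s] st by auto
  moreover have "inner (x s - x t) (j v) = - inner (x t - x s) (j v)" by (simp add: inner_diff_left)
  ultimately show ?thesis by simp
 qed
qed

text \<open>Against vectors of \<open>V\<close> the increments are controlled by the mass of
  \<open>G n\<close>; density of \<open>V\<close> and the bound \<open>C0\<close> extend this to all
  of \<open>H\<close>.\<close>

lemma weakly_continuous: assumes "0 < th"
 obtains de where "0 < de" "!!s t. s : {a..b} ==> t : {a..b} ==> abs(t - s) < de ==> abs(inner h (x t - x s)) <= th"
proof -
 have "h : closure (range j)" using dense_j by simp
 moreover have "0 < th/(4*(C0 + 1))" using assms C00 by simp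
 ultimately obtain v where v: "dist (j v) h < th/(4*(C0 + 1))" unfolding closure_approachable by blast
 define th' where "th' = th/(2*(norm v + 1))"
 have th': "0 < th'" "th'*norm v <= th/2"
 proof -
  have v1: "0 < norm v + 1" by (simp add: add_nonneg_pos)
  thus "0 < th'" using assms by (simp add: th'_def)
  have "th*norm v <= th*(norm v + 1)" using assms by (intro mult_left_mono) auto
  hence "th*norm v / (norm v + 1) <= th" using v1 by (simp add: pos_divide_le_eq)
  thus "th'*norm v <= th/2" using v1 by (simp add: th'_def field_simps)
 qed
 obtain de where de: "0 < de" "!!n s t. a <= s ==> s <= t ==> t <= b ==> t - s < de ==> LI s t (%r. norm (G n r)) <= th'"
  by (rule G_small[OF th'(1)]) blast
 show ?thesis
 proof (rule that[OF de(1)])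
  fix s t assume st: "s : {a..b}" "t : {a..b}" "abs(t - s) < de"
  have "abs(inner (x t - x s) (j v)) <= th/2"
  proof (rule increment_bound[of "min s t" "max s t"])
   fix n
   have "LI (min s t) (max s t) (%r. norm (G n r))*norm v <= th'*norm v"
    using de(2)[of "min s t" "max s t" n] st by (intro mult_right_mono) auto
   thus "LI (min s t) (max s t) (%r. norm (G n r))*norm v <= th/2" using th' by simp
  qed (use st in auto)
  moreover have "abs(inner (h - j v) (x t - x s)) <= th/2"
  proof -
   have "norm (x t - x s) <= 2*C0" using norm_triangle_ineq4[of "x t" "x s"] x_bound[OF st(1)] x_bound[OF st(2)] by linarith
   hence "abs(inner (h - j v) (x t - x s)) <= th/(4*(C0 + 1))*(2*C0)"
    using v C00 assms by (intro order_trans[OF Cauchy_Schwarz_ineq2] mult_mono) (auto simp: dist_norm norm_minus_commute)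
   also have "... <= th/2" using C00 assms by (simp add: field_simps)
   finally show ?thesis .
  qed
  moreover have "inner h (x t - x s) = inner (h - j v) (x t - x s) + inner (x t - x s) (j v)"
   by (simp add: inner_diff_left inner_diff_right inner_commute)
  ultimately show "abs(inner h (x t - x s)) <= th" by linarith
 qed
qed

lemma square_integrable: "intg a b (%t. nsq (x t))"
proof (rule intg_bounded)
 show "(%t. nsq (x t)) : meas a b" using meas_norm_H[OF x_measurable] by simp
 show "AE t in leb a b. abs(nsq (x t)) <= C0^2" using x_bound by (intro AE_I2) (simp add: power_mono)
qed

text \<open>The scales match: by Young's inequality the mean over an interval of length \<open>h\<close> of
 \<open>(x t - x s, x s)\<close> is controlled without a negative power of \<open>h\<close>, since \<open>1 / p + 1 / q = 1\<close>.\<close>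

lemma square_average: assumes t: "t : {a..b}" and et: "0 < et"
 obtains de where "0 < de" "!!c d. a <= c ==> c <= t ==> t <= d ==> d <= b ==> d - c < de ==>
  abs(LI c d (%s. nsq (x s)) - (d - c)*nsq (x t)) <= (d - c)*et"
proof -
 define th where "th = et/(3*(Cq + 1))"
 have th: "0 < th" "th*Cq <= et/3" using et Cq0 by (auto simp: th_def field_simps)
 obtain D where D: "0 <= D" "!!x y. 0 <= x ==> 0 <= y ==> x*y <= th*x powr q + D*y powr p" using Young[OF th(1)] by blast
 have "0 < et/(3*(D + 1))" using et D by simp
 then obtain de1 where de1: "0 < de1" "!!s t. a <= s ==> s <= t ==> t <= b ==> t - s < de1 ==>
   abs(LI s t (%r. norm (X r) powr p)) <= et/(3*(D + 1))" by (rule LI_small[OF Vfun_intg[OF X]]) blast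
 obtain de2 where de2: "0 < de2" "!!s t'. s : {a..b} ==> t' : {a..b} ==> abs(t' - s) < de2 ==> abs(inner (x t) (x t' - x s)) <= et/3"
  using weakly_continuous[of "et/3" "x t"] et by auto
 show ?thesis
 proof (rule that[of "min de1 de2"])
  show "0 < min de1 de2" using de1 de2 by simp
  fix c d assume cd: "a <= c" "c <= t" "t <= d" "d <= b" "d - c < min de1 de2"
  define k where "k s = th*Cq + et/3 + ((d - c)*D)*norm (X s) powr p" for s
  have Xp: "intg c d (%r. norm (X r) powr p)" using Vfun_intg[OF X] cd by (auto intro: intg_sub)
  have sq: "intg c d (%s. nsq (x s))" using square_integrable cd by (auto intro: intg_sub)
  have "AE s in leb c d. x s = j (X s)" using cd by (intro AE_sub[OF xX]) auto
  hence ae: "AE s in leb c d. abs(nsq (x s) - nsq (x t)) <= k s" using AE_space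
  proof eventually_elim
   case (elim s)
   hence s: "s : {c..d}" by simp
   have "LI c d (%r. norm (G n r))*norm (X s) <= th*Cq + ((d - c)*D)*norm (X s) powr p" for n
   proof -
    have "LI c d (%r. norm (G n r)*norm (X s)) <= th*Cq + D*LI c d (%r. norm (X s) powr p)"
     using D th cd by (intro LI_Dfun_le[OF G Gb]) auto
    thus ?thesis using cd by (simp add: LI_const algebra_simps)
   qed
   hence "abs(inner (x t - x s) (j (X s))) <= th*Cq + ((d - c)*D)*norm (X s) powr p"
    using cd s by (intro increment_bound[of c d]) auto
   moreover have "abs(inner (x t) (x t - x s)) <= et/3" using de2(2)[of s t] s cd t by auto
   moreover have "nsq (x s) - nsq (x t) = - inner (x t - x s) (j (X s)) - inner (x t) (x t - x s)"
    unfolding elim(1)[symmetric] by (simp add: power2_norm_eq_inner inner_diff_left inner_diff_right inner_commute)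
   ultimately show ?case unfolding k_def by linarith
  qed
  have "abs(LI c d (%s. nsq (x s)) - (d - c)*nsq (x t)) = abs(LI c d (%s. nsq (x s) - nsq (x t)))"
   using sq cd by (simp add: mult.commute)
  also have "... <= LI c d k" using ae sq Xp by (intro LI_abs_le) (auto simp: k_def[abs_def])
  also have "... = (d - c)*(th*Cq + et/3 + D*LI c d (%r. norm (X r) powr p))"
   unfolding k_def using Xp cd by (simp add: algebra_simps)
  also have "... <= (d - c)*et"
  proof (rule mult_left_mono)
   have "D*LI c d (%r. norm (X r) powr p) <= D*(et/(3*(D + 1)))" using de1(2)[of c d] cd D by (intro mult_left_mono) auto
   also have "... <= et/3" using D et by (simp add: field_simps)
   finally show "th*Cq + et/3 + D*LI c d (%r. norm (X r) powr p) <= et" using th by simp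
  qed (use cd in simp)
  finally show "abs(LI c d (%s. nsq (x s)) - (d - c)*nsq (x t)) <= (d - c)*et" .
 qed
qed

end

context cross_energy
begin

lemma shifted_product: assumes h: "0 < h" and al: "a <= al" "al <= be" "be + h <= b"
 shows "(%t. inner (xn n (t + h) - xn n t) (x (t + h) + x t)) : meas al be"
  and "t : {al..be} ==> abs(inner (xn n (t + h) - xn n t) (x (t + h) + x t)) <= 2*C0*(2*C0)"
proof -
 have ms: "(%t. inner k (f (t + h))) : meas al be" "(%t. inner k (f t)) : meas al be"
  if f: "!!k. (%t. inner k (f t)) : meas a b" for f :: "real => 'b" and k
  by (rule measurable_shift meas_sub[OF f] | use al h in auto)+
 show "(%t. inner (xn n (t + h) - xn n t) (x (t + h) + x t)) : meas al be"
  by (rule inner_measurable; simp only: inner_diff_right inner_add_right; intro borel_measurable_diff borel_measurable_add ms x_measurable xm)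
 assume "t : {al..be}"
 hence t: "t : {a..b}" "t + h : {a..b}" using al h by auto
 have "norm (xn n (t + h) - xn n t) <= 2*C0"
  using norm_triangle_ineq4[of "xn n (t + h)" "xn n t"] xb[OF t(1), of n] xb[OF t(2), of n] by linarith
 moreover have "norm (x (t + h) + x t) <= 2*C0"
  using norm_triangle_ineq[of "x (t + h)" "x t"] x_bound[OF t(1)] x_bound[OF t(2)] by linarith
 ultimately show "abs(inner (xn n (t + h) - xn n t) (x (t + h) + x t)) <= 2*C0*(2*C0)"
  using C00 by (intro order_trans[OF Cauchy_Schwarz_ineq2] mult_mono) auto
qed

text \<open>The discrete product rule: the increment of \<open>xn n\<close> over a step
  \<open>h\<close> is paired with \<open>x (t + h) + x t\<close>, which almost everywhere comes from
  \<open>V\<close>, and hence is an integral of \<open>G n\<close> against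
  \<open>X t + X (t + h)\<close>. Replacing both by \<open>X r\<close> inside the integral costs an
  error proportional to \<open>h\<close>, with a factor made small through the continuous
  \<open>S\<close>. The tolerance \<open>et\<close> is not proportional to \<open>h\<close>; it is
  chosen after \<open>h\<close>.\<close>

lemma shifted_increment: assumes h: "0 < h" and al: "a <= al" "al <= be" "be + h <= b"
  and S: "cont a b S" "intg a b (%t. norm (X t - S t) powr p)"
  and om: "!!s t. s : {a..b} ==> t : {a..b} ==> abs(t - s) <= h ==> norm (S t - S s) powr p <= om"
  and D: "0 <= D" "!!x y. 0 <= x ==> 0 <= y ==> x*y <= th*x powr q + D*y powr p" and th: "0 <= th"
  and et: "0 <= et" "!!s t v. a <= s ==> s <= t ==> t <= b ==>
   abs(inner (xn n t - xn n s) (j v) - LI s t (%r. G n r v)) <= et*norm v"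
 defines "rh == LI a b (%t. norm (X t - S t) powr p)" shows "abs(LI al be (%t. inner (xn n (t + h) - xn n t) (x (t + h) + x t)) -
   2*LI al be (%t. LI t (t + h) (%r. G n r (X r))))
  <= et*LI al be (%t. norm (X t + X (t + h))) +
   h*(2*th*Cq + D*4 powr p*(4*rh + 2 * om*(b - a)))"
proof -
 define R where "R t = norm (X t - S t) powr p" for t
 define g where "g t = norm (G n t) powr q" for t
 have iR: "intg a b R" using S(2) by (simp add: R_def[abs_def])
 have ig: "intg a b g" using Dfun_intg[OF G] by (simp add: g_def[abs_def])
 have R0: "0 <= R t" and g0: "0 <= g t" for t by (auto simp: R_def g_def)
 have om0: "0 <= om" using order_trans[OF powr_ge_zero om[of a a]] h ab by simp
 have sub: "intg s t f" if "intg a b f" "al <= s" "t <= be + h" for s t and f :: "real => real"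
  using that(1) by (rule intg_sub) (use that al in auto)
 define Q where "Q t = inner (xn n (t + h) - xn n t) (x (t + h) + x t)" for t
 define J where "J t = LI t (t + h) (%r. G n r (X r))" for t
 define N where "N t = norm (X t + X (t + h))" for t
 \<comment> \<open>Young's inequality leaves the mass of \<open>G n\<close> in the window, the
   approximation error \<open>R\<close> at both ends and inside the window, and the oscillation
   \<open>om\<close> of \<open>S\<close>.\<close>
 define E where "E t = 2*th*LI t (t + h) g + D*4 powr p*(h*R t + h*R (t + h) + 2*h * om + 2*LI t (t + h) R)" for t
 have inner_bd: "abs(LI t (t + h) (%r. G n r (X t + X (t + h))) - 2*J t) <= E t" if t: "t : {al..be}" for t
 proof -
  have GI: "Dfun t (t + h) (G n)" "Vfun t (t + h) X" using t al h by (auto intro!: Dfun_subinterval[OF G] Vfun_subinterval[OF X])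
  define F where "F r = G n r (X t + X (t + h)) - 2*G n r (X r)" for r
  have iF: "intg t (t + h) F" unfolding F_def using Dfun_apply[OF GI(1)] pair_intg[OF GI] by simp
  have eq: "LI t (t + h) (%r. G n r (X t + X (t + h))) - 2*J t = LI t (t + h) F"
   unfolding F_def J_def using Dfun_apply[OF GI(1)] pair_intg[OF GI] by simp
  have it: "intg t (t + h) g" "intg t (t + h) R" using sub[OF ig, of t "t + h"] sub[OF iR, of t "t + h"] t by auto
  have "abs(LI t (t + h) F) <= LI t (t + h) (%r. 2*th*g r + D*4 powr p*(R t + R (t + h) + 2 * om + 2*R r))"
  proof (rule LI_abs_le[OF AE_I2])
   fix r assume "r : space (leb t (t + h))"
   hence r: "t <= r" "r <= t + h" by auto
   have near: "norm (X s - X r) powr p <= 4 powr p*(R s + om + R r)" if "s = t | s = t + h" for s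
   proof -
    have "norm (X s - X r) <= norm (X s - S s) + norm (S s - S r) + norm (X r - S r)"
     using norm_triangle_ineq[of "X s - S s" "S s - X r"] norm_triangle_ineq[of "S s - S r" "S r - X r"]
     by (simp add: norm_minus_commute[of "S r"])
    hence "norm (X s - X r) powr p <= (norm (X s - S s) + norm (S s - S r) + norm (X r - S r)) powr p"
     using p0 by (intro powr_mono2) auto
    also have "... <= 4 powr p*(R s + norm (S s - S r) powr p + R r)" unfolding R_def using p0 by (intro powr_sum3_le) auto
    also have "... <= 4 powr p*(R s + om + R r)"
     using om[of r s] r t al that h by (intro mult_left_mono add_mono) (auto simp: abs_le_iff)
    finally show ?thesis .
   qed
   have yg: "norm (G n r)*norm (X s - X r) <= th*g r + D*(4 powr p*(R s + om + R r))" if "s = t | s = t + h" for s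
   proof -
    have "norm (G n r)*norm (X s - X r) <= th*g r + D*norm (X s - X r) powr p" unfolding g_def by (rule D(2)) auto
    also have "... <= th*g r + D*(4 powr p*(R s + om + R r))" using near[OF that] D(1) by (intro add_left_mono mult_left_mono) auto
    finally show ?thesis .
   qed
   have "F r = G n r (X t - X r) + G n r (X (t + h) - X r)" by (simp add: F_def blinfun.add_right bl_diff_right)
   hence "abs(F r) <= norm (G n r)*norm (X t - X r) + norm (G n r)*norm (X (t + h) - X r)"
    using norm_blinfun[of "G n r" "X t - X r"] norm_blinfun[of "G n r" "X (t + h) - X r"] by simp
   also have "... <= (th*g r + D*(4 powr p*(R t + om + R r))) + (th*g r + D*(4 powr p*(R (t + h) + om + R r)))"
    using yg[of t] yg[of "t + h"] by (intro add_mono) auto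
   finally show "abs(F r) <= 2*th*g r + D*4 powr p*(R t + R (t + h) + 2 * om + 2*R r)" by (simp add: algebra_simps)
  qed (use it iF in auto)
  also have "... = E t" unfolding E_def using it h by (simp add: algebra_simps)
  finally show ?thesis using eq by simp
 qed
 have Xm: "X : meas al be" using Vfun_measurable[OF X] by (rule meas_sub) (use al h in auto)
 have "AE t in leb al be. x t = j (X t)" using al h by (intro AE_sub[OF xX]) auto
 moreover have "AE t in leb al be. x (t + h) = j (X (t + h))"
  by (rule AE_shift[where P="%t. x t = j (X t)"]) (use al h in "auto intro!: AE_sub[OF xX]")
 ultimately have ae: "AE t in leb al be. abs(Q t - 2*J t) <= et*N t + E t" using AE_space
 proof eventually_elim
  case (elim t)
  hence t: "t : {al..be}" by simp
  have "Q t = inner (xn n (t + h) - xn n t) (j (X t + X (t + h)))" using elim by (simp add: Q_def blinfun.add_right add.commute)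
  hence "abs(Q t - LI t (t + h) (%r. G n r (X t + X (t + h)))) <= et*N t"
   using et(2)[of t "t + h" "X t + X (t + h)"] t al h by (simp add: N_def)
  thus ?case using inner_bd[OF t] by linarith
 qed
 have iQ: "intg al be Q" unfolding Q_def[abs_def]
  by (rule intg_bounded[where C="2*C0*(2*C0)", OF shifted_product(1)[OF h al]]) (use shifted_product(2)[OF h al] in auto)
 have XJ: "intg a b (%r. G n r (X r))" by (rule pair_intg[OF G X])
 have iJ: "intg al be J" unfolding J_def[abs_def] by (rule LI_window(1)[OF XJ less_imp_le[OF h] al])
 have iN: "intg al be N"
 proof -
  have nX: "intg a b X"
  proof (rule intg_bound[where f="%t. 1 + norm (X t) powr p"])
   show "intg a b (%t. 1 + norm (X t) powr p)" using Vfun_intg[OF X] by simp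
   show "AE t in leb a b. norm (X t) <= norm (1 + norm (X t) powr p)"
    using powr_ge_bound[of "norm (X _)" p] p1 by (intro AE_I2) (simp add: add_nonneg_nonneg)
  qed (rule Vfun_measurable[OF X])
  have mX: "(%t. X (t + h)) : meas al be"
  proof (rule measurable_shift)
   show "X : meas (al + h) (be + h)" by (rule meas_sub[OF Vfun_measurable[OF X]]) (use al h in auto)
  qed
  have "intg al be (%t. norm (X t))" "intg (al + h) (be + h) (%t. norm (X t))"
   by (rule intg_sub[OF integrable_norm[OF nX]]; use al h in simp)+
  hence i2: "intg al be (%t. norm (X t) + norm (X (t + h)))" using LI_shift(1)[of al h be "%t. norm (X t)"] by simp
  show ?thesis by (rule intg_AE_le[OF i2]) (use mX Xm in "auto simp: N_def[abs_def] norm_triangle_ineq")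
 qed
 note wg = LI_window_le[OF ig g0 less_imp_le[OF h] al] LI_window(1)[OF ig less_imp_le[OF h] al]
  and wR = LI_window_le[OF iR R0 less_imp_le[OF h] al] LI_window(1)[OF iR less_imp_le[OF h] al]
 have sR: "intg al be (%t. R (t + h))" "LI al be (%t. R (t + h)) = LI (al + h) (be + h) R" "intg al be R"
  using LI_shift[of al h be R] sub[OF iR] h by auto
 have iE: "intg al be E" unfolding E_def using wg wR sR by simp
 have LE: "LI al be E <= h*(2*th*Cq + D*4 powr p*(4*rh + 2 * om*(b - a)))"
 proof -
  have "LI al be E = 2*th*LI al be (%t. LI t (t + h) g) + D*4 powr p*(h*LI al be R + h*LI (al + h) (be + h) R
    + 2*h * om*(be - al) + 2*LI al be (%t. LI t (t + h) R))" unfolding E_def using wg wR sR al by (simp add: algebra_simps)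
  also have "... <= 2*th*(h*Cq) + D*4 powr p*(h*rh + h*rh + 2*h * om*(b - a) + 2*(h*rh))"
  proof (intro add_mono mult_left_mono)
   show "LI al be (%t. LI t (t + h) g) <= h*Cq"
    using order_trans[OF wg(1) mult_left_mono[OF Gb[of n, folded g_def[abs_def]]]] h by (simp add: g_def[abs_def])
   show "LI al be R <= rh" "LI (al + h) (be + h) R <= rh"
    unfolding rh_def R_def[abs_def, symmetric] using iR R0 al h by (auto intro!: LI_mono_subset)
   show "LI al be (%t. LI t (t + h) R) <= h*rh" using wR(1) by (simp add: rh_def R_def[abs_def])
  qed (use th D(1) h al om0 in auto)
  also have "... = h*(2*th*Cq + D*4 powr p*(4*rh + 2 * om*(b - a)))" by (simp add: algebra_simps)
  finally show ?thesis .
 qed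
 have "abs(LI al be Q - 2*LI al be J) = abs(LI al be (%t. Q t - 2*J t))" using iQ iJ by simp
 also have "... <= LI al be (%t. et*N t + E t)" using ae iQ iJ iN iE by (intro LI_abs_le) auto
 also have "... = et*LI al be N + LI al be E" using iN iE by simp
 finally have "abs(LI al be Q - 2*LI al be J) <= et*LI al be N +
   h*(2*th*Cq + D*4 powr p*(4*rh + 2 * om*(b - a)))" using LE by linarith
 thus ?thesis unfolding Q_def[abs_def] J_def[abs_def] N_def[abs_def] .
qed

text \<open>In the limit the shifted product becomes \<open>|x (t + h)|^2 - |x t|^2\<close>, and its
  integral telescopes to two boundary windows. By \<open>square_average\<close> these windows are
  close to \<open>h\<close> times the squares at \<open>be\<close> and \<open>al\<close>.\<close>

lemma increments_converge: assumes h: "0 < h" and al: "a <= al" "al <= be" "be + h <= b"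
 shows "(%n. LI al be (%t. inner (xn n (t + h) - xn n t) (x (t + h) + x t))) ---->
  LI be (be + h) (%t. nsq (x t)) - LI al (al + h) (%t. nsq (x t))"
proof -
 have lim: "(%n. inner (xn n (t + h) - xn n t) (x (t + h) + x t)) ----> inner (x (t + h) - x t) (x (t + h) + x t)" if "t : {al..be}" for t
 proof -
  have t: "t : {a..b}" "t + h : {a..b}" using that al h by auto
  show ?thesis unfolding inner_diff_left using weak[OF t(1)] weak[OF t(2)]
   by (intro tendsto_diff) (auto simp: inner_commute[of "x _"] inner_commute[of "xn _ _"])
 qed
 have "(%n. LI al be (%t. inner (xn n (t + h) - xn n t) (x (t + h) + x t))) ---->
  LI al be (%t. inner (x (t + h) - x t) (x (t + h) + x t))"
 proof (rule integral_dominated_convergence[where w="%_. 2*C0*(2*C0)"])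
  show "(%t. inner (x (t + h) - x t) (x (t + h) + x t)) : meas al be"
   by (rule borel_measurable_LIMSEQ_metric[OF shifted_product(1)[OF h al] lim]) simp
 qed (use shifted_product[OF h al] lim in auto)
 also have "LI al be (%t. inner (x (t + h) - x t) (x (t + h) + x t)) = LI al be (%t. nsq (x (t + h)) - nsq (x t))"
 proof -
  have "inner (y - z) (y + z) = nsq y - nsq z" for y z :: 'b
   by (simp add: power2_norm_eq_inner inner_diff_left inner_add_right inner_commute[of z y])
  thus ?thesis by simp
 qed
 also have "... = LI be (be + h) (%t. nsq (x t)) - LI al (al + h) (%t. nsq (x t))"
  using LI_difference_shift(1)[of al be h "%t. nsq (x t)"] square_integrable h al by (auto intro: intg_sub)
 finally show ?thesis .
qed

text \<open>The condition \<open>be < b\<close> leaves room for the forward shift. First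
  \<open>th\<close>, \<open>S\<close> and \<open>om\<close> are chosen, then \<open>h\<close>, then
  the tolerance \<open>et\<close> depending on \<open>h\<close>, and finally
  \<open>n\<close>.\<close>

lemma energy_interior: assumes al: "a <= al" "al <= be" "be < b" and e0: "0 < e0"
 shows "EX n0. ALL n>=n0. abs(2*LI al be (%r. G n r (X r)) - (nsq (x be) - nsq (x al))) <= e0"
proof -
 \<comment> \<open>Nine errors of size \<open>h*e\<close> meet at the end: four from the shifted
   increments, one from the limit in \<open>n\<close>, two from the windows of the primitive
   \<open>Ph\<close> (counted twice) and two from the windows of the squares.\<close>
 define e where "e = e0/9"
 have e: "0 < e" using e0 by (simp add: e_def)
 define th where "th = e/(2*(Cq + 1))"
 have th: "0 < th" "2*th*Cq <= e" using e Cq0 by (auto simp: th_def field_simps)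
 obtain D where D: "0 <= D" "!!x y. 0 <= x ==> 0 <= y ==> x*y <= th*x powr q + D*y powr p" using Young[OF th(1)] by blast
 define K where "K = D*4 powr p"
 have K: "0 <= K" using D by (simp add: K_def)
 have pos: "0 < e/(4*K + 1)" using e K by (simp add: add_nonneg_pos)
 obtain S where S: "cont a b S" "intg a b (%t. norm (X t - S t) powr p)" "LI a b (%t. norm (X t - S t) powr p) < e/(4*K + 1)"
  by (rule Lp_approx[OF Vfun_measurable[OF X] Vfun_intg[OF X] p0 pos])
 define rh where "rh = LI a b (%t. norm (X t - S t) powr p)"
 have Krh: "K*(4*rh) <= e"
 proof -
  have "4*K*rh <= (4*K + 1)*rh" unfolding rh_def by (intro mult_right_mono integral_nonneg_AE) auto
  also have "... <= e" using S(3) K by (simp add: rh_def pos_less_divide_eq add_nonneg_pos mult.commute less_imp_le)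
  finally show ?thesis by simp
 qed
 define om where "om = e/(2*K*(b - a) + 1)"
 have om: "0 < om" using e K ab by (simp add: om_def add_nonneg_pos)
 have Kom: "K*(2 * om*(b - a)) <= e"
 proof -
  have p: "0 < 2*K*(b - a) + 1" using K ab by (simp add: add_nonneg_pos)
  have "2*K*(b - a) * om <= (2*K*(b - a) + 1) * om" using om by (intro mult_right_mono) auto
  also have "... = e" using p by (simp add: om_def)
  finally show ?thesis by (simp add: mult_ac)
 qed
 have "uniformly_continuous_on {a..b} S" using S(1) by (rule compact_uniformly_continuous) simp
 moreover have "0 < om powr (1/p)" using om by simp
 ultimately obtain deS where deS: "0 < deS" "!!s t. s : {a..b} ==> t : {a..b} ==> abs(t - s) < deS ==> norm (S t - S s) < om powr (1/p)"
  unfolding uniformly_continuous_on_def dist_norm real_norm_def by blast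
 obtain de1 where de1: "0 < de1" "!!c d. a <= c ==> c <= al ==> al <= d ==> d <= b ==> d - c < de1 ==>
  abs(LI c d (%s. nsq (x s)) - (d - c)*nsq (x al)) <= (d - c)*e" using square_average[of al, OF _ e] al by auto
 obtain de2 where de2: "0 < de2" "!!c d. a <= c ==> c <= be ==> be <= d ==> d <= b ==> d - c < de2 ==>
  abs(LI c d (%s. nsq (x s)) - (d - c)*nsq (x be)) <= (d - c)*e" using square_average[of be, OF _ e] al by auto
 have "0 < e/2" using e by simp
 then obtain de3 where de3: "0 < de3" "!!n s t. a <= s ==> s <= t ==> t <= b ==> t - s < de3 ==>
   abs(LI s t (%r. G n r (X r))) <= e/2" by (rule G_small) blast
 define h where "h = min (min (deS/2) (de1/2)) (min (min (de2/2) (de3/2)) (b - be))"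
 have h: "0 < h" "h < deS" "h < de1" "h < de2" "h < de3" "be + h <= b" using deS de1 de2 de3 al by (auto simp: h_def min_def)
 have om': "norm (S t - S s) powr p <= om" if "s : {a..b}" "t : {a..b}" "abs(t - s) <= h" for s t
 proof -
  have "norm (S t - S s) powr p <= (om powr (1/p)) powr p" using deS(2)[OF that(1,2)] that h p0 by (intro powr_mono2) auto
  thus ?thesis using p0 om by (simp add: powr_powr)
 qed
 define sq where "sq t = nsq (x t)" for t
 define NX where "NX = LI al be (%t. norm (X t + X (t + h)))"
 have NX: "0 <= NX" unfolding NX_def by (rule integral_nonneg_AE) auto
 \<comment> \<open>Proportional to \<open>h\<close>, because the final estimate is divided by
   \<open>h\<close>.\<close>
 define et where "et = h*e/(NX + 1)"
 have et: "0 < et" "et*NX <= h*e" using h e NX by (auto simp: et_def field_simps)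
 obtain n1 where n1: "!!n s t v. n1 <= n ==> a <= s ==> s <= t ==> t <= b ==>
   abs(inner (xn n t - xn n s) (j v) - LI s t (%r. G n r v)) <= et*norm v" using app[OF et(1)] by blast
 define Q where "Q n = LI al be (%t. inner (xn n (t + h) - xn n t) (x (t + h) + x t))" for n
 have "0 < h*e" using h e by simp
 then obtain n2 where n2: "!!n. n2 <= n ==> abs(Q n - (LI be (be + h) sq - LI al (al + h) sq)) < h*e"
  using LIMSEQ_D[OF increments_converge[OF h(1) al(1,2) h(6)], of "h*e"] unfolding Q_def sq_def[abs_def] by auto
 show ?thesis
 proof (intro exI allI impI)
  fix n assume n: "max n1 n2 <= n"
  define g where "g r = G n r (X r)" for r
  define Ph where "Ph t = LI a t g" for t
  have gi: "intg a b g" using pair_intg[OF G X] by (simp add: g_def[abs_def])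
  have Phd: "LI s t g = Ph t - Ph s" if "a <= s" "s <= t" "t <= b" for s t
   using LI_combine[of a t g s] intg_sub[OF gi, of a t] that by (simp add: Ph_def)
  have cPh: "cont a b Ph" unfolding Ph_def by (rule LI_continuous[OF gi])
  have iPh: "intg s t Ph" if "a <= s" "t <= b" for s t using cont_intg[OF cPh] that by (rule intg_sub)
  have A1: "abs(Q n - 2*LI al be (%t. LI t (t + h) g)) <= h*e + h*(e + (e + e))"
  proof -
   have "abs(Q n - 2*LI al be (%t. LI t (t + h) g)) <= et*NX + h*(2*th*Cq + K*(4*rh + 2 * om*(b - a)))"
    unfolding Q_def g_def[abs_def] NX_def K_def rh_def
    using n by (intro shifted_increment[OF h(1) al(1,2) h(6) S(1,2) om' D less_imp_le[OF th(1)] less_imp_le[OF et(1)] n1]) auto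
   also have "h*(2*th*Cq + K*(4*rh + 2 * om*(b - a))) <= h*(e + (e + e))"
    using h th(2) Krh Kom by (intro mult_left_mono add_mono) (auto simp: ring_distribs)
   finally show ?thesis using et(2) by linarith
  qed
  have A2: "LI al be (%t. LI t (t + h) g) = LI be (be + h) Ph - LI al (al + h) Ph"
   unfolding Ph_def by (rule LI_window(2)[OF gi less_imp_le[OF h(1)] al(1,2) h(6)])
  have A3: "abs(LI s (s + h) Ph - h*Ph s) <= h*(e/2)" if s: "a <= s" "s + h <= b" for s
  proof -
   have "LI s (s + h) Ph - h*Ph s = LI s (s + h) (%t. Ph t - Ph s)" using iPh[of s "s + h"] s h by simp
   also have "abs(...) <= LI s (s + h) (%t. e/2)"
   proof (rule LI_abs_le[OF AE_I2])
    fix t assume "t : space (leb s (s + h))"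
    thus "abs(Ph t - Ph s) <= e/2" using de3(2)[of s t n] Phd[of s t] s h by (simp add: g_def[abs_def])
   qed (use iPh[of s "s + h"] s in auto)
   finally show ?thesis using h by (simp add: LI_const)
  qed
  have A4: "abs(LI be (be + h) sq - h * sq be) <= h*e" "abs(LI al (al + h) sq - h * sq al) <= h*e"
   using de2(2)[of be "be + h"] de1(2)[of al "al + h"] al h by (auto simp: sq_def[abs_def])
  have n2': "abs(Q n - (LI be (be + h) sq - LI al (al + h) sq)) < h*e" using n2[of n] n by simp
  have "abs(2*(h*(Ph be - Ph al)) - h*(sq be - sq al)) <= 9*(h*e)"
  proof -
   have "a <= be" "al + h <= b" using al h by auto
   hence A3': "abs(LI be (be + h) Ph - h*Ph be) <= h*(e/2)" "abs(LI al (al + h) Ph - h*Ph al) <= h*(e/2)"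
    using A3[of be] A3[of al] al h by auto
   show ?thesis using A1 A3' A4 n2' unfolding A2 by argo
  qed
  also have "2*(h*(Ph be - Ph al)) - h*(sq be - sq al) = h*(2*LI al be g - (sq be - sq al))"
   using al by (subst Phd) (auto simp: algebra_simps)
  finally have "h*abs(2*LI al be g - (sq be - sq al)) <= h*e0" using h by (simp add: abs_mult e_def)
  thus "abs(2*LI al be (%r. G n r (X r)) - (nsq (x be) - nsq (x al))) <= e0" using h by (simp add: g_def[abs_def] sq_def)
 qed
qed

lemma square_uniform: assumes e: "0 < e"
 obtains de where "0 < de" "!!s t. a <= s ==> s <= t ==> t < b ==> t - s < de ==> abs(nsq (x t) - nsq (x s)) <= e"
proof -
 have "0 < e/4" using e by simp
 then obtain de where de: "0 < de" "!!n s t. a <= s ==> s <= t ==> t <= b ==> t - s < de ==>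
   abs(LI s t (%r. G n r (X r))) <= e/4" by (rule G_small) blast
 show ?thesis
 proof (rule that[OF de(1)])
  fix s t assume st: "a <= s" "s <= t" "t < b" "t - s < de"
  obtain n where "abs(2*LI s t (%r. G n r (X r)) - (nsq (x t) - nsq (x s))) <= e/2"
   using energy_interior[OF st(1-3), of "e/2"] e by auto
  moreover have "abs(LI s t (%r. G n r (X r))) <= e/4" using de(2)[of s t n] st by simp
  ultimately show "abs(nsq (x t) - nsq (x s)) <= e" by argo
 qed
qed

text \<open>At the right end no forward shift is possible. Instead the mean of \<open>|x|^2\<close>
  over a short interval ending in \<open>b\<close> is compared with \<open>|x b|^2\<close> by
  \<open>square_average\<close> and with \<open>|x t|^2\<close> by uniform continuity to the left of
  \<open>b\<close>.\<close>

lemma square_left_limit: assumes e: "0 < e"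
 obtains de where "0 < de" "!!t. a <= t ==> t <= b ==> b - t < de ==> abs(nsq (x b) - nsq (x t)) <= e"
proof -
 have e2: "0 < e/2" using e by simp
 obtain de1 where de1: "0 < de1" "!!s t. a <= s ==> s <= t ==> t < b ==> t - s < de1 ==> abs(nsq (x t) - nsq (x s)) <= e/2"
  by (rule square_uniform[OF e2]) blast
 have "b : {a..b}" using ab by simp
 then obtain de2 where de2: "0 < de2" "!!c d. a <= c ==> c <= b ==> b <= d ==> d <= b ==> d - c < de2 ==>
  abs(LI c d (%s. nsq (x s)) - (d - c)*nsq (x b)) <= (d - c)*(e/2)" by (rule square_average[OF _ e2]) blast
 show ?thesis
 proof (rule that[of "min de1 de2"])
  show "0 < min de1 de2" using de1 de2 by simp
  fix t assume t: "a <= t" "t <= b" "b - t < min de1 de2"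
  show "abs(nsq (x b) - nsq (x t)) <= e"
  proof (cases "t = b")
   case False
   hence tb: "t < b" using t by simp
   have sq: "intg t b (%s. nsq (x s))" using square_integrable t by (auto intro: intg_sub)
   have ae: "AE s in leb t b. abs(nsq (x s) - nsq (x t)) <= e/2"
   proof -
    have "AE s in lebesgue_on {t<..<b}. abs(nsq (x s) - nsq (x t)) <= e/2" using de1(2)[of t] t by (intro AE_I2) auto
    thus ?thesis by (simp add: AE_open_iff)
   qed
   have "abs(LI t b (%s. nsq (x s)) - (b - t)*nsq (x t)) = abs(LI t b (%s. nsq (x s) - nsq (x t)))" using sq t by simp
   also have "... <= LI t b (%_. e/2)" using ae sq by (intro LI_abs_le) auto
   also have "... = (b - t)*(e/2)" using t by (simp add: LI_const)
   finally have "abs((b - t)*nsq (x b) - (b - t)*nsq (x t)) <= (b - t)*(e/2) + (b - t)*(e/2)" using de2(2)[of t b] t by argo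
   moreover have "abs((b - t)*nsq (x b) - (b - t)*nsq (x t)) = (b - t)*abs(nsq (x b) - nsq (x t))"
    using tb by (simp add: abs_mult flip: right_diff_distrib)
   ultimately have "(b - t)*abs(nsq (x b) - nsq (x t)) <= (b - t)*e" by argo
   thus ?thesis using tb by simp
  qed (use e in simp)
 qed
qed

theorem energy_limit: assumes st: "a <= s" "s <= t" "t <= b" shows "(%n. 2*LI s t (%r. G n r (X r))) ----> nsq (x t) - nsq (x s)"
proof (rule LIMSEQ_I)
 fix e :: real assume e: "0 < e"
 show "EX no. ALL n>=no. norm (2*LI s t (%r. G n r (X r)) - (nsq (x t) - nsq (x s))) < e"
 proof (cases "t < b | s = t")
  case True
  hence "EX no. ALL n>=no. abs(2*LI s t (%r. G n r (X r)) - (nsq (x t) - nsq (x s))) <= e/2"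
   using energy_interior[of s t "e/2"] st e by (cases "s = t") auto
  thus ?thesis using e by fastforce
 next
  case False
  hence [simp]: "t = b" and sb: "s < b" using st by auto
  have e8: "0 < e/8" using e by simp
  obtain de1 where de1: "0 < de1" "!!t. a <= t ==> t <= b ==> b - t < de1 ==> abs(nsq (x b) - nsq (x t)) <= e/8"
   by (rule square_left_limit[OF e8]) blast
  obtain de2 where de2: "0 < de2" "!!n s t. a <= s ==> s <= t ==> t <= b ==> t - s < de2 ==>
   abs(LI s t (%r. G n r (X r))) <= e/8" by (rule G_small[OF e8]) blast
  define be where "be = max s (b - min de1 de2/2)"
  have be: "s <= be" "be < b" "b - be < de1" "b - be < de2" using de1 de2 sb by (auto simp: be_def max_def min_def)
  obtain n0 where n0: "!!n. n0 <= n ==> abs(2*LI s be (%r. G n r (X r)) - (nsq (x be) - nsq (x s))) <= e/8"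
   using energy_interior[OF st(1) be(1,2) e8] by blast
  show ?thesis
  proof (intro exI allI impI)
   fix n assume "n0 <= n"
   note n0[OF this]
   moreover have "LI s be (%r. G n r (X r)) + LI be b (%r. G n r (X r)) = LI s b (%r. G n r (X r))"
    using be st pair_intg[OF G X] by (intro LI_combine) (auto intro: intg_sub)
   moreover have "abs(LI be b (%r. G n r (X r))) <= e/8" using de2(2)[of be b n] be st by simp
   moreover have "abs(nsq (x b) - nsq (x be)) <= e/8" using de1(2)[of be] be st by simp
   ultimately show "norm (2*LI s t (%r. G n r (X r)) - (nsq (x t) - nsq (x s))) < e"
    using e unfolding `t = b` real_norm_def by argo
  qed
 qed
qed

text \<open>Weak continuity together with continuity of the norm gives norm continuity in a Hilbert
  space.\<close>

theorem x_continuous: "cont a b x"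
proof -
 have "EX de>0. ALL s:{a..b}. dist s t < de --> dist (x s) (x t) < e" if t: "t : {a..b}" and e: "0 < e" for t e
 proof -
  have e2: "0 < e^2/4" using e by simp
  obtain de1 where de1: "0 < de1" "!!s t. a <= s ==> s <= t ==> t < b ==> t - s < de1 ==> abs(nsq (x t) - nsq (x s)) <= e^2/4"
   by (rule square_uniform[OF e2]) blast
  obtain de2 where de2: "0 < de2" "!!t. a <= t ==> t <= b ==> b - t < de2 ==> abs(nsq (x b) - nsq (x t)) <= e^2/4"
   by (rule square_left_limit[OF e2]) blast
  obtain de3 where de3: "0 < de3" "!!s r. s : {a..b} ==> r : {a..b} ==> abs(r - s) < de3 ==> abs(inner (x t) (x r - x s)) <= e^2/4"
   by (rule weakly_continuous[OF e2]) blast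
  define de where "de = min (min de1 de2) de3"
  show ?thesis
  proof (intro exI conjI ballI impI)
   show "0 < de" using de1 de2 de3 by (simp add: de_def)
   fix s assume s: "s : {a..b}" "dist s t < de"
   have "abs(nsq (x s) - nsq (x t)) <= e^2/4"
   proof (cases "max s t < b")
    case True
    thus ?thesis using de1(2)[of s t] de1(2)[of t s] s t by (cases "s <= t") (auto simp: dist_real_def de_def abs_minus_commute)
   next
    case False
    thus ?thesis using de2(2)[of s] de2(2)[of t] s t by (auto simp: dist_real_def de_def max_def abs_minus_commute split: if_splits)
   qed
   moreover have "abs(inner (x t) (x t - x s)) <= e^2/4" using de3(2)[of s t] s t by (simp add: dist_real_def de_def abs_minus_commute)
   moreover have "nsq (x s - x t) = nsq (x s) - nsq (x t) + 2*inner (x t) (x t - x s)"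
    by (simp add: power2_norm_eq_inner inner_diff_left inner_diff_right inner_commute)
   moreover have "0 < e^2" using e by simp
   ultimately have "nsq (x s - x t) < e^2" by linarith
   thus "dist (x s) (x t) < e" using e by (simp add: dist_norm power2_less_imp_less)
  qed
 qed
 thus ?thesis unfolding continuous_on_iff by blast
qed

end

section \<open>Monotone operators\<close>

context evolution_exponents
begin

text \<open>The conditions on the operator at a single time, with all constants as arguments: the
  same predicate then covers \<open>A t\<close> at almost every time and the time integrals solved
  for in the Euler scheme.\<close>

definition monotone_op :: "real => real => real => ('a => 'a dual) => bool" where "monotone_op al c1 c2 B <->
  (ALL x y. 0 <= (B x - B y) (x - y)) \<and>
  (ALL x y v. cont 0 1 (%s::real. B (x + s*.y) v)) \<and>
  (ALL x. norm (B x) <= al + c1*norm x powr (p - 1)) \<and>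
  (ALL x. c2*norm x powr p <= B x x)"

lemma monotone_opD: assumes "monotone_op al c1 c2 B" shows "0 <= (B x - B y) (x - y)" and "cont 0 1 (%s::real. B (x + s*.y) v)"
  and "norm (B x) <= al + c1*norm x powr (p - 1)" and "c2*norm x powr p <= B x x" using assms by (auto simp: monotone_op_def)

lemma monotone_op_hemicontinuous: assumes B: "monotone_op al c1 c2 B" and e: "0 < e"
 obtains s :: real where "0 < s" "s <= 1" "!!s'. 0 <= s' ==> s' <= s ==> abs(B (u + s'*.y) v - B u v) <= e"
proof -
 have "cont 0 1 (%s::real. B (u + s*.y) v)" by (rule monotone_opD(2)[OF B])
 then obtain d where d: "0 < d" "!!s. s : {0..1} ==> dist s 0 < d ==>
   dist (B (u + s*.y) v) (B (u + 0*.y) v) < e"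
  using e unfolding continuous_on_iff by (metis atLeastAtMost_iff order_refl zero_le_one)
 show ?thesis
 proof (rule that[of "min 1 (d/2)"])
  fix s' assume "0 <= s'" "s' <= min 1 (d/2)"
  thus "abs(B (u + s'*.y) v - B u v) <= e" using d(1) d(2)[of s'] by (simp add: dist_real_def)
 qed (use d in auto)
qed

lemma coercive_bound: assumes "0 < c2" "0 <= K" "0 <= r" "c2*r powr p <= K*(1 + r powr (p - 1))" shows "r <= 1 + 2*K / c2"
proof (cases "r <= 1")
 case True
 thus ?thesis using assms by (simp add: add_increasing2)
next
 case False
 hence r: "1 <= r powr (p - 1)" using p1 by (simp add: ge_one_powr_ge_zero)
 have "r powr p = r*r powr (p - 1)" using False powr_mult_base[of r "p - 1"] by simp
 hence "(c2*r)*r powr (p - 1) <= K*(1 + r powr (p - 1))" using assms by (simp add: mult.assoc)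
 also have "... <= (2*K)*r powr (p - 1)" using r assms mult_left_mono[OF r, of K] by (simp add: algebra_simps)
 finally have "c2*r <= 2*K" using r False by (simp add: mult_le_cancel_right)
 thus ?thesis using assms by (simp add: field_simps)
qed

lemma monotone_op_bounded: assumes B: "monotone_op al c1 c2 B" and c: "0 <= al" "0 <= c1" "0 < c2"
 obtains R where "!!u'. (B u' - B u) (u' - u) <= 1 ==> norm u' <= R"
proof -
 define K where "K = 1 + (al + c1)*norm u + norm (B u)*(2 + norm u)"
 have K0: "0 <= K" using c by (simp add: K_def)
 have "norm u' <= 1 + 2*K / c2" if d: "(B u' - B u) (u' - u) <= 1" for u'
 proof (rule coercive_bound[OF c(3) K0 norm_ge_zero])
  define P where "P = norm u' powr (p - 1)"
  have P: "0 <= P" "norm u' <= 1 + P" using powr_ge_bound[of "norm u'" "p - 1"] p2 by (auto simp: P_def)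
  have 1: "B u' u <= (al + c1*P)*norm u"
   using norm_blinfun[of "B u'" u] monotone_opD(3)[OF B, of u'] mult_right_mono[OF monotone_opD(3)[OF B, of u'] norm_ge_zero[of u]]
   by (simp add: P_def)
  have 2: "B u (u' - u) <= norm (B u)*(1 + P + norm u)" using norm_blinfun[of "B u" "u' - u"] P norm_triangle_ineq4[of u' u]
    mult_left_mono[of "norm (u' - u)" "1 + P + norm u" "norm (B u)"] by auto
  have "c2*norm u' powr p <= B u' u'" by (rule monotone_opD(4)[OF B])
  also have "... = (B u' - B u) (u' - u) + B u' u + B u (u' - u)" by (simp add: bl_diff_left bl_diff_right)
  also have "... <= 1 + (al + c1*P)*norm u + norm (B u)*(1 + P + norm u)" using 1 2 d by linarith
  also have "... <= K*(1 + P)"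
  proof -
   have "K*(1 + P) - (1 + (al + c1*P)*norm u + norm (B u)*(1 + P + norm u)) =
    P + al*norm u*P + c1*norm u + norm (B u) + norm (B u)*P + norm (B u)*norm u*P" unfolding K_def by (simp add: algebra_simps)
   also have "... >= 0" using P c by simp
   finally show ?thesis by simp
  qed
  finally show "c2*norm u' powr p <= K*(1 + norm u' powr (p - 1))" by (simp add: P_def)
 qed
 thus ?thesis using that by blast
qed

text \<open>Minty's argument at a fixed time. The vanishing defect and coercivity bound
  \<open>u n\<close> in \<open>V\<close> eventually, so weak convergence in \<open>H\<close> becomes
  weak convergence in \<open>V\<close>. Monotonicity tested at \<open>u0 + s*.y\<close> is divided
  by \<open>s\<close>, and hemicontinuity lets \<open>s\<close> be small; \<open>y\<close> and
  \<open>- y\<close> give both bounds.\<close>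

lemma monotone_op_converges: assumes B: "monotone_op al c1 c2 B" and c: "0 <= al" "0 <= c1" "0 < c2"
  and w: "!!h. (%n. inner h (j (u n))) ----> inner h (j u0)" and d: "(%n. (B (u n) - B u0) (u n - u0)) ----> 0"
 shows "(%n. B (u n) y) ----> B u0 y"
proof -
 obtain R where R: "!!u'. (B u' - B u0) (u' - u0) <= 1 ==> norm u' <= R" by (rule monotone_op_bounded[OF B c, of u0]) blast
 obtain N where N: "!!n. N <= n ==> (B (u n) - B u0) (u n - u0) <= 1"
  using order_tendstoD(2)[OF d, of 1] by (auto simp: eventually_sequentially intro: less_imp_le)
 have wl: "(%n. l (u n)) ----> l u0" for l :: "'a dual"
 proof -
  have b: "norm (u (n + N)) <= R" for n by (rule R[OF N]) simp
  obtain u1 where u1: "j u1 = j u0" "!!l :: 'a dual. (%n. l (u (n + N))) ----> l u1"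
   using bounded_weak_limit_in_range[of "%n. u (n + N)", OF b LIMSEQ_ignore_initial_segment[OF w]] by blast
  hence "u1 = u0" by (simp add: j_eq_iff)
  thus ?thesis using LIMSEQ_offset[OF u1(2)[of l]] by simp
 qed
 have half: "EVN n. B (u n) y <= B u0 y + e" if e: "0 < e" for e y
 proof -
  obtain s :: real where s: "0 < s" "abs(B (u0 + s*.y) y - B u0 y) <= e/2"
   using monotone_op_hemicontinuous[OF B, of "e/2" u0 y y] e by (metis half_gt_zero less_imp_le order_refl)
  define v where "v = u0 + s*.y"
  define r where "r n = (B (u n) - B u0) (u n - u0) + (B u0 - B v) (u n - u0)" for n
  have "r ----> 0 + ((B u0 - B v) u0 - (B u0 - B v) u0)"
   unfolding r_def bl_diff_right[of "B u0 - B v"] by (intro tendsto_add d tendsto_diff wl tendsto_const)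
  hence "EVN n. r n < s*(e/2)" using order_tendstoD(2)[of r 0 sequentially "s*(e/2)"] s e by simp
  thus ?thesis
  proof eventually_elim
   case (elim n)
   have "0 <= (B (u n) - B v) (u n - v)" by (rule monotone_opD(1)[OF B])
   also have "... = r n - s*B (u n) y + s*B v y"
    unfolding r_def v_def by (simp add: bl_diff_left bl_diff_right blinfun.add_right blinfun.scaleR_right algebra_simps)
   finally have "s*B (u n) y <= s*(B v y + e/2)" using elim by (simp add: algebra_simps)
   hence "B (u n) y <= B v y + e/2" using s by simp
   thus ?case using s(2) unfolding v_def by linarith
  qed
 qed
 show ?thesis
 proof (rule tendstoI)
  fix e :: real assume e: "0 < e"
  have "EVN n. B (u n) y <= B u0 y + e/2" "EVN n. B (u n) (- y) <= B u0 (- y) + e/2" by (rule half; use e in simp)+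
  thus "EVN n. dist (B (u n) y) (B u0 y) < e"
  proof eventually_elim
   case (elim n)
   thus ?case using e by (simp add: dist_real_def blinfun.minus_right abs_if)
  qed
 qed
qed

text \<open>For norm convergent arguments the defect vanishes by the growth bound. This is the
  continuity that makes the superposition \<open>A t (X t)\<close> measurable.\<close>

lemma monotone_op_demicontinuous: assumes B: "monotone_op al c1 c2 B" and c: "0 <= al" "0 <= c1" "0 < c2" and u: "u ----> u0"
 shows "(%n. B (u n) y) ----> B u0 y"
proof (rule monotone_op_converges[OF B c])
 show "(%n. inner h (j (u n))) ----> inner h (j u0)" for h by (intro tendsto_inner tendsto_const blinfun.tendsto u)
 obtain R where R: "0 < R" "!!n. norm (u n) <= R" using Bseq_def convergent_imp_Bseq[OF convergentI[OF u]] by metis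
 define K where "K = al + c1*R powr (p - 1) + norm (B u0)"
 have b: "norm (B (u n) - B u0) <= K" for n
 proof -
  have "norm (B (u n)) <= al + c1*norm (u n) powr (p - 1)" by (rule monotone_opD(3)[OF B])
  also have "... <= al + c1*R powr (p - 1)" using R p1 c by (intro add_left_mono mult_left_mono powr_mono2) auto
  finally show ?thesis using norm_triangle_ineq4[of "B (u n)" "B u0"] by (simp add: K_def)
 qed
 show "(%n. (B (u n) - B u0) (u n - u0)) ----> 0"
 proof (rule Lim_null_comparison)
  show "EVN n. norm ((B (u n) - B u0) (u n - u0)) <= K*norm (u n - u0)"
   using b by (intro always_eventually allI order_trans[OF norm_blinfun] mult_right_mono) auto
  have "(%n. K*norm (u n - u0)) ----> K*norm (u0 - u0)" by (intro tendsto_intros u)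
  thus "(%n. K*norm (u n - u0)) ----> 0" by simp
 qed
qed

text \<open>The finite-dimensional core of the Minty--Browder theorem: a minimiser of the sum of the squared
 positive parts over the convex hull solves the finitely many inequalities, because otherwise the
 direction towards the barycentre with weights \<open>mu\<close> would decrease that sum.\<close>

lemma finite_Minty:
 fixes E :: "'a => 'a dual" assumes S: "finite S" "S ~= {}" and mono: "!!x y. 0 <= (E x - E y) (x - y)"
 obtains x where "x : convex hull S" "!!v. v : S ==> E v (x - v) <= 0"
proof -
 define f where "f x = (SUM v:S. (max 0 (E v (x - v)))^2)" for x
 have "continuous_on (convex hull S) f" unfolding f_def by (intro continuous_intros)
 moreover have "compact (convex hull S)" by (rule finite_imp_compact_convex_hull[OF S(1)])
 moreover have "convex hull S ~= {}" using S by simp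
 ultimately obtain x where x: "x : convex hull S" "!!y. y : convex hull S ==> f x <= f y" using continuous_attains_inf by metis
 define mu where "mu v = max 0 (E v (x - v))" for v
 have mu0: "0 <= mu v" for v by (simp add: mu_def)
 define s where "s = sum mu S"
 have "s <= 0"
 proof (rule ccontr)
  assume "~ s <= 0"
  hence s: "0 < s" by simp
  define z where "z = (SUM v:S. (mu v / s)*.v)"
  have z: "z : convex hull S" unfolding z_def by (rule convex_sum[OF S(1) convex_convex_hull])
    (use s mu0 in "auto simp: s_def sum_divide_distrib[symmetric] intro: hull_inc")
  define c where "c v = E v (z - x)" for v
  define Q where "Q = (SUM v:S. (c v)^2)"
  have dir: "0 <= 2*(SUM v:S. mu v * c v) + t*Q" if t: "0 < t" "t <= 1" for t
  proof -
   have "x + t*.(z - x) = (1 - t)*.x + t*.z" by (simp add: algebra_simps)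
   hence "x + t*.(z - x) : convex hull S" using convexD_alt[OF convex_convex_hull x(1) z, of t] t by simp
   hence "f x <= f (x + t*.(z - x))" by (rule x(2))
   also have "... <= (SUM v:S. (mu v)^2 + t*(2*(mu v * c v)) + t^2*(c v)^2)" unfolding f_def
   proof (rule sum_mono)
    fix v assume "v : S"
    define a where "a = E v (x - v)"
    have eq: "E v (x + t*.(z - x) - v) = a + t * c v"
     by (simp add: a_def c_def bl_diff_right blinfun.add_right blinfun.scaleR_right)
    have "(max 0 (a + t * c v))^2 <= (max 0 a + t * c v)^2" by (rule abs_le_square_iff[THEN iffD1]) (simp add: abs_if max_def)
    thus "(max 0 (E v (x + t*.(z - x) - v)))^2 <= (mu v)^2 + t*(2*(mu v * c v)) + t^2*(c v)^2"
     unfolding eq mu_def a_def[symmetric] by (simp add: power2_eq_square algebra_simps)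
   qed
   also have "... = f x + t*(2*(SUM v:S. mu v * c v) + t*Q)"
    unfolding f_def mu_def[symmetric] Q_def by (simp add: sum.distrib sum_distrib_left power2_eq_square algebra_simps)
   finally show ?thesis using t by (simp add: zero_le_mult_iff)
  qed
  have sq: "0 < (SUM v:S. mu v * mu v)"
  proof -
   have "EX v:S. mu v ~= 0" using s by (metis s_def sum.neutral less_irrefl)
   then obtain v where v: "v : S" "0 < mu v * mu v" using mu0 by (metis mult_eq_0_iff zero_le_mult_iff less_le)
   hence "mu v * mu v <= (SUM v:S. mu v * mu v)" by (intro member_le_sum S) auto
   thus ?thesis using v by linarith
  qed
  have "(SUM v:S. mu v * c v) < 0"
  proof -
   \<comment> \<open>Multiplication by \<open>s\<close> produces a double sum with symmetric
     weights; pairing \<open>(v, w)\<close> with \<open>(w, v)\<close> turns its terms into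
     \<open>- (E v - E w) (v - w)\<close>, which monotonicity makes nonpositive.\<close>
   define m where "m v w = E v (w - v)" for v w
   have "s*(SUM v:S. mu v * E v (z - v)) = (SUM v:S. SUM w:S. mu v * mu w*m v w)"
   proof -
    have "s*E v (z - v) = (SUM w:S. mu w*m v w)" for v
    proof -
     have "s*.(z - v) = (SUM w:S. mu w*.(w - v))"
     proof -
      have "s*.z = (SUM w:S. mu w*.w)" using s by (simp add: z_def scaleR_sum_right)
      moreover have "s*.v = (SUM w:S. mu w*.v)" by (simp add: s_def scaleR_sum_left)
      ultimately show ?thesis by (simp add: scaleR_diff_right sum_subtractf)
     qed
     hence "E v (s*.(z - v)) = E v (SUM w:S. mu w*.(w - v))" by simp
     thus ?thesis by (simp add: blinfun.scaleR_right blinfun.sum_right m_def)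
    qed
    hence "mu v * (s*E v (z - v)) = (SUM w:S. mu v * mu w*m v w)" for v by (simp add: sum_distrib_left mult.assoc)
    thus ?thesis by (simp add: sum_distrib_left mult.left_commute)
   qed
   also have "... <= 0"
   proof -
    have "(SUM v:S. SUM w:S. mu v * mu w*m v w) = (SUM v:S. SUM w:S. mu v * mu w*m w v)"
     by (subst sum.swap) (simp add: mult.commute)
    hence "2*(SUM v:S. SUM w:S. mu v * mu w*m v w) = (SUM v:S. SUM w:S. mu v * mu w*(m v w + m w v))"
     by (simp add: sum.distrib algebra_simps)
    also have "... <= 0"
    proof (intro sum_nonpos mult_nonneg_nonpos)
     fix v w
     have "m v w + m w v = - (E v - E w) (v - w)" by (simp add: m_def bl_diff_left bl_diff_right)
     thus "m v w + m w v <= 0" using mono[of v w] by linarith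
    qed (use mu0 in auto)
    finally show ?thesis by simp
   qed
   finally have "(SUM v:S. mu v * E v (z - v)) <= 0" using s by (simp add: mult_le_0_iff)
   moreover have "(SUM v:S. mu v * E v (z - v)) = (SUM v:S. mu v * mu v) + (SUM v:S. mu v * c v)"
   proof -
    have "mu v * E v (z - v) = mu v * mu v + mu v * c v" for v
    proof -
     have "mu v * E v (x - v) = mu v * mu v" by (simp add: mu_def max_def)
     moreover have "E v (z - v) = E v (x - v) + c v" by (simp add: c_def bl_diff_right)
     ultimately show ?thesis by (simp add: distrib_left)
    qed
    thus ?thesis by (simp add: sum.distrib)
   qed
   ultimately show ?thesis using sq by linarith
  qed
  moreover have "0 <= (SUM v:S. mu v * c v)"
  proof (rule ccontr)
   define k where "k = - (SUM v:S. mu v * c v)"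
   assume "~ 0 <= (SUM v:S. mu v * c v)"
   hence k: "0 < k" by (simp add: k_def)
   have Q0: "0 <= Q" by (simp add: Q_def sum_nonneg)
   define t where "t = min 1 (k/(Q + 1))"
   have t: "0 < t" "t <= 1" "t <= k/(Q + 1)" using k Q0 by (auto simp: t_def)
   hence "t*(Q + 1) <= k" using Q0 by (simp add: pos_le_divide_eq)
   hence "t*Q <= k" using t(1) by (simp add: distrib_left)
   thus False using dir[OF t(1,2)] k by (simp add: k_def)
  qed
  ultimately show False by simp
 qed
 hence "s = 0" using sum_nonneg[of S mu] mu0 by (simp add: s_def)
 hence "!!v. v : S ==> mu v = 0" using sum_nonneg_eq_0_iff[OF S(1), of mu] mu0 by (simp add: s_def)
 hence "!!v. v : S ==> E v (x - v) <= 0" unfolding mu_def by (metis max.cobounded2)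
 thus ?thesis using x(1) that by blast
qed

text \<open>The inequality is written with \<open>E v\<close> instead of \<open>E u\<close>: for
  fixed \<open>v\<close> it is then affine in \<open>u\<close> and survives weak limits. So the sets
  \<open>S v\<close> are closed, \<open>finite_Minty\<close> gives the finite intersection property,
  and compactness gives a common point.\<close>

lemma Minty_on_ball:
 fixes E :: "'a => 'a dual" assumes mono: "!!x y. 0 <= (E x - E y) (x - y)" and R: "0 <= R"
 obtains u where "norm u <= R" "!!v. norm v <= R ==> E v (u - v) <= 0"
proof -
 define S where "S v = j ` {u. norm u <= R & E v (u - v) <= 0}" for v
 have "j ` cball 0 R Int \<Inter>(S ` cball 0 R) ~= {}"
 proof (rule compact_imp_fip[OF compact_j_cball])
  fix K assume "K : S ` cball 0 R"
  then obtain v where K: "K = S v" by blast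
  show "closed K" unfolding K closed_sequential_limits
  proof (intro allI impI, elim conjE)
   fix z z0 assume z: "ALL n. z n : S v" and l: "z ----> z0"
   hence "ALL n. EX u. z n = j u & norm u <= R & E v (u - v) <= 0" unfolding S_def by blast
   then obtain u where u: "!!n. z n = j (u n)" "!!n. norm (u n) <= R" "!!n. E v (u n - v) <= 0" by metis
   have "(%n. inner h (j (u n))) ----> inner h z0" for h using tendsto_inner[OF tendsto_const l] by (simp add: u(1))
   then obtain u0 where u0: "j u0 = z0" "norm u0 <= R" "!!l :: 'a dual. (%n. l (u n)) ----> l u0"
    using bounded_weak_limit_in_range[of u, OF u(2)] by blast
   have "E v u0 <= E v v" by (rule LIMSEQ_le_const2[OF u0(3)]) (use u(3) in "simp add: bl_diff_right")
   thus "z0 : S v" using u0 by (auto simp: S_def bl_diff_right)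
  qed
 next
  fix F assume F: "finite F" "F <= S ` cball 0 R"
  then obtain V where V: "finite V" "V <= cball 0 R" "F = S ` V" by (meson finite_subset_image)
  define V' where "V' = insert 0 V"
  have V': "finite V'" "V' ~= {}" "V' <= cball 0 R" using V R by (auto simp: V'_def)
  obtain x where x: "x : convex hull V'" "!!v. v : V' ==> E v (x - v) <= 0" using finite_Minty[OF V'(1,2) mono] by blast
  have "x : cball 0 R" using hull_minimal[OF V'(3), of convex] x(1) convex_cball by blast
  hence "j x : j ` cball 0 R Int \<Inter>F" using x(2) V by (auto simp: S_def V'_def)
  thus "j ` cball 0 R Int \<Inter>F ~= {}" by blast
 qed
 then obtain z where z: "z : j ` cball 0 R" "!!v. v : cball 0 R ==> z : S v" by blast
 then obtain u where u: "z = j u" "norm u <= R" by auto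
 show ?thesis
 proof (rule that[OF u(2)])
  fix v :: 'a assume "norm v <= R"
  hence "z : S v" using z(2) by simp
  thus "E v (u - v) <= 0" using u by (auto simp: S_def j_eq_iff)
 qed
qed

text \<open>The variational inequality on a large ball becomes an equation once its solution is
  interior: directions \<open>w\<close> and \<open>- w\<close> are then both admissible. Coercivity
  keeps the solution away from the sphere.\<close>

theorem elliptic_step: assumes B: "monotone_op al c1 c2 B" and c: "0 < c2"
 obtains u where "!!v. inner (j u) (j v) + B u v = inner y (j v)"
proof -
 define E where "E u = to_dual j (j u) + B u - to_dual j y" for u
 have mono: "0 <= (E x - E y') (x - y')" for x y'
 proof -
  have "(E x - E y') (x - y') = nsq (j (x - y')) + (B x - B y') (x - y')"
   by (simp add: E_def bl_diff_left bl_diff_right blinfun.add_left power2_norm_eq_inner inner_diff_left inner_diff_right)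
  thus ?thesis using monotone_opD(1)[OF B, of x y'] by simp
 qed
 define k where "k = norm y*norm j / c2"
 have k0: "0 <= k" using c by (simp add: k_def)
 \<comment> \<open>Half of a solution on the sphere would have norm \<open>k + 2\<close>. Since this
   is at least 1, its \<open>p\<close>-th power dominates its square, and testing with this half
   would bound its norm by \<open>k\<close>.\<close>
 define R where "R = 2*(k + 2)"
 have R: "0 <= R" "0 < R" using k0 by (auto simp: R_def)
 obtain u where u: "norm u <= R" "!!v. norm v <= R ==> E v (u - v) <= 0" using Minty_on_ball[OF mono R(1)] by blast
 have "norm u < R"
 proof (rule ccontr)
  assume "~ norm u < R"
  hence nu: "norm u = R" using u(1) by simp
  define v where "v = (1/2)*.u"
  have nv: "norm v = k + 2" by (simp add: v_def nu R_def)
  have "u - v = v" by (simp add: v_def algebra_simps flip: scaleR_add_left)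
  hence "E v v <= 0" using u(2)[of v] nv R_def k0 by simp
  hence "nsq (j v) + B v v <= inner y (j v)" by (simp add: E_def bl_diff_left blinfun.add_left power2_norm_eq_inner)
  also have "... <= norm y*(norm j*norm v)" by (intro order_trans[OF norm_cauchy_schwarz] mult_left_mono norm_blinfun) simp
  finally have "c2*norm v powr p <= norm y*(norm j*norm v)"
   using monotone_opD(4)[OF B, of v] zero_le_power2[of "norm (j v)"] by linarith
  moreover have "norm v powr p >= norm v * norm v"
  proof -
   have "norm v powr 2 <= norm v powr p" using nv k0 p2 by (intro powr_mono) auto
   thus ?thesis using nv k0 by (simp add: power2_eq_square)
  qed
  ultimately have "c2*(norm v * norm v) <= norm y*(norm j*norm v)"
   using c mult_left_mono[of "norm v * norm v" "norm v powr p" c2] by linarith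
  hence "(c2*norm v)*norm v <= (norm y*norm j)*norm v" by (simp only: mult.assoc)
  hence "c2*norm v <= norm y*norm j" using nv k0 by simp
  hence "norm v <= k" using c by (simp add: k_def field_simps)
  thus False using nv by simp
 qed
 have nonneg: "0 <= E u w" for w
 proof (rule field_le_epsilon)
  fix e :: real assume e: "0 < e"
  define r where "r = R - norm u"
  have r: "0 < r" using `norm u < R` by (simp add: r_def)
  obtain s0 :: real where s0: "0 < s0" "s0 <= 1" "!!s'. 0 <= s' ==> s' <= s0 ==> abs(B (u + s'*.w) w - B u w) <= e/2"
   using monotone_op_hemicontinuous[OF B, of "e/2" u w w] e by (metis half_gt_zero)
  define N where "N = nsq (j w)"
  have N: "0 <= N" by (simp add: N_def)
  \<comment> \<open>The three bounds keep the hemicontinuity error below \<open>e/2\<close>, the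
    point \<open>u + s*.w\<close> in the ball, and the quadratic term \<open>s*N\<close> below
    \<open>e/2\<close>.\<close>
  define s where "s = min s0 (min (r/(norm w + 1)) (e/(2*(N + 1))))"
  have w1: "0 < norm w + 1" by (simp add: add_nonneg_pos)
  have s: "0 < s" "s <= s0" "s <= r/(norm w + 1)" "s <= e/(2*(N + 1))" using s0 r e N w1 by (auto simp: s_def)
  hence sr: "s*norm w <= r"
  proof -
   have "s*(norm w + 1) <= r" using s(3) w1 by (simp add: field_simps)
   thus ?thesis using s(1) by (simp add: distrib_left)
  qed
  have sN: "s*N <= e/2"
  proof -
   have "s*(N + 1) <= e/2" using s(4) N by (simp add: field_simps)
   thus ?thesis using s(1) by (simp add: distrib_left)
  qed
  have "norm (u + s*.w) <= R" using norm_triangle_ineq[of u "s*.w"] sr s by (simp add: r_def)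
  hence "E (u + s*.w) (u - (u + s*.w)) <= 0" by (rule u(2))
  hence "0 <= s*E (u + s*.w) w" by (simp add: blinfun.minus_right blinfun.scaleR_right)
  hence "0 <= E (u + s*.w) w" using s(1) by (simp add: zero_le_mult_iff)
  also have "... = E u w + s*N + (B (u + s*.w) w - B u w)"
   by (simp add: E_def N_def bl_diff_left blinfun.add_left blinfun.add_right blinfun.scaleR_right power2_norm_eq_inner inner_add_left)
  also have "... <= E u w + e" using s0(3)[of s] s sN by linarith
  finally show "0 <= E u w + e" .
 qed
 show ?thesis
 proof (rule that[of u])
  fix v
  have "E u v = 0" using nonneg[of v] nonneg[of "- v"] by (simp add: blinfun.minus_right)
  thus "inner (j u) (j v) + B u v = inner y (j v)" by (simp add: E_def bl_diff_left blinfun.add_left)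
 qed
qed

end

section \<open>The time-dependent operator on functions with values in V\<close>

locale evolution_operator = evolution_exponents j p q
 for j :: "'a::{banach, second_countable_topology} \<Rightarrow>\<^sub>L 'b::{real_inner, complete_space}" and p q +
 fixes T :: real and A :: "real => 'a => 'a dual" and a1 :: "real => real" and c1 c2 :: real assumes T0: "0 < T"
  and A_measurable: "!!x v. (%t. A t x v) : meas 0 T" and A_monotone: "AE t in leb 0 T. monotone_op (a1 t) c1 c2 (A t)"
  and a1_measurable: "a1 : meas 0 T" and a1_nonneg: "!!t. 0 <= a1 t" and a1_integrable: "intg 0 T (%t. a1 t powr q)"
  and c1: "0 <= c1" and c2: "0 < c2"
begin

abbreviation "rhs f X r == to_dual j (f r) - A r (X r)"

abbreviation "trj == trajectory T p q j A"

abbreviation "trjs == trajectories T p q j A"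

lemma conjugate_exponent: "(p - 1)*q = p" using pq p0 q0 by (simp add: field_simps)

lemma A_monotone_on: "0 <= a ==> b <= T ==> AE t in leb a b. monotone_op (a1 t) c1 c2 (A t)" using AE_sub[OF A_monotone] by blast

lemma a1_integrable_on: "0 <= a ==> b <= T ==> intg a b (%t. a1 t powr q)" using intg_sub[OF a1_integrable] by blast

lemma a1_integrable1: assumes "0 <= a" "b <= T" shows "intg a b a1"
proof (rule intg_AE_le)
 show "intg a b (%t. 1 + a1 t powr q)" using a1_integrable_on[OF assms] by simp
 show "a1 : meas a b" by (rule meas_sub[OF a1_measurable]) (use assms in auto)
 show "AE t in leb a b. abs(a1 t) <= 1 + a1 t powr q" using powr_ge_bound[OF a1_nonneg, of q] a1_nonneg q1 by (intro AE_I2) simp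
qed

definition CA :: real where "CA = 2 powr q*(LI 0 T (%t. a1 t powr q) + c1 powr q)"

lemma CA0: "0 <= CA" unfolding CA_def by (intro mult_nonneg_nonneg add_nonneg_nonneg integral_nonneg_AE) auto

lemma growth_powr: assumes "monotone_op (a1 t) c1 c2 (A t)"
 shows "norm (A t u) powr q <= 2 powr q*(a1 t powr q + c1 powr q*norm u powr p)"
proof -
 have "norm (A t u) powr q <= (a1 t + c1*norm u powr (p - 1)) powr q"
  using monotone_opD(3)[OF assms, of u] q0 by (intro powr_mono2) auto
 also have "... <= 2 powr q*(a1 t powr q + (c1*norm u powr (p - 1)) powr q)" using a1_nonneg c1 q0 by (intro powr_sum_le) auto
 also have "(c1*norm u powr (p - 1)) powr q = c1 powr q*norm u powr p"
  using c1 by (simp add: powr_mult powr_powr conjugate_exponent)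
 finally show ?thesis .
qed

text \<open>The exponents match because \<open>(p - 1)*q = p\<close>: the growth bound turns a
  \<open>p\<close>-th mean of \<open>X\<close> into a \<open>q\<close>-th mean of
  \<open>A t (X t)\<close>, with a bound that is affine in the former.\<close>

lemma A_Dfun: assumes X: "Vfun a b X" and ab: "0 <= a" "b <= T"
 shows "Dfun a b (%t. A t (X t))" and "LI a b (%t. norm (A t (X t)) powr q) <= CA*(1 + LI a b (%t. norm (X t) powr p))"
proof -
 have sub: "{a..b} <= {0..T}" using ab by auto
 note good = A_monotone_on[OF ab]
 have m: "(%t. A t (X t) v) : meas a b" for v
 proof (rule Caratheodory_measurable[OF _ _ _ Vfun_measurable[OF X]])
  show "(%t. A t u v) : meas a b" for u by (rule meas_sub[OF A_measurable sub])
  show "AE t in leb a b. ALL u u0. u ----> u0 --> (%n. A t (u n) v) ----> A t u0 v"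
   using good by eventually_elim (use monotone_op_demicontinuous[OF _ a1_nonneg c1 c2] in blast)
 qed simp
 have mn: "(%t. norm (A t (X t))) : meas a b" by (rule meas_norm_dual[OF m])
 have w: "intg a b (%t. 2 powr q*(a1 t powr q + c1 powr q*norm (X t) powr p))"
  using a1_integrable_on[OF ab] Vfun_intg[OF X] by simp
 have le: "AE t in leb a b. norm (A t (X t)) powr q <= 2 powr q*(a1 t powr q + c1 powr q*norm (X t) powr p)"
  using good by eventually_elim (rule growth_powr)
 have i: "intg a b (%t. norm (A t (X t)) powr q)" by (rule intg_AE_le[OF w]) (use mn le in auto)
 thus "Dfun a b (%t. A t (X t))" using m by (simp add: Dfun_def)
 have "LI a b (%t. norm (A t (X t)) powr q) <= LI a b (%t. 2 powr q*(a1 t powr q + c1 powr q*norm (X t) powr p))"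
  by (rule LI_mono_AE[OF i w le])
 also have "... = 2 powr q*(LI a b (%t. a1 t powr q) + c1 powr q*LI a b (%t. norm (X t) powr p))"
  using a1_integrable_on[OF ab] Vfun_intg[OF X] by simp
 also have "... <= CA*(1 + LI a b (%t. norm (X t) powr p))"
 proof -
  define K where "K = LI 0 T (%t. a1 t powr q)"
  define P where "P = LI a b (%t. norm (X t) powr p)"
  have "LI a b (%t. a1 t powr q) <= K" unfolding K_def by (rule LI_mono_subset[OF a1_integrable]) (use ab in auto)
  moreover have "0 <= P" "0 <= K" unfolding P_def K_def by (intro integral_nonneg_AE; simp)+
  ultimately have "LI a b (%t. a1 t powr q) + c1 powr q*P <= (K + c1 powr q)*(1 + P)" by (simp add: algebra_simps add_increasing2)
  thus ?thesis unfolding CA_def K_def[symmetric] P_def[symmetric] by (simp add: mult.assoc)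
 qed
 finally show "LI a b (%t. norm (A t (X t)) powr q) <= CA*(1 + LI a b (%t. norm (X t) powr p))" .
qed

text \<open>The operator of one implicit step. It is integrated over the step instead of being
  evaluated at a node, because \<open>A\<close> is merely measurable in time.\<close>

definition A_integral :: "real => real => 'a => 'a dual" where "A_integral a b u = Blinfun (%v. LI a b (%t. A t u v))"

lemma A_const_Dfun: "0 <= a ==> b <= T ==> Dfun a b (%t. A t u)" using A_Dfun(1)[OF Vfun_const] .

lemma A_integral_apply: assumes "0 <= a" "b <= T" shows "A_integral a b u v = LI a b (%t. A t u v)"
proof -
 note D = A_const_Dfun[OF assms, of u]
 have "bounded_linear (%v. LI a b (%t. A t u v))"
 proof (rule bounded_linear_intro)
  show "LI a b (%t. A t u (x + y)) = LI a b (%t. A t u x) + LI a b (%t. A t u y)" for x y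
   using Dfun_apply[OF D] by (simp add: blinfun.add_right)
  show "LI a b (%t. A t u (r*.x)) = r*.LI a b (%t. A t u x)" for r x by (simp add: blinfun.scaleR_right)
  show "norm (LI a b (%t. A t u x)) <= norm x*LI a b (%t. norm (A t u))" for x
  proof -
   note n = Dfun_norm_intg[OF D Vfun_const[of _ _ x]]
   have "abs(LI a b (%t. A t u x)) <= LI a b (%t. norm (A t u)*norm x)" using norm_blinfun[of "A _ u" x] Dfun_apply[OF D] n
    by (intro LI_abs_le AE_I2) auto
   thus ?thesis by (simp add: mult.commute)
  qed
 qed
 thus ?thesis by (simp add: A_integral_def bounded_linear_Blinfun_apply)
qed

lemma A_integral_monotone_op: assumes ab: "0 <= a" "a <= b" "b <= T"
 shows "monotone_op (LI a b a1) (c1*(b - a)) (c2*(b - a)) (A_integral a b)" unfolding monotone_op_def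
proof (intro conjI allI)
 note ap = A_integral_apply[OF ab(1,3)] and D = A_const_Dfun[OF ab(1,3)] and good = A_monotone_on[OF ab(1,3)]
 note i = Dfun_apply[OF D]
 fix x y v
 show "0 <= (A_integral a b x - A_integral a b y) (x - y)"
 proof -
  have "(A_integral a b x - A_integral a b y) (x - y) = LI a b (%t. (A t x - A t y) (x - y))"
   using i by (simp add: bl_diff_left ap)
  also have "... >= 0" by (rule integral_nonneg_AE) (use good in eventually_elim, rule monotone_opD(1))
  finally show ?thesis .
 qed
 show "cont 0 1 (%s::real. A_integral a b (x + s*.y) v)" unfolding ap
 proof (rule continuous_on_sequentiallyI)
  fix s :: "nat => real" and s0 assume s: "ALL n. s n : {0..1}" "s0 : {0..1}" "s ----> s0"
  define w where "w t = (a1 t + c1*(norm x + norm y) powr (p - 1))*norm v" for t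
  show "(%n. LI a b (%t. A t (x + s n*.y) v)) ----> LI a b (%t. A t (x + s0*.y) v)"
  proof (rule integral_dominated_convergence[where w=w])
   show "intg a b w" unfolding w_def using a1_integrable1[OF ab(1,3)] by simp
   show "AE t in leb a b. (%n. A t (x + s n*.y) v) ----> A t (x + s0*.y) v" using good
   proof eventually_elim
    case (elim t)
    hence "cont 0 1 (%s::real. A t (x + s*.y) v)" by (rule monotone_opD(2))
    thus ?case using s unfolding continuous_on_sequentially comp_def by blast
   qed
   fix n
   have "norm (x + s n*.y) <= norm x + norm y"
   proof -
    have "abs(s n)*norm y <= 1*norm y" using s(1) by (intro mult_right_mono) auto
    thus ?thesis using norm_triangle_ineq[of x "s n*.y"] by simp
   qed
   hence g: "norm (x + s n*.y) powr (p - 1) <= (norm x + norm y) powr (p - 1)" using p1 by (intro powr_mono2) auto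
   show "AE t in leb a b. norm (A t (x + s n*.y) v) <= w t" using good
   proof eventually_elim
    case (elim t)
    have "norm (A t (x + s n*.y)) <= a1 t + c1*norm (x + s n*.y) powr (p - 1)" by (rule monotone_opD(3)[OF elim])
    also have "... <= a1 t + c1*(norm x + norm y) powr (p - 1)" using g c1 by (intro add_left_mono mult_left_mono) auto
    finally show ?case unfolding w_def by (intro order_trans[OF norm_blinfun] mult_right_mono) auto
   qed
  qed (use i in auto)
 qed
 show "norm (A_integral a b x) <= LI a b a1 + c1*(b - a)*norm x powr (p - 1)"
 proof (rule norm_blinfun_bound)
  have ii: "intg a b (%t. a1 t + c1*norm x powr (p - 1))" using a1_integrable1[OF ab(1,3)] by simp
  have eq: "LI a b (%t. a1 t + c1*norm x powr (p - 1)) = LI a b a1 + c1*(b - a)*norm x powr (p - 1)"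
   using a1_integrable1[OF ab(1,3)] ab by (simp add: mult.commute mult.left_commute)
  show "0 <= LI a b a1 + c1*(b - a)*norm x powr (p - 1)"
   using ab c1 a1_nonneg by (intro add_nonneg_nonneg integral_nonneg_AE mult_nonneg_nonneg) auto
  fix z
  have "abs(LI a b (%t. A t x z)) <= LI a b (%t. (a1 t + c1*norm x powr (p - 1))*norm z)"
  proof (rule LI_abs_le)
   show "AE t in leb a b. abs(A t x z) <= (a1 t + c1*norm x powr (p - 1))*norm z" using good
   proof eventually_elim
    case (elim t)
    show ?case using norm_blinfun[of "A t x" z] mult_right_mono[OF monotone_opD(3)[OF elim, of x] norm_ge_zero[of z]] by simp
   qed
  qed (use ii i in auto)
  also have "... = (LI a b a1 + c1*(b - a)*norm x powr (p - 1))*norm z" using eq by simp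
  finally show "norm (A_integral a b x z) <= (LI a b a1 + c1*(b - a)*norm x powr (p - 1))*norm z" by (simp add: ap)
 qed
 have "c2*(b - a)*norm x powr p = LI a b (%t. c2*norm x powr p)" using ab by (simp add: LI_const)
 also have "... <= LI a b (%t. A t x x)" by (rule LI_mono_AE[OF _ i]) (simp, use good in eventually_elim, rule monotone_opD(4))
 finally show "c2*(b - a)*norm x powr p <= A_integral a b x x" by (simp add: ap)
qed

lemma coercive_integral: assumes X: "Vfun al be X" and st: "0 <= al" "be <= T"
 shows "c2*LI al be (%t. norm (X t) powr p) <= LI al be (%t. A t (X t) (X t))"
proof -
 have "LI al be (%t. c2*norm (X t) powr p) <= LI al be (%t. A t (X t) (X t))"
 proof (rule LI_mono_AE)
  show "AE t in leb al be. c2*norm (X t) powr p <= A t (X t) (X t)"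
   using A_monotone_on[OF st] by eventually_elim (rule monotone_opD(4))
 qed (use Vfun_intg[OF X] pair_intg[OF A_Dfun(1)[OF X st] X] in auto)
 thus ?thesis by simp
qed

end

section \<open>Limits of approximate solutions\<close>

context evolution_exponents
begin

lemma to_dual_Dfun:
 fixes f :: "real => 'b" assumes m: "!!h. (%t. inner h (f t)) : meas a b" and K: "AE t in leb a b. norm (f t) <= K"
 shows "Dfun a b (%t. to_dual j (f t))" "LI a b (%t. norm (to_dual j (f t)) powr q) <= (K*norm j) powr q*measure lborel {a..b}"
proof -
 have dm: "(%t. to_dual j (f t) v) : meas a b" for v using m[of "j v"] by (simp add: inner_commute)
 have le: "AE t in leb a b. norm (to_dual j (f t)) powr q <= (K*norm j) powr q" using K
 proof eventually_elim
  case (elim t)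
  have "norm (to_dual j (f t)) <= K*norm j" using elim by (intro order_trans[OF norm_to_dual_le] mult_right_mono) auto
  thus ?case using q0 by (intro powr_mono2) auto
 qed
 have mn: "(%t. norm (to_dual j (f t))) : meas a b" by (rule meas_norm_dual[OF dm])
 have i: "intg a b (%t. norm (to_dual j (f t)) powr q)" by (rule intg_bounded[where C="(K*norm j) powr q"]) (use mn le in auto)
 thus "Dfun a b (%t. to_dual j (f t))" using dm by (simp add: Dfun_def)
 have "LI a b (%t. norm (to_dual j (f t)) powr q) <= LI a b (%t. (K*norm j) powr q)" by (rule LI_mono_AE[OF i intg_const le])
 also have "... = (K*norm j) powr q*measure lborel {a..b}" by (cases "a <= b") (simp_all add: measure_restrict_space)
 finally show "LI a b (%t. norm (to_dual j (f t)) powr q) <= (K*norm j) powr q*measure lborel {a..b}" .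
qed

lemma LI_Dfun_diff_le: assumes G: "Dfun a b G" "Dfun a b H"
 shows "LI a b (%t. norm (G t - H t) powr q) <= 2 powr q*(LI a b (%t. norm (G t) powr q) + LI a b (%t. norm (H t) powr q))"
 using add_powr_integrable(2)[of q a b G "%t. - H t"] Dfun_intg[OF G(1)] Dfun_intg[OF G(2)] meas_norm_dual[OF Dfun_measurable[OF Dfun_diff[OF G]]] q0
 by simp

lemma LI_Vfun_diff_le: assumes X: "Vfun a b X" "Vfun a b Y"
 shows "LI a b (%t. norm (X t - Y t) powr p) <= 2 powr p*(LI a b (%t. norm (X t) powr p) + LI a b (%t. norm (Y t) powr p))"
 using add_powr_integrable(2)[of p a b X "%t. - Y t"] Vfun_intg[OF X(1)] Vfun_intg[OF X(2)] Vfun_measurable[OF Vfun_diff[OF X]] p0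
 by simp

end

text \<open>A common frame for the Euler scheme and for sequences of trajectories. The energy
  relation is one-sided because the implicit scheme dissipates energy, and up to an error that
  vanishes with \<open>n\<close>.\<close>

locale bounded_solutions = evolution_operator +
 fixes a b C0 CX K :: real and xn :: "nat => real => 'b::{real_inner, complete_space}" and Xn :: "nat => real => 'a::{banach, second_countable_topology}" and fn :: "nat => real => 'b"
 assumes ab': "0 <= a" "a < b" "b <= T" and Xn: "!!n. Vfun a b (Xn n)" and XnC: "!!n. LI a b (%t. norm (Xn n t) powr p) <= CX"
  and xnX: "!!n. AE t in leb a b. xn n t = j (Xn n t)" and fm: "!!n h. (%t. inner h (fn n t)) : meas a b"
  and fK: "!!n. AE t in leb a b. norm (fn n t) <= K" and xb': "!!n t. t : {a..b} ==> norm (xn n t) <= C0"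
  and xm': "!!n h. (%t. inner h (xn n t)) : meas a b" and app': "!!et. 0 < et ==> increments j a b xn (%n. rhs (fn n) (Xn n)) et"
  and energy: "!!et. 0 < et ==> EX n0. ALL n>=n0.
   2*LI a b (%t. A t (Xn n t) (Xn n t)) <=
    nsq (xn n a) - nsq (xn n b) + 2*LI a b (%t. inner (fn n t) (xn n t)) + et"
begin

abbreviation "G == %n t. rhs (fn n) (Xn n) t"

abbreviation "AXn == %n t. A t (Xn n t)"

definition Cq :: real where "Cq = 2 powr q*((K*norm j) powr q*(b - a) + CA*(1 + CX))"

lemma AXn_Dfun: "Dfun a b (AXn n)" using A_Dfun(1)[OF Xn] ab' by auto

lemma AXn_bound: "LI a b (%t. norm (AXn n t) powr q) <= CA*(1 + CX)"
 using order_trans[OF A_Dfun(2)[OF Xn ab'(1,3)] mult_left_mono[OF add_left_mono[OF XnC] CA0]] .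

lemma G_Dfun: "Dfun a b (G n)" by (rule Dfun_diff[OF to_dual_Dfun(1)[OF fm fK] AXn_Dfun])

lemma G_bound: "LI a b (%t. norm (G n t) powr q) <= Cq" unfolding Cq_def using to_dual_Dfun(2)[OF fm fK, of n] AXn_bound[of n] ab'
 by (intro order_trans[OF LI_Dfun_diff_le[OF to_dual_Dfun(1)[OF fm fK] AXn_Dfun]] mult_left_mono add_mono) auto

end

locale approx_solutions = bounded_solutions +
 fixes X :: "real => 'a::{banach, second_countable_topology}" and x :: "real => 'b::{real_inner, complete_space}"
 assumes X': "Vfun a b X" and xX': "AE t in leb a b. x t = j (X t)"
  and weak': "!!t h. t : {a..b} ==> (%n. inner h (xn n t)) ----> inner h (x t)" and init: "(%n. xn n a) ----> x a"
begin

abbreviation "AX == %t. A t (X t)"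

lemma AX_Dfun: "Dfun a b AX" using A_Dfun(1)[OF X'] ab' by auto

sublocale cross_energy j p q a b C0 Cq X x xn G by unfold_locales (use ab' X' xX' G_Dfun G_bound xb' xm' weak' app' in auto)

lemma difference_bound: shows "Vfun a b (%t. Xn n t - X t)"
  and "LI a b (%t. norm (Xn n t - X t) powr p) <= 2 powr p*(CX + LI a b (%t. norm (X t) powr p))"
 using Vfun_diff[OF Xn X'] order_trans[OF LI_Vfun_diff_le[OF Xn X'] mult_left_mono[OF add_right_mono[OF XnC]]] by auto

lemma weakly_null_AE: "AE t in leb a b. (ALL n. xn n t = j (Xn n t)) & x t = j (X t) \<and>
  (ALL h. (%n. inner h (j (Xn n t - X t))) ----> 0)"
proof -
 have "AE t in leb a b. ALL n. xn n t = j (Xn n t)" using xnX by (simp add: AE_all_countable)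
 with xX' AE_space show ?thesis
 proof eventually_elim
  case (elim t)
  have "(%n. inner h (xn n t) - inner h (x t)) ----> inner h (x t) - inner h (x t)" for h
   using elim by (intro tendsto_diff weak' tendsto_const) simp
  thus ?case using elim(1,3) by (simp add: bl_diff_right inner_diff_right)
 qed
qed

lemma difference_measurable: "(%t. norm (xn n t - x t)) : meas a b"
proof (rule meas_norm_H)
 show "(%t. inner h (xn n t - x t)) : meas a b" for h unfolding inner_diff_right by (intro borel_measurable_diff xm' x_measurable)
qed

text \<open>A compactness statement of Aubin-Lions type: pointwise weak convergence in
  \<open>H\<close> and the bound in \<open>L^p\<close> with values in \<open>V\<close>, combined
  with the compact embedding through \<open>weakly_null_ratios\<close> and
  \<open>weak_product_limit\<close>.\<close>

lemma strong_L1_limit: shows "intg a b (%t. norm (xn n t - x t))" and "(%n. LI a b (%t. norm (xn n t - x t))) ----> 0"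
proof -
 note d = difference_bound
 have m: "(%t. norm (Xn n t - X t)) : meas a b" for n using Vfun_measurable[OF d(1)] by simp
 have "AE t in leb a b. abs(norm (xn n t - x t)) <= norm j*norm (Xn n t - X t)" for n
  using weakly_null_AE by eventually_elim (simp add: norm_blinfun flip: bl_diff_right)
 moreover have "AE t in leb a b. (%n. norm (xn n t - x t)/(1 + norm (Xn n t - X t))) ----> 0" using weakly_null_AE
 proof eventually_elim
  case (elim t)
  show ?case using weakly_null_ratios(1)[of "%n. Xn n t - X t"] elim by (simp add: bl_diff_right)
 qed
 ultimately have "!!n. intg a b (%t. norm (xn n t - x t))" "(%n. LI a b (%t. abs(norm (xn n t - x t)))) ----> 0"
  using weak_product_limit[OF p1 q1 pq finite_measure_interval, of a b "%_. norm j" "%n t. norm (Xn n t - X t)"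
    "2 powr p*(CX + LI a b (%t. norm (X t) powr p))" "%n t. norm (xn n t - x t)"]
   m Vfun_intg[OF d(1)] d(2) difference_measurable by auto
 thus "intg a b (%t. norm (xn n t - x t))" "(%n. LI a b (%t. norm (xn n t - x t))) ----> 0" by auto
qed

lemma pairing_limit: "(%n. LI a b (%t. AX t (Xn n t - X t))) ----> 0"
proof -
 note d = difference_bound
 have m: "(%t. norm (Xn n t - X t)) : meas a b" for n using Vfun_measurable[OF d(1)] by simp
 have i: "intg a b (%t. AX t (Xn n t - X t))" for n by (rule pair_intg[OF AX_Dfun d(1)])
 have mi: "(%t. AX t (Xn n t - X t)) : meas a b" for n by (rule meas_intg[OF i])
 have le: "AE t in leb a b. abs(AX t (Xn n t - X t)) <= norm (AX t)*norm (Xn n t - X t)" for n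
  using norm_blinfun[of "AX _"] by (intro AE_I2) simp
 have ra: "AE t in leb a b. (%n. AX t (Xn n t - X t)/(1 + norm (Xn n t - X t))) ----> 0"
  using weakly_null_AE by eventually_elim (rule weakly_null_ratios(2), blast)
 have "(%n. LI a b (%t. abs(AX t (Xn n t - X t)))) ----> 0"
  by (rule weak_product_limit(2)[OF p1 q1 pq finite_measure_interval Dfun_intg[OF AX_Dfun] norm_ge_zero
    Dfun_norm_measurable[OF AX_Dfun] m norm_ge_zero Vfun_intg[OF d(1)] d(2) mi le ra])
 moreover have "EVN n. norm (LI a b (%t. AX t (Xn n t - X t))) <= LI a b (%t. abs(AX t (Xn n t - X t)))"
  using i by (intro always_eventually allI) (simp add: LI_abs_le)
 ultimately show ?thesis by (rule Lim_null_comparison[rotated])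
qed

lemma force_integrable: "intg a b (%t. inner (fn n t) (xn n t))" "intg a b (%t. inner (fn n t) (x t))"
proof -
 have K0: "AE t in leb a b. norm (fn n t) <= abs(K)" using fK[of n] by eventually_elim simp
 show "intg a b (%t. inner (fn n t) (xn n t))"
 proof (rule intg_bounded)
  show "(%t. inner (fn n t) (xn n t)) : meas a b" by (rule inner_measurable[OF fm xm'])
  show "AE t in leb a b. abs(inner (fn n t) (xn n t)) <= abs(K)*C0"
   using K0 AE_space by eventually_elim (intro order_trans[OF Cauchy_Schwarz_ineq2] mult_mono xb', auto)
 qed
 show "intg a b (%t. inner (fn n t) (x t))"
 proof (rule intg_bounded)
  show "(%t. inner (fn n t) (x t)) : meas a b" by (rule inner_measurable[OF fm x_measurable])
  show "AE t in leb a b. abs(inner (fn n t) (x t)) <= abs(K)*C0"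
   using K0 AE_space by eventually_elim (intro order_trans[OF Cauchy_Schwarz_ineq2] mult_mono x_bound, auto)
 qed
qed

lemma force_limit: "(%n. LI a b (%t. inner (fn n t) (xn n t)) - LI a b (%t. inner (fn n t) (x t))) ----> 0"
proof (rule Lim_null_comparison)
 show "(%n. abs(K)*LI a b (%t. norm (xn n t - x t))) ----> 0" using tendsto_mult_right_zero[OF strong_L1_limit(2)] .
 have "abs(LI a b (%t. inner (fn n t) (xn n t) - inner (fn n t) (x t))) <= LI a b (%t. abs(K)*norm (xn n t - x t))" for n
 proof (rule LI_abs_le)
  show "AE t in leb a b. abs(inner (fn n t) (xn n t) - inner (fn n t) (x t)) <= abs(K)*norm (xn n t - x t)"
   using fK[of n] unfolding inner_diff_right[symmetric]
   by eventually_elim (intro order_trans[OF Cauchy_Schwarz_ineq2] mult_right_mono, auto)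
 qed (use force_integrable strong_L1_limit in auto)
 thus "EVN n. norm (LI a b (%t. inner (fn n t) (xn n t)) - LI a b (%t. inner (fn n t) (x t)))
   <= abs(K)*LI a b (%t. norm (xn n t - x t))" using force_integrable by (intro always_eventually) simp
qed

abbreviation "defect == %n t. (AXn n t - AX t) (Xn n t - X t)"

lemma defect_integrable: "intg a b (defect n)" by (rule pair_intg[OF Dfun_diff[OF AXn_Dfun AX_Dfun] difference_bound(1)])

lemma defect_nonneg: "AE t in leb a b. 0 <= defect n t" using A_monotone_on[OF ab'(1,3)] by eventually_elim (rule monotone_opD(1))

text \<open>The integrated form of Minty's argument. The diagonal term of the \<open>Xn n\<close> is
  bounded above by the energy inequality, the mixed term is rewritten through \<open>G n\<close> and
  has the limit given by \<open>energy_limit\<close>, and the two balance up to the terminal square,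
  which is weakly lower semicontinuous.\<close>

lemma defect_limit: "(%n. LI a b (defect n)) ----> 0"
proof (rule tendstoI)
 fix e :: real assume e: "0 < e"
 define et where "et = e/8"
 have et: "0 < et" using e by (simp add: et_def)
 \<comment> \<open>The mixed term \<open>AXn n t (X t)\<close> is replaced by
   \<open>inner (fn n t) (x t) - G n t (X t)\<close>, the form to which the cross energy identity
   applies.\<close>
 have eq: "LI a b (defect n) = LI a b (%t. AXn n t (Xn n t)) - LI a b (%t. inner (fn n t) (x t))
   + LI a b (%t. G n t (X t)) - LI a b (%t. AX t (Xn n t - X t))" for n
 proof -
  have i: "intg a b (%t. AXn n t (Xn n t))" "intg a b (%t. G n t (X t))" "intg a b (%t. AX t (Xn n t - X t))"
   by (intro pair_intg AXn_Dfun AX_Dfun G_Dfun Xn X' difference_bound)+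
  have "LI a b (defect n) = LI a b (%t. AXn n t (Xn n t) - inner (fn n t) (x t)
   + G n t (X t) - AX t (Xn n t - X t))"
  proof (rule integral_cong_AE)
   show "AE t in leb a b. defect n t = AXn n t (Xn n t) - inner (fn n t) (x t)
    + G n t (X t) - AX t (Xn n t - X t)" using xX' by eventually_elim (simp add: bl_diff_left bl_diff_right)
  qed (use i force_integrable defect_integrable in "auto intro!: meas_intg")
  thus ?thesis using i force_integrable[of n] by simp
 qed
 have l: "EVN n. abs(2*LI a b (%t. G n t (X t)) - (nsq (x b) - nsq (x a))) < et"
  using tendstoD[OF energy_limit[of a b] et] ab' by (simp add: dist_real_def)
 have l2: "EVN n. abs(LI a b (%t. AX t (Xn n t - X t))) < et" using tendstoD[OF pairing_limit et] by simp
 have l3: "EVN n. abs(LI a b (%t. inner (fn n t) (xn n t)) - LI a b (%t. inner (fn n t) (x t))) < et"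
  using tendstoD[OF force_limit et] by simp
 have l4: "EVN n. abs(nsq (xn n a) - nsq (x a)) < et"
  using tendstoD[OF tendsto_power[OF tendsto_norm[OF init], of 2] et] by (simp add: dist_real_def)
 have l5: "EVN n. 2*LI a b (%t. AXn n t (Xn n t)) <=
    nsq (xn n a) - nsq (xn n b) + 2*LI a b (%t. inner (fn n t) (xn n t)) + et"
  using energy[OF et] by (simp add: eventually_sequentially)
 have "(%n. 2*inner (x b) (xn n b)) ----> 2*inner (x b) (x b)" using weak'[of b "x b"] ab' by (intro tendsto_mult tendsto_const) auto
 from tendstoD[OF this et] have "EVN n. abs(2*inner (x b) (xn n b) - 2*inner (x b) (x b)) < et" by (simp add: dist_real_def)
 \<comment> \<open>Weak lower semicontinuity of the norm at the terminal time: strong convergence of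
   \<open>xn n b\<close> is not yet known.\<close>
 hence l6: "EVN n. nsq (x b) <= nsq (xn n b) + et"
 proof eventually_elim
  case (elim n)
  have "0 <= inner (xn n b - x b) (xn n b - x b)" by simp
  hence "2*inner (x b) (xn n b) - inner (x b) (x b) <= nsq (xn n b)"
   by (simp add: power2_norm_eq_inner inner_diff_left inner_diff_right inner_commute)
  thus ?case using elim by (simp add: power2_norm_eq_inner)
 qed
 from l l2 l3 l4 l5 l6 show "EVN n. dist (LI a b (defect n)) 0 < e"
 proof eventually_elim
  case (elim n)
  have "0 <= LI a b (defect n)" by (rule integral_nonneg_AE[OF defect_nonneg])
  moreover have "LI a b (defect n) < e" using elim eq[of n] et_def et unfolding abs_less_iff by linarith
  ultimately show ?case by simp
 qed
qed

text \<open>The defect is nonnegative, so its integrals control its \<open>L^1\<close> norm and a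
  subsequence tends to zero almost everywhere. Pointwise convergence of the operator values follows
  by \<open>monotone_op_converges\<close>, and \<open>weak_product_limit\<close> with exchanged
  exponents gives convergence of the integrals.\<close>

theorem operator_limit: obtains r :: "nat => nat" where "strict_mono r"
  "!!s t v. a <= s ==> s <= t ==> t <= b ==> (%n. LI s t (%r'. AXn (r n) r' v)) ----> LI s t (%r'. AX r' v)"
proof -
 have "(%n. LI a b (%t. norm (defect n t))) ----> 0"
 proof -
  have "LI a b (%t. norm (defect n t)) = LI a b (defect n)" for n
  proof (rule integral_cong_AE)
   show "AE t in leb a b. norm (defect n t) = defect n t" using defect_nonneg[of n] by eventually_elim simp
  qed (use meas_intg[OF defect_integrable] in auto)
  thus ?thesis using defect_limit by simp
 qed
 then obtain r :: "nat => nat" where r: "strict_mono r" "AE t in leb a b. (%n. defect (r n) t) ----> 0"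
  using tendsto_L1_AE_subseq[of "leb a b" defect] defect_integrable by auto
 have ae: "AE t in leb a b. ALL v. (%n. AXn (r n) t v) ----> AX t v" using r(2) weakly_null_AE A_monotone_on[OF ab'(1,3)]
 proof eventually_elim
  case (elim t)
  have "(%n. inner h (j (Xn (r n) t))) ----> inner h (j (X t))" for h
  proof -
   have "(%n. inner h (j (Xn n t - X t)) + inner h (j (X t))) ----> 0 + inner h (j (X t))"
    using elim(2) by (intro tendsto_add tendsto_const) blast
   hence "(%n. inner h (j (Xn n t))) ----> inner h (j (X t))" by (simp add: bl_diff_right inner_diff_right)
   thus ?thesis using LIMSEQ_subseq_LIMSEQ[OF _ r(1)] by (simp add: comp_def)
  qed
  thus ?case using monotone_op_converges[OF elim(3) a1_nonneg c1 c2, of "%n. Xn (r n) t" "X t"] elim(1) by blast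
 qed
 show ?thesis
 proof (rule that[OF r(1)])
  fix s t v assume st: "a <= s" "s <= t" "t <= b"
  define S where "S n ta = (AXn (r n) ta - AX ta) v" for n ta
  have D: "Dfun a b (%t. AXn (r n) t - AX t)" for n by (rule Dfun_diff[OF AXn_Dfun AX_Dfun])
  have Db: "LI a b (%t. norm (AXn (r n) t - AX t) powr q) <= 2 powr q*(CA*(1 + CX) + LI a b (%t. norm (AX t) powr q))" for n
   by (intro order_trans[OF LI_Dfun_diff_le[OF AXn_Dfun AX_Dfun]] mult_left_mono add_right_mono AXn_bound) simp
  have Si: "intg a b (S n)" for n unfolding S_def by (rule Dfun_apply[OF D])
  have le: "AE t in leb a b. abs(S n t) <= norm v * norm (AXn (r n) t - AX t)" for n
   using norm_blinfun[of "AXn (r n) _ - AX _" v] by (intro AE_I2) (simp add: S_def mult.commute)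
  have ra: "AE t in leb a b. (%n. S n t/(1 + norm (AXn (r n) t - AX t))) ----> 0" using ae
  proof eventually_elim
   case (elim t)
   have "(%n. S n t) ----> AX t v - AX t v" unfolding S_def bl_diff_left using elim by (intro tendsto_diff tendsto_const) blast
   hence "(%n. norm (S n t)) ----> 0" by (intro tendsto_norm_zero) simp
   thus ?case
   proof (rule Lim_null_comparison[rotated], intro always_eventually allI)
    fix n
    have "abs(S n t)/(1 + norm (AXn (r n) t - AX t)) <= abs(S n t)/1" by (intro divide_left_mono) (auto simp: add_pos_nonneg)
    thus "norm (S n t/(1 + norm (AXn (r n) t - AX t))) <= norm (S n t)" by (simp add: abs_of_nonneg)
   qed
  qed
  have lim: "(%n. LI a b (%t. abs(S n t))) ----> 0"
   by (rule weak_product_limit(2)[OF q1 p1 qp finite_measure_interval _ _ _ Dfun_norm_measurable[OF D] norm_ge_zero Dfun_intg[OF D] Db meas_intg[OF Si] le ra]) auto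
  have "(%n. LI s t (%ta. AXn (r n) ta v) - LI s t (%ta. AX ta v)) ----> 0"
  proof (rule Lim_null_comparison[OF _ lim], intro always_eventually allI)
   fix n
   have i: "intg s t (S n)" "intg s t (%ta. AXn (r n) ta v)" "intg s t (%ta. AX ta v)"
    by (rule intg_sub[OF _ st(1,3)], rule Si Dfun_apply[OF AXn_Dfun] Dfun_apply[OF AX_Dfun])+
   have "LI s t (%ta. AXn (r n) ta v) - LI s t (%ta. AX ta v) = LI s t (S n)" using i by (simp add: S_def[abs_def] bl_diff_left)
   also have "norm ... <= LI s t (%ta. abs(S n ta))" using i by (simp add: LI_abs_le)
   also have "... <= LI a b (%ta. abs(S n ta))" using Si st by (intro LI_mono_subset) auto
   finally show "norm (LI s t (%ta. AXn (r n) ta v) - LI s t (%ta. AX ta v)) <= LI a b (%ta. abs(S n ta))" .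
  qed
  thus "(%n. LI s t (%r'. AXn (r n) r' v)) ----> LI s t (%r'. AX r' v)" by (simp add: LIM_zero_cancel)
 qed
qed

theorem limit_equation:
 assumes f: "!!s t v. a <= s ==> s <= t ==> t <= b ==> (%n. LI s t (%r. inner (fn n r) (j v))) ----> Ph s t v"
  and st: "a <= s" "s <= t" "t <= b" shows "inner (x t - x s) (j v) = Ph s t v - LI s t (%r. AX r v)"
proof -
 obtain r :: "nat => nat" where r: "strict_mono r"
  "!!s t v. a <= s ==> s <= t ==> t <= b ==> (%n. LI s t (%r'. AXn (r n) r' v)) ----> LI s t (%r'. AX r' v)"
  by (rule operator_limit) blast
 define D where "D n = inner (xn n t - xn n s) (j v) - LI s t (%r. G n r v)" for n
 have "D ----> 0"
 proof (rule LIMSEQ_I)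
  fix e :: real assume e: "0 < e"
  define et where "et = e/(2*(norm v + 1))"
  have v1: "0 < norm v + 1" by (simp add: add_nonneg_pos)
  hence et: "0 < et" using e by (simp add: et_def)
  have "et*norm v <= et*(norm v + 1)" using et by simp
  also have "... = e/2" using v1 unfolding et_def by (metis divide_divide_eq_left mult.commute nonzero_eq_divide_eq order_less_irrefl)
  finally have etv: "et*norm v < e" using e by simp
  obtain n0 where "ALL n>=n0. abs(D n) <= et*norm v" using app'[OF et] st unfolding D_def by blast
  thus "EX no. ALL n>=no. norm (D n - 0) < e" using etv by (metis diff_zero le_less_trans real_norm_def)
 qed
 hence D: "(%n. D (r n)) ----> 0" using LIMSEQ_subseq_LIMSEQ[OF _ r(1)] by (simp add: comp_def)
 have eq: "inner (xn n t - xn n s) (j v) = D n + (LI s t (%r. inner (fn n r) (j v)) - LI s t (%r'. AXn n r' v))" for n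
 proof -
  have "intg s t (%r. to_dual j (fn n r) v)" "intg s t (%r'. AXn n r' v)"
   using Dfun_apply[OF Dfun_subinterval[OF to_dual_Dfun(1)[OF fm fK] st(1,3)]] Dfun_apply[OF Dfun_subinterval[OF AXn_Dfun st(1,3)]] by auto
  thus ?thesis by (simp add: D_def bl_diff_left)
 qed
 have "(%n. inner (xn (r n) t - xn (r n) s) (j v)) ----> 0 + (Ph s t v - LI s t (%r'. AX r' v))"
  unfolding eq using LIMSEQ_subseq_LIMSEQ[OF f[OF st] r(1)] st by (intro tendsto_add tendsto_diff D r) (auto simp: comp_def)
 moreover have "(%n. inner (xn (r n) t - xn (r n) s) (j v)) ----> inner (x t - x s) (j v)"
  unfolding inner_diff_left using LIMSEQ_subseq_LIMSEQ[OF weak'[of t "j v"] r(1)] LIMSEQ_subseq_LIMSEQ[OF weak'[of s "j v"] r(1)] st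
  by (intro tendsto_diff) (auto simp: comp_def inner_commute)
 ultimately show ?thesis using LIMSEQ_unique by fastforce
qed

end

section \<open>Weak compactness of bounded sequences of paths\<close>

lemma diagonal_subsequence:
 fixes f :: "nat => nat => real" assumes M: "!!n i. abs(f n i) <= M"
 obtains r :: "nat => nat" where "strict_mono r" "!!i. convergent (%n. f (r n) i)"
proof -
 \<comment> \<open>A countable product of compact intervals is compact and therefore sequentially
   compact, which chooses all coordinates at once.\<close>
 have "compactin (product_topology (%_. euclidean) UNIV) (PiE UNIV (%_::nat. {- M..M}))" by (simp add: compactin_PiE)
 hence "compact (PiE UNIV (%_::nat. {- M..M}))" by (simp add: euclidean_product_topology)
 hence "seq_compact (PiE UNIV (%_::nat. {- M..M}))" by (simp add: compact_imp_seq_compact)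
 moreover have "ALL n. f n : PiE UNIV (%_. {- M..M})" using M by (auto simp: abs_le_iff minus_le_iff)
 ultimately obtain l r where r: "strict_mono r" "(f \<circ> r) ----> l" by (auto elim!: seq_compactE)
 have "(%n. f (r n) i) ----> l i" for i
 proof -
  have "continuous_on UNIV (%x::nat => real. x i)" by simp
  hence "isCont (%x::nat => real. x i) l" by (simp only: continuous_on_eq_continuous_at[OF open_UNIV] ball_UNIV)
  from isCont_tendsto_compose[OF this r(2)] show ?thesis by (simp add: comp_def)
 qed
 thus ?thesis using that[OF r(1)] by (auto simp: convergent_def)
qed

context evolution_triple
begin

text \<open>Convergence is arranged at rational times against a countable dense subset of
  \<open>V\<close>. Equicontinuity carries it to all times, density of \<open>V\<close> and the
  common bound to all vectors of \<open>H\<close>.\<close>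

lemma weak_subsequence:
 fixes xn :: "nat => real => 'b" assumes ab: "a < b" and xb: "!!n t. t : {a..b} ==> norm (xn n t) <= C0"
  and equi: "!!e. 0 < e ==> EX de>0. EX n0. ALL n>=n0. ALL s t v. s : {a..b} --> t : {a..b} --> abs(t - s) < de -->
   abs(inner (xn n t - xn n s) (j v)) <= e*norm v" obtains r :: "nat => nat" and x where "strict_mono r"
  "!!t h. t : {a..b} ==> (%n. inner h (xn (r n) t)) ----> inner h (x t)"
proof -
 obtain D :: "'a set" where D: "countable D" "closure D = UNIV" by (rule countable_dense_V)
 define Q where "Q = (\<rat> Int {a..b}) \<times> D"
 have cQ: "countable Q" unfolding Q_def using D countable_rat by (intro countable_SIGMA) auto
 have "D ~= {}" using D(2) by auto
 moreover have "\<rat> Int {a..b} ~= {}" using Rats_dense_in_real[OF ab] by fastforce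
 ultimately have Qne: "Q ~= {}" by (simp add: Q_def)
 \<comment> \<open>Normalised such that all coordinates share the bound \<open>C0\<close>.\<close>
 define g where "g n z = inner (xn n (fst z)) (j (snd z))/(1 + norm (j (snd z)))" for n z
 have C0: "0 <= C0" using order_trans[OF norm_ge_zero xb[of a 0]] ab by simp
 have "abs(g n z) <= C0" if "z : Q" for n z
 proof -
  have "abs(inner (xn n (fst z)) (j (snd z))) <= C0*norm (j (snd z))"
   using xb[of "fst z" n] that by (intro order_trans[OF Cauchy_Schwarz_ineq2] mult_right_mono) (auto simp: Q_def)
  also have "... <= C0*(1 + norm (j (snd z)))" using C0 by (intro mult_left_mono) auto
  finally show ?thesis unfolding g_def by (simp add: abs_divide pos_divide_le_eq add_pos_nonneg)
 qed
 hence "abs(g n (from_nat_into Q i)) <= C0" for n i using from_nat_into[OF Qne] by blast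
 then obtain r :: "nat => nat" where r: "strict_mono r" "!!i. convergent (%n. g (r n) (from_nat_into Q i))"
  using diagonal_subsequence[of "%n i. g n (from_nat_into Q i)"] by blast
 have conv: "convergent (%n. inner (xn (r n) t) (j v))" if "t : \<rat> Int {a..b}" "v : D" for t v
 proof -
  have "(t, v) : Q" using that by (simp add: Q_def)
  then obtain i where i: "from_nat_into Q i = (t, v)" using from_nat_into_surj[OF cQ] by blast
  have nz: "1 + norm (j v) ~= 0" using norm_ge_zero[of "j v"] by linarith
  obtain l where "(%n. g (r n) (t, v)) ----> l" using r(2)[of i] unfolding i convergent_def by blast
  hence "(%n. g (r n) (t, v)*(1 + norm (j v))) ----> l*(1 + norm (j v))" by (rule tendsto_mult_right)
  hence "convergent (%n. g (r n) (t, v)*(1 + norm (j v)))" by (rule convergentI)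
  thus ?thesis using nz by (simp add: g_def)
 qed
 have conv2: "convergent (%n. inner (xn (r n) t) (j v))" if t: "t : {a..b}" and v: "v : D" for t v
  unfolding Cauchy_convergent_iff[symmetric]
 proof (rule CauchyI)
  fix e :: real assume e: "0 < e"
  define e' where "e' = e/(4*(norm v + 1))"
  have v1: "0 < norm v + 1" by (simp add: add_nonneg_pos)
  have e': "0 < e'" using e v1 by (simp add: e'_def)
  have "e'*norm v <= e'*(norm v + 1)" using e' by simp
  also have "... = e/4" using v1 unfolding e'_def by (metis divide_divide_eq_left mult.commute nonzero_eq_divide_eq order_less_irrefl)
  finally have e'a: "e'*norm v <= e/4" .
  obtain de n0 where de: "0 < de" "!!n s t v. n0 <= n ==> s : {a..b} ==> t : {a..b} ==> abs(t - s) < de ==>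
   abs(inner (xn n t - xn n s) (j v)) <= e'*norm v" using equi[OF e'] by blast
  have "max a (t - de) < min b (t + de)" using de(1) t ab by auto
  then obtain s where s: "s : \<rat>" "max a (t - de) < s" "s < min b (t + de)" using Rats_dense_in_real by blast
  hence sQ: "s : \<rat> Int {a..b}" "abs(t - s) < de" by auto
  have "Cauchy (%n. inner (xn (r n) s) (j v))" using conv[OF sQ(1) v] by (rule convergent_Cauchy)
  then obtain M where M: "!!m n. M <= m ==> M <= n ==> norm (inner (xn (r m) s) (j v) - inner (xn (r n) s) (j v)) < e/4"
   using CauchyD[of _ "e/4"] e by fastforce
  show "EX M. ALL m>=M. ALL n>=M. norm (inner (xn (r m) t) (j v) - inner (xn (r n) t) (j v)) < e"
  proof (intro exI[of _ "max M n0"] allI impI)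
   fix m n assume mn: "max M n0 <= m" "max M n0 <= n"
   have "n0 <= r m" "n0 <= r n" using mn seq_suble[OF r(1), of m] seq_suble[OF r(1), of n] by linarith+
   hence "abs(inner (xn (r m) t - xn (r m) s) (j v)) <= e/4" "abs(inner (xn (r n) t - xn (r n) s) (j v)) <= e/4"
    using de(2)[of _ s t v] sQ t e'a by (meson IntD2 order_trans)+
   thus "norm (inner (xn (r m) t) (j v) - inner (xn (r n) t) (j v)) < e"
    using M[of m n] mn e unfolding inner_diff_left real_norm_def by linarith
  qed
 qed
 have dense: "closure (j ` D) = UNIV"
 proof -
  have "j ` closure D <= closure (j ` D)"
   by (rule image_closure_subset) (auto intro!: continuous_intros closure_subset[THEN subsetD])
  hence "range j <= closure (j ` D)" using D by simp
  hence "closure (range j) <= closure (j ` D)" by (simp add: closure_minimal)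
  thus ?thesis using dense_j by auto
 qed
 have "EX w. ALL h. (%n. inner h (xn (r n) t)) ----> inner h w" if t: "t : {a..b}" for t
 proof -
  have "convergent (%n. inner d (xn (r n) t))" if "d : j ` D" for d using that conv2[OF t] by (auto simp: inner_commute)
  then obtain w where "!!h. (%n. inner h (xn (r n) t)) ----> inner h w"
   using weak_limit_exists[of "%n. xn (r n) t", OF xb[OF t] dense] by blast
  thus ?thesis by blast
 qed
 then obtain x where "ALL t. t : {a..b} --> (ALL h. (%n. inner h (xn (r n) t)) ----> inner h (x t))" by metis
 thus ?thesis using that[OF r(1)] by blast
qed

end

context evolution_exponents
begin

lemma equicontinuity:
 fixes xn :: "nat => real => 'b" assumes G: "!!n. Dfun a b (G n)" and Gb: "!!n. LI a b (%t. norm (G n t) powr q) <= Cq"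
  and app: "!!et. 0 < et ==> increments j a b xn G et" and e: "0 < e"
 shows "EX de>0. EX n0. ALL n>=n0. ALL s t v. s : {a..b} --> t : {a..b} --> abs(t - s) < de -->
   abs(inner (xn n t - xn n s) (j v)) <= e*norm v"
proof -
 have Cq: "0 <= Cq" by (rule order_trans[OF integral_nonneg_AE Gb[of 0]]) auto
 define th where "th = e/(4*(Cq + 1))"
 have th: "0 < th" "th*Cq <= e/4" using e Cq by (auto simp: th_def field_simps)
 obtain D where D: "0 <= D" "!!x y. 0 <= x ==> 0 <= y ==> x*y <= th*x powr q + D*y powr p" using Young[OF th(1)] by blast
 define de where "de = e/(4*(D + 1))"
 have de: "0 < de" "D*de <= e/4" using e D by (auto simp: de_def field_simps)
 obtain n0 where n0: "!!n s t v. n0 <= n ==> a <= s ==> s <= t ==> t <= b ==>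
   abs(inner (xn n t - xn n s) (j v) - LI s t (%r. G n r v)) <= e/2*norm v" using app[OF half_gt_zero[OF e]] by blast
 have main: "abs(inner (xn n t - xn n s) (j v)) <= e*norm v"
  if "n0 <= n" and st: "a <= s" "s <= t" "t <= b" "t - s < de" for n s t v
 proof -
  have "LI s t (%r. norm (G n r)*1) <= th*Cq + D*LI s t (%r. 1 powr p)" using D th st by (intro LI_Dfun_le[OF G Gb]) auto
  also have "D*LI s t (%r. 1 powr p) <= D*de" using st D by (intro mult_left_mono) (auto simp: LI_const)
  finally have N: "LI s t (%r. norm (G n r)) <= e/2" using th de by simp
  have Gs: "Dfun s t (G n)" by (rule Dfun_subinterval[OF G st(1,3)])
  have "abs(LI s t (%r. G n r v)) <= LI s t (%r. norm (G n r)*norm v)"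
   using norm_blinfun[of "G n _"] Dfun_apply[OF Gs] Dfun_norm_intg(1)[OF Gs Vfun_const[of _ _ v]] by (intro LI_abs_le AE_I2) auto
  also have "... = LI s t (%r. norm (G n r))*norm v" by simp
  also have "... <= e/2*norm v" by (intro mult_right_mono N) simp
  finally show ?thesis using n0[OF that(1) st(1-3), of v] by linarith
 qed
 have "abs(inner (xn n t - xn n s) (j v)) <= e*norm v"
  if "n0 <= n" and st: "s : {a..b}" "t : {a..b}" "abs(t - s) < de" for n s t v
 proof (cases "s <= t")
  case True
  thus ?thesis using main[OF that(1)] st by auto
 next
  case False
  hence "abs(inner (xn n s - xn n t) (j v)) <= e*norm v" using main[OF that(1), of t s v] st by auto
  thus ?thesis by (simp add: inner_diff_left abs_minus_commute)
 qed
 thus ?thesis using de(1) by blast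
qed

text \<open>Any number above the lower limit bounds the \<open>p\<close>-th powers along a
  subsequence, and weak closedness of balls puts the limit into the corresponding ball of
  \<open>V\<close>.\<close>

lemma weak_limit_pointwise: assumes w: "!!h. (%n. inner h (j (u n))) ----> inner h z"
  and fin: "liminf (%n. ennreal (norm (u n) powr p)) < \<infinity>"
 shows "z : range j" and "ennreal (norm (in_V j z) powr p) <= liminf (%n. ennreal (norm (u n) powr p))"
proof -
 have key: "EX v. j v = z & norm v powr p <= c" if c: "liminf (%n. ennreal (norm (u n) powr p)) < ennreal c" for c
 proof -
  have c0: "0 < c" using c by (metis ennreal_neg not_less not_less_zero)
  have "\<exists>\<^sub>F n in sequentially. ennreal (norm (u n) powr p) < ennreal c"
  proof (rule ccontr)
   assume "~ ?thesis"
   hence "EVN n. ennreal c <= ennreal (norm (u n) powr p)" by (simp add: not_frequently not_less)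
   hence "ennreal c <= liminf (%n. ennreal (norm (u n) powr p))" by (rule Liminf_bounded)
   thus False using c by simp
  qed
  hence "infinite {n. ennreal (norm (u n) powr p) < ennreal c}"
   by (simp add: frequently_cofinite cofinite_eq_sequentially[symmetric])
  from infinite_enumerate[OF this] obtain r :: "nat => nat" where r: "strict_mono r"
   "ALL n. r n : {n. ennreal (norm (u n) powr p) < ennreal c}" by blast
  hence "ennreal (norm (u (r n)) powr p) < ennreal c" for n by blast
  hence lt: "norm (u (r n)) powr p <= c" for n using c0 by (simp add: ennreal_less_iff less_imp_le)
  define R where "R = c powr (1/p)"
  have "norm (u (r n)) <= R" for n
  proof -
   have "(norm (u (r n)) powr p) powr (1/p) <= R" unfolding R_def using lt p0 by (intro powr_mono2) auto
   thus ?thesis using p0 by (simp add: powr_powr)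
  qed
  moreover have "(%n. inner h (j (u (r n)))) ----> inner h z" for h using LIMSEQ_subseq_LIMSEQ[OF w r(1)] by (simp add: comp_def)
  ultimately obtain v where v: "j v = z" "norm v <= R" using bounded_weak_limit_in_range[of "%n. u (r n)" R z] by blast
  have "norm v powr p <= R powr p" using v p0 by (intro powr_mono2) auto
  also have "... = c" using p0 c0 by (simp add: R_def powr_powr)
  finally show ?thesis using v by blast
 qed
 obtain c0 where c0: "0 <= c0" "liminf (%n. ennreal (norm (u n) powr p)) = ennreal c0"
 proof (cases "liminf (%n. ennreal (norm (u n) powr p))" rule: ennreal_cases)
  case (real c)
  thus ?thesis by (rule that)
 next
  case top
  thus ?thesis using fin by (simp only: infinity_ennreal_def less_irrefl)
 qed
 have "liminf (%n. ennreal (norm (u n) powr p)) < ennreal (c0 + 1)" unfolding c0(2) using c0(1) by (simp add: ennreal_less_iff)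
 thus "z : range j" using key by blast
 show "ennreal (norm (in_V j z) powr p) <= liminf (%n. ennreal (norm (u n) powr p))"
 proof (rule dense_ge)
  fix c assume c: "liminf (%n. ennreal (norm (u n) powr p)) < c"
  show "ennreal (norm (in_V j z) powr p) <= c"
  proof (cases c)
   case (real r)
   have "liminf (%n. ennreal (norm (u n) powr p)) < ennreal r" using c unfolding real(2) .
   then obtain v where "j v = z" "norm v powr p <= r" using key by blast
   thus ?thesis unfolding real(2) by (auto simp: ennreal_leI)
  qed simp
 qed
qed

text \<open>Fatou's lemma makes the lower limit of the \<open>V\<close>-norms finite almost
  everywhere and integrable, so that the limit path has values in \<open>V\<close>. Measurability of
  its \<open>V\<close>-valued version comes from closedness of the images of balls.\<close>

lemma weak_limit_Vfun:
 fixes x :: "real => 'b" assumes Xn: "!!n. Vfun a b (Xn n)" and XnC: "!!n. LI a b (%t. norm (Xn n t) powr p) <= CX"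
  and xnX: "!!n. AE t in leb a b. xn n t = j (Xn n t)" and xm: "!!h. (%t. inner h (x t)) : meas a b"
  and weak: "!!t h. t : {a..b} ==> (%n. inner h (xn n t)) ----> inner h (x t)"
 obtains X where "Vfun a b X" "AE t in leb a b. x t = j (X t)" "LI a b (%t. norm (X t) powr p) <= CX"
proof -
 \<comment> \<open>The default 0 occurs only on a null set, but it has to be accounted for in the
   measurability proof.\<close>
 define X where "X t = (if x t : range j then in_V j (x t) else 0)" for t
 let ?M = "leb a b"
 have sx: "strongly_measurable {a..b} x" by (rule strongly_measurable_H[OF xm])
 have dist_m: "(%t. infdist (x t) K) : borel_measurable ?M" for K
  by (rule strongly_measurable_imp_borel[OF strongly_measurable_compose[OF sx]]) (auto intro!: continuous_intros)
 have mem: "{t : space ?M. x t : K} : sets ?M" if "closed K" "K ~= {}" for K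
 proof -
  have "{t : space ?M. x t : K} = {t : space ?M. infdist (x t) K = 0}" using in_closed_iff_infdist_zero[OF that] by simp
  also have "... = (%t. infdist (x t) K) -` {0} Int space ?M" by auto
  finally show ?thesis using measurable_sets[OF dist_m, of "{0}"] by (simp only:) simp
 qed
 have range: "{t : space ?M. x t : range j} : sets ?M"
 proof -
  have "range j = (\<Union>n::nat. j ` cball 0 (real n))" using real_arch_simple by (fastforce simp: image_iff)
  hence "{t : space ?M. x t : range j} = (\<Union>n::nat. {t : space ?M. x t : j ` cball 0 (real n)})" by auto
  also have "... : sets ?M"
  proof (rule sets.countable_UN)
   have "{t : space ?M. x t : j ` cball 0 (real n)} : sets ?M" for n by (rule mem[OF closed_j_cball]) simp
   thus "range (%n. {t : space ?M. x t : j ` cball 0 (real n)}) <= sets ?M" by blast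
  qed
  finally show ?thesis .
 qed
 have norm_m: "(%t. norm (X t - d)) : borel_measurable ?M" for d unfolding borel_measurable_iff_le
 proof
  fix r :: real
  \<comment> \<open>Distances in \<open>V\<close> are read off from \<open>x t\<close> in
    \<open>H\<close>: balls of \<open>V\<close> are closed there, and outside of the range the
    default 0 is compared with \<open>d\<close>.\<close>
  have iff: "norm (X t - d) <= r <-> x t : j ` cball d r | x t ~: range j & norm d <= r" for t
  proof (cases "x t : range j")
   case True
   then obtain v where v: "x t = j v" by blast
   thus ?thesis by (auto simp: X_def dist_norm norm_minus_commute j_eq_iff image_iff)
  next
   case False
   thus ?thesis by (auto simp: X_def)
  qed
  show "{t : space ?M. norm (X t - d) <= r} : sets ?M"
  proof (cases "0 <= r")
   case True
   have 1: "{t : space ?M. x t : j ` cball d r} : sets ?M" using True by (intro mem closed_j_cball) auto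
   have 2: "{t : space ?M. x t ~: range j & norm d <= r} : sets ?M"
   proof (cases "norm d <= r")
    case True
    hence "{t : space ?M. x t ~: range j & norm d <= r} = space ?M - {t : space ?M. x t : range j}" by blast
    thus ?thesis using sets.compl_sets[OF range] by (simp only:)
   next
    case False
    hence "{t : space ?M. x t ~: range j & norm d <= r} = {}" by blast
    thus ?thesis by (simp only: sets.empty_sets)
   qed
   have "{t : space ?M. norm (X t - d) <= r} = {t : space ?M. x t : j ` cball d r} Un
    {t : space ?M. x t ~: range j & norm d <= r}" unfolding iff by blast
   thus ?thesis using sets.Un[OF 1 2] by (simp only:)
  next
   case False
   have "~ norm (X t - d) <= r" for t using norm_ge_zero[of "X t - d"] False by linarith
   hence "{t : space ?M. norm (X t - d) <= r} = {}" by blast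
   thus ?thesis by (simp only: sets.empty_sets)
  qed
 qed
 obtain D :: "'a set" where D: "countable D" "closure D = UNIV" by (rule countable_dense_V)
 have Xm: "X : borel_measurable ?M" by (rule strongly_measurable_imp_borel[OF strongly_measurableI[OF D norm_m]]) simp
 define g where "g n t = ennreal (norm (Xn n t) powr p)" for n t
 have gm: "g n : borel_measurable ?M" for n unfolding g_def using Vfun_measurable[OF Xn[of n]] by simp
 have gi: "integral\<^sup>N ?M (g n) <= ennreal CX" for n
  unfolding g_def using nn_integral_eq_integral[OF Vfun_intg[OF Xn[of n]]] XnC[of n] by (simp add: ennreal_leI)
 have fatou: "(\<integral>\<^sup>+ t. liminf (%n. g n t) \<partial>?M) <= ennreal CX"
 proof (rule order_trans[OF nn_integral_liminf[OF gm]])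
  have "liminf (%n. integral\<^sup>N ?M (g n)) <= liminf (%_. ennreal CX)"
   by (rule Liminf_mono[OF always_eventually]) (use gi in blast)
  thus "liminf (%n. integral\<^sup>N ?M (g n)) <= ennreal CX" by (simp add: Liminf_const)
 qed
 hence "AE t in ?M. liminf (%n. g n t) ~= \<infinity>" using gm by (intro nn_integral_PInf_AE) (auto simp: top_unique)
 moreover have "AE t in ?M. ALL n. xn n t = j (Xn n t)" using xnX by (simp add: AE_all_countable)
 ultimately have ae: "AE t in ?M. x t = j (X t) & ennreal (norm (X t) powr p) <= liminf (%n. g n t)" using AE_space
 proof eventually_elim
  case (elim t)
  have w: "(%n. inner h (j (Xn n t))) ----> inner h (x t)" for h using weak[of t h] elim(2,3) by simp
  have fin: "liminf (%n. ennreal (norm (Xn n t) powr p)) < \<infinity>" using elim(1) by (simp add: g_def less_top)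
  note wl = weak_limit_pointwise[OF w fin]
  thus ?case by (auto simp: X_def g_def)
 qed
 have "(\<integral>\<^sup>+ t. ennreal (norm (X t) powr p) \<partial>?M) <= (\<integral>\<^sup>+ t. liminf (%n. g n t) \<partial>?M)"
  by (rule nn_integral_mono_AE) (use ae in eventually_elim, blast)
 hence le: "(\<integral>\<^sup>+ t. ennreal (norm (X t) powr p) \<partial>?M) <= ennreal CX" using fatou by (rule order_trans)
 have i: "integrable ?M (%t. norm (X t) powr p)"
  by (rule integrableI_bounded) (use Xm le in "auto simp: top_unique less_top[symmetric]")
 have CX: "0 <= CX" by (rule order_trans[OF integral_nonneg_AE XnC[of 0]]) auto
 show ?thesis
 proof (rule that)
  show "Vfun a b X" using Xm i by (simp add: Vfun_def)
  show "AE t in ?M. x t = j (X t)" using ae by eventually_elim blast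
  show "LI a b (%t. norm (X t) powr p) <= CX" using le nn_integral_eq_integral[OF i] CX by (simp add: ennreal_le_iff)
 qed
qed

theorem weak_compactness:
 fixes xn :: "nat => real => 'b" assumes ab: "a < b" and xb: "!!n t. t : {a..b} ==> norm (xn n t) <= C0"
  and xm: "!!n h. (%t. inner h (xn n t)) : meas a b"
  and Xn: "!!n. Vfun a b (Xn n)" and XnC: "!!n. LI a b (%t. norm (Xn n t) powr p) <= CX"
  and xnX: "!!n. AE t in leb a b. xn n t = j (Xn n t)"
  and G: "!!n. Dfun a b (G n)" and Gb: "!!n. LI a b (%t. norm (G n t) powr q) <= Cq"
  and app: "!!et. 0 < et ==> increments j a b xn G et" obtains r :: "nat => nat" and x X where "strict_mono r"
  "!!t h. t : {a..b} ==> (%n. inner h (xn (r n) t)) ----> inner h (x t)"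
  "Vfun a b X" "AE t in leb a b. x t = j (X t)" "LI a b (%t. norm (X t) powr p) <= CX"
proof -
 obtain r :: "nat => nat" and x where r: "strict_mono r" "!!t h. t : {a..b} ==> (%n. inner h (xn (r n) t)) ----> inner h (x t)"
  using weak_subsequence[OF ab xb equicontinuity[OF G Gb app]] by blast
 have xm': "(%t. inner h (x t)) : meas a b" for h by (rule borel_measurable_LIMSEQ_real[OF _ xm[of h "r _"]]) (use r in simp)
 obtain X where "Vfun a b X" "AE t in leb a b. x t = j (X t)" "LI a b (%t. norm (X t) powr p) <= CX"
  using weak_limit_Vfun[OF Xn XnC xnX xm' r(2)] by blast
 thus ?thesis using that[OF r] by blast
qed

end

lemma (in bounded_solutions) limit_exists: assumes start: "!!n. xn n a = y0"
 obtains r :: "nat => nat" and x X where "strict_mono r" "x a = y0"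
  "approx_solutions j p q T A a1 c1 c2 a b C0 CX K (%n. xn (r n)) (%n. Xn (r n)) (%n. fn (r n)) X x"
proof -
 obtain r :: "nat => nat" and x X where r: "strict_mono r"
  and w: "!!t h. t : {a..b} ==> (%n. inner h (xn (r n) t)) ----> inner h (x t)"
  and X: "Vfun a b X" "AE t in leb a b. x t = j (X t)"
  by (rule weak_compactness[OF ab'(2) xb' xm' Xn XnC xnX G_Dfun G_bound app']) blast+
 have "inner h (x a) = inner h y0" for h using w[of a h] ab' by (simp add: start LIMSEQ_const_iff)
 hence "inner (x a - y0) (x a - y0) = 0" by (simp add: inner_diff_right)
 hence xa: "x a = y0" by simp
 have sub: "EX n0. ALL n>=n0. P (r n)" if "EX n0. ALL n>=n0. P n" for P using that by (auto intro: le_trans[OF _ seq_suble[OF r]])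
 have "approx_solutions j p q T A a1 c1 c2 a b C0 CX K (%n. xn (r n)) (%n. Xn (r n)) (%n. fn (r n)) X x"
  by unfold_locales (rule ab' Xn XnC xnX fm fK xb' xm' X w sub[OF app'] sub[OF energy], assumption? | simp add: start xa)+
 with r xa show thesis by (intro that[rotated 2])
qed

section \<open>The implicit Euler scheme\<close>

lemma to_dual_zero [simp]: "to_dual j 0 = 0" by (rule blinfun_eqI) simp

locale implicit_Euler = evolution_operator +
 fixes a b :: real and y0 :: "'b::{real_inner, complete_space}" assumes ab: "0 <= a" "a < b" "b <= T"
begin

definition mesh :: "nat => real" where "mesh n = (b - a)/real (Suc n)"

definition node :: "nat => nat => real" where "node n k = a + real k*mesh n"

text \<open>The choice is justified in \<open>step_equation\<close>, where
  \<open>elliptic_step\<close> yields a solution for every step inside the interval.\<close>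

definition Euler_step :: "nat => nat => 'b => 'a" where "Euler_step n k y = (SOME u. ALL v. inner (j u) (j v) +
  (A_integral (node n k) (node n (Suc k)) u) v = inner y (j v))"

primrec Y :: "nat => nat => 'b" where
 "Y n 0 = y0"
| "Y n (Suc k) = j (Euler_step n k (Y n k))"

text \<open>The \<open>V\<close>-valued companion of \<open>Y\<close>. The initial value
  \<open>y0\<close> need not lie in \<open>V\<close>; the entry 0 at index 0 is seen only at the
  time \<open>a\<close>.\<close>

primrec U :: "nat => nat => 'a" where
 "U n 0 = 0"
| "U n (Suc k) = Euler_step n k (Y n k)"

text \<open>The index of the right endpoint of the mesh interval that contains \<open>t\<close>:
  rounding up makes the step functions take the implicit value on the whole step and the index 0
  only at \<open>a\<close>.\<close>

definition cell :: "nat => real => nat" where "cell n t = nat \<lceil>(t - a)/mesh n\<rceil>"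

definition xn :: "nat => real => 'b" where "xn n t = Y n (cell n t)"

definition Xn :: "nat => real => 'a" where "Xn n t = U n (cell n t)"

lemma mesh_pos: "0 < mesh n" using ab by (simp add: mesh_def)

lemma node_0 [simp]: "node n 0 = a" and node_last: "node n (Suc n) = b" by (simp_all add: node_def mesh_def)

lemma node_Suc: "node n (Suc k) = node n k + mesh n" by (simp add: node_def algebra_simps)

lemma node_mono: "k <= m ==> node n k <= node n m" using mesh_pos[of n] by (simp add: node_def mult_right_mono)

lemma node_range: "k <= Suc n ==> a <= node n k & node n k <= b"
 using node_mono[of 0 k n] node_mono[of k "Suc n" n] by (simp add: node_last)

lemma cell_bounds: assumes "t : {a..b}" shows "cell n t <= Suc n" "t <= node n (cell n t)" "node n (cell n t) < t + mesh n"
proof -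
 define z where "z = (t - a)/mesh n"
 have z: "0 <= z" "t = a + z*mesh n" using assms mesh_pos[of n] by (auto simp: z_def)
 have "z <= real (Suc n)"
 proof -
  have "z*mesh n <= real (Suc n)*mesh n" using assms z(2) node_last[of n] by (simp add: node_def)
  thus ?thesis using mesh_pos[of n] by simp
 qed
 thus "cell n t <= Suc n" by (simp add: cell_def z_def[symmetric] nat_le_iff ceiling_le_iff)
 have c: "real (cell n t) = of_int \<lceil>z\<rceil>" using z(1) by (simp add: cell_def z_def[symmetric])
 have "z <= real (cell n t)" "real (cell n t) < z + 1" unfolding c by linarith+
 hence "z*mesh n <= real (cell n t)*mesh n" "real (cell n t)*mesh n < (z + 1)*mesh n" using mesh_pos[of n] by auto
 thus "t <= node n (cell n t)" "node n (cell n t) < t + mesh n" by (auto simp: node_def z(2) algebra_simps)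
qed

lemma cell_mono: "s <= t ==> cell n s <= cell n t"
 unfolding cell_def using mesh_pos[of n] by (intro nat_mono ceiling_mono divide_right_mono) auto

lemma cell_eq: assumes "node n k < t" "t <= node n (Suc k)" shows "cell n t = Suc k"
proof -
 have "real k*mesh n < t - a" "t - a <= real (Suc k)*mesh n" using assms by (auto simp: node_def)
 hence "real k < (t - a)/mesh n" "(t - a)/mesh n <= real (Suc k)"
  using mesh_pos[of n] by (simp_all add: pos_less_divide_eq pos_divide_le_eq)
 hence "\<lceil>(t - a)/mesh n\<rceil> = int (Suc k)" by (intro ceiling_unique) auto
 thus ?thesis by (simp add: cell_def)
qed

lemma cell_measurable: "cell n : measurable (leb a b) (count_space UNIV)"
proof -
 have "(%t. (t - a)/mesh n) : meas a b" using mesh_pos[of n] by (intro meas_intg[OF cont_intg] continuous_intros) auto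
 hence "(%t. nat \<lceil>(t - a)/mesh n\<rceil>) : measurable (leb a b) (count_space UNIV)" by measurable
 thus ?thesis unfolding cell_def[abs_def] .
qed

lemma Xn_measurable: "Xn n : meas a b" unfolding Xn_def[abs_def] by (rule measurable_compose[OF cell_measurable]) simp

lemma xn_measurable: "(%t. inner h (xn n t)) : meas a b"
 unfolding xn_def[abs_def] by (rule measurable_compose[OF cell_measurable]) simp

lemma Xn_Vfun: "Vfun a b (Xn n)"
proof -
 define B where "B = (\<Sum>k\<le>Suc n. norm (U n k) powr p)"
 have "intg a b (%t. norm (Xn n t) powr p)"
 proof (rule intg_bounded)
  show "AE t in leb a b. abs(norm (Xn n t) powr p) <= B"
  proof (rule AE_I2)
   fix t assume "t : space (leb a b)"
   hence "cell n t <= Suc n" using cell_bounds by simp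
   hence "norm (U n (cell n t)) powr p <= B" unfolding B_def by (intro member_le_sum) auto
   thus "abs(norm (Xn n t) powr p) <= B" by (simp add: Xn_def)
  qed
 qed (use Xn_measurable[of n] in simp)
 thus ?thesis using Xn_measurable by (simp add: Vfun_def)
qed

lemma xn_Xn: "AE t in leb a b. xn n t = j (Xn n t)"
proof -
 have "AE t in leb a b. t ~= a" using AE_lebesgue_neq[of a] by (auto simp: AE_on_iff elim: eventually_mono)
 thus ?thesis using AE_space
 proof eventually_elim
  case (elim t)
  hence t: "t : {a..b}" by simp
  have "cell n t ~= 0" using cell_bounds(2)[OF t, of n] elim by (intro notI) simp
  then obtain k where "cell n t = Suc k" using not0_implies_Suc by blast
  thus ?case by (simp add: xn_def Xn_def)
 qed
qed

lemma step_equation: assumes "k < Suc n" shows "inner (Y n (Suc k)) (j v) +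
  LI (node n k) (node n (Suc k)) (%t. A t (U n (Suc k)) v) = inner (Y n k) (j v)"
proof -
 have nd: "0 <= node n k" "node n k <= node n (Suc k)" "node n (Suc k) <= T" "0 < node n (Suc k) - node n k"
  using node_range[of k n] node_range[of "Suc k" n] assms ab mesh_pos[of n] by (auto simp: node_Suc)
 have c: "0 < c2*(node n (Suc k) - node n k)" using nd c2 by simp
 obtain u where "!!v. inner (j u) (j v) +
  (A_integral (node n k) (node n (Suc k)) u) v = inner (Y n k) (j v)"
  by (rule elliptic_step[OF A_integral_monotone_op[OF nd(1-3)] c, of "Y n k"]) blast
 hence "EX u. ALL v. inner (j u) (j v) +
  (A_integral (node n k) (node n (Suc k)) u) v = inner (Y n k) (j v)" by blast
 from someI_ex[OF this] have "ALL v. inner (j (Euler_step n k (Y n k))) (j v) +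
  (A_integral (node n k) (node n (Suc k)) (Euler_step n k (Y n k))) v = inner (Y n k) (j v)" unfolding Euler_step_def .
 thus ?thesis using A_integral_apply[OF nd(1,3)] by simp
qed

lemma LI_cell: assumes k: "k < Suc n" and m: "f : meas a b" "g : meas a b"
  and eq: "!!t. node n k < t ==> t <= node n (Suc k) ==> f t = g t"
 shows "LI (node n k) (node n (Suc k)) f = LI (node n k) (node n (Suc k)) g"
proof (rule integral_cong_AE)
 have "{node n k..node n (Suc k)} <= {a..b}" using node_range[of k n] node_range[of "Suc k" n] k by auto
 thus "f : meas (node n k) (node n (Suc k))" "g : meas (node n k) (node n (Suc k))" using m meas_sub by blast+
 have "AE t in leb (node n k) (node n (Suc k)). t ~= node n k" using AE_lebesgue_neq[of "node n k"] by (auto simp: AE_on_iff elim: eventually_mono)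
 thus "AE t in leb (node n k) (node n (Suc k)). f t = g t" using AE_space by eventually_elim (use eq in auto)
qed

abbreviation "AXn == %n t. A t (Xn n t)"

lemma AXn_Dfun: "Dfun a b (AXn n)" using A_Dfun(1)[OF Xn_Vfun] ab by auto

lemma AU_Dfun: "Dfun a b (%t. A t u)" using A_const_Dfun ab by auto

lemma Euler_sum: "m <= Suc n ==> inner (Y n m - y0) (j v) = - LI a (node n m) (%t. AXn n t v)"
proof (induction m)
 case (Suc k)
 note i = Dfun_apply[OF AXn_Dfun, of n v]
 have "LI (node n k) (node n (Suc k)) (%t. AXn n t v) = LI (node n k) (node n (Suc k)) (%t. A t (U n (Suc k)) v)"
  using Suc.prems by (intro LI_cell meas_intg[OF i] meas_intg[OF Dfun_apply[OF AU_Dfun]]) (auto simp: Xn_def cell_eq)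
 moreover have "LI a (node n k) (%t. AXn n t v) + LI (node n k) (node n (Suc k)) (%t. AXn n t v)
   = LI a (node n (Suc k)) (%t. AXn n t v)" using node_range[of k n] node_range[of "Suc k" n] Suc.prems node_mono[of k "Suc k" n]
  by (intro LI_combine intg_sub[OF i]) auto
 ultimately show ?case using Suc.IH Suc.prems step_equation[of k n v] by (simp add: inner_diff_left)
qed simp

text \<open>Each step is tested with its new value. The discarded square of the increment of
  \<open>Y\<close> is the numerical dissipation and the origin of the inequality sign.\<close>

lemma Euler_energy: "m <= Suc n ==> 2*LI a (node n m) (%t. AXn n t (Xn n t)) <= nsq y0 - nsq (Y n m)"
proof (induction m)
 case (Suc k)
 note i = pair_intg[OF AXn_Dfun Xn_Vfun, of n n]
 have "LI (node n k) (node n (Suc k)) (%t. AXn n t (Xn n t)) = LI (node n k) (node n (Suc k)) (%t. A t (U n (Suc k)) (U n (Suc k)))"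
  using Suc.prems by (intro LI_cell meas_intg[OF i] meas_intg[OF Dfun_apply[OF AU_Dfun]]) (auto simp: Xn_def cell_eq)
 moreover have "LI a (node n k) (%t. AXn n t (Xn n t)) + LI (node n k) (node n (Suc k)) (%t. AXn n t (Xn n t))
   = LI a (node n (Suc k)) (%t. AXn n t (Xn n t))"
  using node_range[of k n] node_range[of "Suc k" n] Suc.prems node_mono[of k "Suc k" n] by (intro LI_combine intg_sub[OF i]) auto
 moreover have "inner (Y n (Suc k)) (Y n (Suc k)) + LI (node n k) (node n (Suc k)) (%t. A t (U n (Suc k)) (U n (Suc k))) = inner (Y n k) (Y n (Suc k))"
  using step_equation[of k n "U n (Suc k)"] Suc.prems by simp
 moreover have "2*inner (Y n k) (Y n (Suc k)) <= nsq (Y n k) + nsq (Y n (Suc k))"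
  using zero_le_power2[of "norm (Y n k - Y n (Suc k))"]
  by (simp add: power2_norm_eq_inner inner_diff_left inner_diff_right inner_commute del: Y.simps zero_le_power2)
 moreover have "2*LI a (node n k) (%t. AXn n t (Xn n t)) <= nsq y0 - nsq (Y n k)" using Suc by simp
 ultimately show ?case unfolding power2_norm_eq_inner by linarith
qed simp

lemma Y_bound: "m <= Suc n ==> norm (Y n m) <= norm y0"
proof -
 assume m: "m <= Suc n"
 have r: "a <= node n m" "node n m <= b" using node_range[OF m] by auto
 have "0 <= c2*LI a (node n m) (%t. norm (Xn n t) powr p)" using c2 by (simp add: integral_nonneg_AE)
 also have "... <= LI a (node n m) (%t. AXn n t (Xn n t))"
  using ab r by (intro coercive_integral Vfun_subinterval[OF Xn_Vfun]) auto
 finally have "nsq (Y n m) <= nsq y0" using Euler_energy[OF m] by linarith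
 thus ?thesis by (simp add: power2_le_iff_abs_le)
qed

lemma xn_bound: "t : {a..b} ==> norm (xn n t) <= norm y0" unfolding xn_def by (rule Y_bound[OF cell_bounds(1)])

lemma xn_start: "xn n a = y0" by (simp add: xn_def cell_def)

lemma xn_end: "xn n b = Y n (Suc n)"
proof -
 have "node n n < b" "b <= node n (Suc n)" using mesh_pos[of n] node_last[of n] by (auto simp: node_Suc)
 thus ?thesis unfolding xn_def using cell_eq by metis
qed

definition CX :: real where "CX = nsq y0/(2 * c2)"

lemma Xn_bound: "LI a b (%t. norm (Xn n t) powr p) <= CX"
proof -
 have "c2*LI a b (%t. norm (Xn n t) powr p) <= LI a b (%t. AXn n t (Xn n t))" using ab by (intro coercive_integral Xn_Vfun) auto
 moreover have "2*LI a b (%t. AXn n t (Xn n t)) <= nsq y0 - nsq (Y n (Suc n))"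
  using Euler_energy[of "Suc n" n] by (simp only: node_last order_refl)
 ultimately have "c2*LI a b (%t. norm (Xn n t) powr p)*2 <= nsq y0" using zero_le_power2[of "norm (Y n (Suc n))"] by linarith
 thus ?thesis unfolding CX_def using c2 by (simp add: field_simps)
qed

lemma AXn_bound: "LI a b (%t. norm (AXn n t) powr q) <= CA*(1 + CX)"
 using order_trans[OF A_Dfun(2)[OF Xn_Vfun ab(1,3)] mult_left_mono[OF add_left_mono[OF Xn_bound] CA0]] .

text \<open>At nodes the identity is exact; for general \<open>s\<close> and \<open>t\<close> only
  the two incomplete cells contribute. They are shorter than the mesh, so equi-integrability makes
  them small uniformly.\<close>

lemma Euler_increment: assumes et: "0 < et" shows "increments j a b xn (%n r. to_dual j 0 - AXn n r) et"
proof -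
 define Cq where "Cq = CA*(1 + CX)"
 have Cq: "0 <= Cq" using CA0 c2 by (simp add: Cq_def CX_def)
 define th where "th = et/(4*(Cq + 1))"
 have th: "0 < th" "th*Cq <= et/4" using et Cq by (auto simp: th_def field_simps)
 obtain D where D: "0 <= D" "!!x y. 0 <= x ==> 0 <= y ==> x*y <= th*x powr q + D*y powr p" using Young[OF th(1)] by blast
 have "(%n. D*((b - a)*inverse (real (Suc n)))) ----> D*((b - a)*0)"
  by (intro tendsto_mult tendsto_const LIMSEQ_inverse_real_of_nat)
 hence "(%n. D*mesh n) ----> 0" by (simp add: mesh_def divide_inverse)
 hence "EVN n. D*mesh n < et/4" using et by (intro order_tendstoD(2)) auto
 then obtain n0 where n0: "!!n. n0 <= n ==> D*mesh n < et/4" by (auto simp: eventually_sequentially)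
 have short: "abs(LI s (node n (cell n s)) (%r. AXn n r v)) <= et/2*norm v" if n: "n0 <= n" and s: "s : {a..b}" for n s v
 proof -
  define s' where "s' = node n (cell n s)"
  have s': "s <= s'" "s' < s + mesh n" "s' <= b" using cell_bounds[OF s, of n] node_range[of "cell n s" n] by (auto simp: s'_def)
  have as: "a <= s" using s by simp
  have "LI s s' (%r. norm (AXn n r)*1) <= th*Cq + D*LI s s' (%r. 1 powr p)"
   using D th s s' by (intro LI_Dfun_le[OF AXn_Dfun AXn_bound[folded Cq_def]]) auto
  also have "D*LI s s' (%r. 1 powr p) <= D*mesh n" using s' D by (intro mult_left_mono) (auto simp: LI_const)
  finally have N: "LI s s' (%r. norm (AXn n r)) <= et/2" using th n0[OF n] by simp
  have Gs: "Dfun s s' (AXn n)" by (rule Dfun_subinterval[OF AXn_Dfun as s'(3)])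
  have "abs(LI s s' (%r. AXn n r v)) <= LI s s' (%r. norm (AXn n r)*norm v)"
   using norm_blinfun[of "AXn n _"] Dfun_apply[OF Gs] Dfun_norm_intg(1)[OF Gs Vfun_const[of _ _ v]]
   by (intro LI_abs_le AE_I2) auto
  also have "... = LI s s' (%r. norm (AXn n r))*norm v" by simp
  also have "... <= et/2*norm v" by (intro mult_right_mono N) simp
  finally show ?thesis unfolding s'_def .
 qed
 have "abs(inner (xn n t - xn n s) (j v) - LI s t (%r. (to_dual j 0 - AXn n r) v)) <= et*norm v"
  if n: "n0 <= n" and st: "a <= s" "s <= t" "t <= b" for n s t v
 proof -
  define g where "g r = AXn n r v" for r
  have i: "intg a b g" unfolding g_def by (rule Dfun_apply[OF AXn_Dfun])
  have S: "inner (xn n s - y0) (j v) = - LI a (node n (cell n s)) g" if "s : {a..b}" for s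
   unfolding xn_def g_def by (rule Euler_sum[OF cell_bounds(1)[OF that]])
  have C: "LI a (node n (cell n s)) g = LI a s g + LI s (node n (cell n s)) g" if "s : {a..b}" for s
   using that cell_bounds[OF that, of n] node_range[of "cell n s" n] by (intro LI_combine[symmetric] intg_sub[OF i]) auto
  have "LI a s g + LI s t g = LI a t g" using st by (intro LI_combine intg_sub[OF i]) auto
  hence "inner (xn n t - xn n s) (j v) + LI s t g = LI s (node n (cell n s)) g - LI t (node n (cell n t)) g"
   using S[of s] S[of t] C[of s] C[of t] st by (simp add: inner_diff_left)
  moreover have "LI s t (%r. (to_dual j 0 - AXn n r) v) = - LI s t g" by (simp add: g_def[abs_def] blinfun.minus_left)
  moreover have "abs(LI s (node n (cell n s)) g) <= et/2*norm v" "abs(LI t (node n (cell n t)) g) <= et/2*norm v"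
   unfolding g_def by (rule short[OF n]; use st in simp)+
  ultimately show ?thesis by linarith
 qed
 thus ?thesis by blast
qed

theorem solution_exists: obtains x X where "cont a b x" "x a = y0" "Vfun a b X" "AE t in leb a b. x t = j (X t)"
  "!!s t v. a <= s ==> s <= t ==> t <= b ==> inner (x t - x s) (j v) = - LI s t (%r. A r (X r) v)"
proof -
 interpret B: bounded_solutions j p q T A a1 c1 c2 a b "norm y0" CX 0 xn Xn "%_ _. 0"
 proof unfold_locales
  fix et :: real assume et: "0 < et"
  have "2*LI a b (%t. AXn n t (Xn n t)) <= nsq (xn n a) - nsq (xn n b)" for n
   using Euler_energy[of "Suc n" n] by (simp only: node_last order_refl xn_start xn_end)
  thus "EX n0. ALL n>=n0. 2*LI a b (%t. AXn n t (Xn n t)) <=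
    nsq (xn n a) - nsq (xn n b) + 2*LI a b (%t. inner 0 (xn n t)) + et"
   using et by (intro exI[of _ 0] allI impI) (simp add: add_increasing2)
 qed (use ab Xn_Vfun Xn_bound xn_Xn xn_bound xn_measurable Euler_increment in auto)
 obtain r x X where xa: "x a = y0"
  and S: "approx_solutions j p q T A a1 c1 c2 a b (norm y0) CX 0 (%n. xn (r n)) (%n. Xn (r n)) (%n _. 0) X x"
  using B.limit_exists[OF xn_start] by blast
 interpret lim: approx_solutions j p q T A a1 c1 c2 a b "norm y0" CX 0 "%n. xn (r n)" "%n. Xn (r n)" "%n _. 0" X x by (rule S)
 show ?thesis
 proof (rule that[OF lim.x_continuous xa lim.X' lim.xX'])
  fix s t v assume st: "a <= s" "s <= t" "t <= b"
  show "inner (x t - x s) (j v) = - LI s t (%r. A r (X r) v)" using lim.limit_equation[of "%_ _ _. 0" s t v] st by simp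
 qed
qed

end

section \<open>Trajectories\<close>

lemma running_sup_bdd:
 fixes x :: "real => 'a::real_normed_vector" assumes "cont 0 T x" "t <= T" shows "bdd_above ((%s. norm (x s)) ` {0..t})"
proof -
 have "cont 0 t x" by (rule continuous_on_subset[OF assms(1)]) (use assms in auto)
 then obtain B where "!!s. s : {0..t} ==> norm (x s) <= B" using Icc_bounded by blast
 thus ?thesis by (intro bdd_aboveI2)
qed

lemma norm_le_running_sup: assumes "cont 0 T x" "0 <= s" "s <= t" "t <= T" shows "norm (x s) <= running_sup x t"
 unfolding running_sup_def by (rule cSUP_upper[OF _ running_sup_bdd[OF assms(1,4)]]) (use assms in auto)

lemma running_sup_le: "0 <= t ==> (!!s. 0 <= s ==> s <= t ==> norm (x s) <= B) ==> running_sup x t <= B"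
 unfolding running_sup_def by (rule cSUP_least) auto

lemma running_sup_nonneg: "cont 0 T x ==> 0 <= t ==> t <= T ==> 0 <= running_sup x t"
 using order_trans[OF norm_ge_zero norm_le_running_sup[of T x 0]] by simp

lemma running_sup_mono: assumes "cont 0 T x" "0 <= s" "s <= t" "t <= T" shows "running_sup x s <= running_sup x t"
 by (rule running_sup_le[OF assms(2)]) (use norm_le_running_sup[OF assms(1)] assms in auto)

lemma running_sup_diff_le: assumes "cont 0 T x" "cont 0 T y" "0 <= t" "t <= T"
  and "!!s. 0 <= s ==> s <= t ==> norm (x s - y s) <= e" shows "running_sup x t <= running_sup y t + e"
proof (rule running_sup_le[OF assms(3)])
 fix s assume "0 <= s" "s <= t"
 thus "norm (x s) <= running_sup y t + e"
  using norm_le_running_sup[OF assms(2), of s t] assms(5)[of s] norm_triangle_sub[of "x s" "y s"] assms(4) by linarith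
qed

lemma running_sup_continuous: assumes x: "cont 0 T x" shows "cont 0 T (running_sup x)" unfolding continuous_on_iff
proof (intro ballI allI impI)
 fix t e :: real assume t: "t : {0..T}" and e: "0 < e"
 have "uniformly_continuous_on {0..T} x" by (rule compact_uniformly_continuous[OF x compact_Icc])
 then obtain d where d: "0 < d" "!!r s. r : {0..T} ==> s : {0..T} ==> dist r s < d ==> dist (x r) (x s) < e/2"
  unfolding uniformly_continuous_on_def using half_gt_zero[OF e] by metis
 have inc: "running_sup x s <= running_sup x r + e/2" if "0 <= r" "r <= s" "s <= T" "s - r < d" for r s
 proof (rule running_sup_le)
  fix u assume u: "0 <= u" "u <= s"
  show "norm (x u) <= running_sup x r + e/2"
  proof (cases "u <= r")
   case True
   thus ?thesis using norm_le_running_sup[OF x, of u r] u that e by simp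
  next
   case False
   hence "dist (x u) (x r) < e/2" using d(2)[of u r] u that by (simp add: dist_real_def)
   hence "norm (x u) <= norm (x r) + e/2" using norm_triangle_sub[of "x u" "x r"] by (simp add: dist_norm)
   thus ?thesis using norm_le_running_sup[OF x, of r r] that by simp
  qed
 qed (use that in simp)
 show "EX d>0. ALL s:{0..T}. dist s t < d --> dist (running_sup x s) (running_sup x t) < e"
 proof (intro exI[of _ d] conjI ballI impI)
  fix s assume s: "s : {0..T}" "dist s t < d"
  show "dist (running_sup x s) (running_sup x t) < e"
  proof (cases "s <= t")
   case True
   thus ?thesis using inc[of s t] running_sup_mono[OF x, of s t] s t e by (auto simp: dist_real_def)
  next
   case False
   thus ?thesis using inc[of t s] running_sup_mono[OF x, of t s] s t e by (auto simp: dist_real_def)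
  qed
 qed (rule d(1))
qed

lemma paths_continuous: "x : paths T ==> cont 0 T x" by (simp add: paths_def)

lemma extend_path: assumes x0: "x0 : paths T" and x: "cont t0 T x" "x t0 = x0 t0" and t0: "0 <= t0" "t0 < T"
 obtains z where "z : paths T" "!!t. t <= t0 ==> z t = x0 t" "!!t. t : {t0..T} ==> z t = x t"
proof
 \<comment> \<open>The value \<open>undefined\<close> beyond \<open>T\<close> makes the glued path
   extensional; to the left of 0 the path \<open>x0\<close> already has that value.\<close>
 let ?z = "%t. if t <= t0 then x0 t else if t <= T then x t else undefined"
 have "cont 0 t0 ?z" by (rule continuous_on_eq[OF continuous_on_subset[OF paths_continuous[OF x0]]]) (use t0 in auto)
 moreover show z: "?z t = x t" if "t : {t0..T}" for t using that x(2) by auto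
 have "cont t0 T ?z" by (rule continuous_on_eq[OF x(1)]) (use z in auto)
 ultimately have "continuous_on ({0..t0} Un {t0..T}) ?z" by (intro continuous_on_closed_Un) auto
 moreover have "{0..t0} Un {t0..T} = {0..T}" using t0 by auto
 ultimately show "?z : paths T" using x0 t0 by (auto simp: paths_def extensional_def)
qed simp

section \<open>The chain rule and the equation in integrated form\<close>

context evolution_exponents
begin

text \<open>The theorem on weak limits for constant sequences: all errors vanish, and the limit of a
  constant sequence is its value.\<close>

lemma chain_rule_square:
 fixes x :: "real => 'b" assumes ab: "a < b" and X: "Vfun a b X" and xX: "AE t in leb a b. x t = j (X t)"
  and G: "Dfun a b G" and x: "cont a b x"
  and inc: "!!s t v. a <= s ==> s <= t ==> t <= b ==> inner (x t - x s) (j v) = LI s t (%r. G r v)"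
  and st: "a <= s" "s <= t" "t <= b" shows "nsq (x t) - nsq (x s) = 2*LI s t (%r. G r (X r))"
proof -
 obtain B where B: "!!t. t : {a..b} ==> norm (x t) <= B" using Icc_bounded[OF x] by blast
 have m: "(%t. inner h (x t)) : meas a b" for h by (intro meas_intg[OF cont_intg] continuous_intros x)
 interpret cross_energy j p q a b B "LI a b (%t. norm (G t) powr q)" X x "%_. x" "%_. G"
  by unfold_locales (use ab X xX G B m inc in auto)
 show ?thesis using energy_limit[OF st] by (simp add: LIMSEQ_const_iff)
qed

text \<open>With \<open>W_pqI\<close> this is the dictionary between the distributional definition
  of \<open>W_pq\<close> and increments over intervals, the form in which the derivative is used
  from here on.\<close>

lemma W_pqD: assumes W: "W_pq j p q a b X X'" and ab: "a < b" shows "Vfun a b X" "Dfun a b X'"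
  and "\<lbrakk>cont a b x; AE t in lebesgue_on {a<..<b}. x t = j (X t); a <= s; s <= t; t <= b\<rbrakk> \<Longrightarrow>
   inner (x t - x s) (j v) = LI s t (%r. X' r v)"
proof -
 have L: "X : Lp p {a<..<b}" "X' : Lp q {a<..<b}" and g: "generalized_derivative j a b X X'" using W by (auto simp: W_pq_def)
 have o: "{a<..<b} : sets lebesgue" by simp
 have "X : mbl {a<..<b}" using L by (intro strongly_measurable_imp_borel[OF _ o]) (simp add: Lp_def)
 thus V: "Vfun a b X" using L by (simp add: Vfun_def Lp_def meas_open_iff intg_open_iff)
 have "(%t. X' t v) : mbl {a<..<b}" for v using L by (intro strongly_measurable_blinfun_apply[OF _ o]) (simp add: Lp_def)
 thus D: "Dfun a b X'" using L by (simp add: Dfun_def Lp_def meas_open_iff intg_open_iff)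
 assume x: "cont a b x" "AE t in lebesgue_on {a<..<b}. x t = j (X t)" and st: "a <= s" "s <= t" "t <= b"
 show "inner (x t - x s) (j v) = LI s t (%r. X' r v)"
 proof (rule generalized_derivative_increment[OF ab g Dfun_apply[OF D] x(1) _ _ st])
  show "AE t in leb a b. x t = j (X t)" using x(2) by (simp add: AE_open_iff)
  show "(%t. inner (j (X t)) (j v)) : meas a b"
   by (rule borel_measurable_continuous_on[OF _ Vfun_measurable[OF V]]) (intro continuous_intros)
 qed
qed

lemma W_pqI: assumes ab: "a < b" and X: "Vfun a b X" and G: "Dfun a b X'" and ae: "AE t in leb a b. x t = j (X t)"
  and inc: "!!s t v. a <= s ==> s <= t ==> t <= b ==> inner (x t - x s) (j v) = LI s t (%r. X' r v)" shows "W_pq j p q a b X X'"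
 unfolding W_pq_def
proof (intro conjI)
 have "X : mbl {a<..<b}" using Vfun_measurable[OF X] by (simp add: meas_open_iff)
 from strongly_measurable_V[OF this] show "X : Lp p {a<..<b}" using Vfun_intg[OF X] by (simp add: Lp_def intg_open_iff)
 have "strongly_measurable {a<..<b} X'"
  by (rule strongly_measurable_dual) (use Dfun_measurable[OF G] in "simp add: meas_open_iff")
 thus "X' : Lp q {a<..<b}" using Dfun_intg[OF G] by (simp add: Lp_def intg_open_iff)
 show "generalized_derivative j a b X X'"
 proof (rule generalized_derivativeI[OF ab Dfun_apply[OF G] ae _ inc])
  show "(%t. inner (j (X t)) (j v)) : meas a b" for v
   by (rule borel_measurable_continuous_on[OF _ Vfun_measurable[OF X]]) (intro continuous_intros)
 qed
qed

end

context evolution_operator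
begin

text \<open>The equation in integrated form with an essentially bounded force. In this form
  restriction and concatenation of solutions are elementary.\<close>

definition solves :: "real => real => (real => 'b) => (real => 'a) => (real => 'b) => bool" where
 "solves a b x X f <-> cont a b x & Vfun a b X \<and>
  (AE t in leb a b. x t = j (X t)) \<and>
  (ALL h. (%t. inner h (f t)) : meas a b) \<and>
  (EX K. AE t in leb a b. norm (f t) <= K) \<and>
  (ALL s t v. a <= s --> s <= t --> t <= b -->
   inner (x t - x s) (j v) = LI s t (%r. rhs f X r v))"

lemma solvesD: assumes "solves a b x X f" shows "cont a b x" "Vfun a b X" "AE t in leb a b. x t = j (X t)"
  "(%t. inner h (f t)) : meas a b" "a <= s ==> s <= t ==> t <= b ==> inner (x t - x s) (j v) = LI s t (%r. rhs f X r v)"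
 using assms by (auto simp: solves_def)

lemma solves_bounded: assumes "solves a b x X f" obtains K where "AE t in leb a b. norm (f t) <= K"
 using assms unfolding solves_def by blast

lemma solves_Dfun: assumes s: "solves a b x X f" and ab: "0 <= a" "b <= T"
 shows "Dfun a b (%r. to_dual j (f r))" "Dfun a b (%r. A r (X r))" "Dfun a b (%r. to_dual j (f r) - A r (X r))"
proof -
 obtain K where K: "AE t in leb a b. norm (f t) <= K" by (rule solves_bounded[OF s])
 show f: "Dfun a b (%r. to_dual j (f r))" by (rule to_dual_Dfun(1)[OF solvesD(4)[OF s] K])
 show g: "Dfun a b (%r. A r (X r))" by (rule A_Dfun(1)[OF solvesD(2)[OF s] ab])
 show "Dfun a b (%r. to_dual j (f r) - A r (X r))" by (rule Dfun_diff[OF f g])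
qed

lemma solves_subinterval: assumes s: "solves a b x X f" and cd: "a <= c" "d <= b" shows "solves c d x X f" unfolding solves_def
proof (intro conjI allI impI)
 have sub: "{c..d} <= {a..b}" using cd by auto
 show "cont c d x" by (rule continuous_on_subset[OF solvesD(1)[OF s] sub])
 show "Vfun c d X" by (rule Vfun_subinterval[OF solvesD(2)[OF s] cd])
 show "AE t in leb c d. x t = j (X t)" by (rule AE_sub[OF solvesD(3)[OF s] cd])
 show "(%t. inner h (f t)) : meas c d" for h by (rule meas_sub[OF solvesD(4)[OF s] sub])
 show "EX K. AE t in leb c d. norm (f t) <= K" using solves_bounded[OF s] AE_sub[OF _ cd] by metis
 fix r t v assume "c <= r" "r <= t" "t <= d"
 thus "inner (x t - x r) (j v) = LI r t (%r. rhs f X r v)" using solvesD(5)[OF s, of r t v] cd by auto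
qed

lemma LI_Dfun_diff: assumes "Dfun a b G" "Dfun a b H" "a <= s" "t <= b"
 shows "LI s t (%r. (G r - H r) v) = LI s t (%r. G r v) - LI s t (%r. H r v)"
 unfolding bl_diff_left using assms by (intro LI_diff intg_sub[OF Dfun_apply])

lemma solves_cong: assumes s: "solves a b x X f" and ab: "0 <= a" "b <= T" and x: "!!t. t : {a..b} ==> x t = y t"
  and ae: "AE t in leb a b. X t = Y t & f t = g t" shows "solves a b y Y g" unfolding solves_def
proof (intro conjI allI impI)
 note D = solvesD[OF s]
 have S: "{a..b} : sets lebesgue" by simp
 show "cont a b y" by (rule continuous_on_eq[OF D(1) x])
 have Y: "Y : meas a b" by (rule meas_AE[OF Vfun_measurable[OF D(2)] S]) (use ae in eventually_elim, auto)
 have "intg a b (%t. norm (Y t) powr p)"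
  by (rule integrable_cong_AE_imp[OF Vfun_intg[OF D(2)]]) (use Y in simp, use ae in eventually_elim, auto)
 thus "Vfun a b Y" using Y by (simp add: Vfun_def)
 show "AE t in leb a b. y t = j (Y t)" using D(3) ae AE_space by eventually_elim (use x in auto)
 show "(%t. inner h (g t)) : meas a b" for h by (rule meas_AE[OF D(4)[of h] S]) (use ae in eventually_elim, auto)
 obtain K where "AE t in leb a b. norm (f t) <= K" by (rule solves_bounded[OF s])
 hence "AE t in leb a b. norm (g t) <= K" using ae by eventually_elim auto
 thus "EX K. AE t in leb a b. norm (g t) <= K" by blast
 fix r t v assume rt: "a <= r" "r <= t" "t <= b"
 have m: "(%s. rhs f X s v) : meas r t" by (rule meas_sub[OF Dfun_measurable[OF solves_Dfun(3)[OF s ab]]]) (use rt in auto)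
 have e: "AE s in leb r t. rhs f X s v = rhs g Y s v" using AE_sub[OF ae rt(1,3)] by eventually_elim auto
 have "LI r t (%s. rhs f X s v) = LI r t (%s. rhs g Y s v)" by (rule integral_cong_AE[OF m meas_AE[OF m _ e] e]) simp
 thus "inner (y t - y r) (j v) = LI r t (%r. rhs g Y r v)" using D(5)[OF rt, of v] x[of r] x[of t] rt by simp
qed

lemma solves_combine: assumes s: "solves a b x X f" "solves b c x X f" and abc: "0 <= a" "a <= b" "b <= c" "c <= T"
 shows "solves a c x X f" unfolding solves_def
proof (intro conjI allI impI)
 note D = solvesD[OF s(1)] and E = solvesD[OF s(2)] and comb = interval_combine[OF abc(2,3)]
 show "cont a c x" using continuous_on_closed_Un[OF _ _ D(1) E(1)] abc by (simp add: ivl_disj_un_two_touch)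
 show "Vfun a c X" using comb(2,3) D(2) E(2) by (auto simp: Vfun_def)
 show "AE t in leb a c. x t = j (X t)" by (rule comb(1)[OF D(3) E(3)])
 show "(%t. inner h (f t)) : meas a c" for h by (rule comb(2)[OF D(4) E(4)])
 obtain K1 K2 where "AE t in leb a b. norm (f t) <= K1" "AE t in leb b c. norm (f t) <= K2"
  using solves_bounded[OF s(1)] solves_bounded[OF s(2)] by metis
 hence "AE t in leb a b. norm (f t) <= max K1 K2" "AE t in leb b c. norm (f t) <= max K1 K2" by auto
 thus "EX K. AE t in leb a c. norm (f t) <= K" using comb(1) by blast
 fix r t v assume rt: "a <= r" "r <= t" "t <= c"
 let ?G = "%r. rhs f X r v"
 have "intg a c ?G" using comb(3) Dfun_apply[OF solves_Dfun(3)[OF s(1)]] Dfun_apply[OF solves_Dfun(3)[OF s(2)]] abc by auto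
 hence i: "intg r t ?G" by (rule intg_sub) (use rt in auto)
 consider "t <= b" | "b <= r" | "r <= b" "b <= t" by linarith
 thus "inner (x t - x r) (j v) = LI r t ?G"
 proof cases
  case 3
  have "inner (x t - x r) (j v) = inner (x b - x r) (j v) + inner (x t - x b) (j v)" by (simp add: inner_diff_left)
  also have "... = LI r t ?G" using D(5)[of r b v] E(5)[of b t v] LI_combine[OF i 3] rt 3 by simp
  finally show ?thesis .
 qed (use D(5) E(5) rt in auto)
qed

lemma forced_intg: assumes s: "solves a b x X f" and z: "cont a b z" shows "intg a b (%r. inner (f r) (z r))"
proof -
 obtain K where K: "AE t in leb a b. norm (f t) <= K" by (rule solves_bounded[OF s])
 obtain B where B: "!!t. t : {a..b} ==> norm (z t) <= B" "0 <= B" using Icc_bounded[OF z] by blast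
 have zm: "(%t. inner h (z t)) : meas a b" for h by (intro meas_intg[OF cont_intg] continuous_intros z)
 show ?thesis
 proof (rule intg_bounded)
  show "(%r. inner (f r) (z r)) : meas a b" by (rule inner_measurable[OF solvesD(4)[OF s] zm])
  show "AE t in leb a b. abs(inner (f t) (z t)) <= abs(K)*B"
   using K AE_space by eventually_elim (intro order_trans[OF Cauchy_Schwarz_ineq2] mult_mono B, auto)
 qed
qed

lemma solves_energy: assumes s: "solves a b x X f" and ab: "0 <= a" "a < b" "b <= T" and st: "a <= s" "s <= t" "t <= b"
 shows "nsq (x t) - nsq (x s) = 2*LI s t (%r. inner (f r) (x r)) - 2*LI s t (%r. A r (X r) (X r))"
proof -
 note D = solves_Dfun[OF s ab(1,3)] and V = solvesD(2)[OF s]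
 have "nsq (x t) - nsq (x s) = 2*LI s t (%r. rhs f X r (X r))"
  by (rule chain_rule_square[OF ab(2) V solvesD(3)[OF s] D(3) solvesD(1)[OF s] _ st]) (rule solvesD(5)[OF s])
 also have "LI s t (%r. rhs f X r (X r)) = LI s t (%r. inner (f r) (x r) - A r (X r) (X r))"
 proof (rule integral_cong_AE)
  have sub: "{s..t} <= {a..b}" using st by auto
  show "(%r. rhs f X r (X r)) : meas s t" by (rule meas_sub[OF meas_intg[OF pair_intg[OF D(3) V]] sub])
  show "(%r. inner (f r) (x r) - A r (X r) (X r)) : meas s t"
   by (rule meas_sub[OF meas_intg[OF intg_diff[OF forced_intg[OF s solvesD(1)[OF s]] pair_intg[OF D(2) V]]] sub])
  show "AE r in leb s t. rhs f X r (X r) = inner (f r) (x r) - A r (X r) (X r)"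
   using AE_sub[OF solvesD(3)[OF s] st(1,3)] by eventually_elim (simp add: bl_diff_left)
 qed
 also have "... = LI s t (%r. inner (f r) (x r)) - LI s t (%r. A r (X r) (X r))" by (rule LI_diff)
   (rule intg_sub[OF _ st(1,3)], rule forced_intg[OF s solvesD(1)[OF s]] pair_intg[OF D(2) V])+
 finally show ?thesis by simp
qed

text \<open>The chain rule for the difference of two solutions; monotonicity discards the operator
  term and leaves the forces.\<close>

lemma solves_difference:
 assumes s: "solves a b x X f" "solves a b y Y g" and ab: "0 <= a" "a < b" "b <= T" and st: "a <= s" "s <= t" "t <= b"
 shows "nsq (x t - y t) - nsq (x s - y s) <= 2*LI s t (%r. inner (f r - g r) (x r - y r))"
proof -
 note D = solves_Dfun[OF s(1) ab(1,3)] and E = solves_Dfun[OF s(2) ab(1,3)]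
 note V = Vfun_diff[OF solvesD(2)[OF s(1)] solvesD(2)[OF s(2)]]
 note DE = Dfun_diff[OF D(3) E(3)]
 have ae: "AE t in leb a b. x t - y t = j (X t - Y t)"
  using solvesD(3)[OF s(1)] solvesD(3)[OF s(2)] by eventually_elim (simp add: bl_diff_right)
 have c: "cont a b (%t. x t - y t)" by (intro continuous_intros solvesD(1)[OF s(1)] solvesD(1)[OF s(2)])
 have inc: "inner ((x t - y t) - (x s - y s)) (j v) =
   LI s t (%r. (rhs f X r - rhs g Y r) v)" if "a <= s" "s <= t" "t <= b" for s t v
 proof -
  have "inner ((x t - y t) - (x s - y s)) (j v) = inner (x t - x s) (j v) - inner (y t - y s) (j v)"
   by (simp add: inner_diff_left)
  also have "... = LI s t (%r. rhs f X r v) - LI s t (%r. rhs g Y r v)"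
   by (simp only: solvesD(5)[OF s(1) that] solvesD(5)[OF s(2) that])
  finally show ?thesis unfolding LI_Dfun_diff[OF D(3) E(3) that(1,3)] .
 qed
 have "nsq (x t - y t) - nsq (x s - y s) =
   2*LI s t (%r. (rhs f X r - rhs g Y r) (X r - Y r))" by (rule chain_rule_square[OF ab(2) V ae DE c inc st])
 also have "... <= 2*LI s t (%r. inner (f r - g r) (x r - y r))"
 proof (rule mult_left_mono, rule LI_mono_AE)
  show "intg s t (%r. (rhs f X r - rhs g Y r) (X r - Y r))" by (rule intg_sub[OF pair_intg[OF DE V] st(1,3)])
  have "intg a b (%r. inner (f r - g r) (x r - y r))" unfolding inner_diff_left
   by (rule intg_diff[OF forced_intg[OF s(1) c] forced_intg[OF s(2) c]])
  thus "intg s t (%r. inner (f r - g r) (x r - y r))" using st by (rule_tac intg_sub)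
  show "AE r in leb s t. (rhs f X r - rhs g Y r) (X r - Y r)
    <= inner (f r - g r) (x r - y r)" using AE_sub[OF ae st(1,3)] AE_sub[OF A_monotone_on[OF ab(1,3)] st(1,3)]
  proof eventually_elim
   case (elim r)
   hence "0 <= (A r (X r) - A r (Y r)) (X r - Y r)" by (intro monotone_opD(1))
   thus ?case unfolding elim(1) by (simp add: bl_diff_left inner_diff_left)
  qed
 qed simp
 finally show ?thesis .
qed

lemma trajectoryD: assumes tr: "trj L t0 x0 x X X' f" and t0: "0 <= t0" "t0 < T" and L: "0 <= L"
 shows "x : paths T" "!!t. 0 <= t ==> t <= t0 ==> x t = x0 t" "solves t0 T x X f"
  "AE t in leb t0 T. norm (f t) <= L*(1 + running_sup x t)"
  "W_pq j p q t0 T X X'" "AE t in leb t0 T. X' t + A t (X t) = to_dual j (f t)"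
proof -
 show x: "x : paths T" "!!t. 0 <= t ==> t <= t0 ==> x t = x0 t" using tr by (auto simp: trajectory_def)
 show W: "W_pq j p q t0 T X X'" using tr by (simp add: trajectory_def)
 show fb: "AE t in leb t0 T. norm (f t) <= L*(1 + running_sup x t)" using tr by (simp add: trajectory_def AE_open_iff)
 show eq: "AE t in leb t0 T. X' t + A t (X t) = to_dual j (f t)" using tr by (simp add: trajectory_def AE_open_iff)
 have xX: "AE t in lebesgue_on {t0<..<T}. x t = j (X t)" using tr by (simp add: trajectory_def)
 have c: "cont 0 T x" by (rule paths_continuous[OF x(1)])
 have c0: "cont t0 T x" by (rule continuous_on_subset[OF c]) (use t0 in auto)
 have fm: "(%t. inner h (f t)) : meas t0 T" for h
 proof -
  have "strongly_measurable {t0<..<T} f" using tr by (simp add: trajectory_def Lp_def)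
  from strongly_measurable_inner[OF this] show ?thesis by (simp add: meas_open_iff)
 qed
 \<comment> \<open>The force is essentially bounded, since the running supremum is at most its value
   at \<open>T\<close>.\<close>
 have K: "AE t in leb t0 T. norm (f t) <= L*(1 + running_sup x T)" using fb AE_space
 proof eventually_elim
  case (elim t)
  hence "running_sup x t <= running_sup x T" using running_sup_mono[OF c, of t T] t0 by simp
  thus ?case using elim L by (meson add_left_mono mult_left_mono order_trans)
 qed
 note Wd = W_pqD[OF W t0(2)]
 show "solves t0 T x X f" unfolding solves_def
 proof (intro conjI allI impI)
  show "AE t in leb t0 T. x t = j (X t)" using xX by (simp add: AE_open_iff)
  show "EX K. AE t in leb t0 T. norm (f t) <= K" using K by blast
  fix s t v assume st: "t0 <= s" "s <= t" "t <= T"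
  have "inner (x t - x s) (j v) = LI s t (%r. X' r v)" by (rule Wd(3)[OF c0 xX st])
  also have "... = LI s t (%r. rhs f X r v)"
  proof (rule integral_cong_AE)
   have D: "Dfun t0 T (%r. to_dual j (f r) - A r (X r))"
    by (rule Dfun_diff[OF to_dual_Dfun(1)[OF fm K] A_Dfun(1)[OF Wd(1) t0(1) order_refl]])
   have sub: "{s..t} <= {t0..T}" using st by auto
   show "(%r. rhs f X r v) : meas s t" by (rule meas_sub[OF Dfun_measurable[OF D] sub])
   show "(%r. X' r v) : meas s t" by (rule meas_sub[OF Dfun_measurable[OF Wd(2)] sub])
   show "AE r in leb s t. X' r v = rhs f X r v" using AE_sub[OF eq st(1,3)] by eventually_elim (metis add_diff_cancel_right')
  qed
  finally show "inner (x t - x s) (j v) = LI s t (%r. rhs f X r v)" .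
 qed (use c0 Wd fm in auto)
qed

lemma trajectoryI: assumes x: "x : paths T" "!!t. 0 <= t ==> t <= t0 ==> x t = x0 t" and s: "solves t0 T x X f"
  and fb: "AE t in leb t0 T. norm (f t) <= L*(1 + running_sup x t)" and t0: "0 <= t0" "t0 < T"
 shows "trj L t0 x0 x X (%t. to_dual j (f t) - A t (X t)) f" unfolding trajectory_def
proof (intro conjI)
 note D = solves_Dfun[OF s t0(1) order_refl]
 show "W_pq j p q t0 T X (%t. to_dual j (f t) - A t (X t))"
  by (rule W_pqI[OF t0(2) solvesD(2)[OF s] D(3) solvesD(3)[OF s] solvesD(5)[OF s]])
 have m: "(%t. inner h (f t)) : mbl {t0<..<T}" for h using solvesD(4)[OF s] by (simp add: meas_open_iff)
 obtain K where K: "AE t in leb t0 T. norm (f t) <= K" by (rule solves_bounded[OF s])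
 have "intg t0 T (%t. norm (f t) powr 2)"
 proof (rule intg_bounded)
  show "(%t. norm (f t) powr 2) : meas t0 T" using meas_norm_H[OF solvesD(4)[OF s]] by simp
  show "AE t in leb t0 T. abs(norm (f t) powr 2) <= abs(K) powr 2" using K by eventually_elim (simp, rule power_mono, auto)
 qed
 thus "f : Lp 2 {t0<..<T}" using strongly_measurable_H[OF m] by (simp add: Lp_def intg_open_iff)
 show "AE t in lebesgue_on {t0<..<T}. x t = j (X t)" using solvesD(3)[OF s] by (simp add: AE_open_iff)
 show "AE t in lebesgue_on {t0<..<T}. to_dual j (f t) - A t (X t) + A t (X t) = to_dual j (f t)" by simp
 show "AE t in lebesgue_on {t0<..<T}. norm (f t) <= L*(1 + running_sup x t)" using fb by (simp add: AE_open_iff)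
qed (use x in auto)

end

section \<open>Completeness and weak limits of forces in L2\<close>

inductive_set mid_hull :: "(nat => real => 'b::real_vector) => nat => (real => 'b) set"
 for F k where
 base: "k <= n ==> F n : mid_hull F k"
| mid: "g : mid_hull F k ==> h : mid_hull F k ==> (%t. (1/2)*.(g t + h t)) : mid_hull F k"

lemma mid_hull_mono: assumes "k <= l" "g : mid_hull F l" shows "g : mid_hull F k"
 using assms(2,1) by (induction rule: mid_hull.induct) (auto intro: mid_hull.intros)

lemma fast_subsequence:
 fixes P :: "nat => nat => bool" assumes "!!i. EX N. ALL n>=N. P i n"
 obtains r :: "nat => nat" where "strict_mono r" "!!i. P i (r i)"
proof -
 obtain N where N: "!!i n. N i <= n ==> P i n" using assms by metis
 define r where "r i = (\<Sum>k\<le>i. Suc (N k))" for i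
 have "strict_mono r" unfolding strict_mono_Suc_iff by (simp add: r_def)
 moreover have "N i <= r i" for i
 proof -
  have "Suc (N i) <= r i" unfolding r_def by (intro member_le_sum) auto
  thus ?thesis by simp
 qed
 ultimately show ?thesis using that N by blast
qed

context evolution_triple
begin

text \<open>Completeness of \<open>L^2\<close> in its pointwise form: along a fast subsequence the
  increments are summable almost everywhere.\<close>

lemma L2_Cauchy_subsequence:
 fixes g :: "nat => real => 'b" assumes ab: "a <= b" and gm: "!!n h. (%t. inner h (g n t)) : meas a b"
  and gi: "!!m n. intg a b (%t. nsq (g m t - g n t))"
  and C: "!!e. 0 < e ==> EX N. ALL m>=N. ALL n>=m. LI a b (%t. nsq (g m t - g n t)) <= e"
 obtains r :: "nat => nat" and f where "strict_mono r" "AE t in leb a b. (%i. g (r i) t) ----> f t"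
proof -
 have "EX N. ALL m>=N. ALL n>=m. LI a b (%t. nsq (g m t - g n t)) <= (1/4) ^ i" for i by (rule C) simp
 then obtain r :: "nat => nat" where r: "strict_mono r" "!!i. ALL n>=r i. LI a b (%t. nsq (g (r i) t - g n t)) <= (1/4) ^ i"
  using fast_subsequence[of "%i m. ALL n>=m. LI a b (%t. nsq (g m t - g n t)) <= (1/4) ^ i"] by blast
 define d where "d i t = norm (g (r i) t - g (r (Suc i)) t)" for i t
 have dm: "d i : meas a b" for i
  unfolding d_def by (rule meas_norm_H) (simp only: inner_diff_right, intro borel_measurable_diff gm)
 have d2: "intg a b (%t. (d i t)^2)" "LI a b (%t. (d i t)^2) <= (1/4) ^ i" for i
  using gi r(2)[of i] strict_mono_leD[OF r(1), of i "Suc i"] by (auto simp: d_def)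
 have d0: "0 <= d i t" for i t by (simp add: d_def)
 \<comment> \<open>A weighted square inequality: squares with integral at most
   \<open>(1/4)^i\<close> give increments with integral of order \<open>(1/2)^i\<close>, which is
   summable.\<close>
 have dle: "d i t <= (1/2) ^ i + 2 ^ i*(d i t)^2" for i t
 proof -
  have "0 <= (2 ^ i*d i t - 1)^2 + 2 ^ i*d i t*0" by simp
  hence "2 ^ i*(2*d i t) <= 2 ^ i*((1/2) ^ i + 2 ^ i*(d i t)^2)" by (simp add: power2_eq_square algebra_simps power_one_over)
  hence "2*d i t <= (1/2) ^ i + 2 ^ i*(d i t)^2" by simp
  thus ?thesis using d0[of i t] by linarith
 qed
 have ii: "intg a b (%t. (1/2) ^ i + 2 ^ i*(d i t)^2)" for i using d2(1) by simp
 have di: "intg a b (d i)" for i by (rule intg_AE_le[OF ii dm]) (use dle d0 in "auto intro!: AE_I2")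
 have dI: "LI a b (d i) <= (1/2) ^ i*(b - a + 1)" for i
 proof -
  have "LI a b (d i) <= LI a b (%t. (1/2) ^ i + 2 ^ i*(d i t)^2)" using dle by (intro LI_mono_AE di ii) auto
  also have "... = (1/2) ^ i*(b - a) + 2 ^ i*LI a b (%t. (d i t)^2)" using d2(1) ab by simp
  also have "2 ^ i*LI a b (%t. (d i t)^2) <= 2 ^ i*(1/4) ^ i" using d2(2) by (intro mult_left_mono) auto
  also have "2 ^ i*(1/4 :: real) ^ i = (1/2) ^ i" by (simp flip: power_mult_distrib)
  finally show ?thesis by (simp add: algebra_simps)
 qed
 have "(\<integral>\<^sup>+ t. (\<Sum>i. ennreal (d i t)) \<partial>leb a b) = (\<Sum>i. \<integral>\<^sup>+ t. ennreal (d i t) \<partial>leb a b)"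
  using dm by (intro nn_integral_suminf) auto
 also have "... = (\<Sum>i. ennreal (LI a b (d i)))" by (intro suminf_cong nn_integral_eq_integral di) (simp add: d0)
 also have "... <= (\<Sum>i. ennreal ((1/2) ^ i*(b - a + 1)))" by (intro suminf_le ennreal_leI dI) auto
 also have "... < \<infinity>"
 proof -
  have "summable (%i. (1/2 :: real) ^ i*(b - a + 1))" by (intro summable_mult2 summable_geometric) simp
  hence "(\<Sum>i. ennreal ((1/2) ^ i*(b - a + 1))) = ennreal (\<Sum>i. (1/2) ^ i*(b - a + 1))"
   using ab by (intro suminf_ennreal2) auto
  thus ?thesis by simp
 qed
 finally have "AE t in leb a b. (\<Sum>i. ennreal (d i t)) ~= \<infinity>" using dm by (intro nn_integral_PInf_AE) auto
 hence "AE t in leb a b. EX z. (%i. g (r i) t) ----> z"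
 proof eventually_elim
  case (elim t)
  hence sm: "summable (%i. d i t)" by (intro summable_suminf_not_top) (auto simp: d0)
  have tele: "norm (g (r m) t - g (r n) t) <= (\<Sum>i=m..<n. d i t)" if "m <= n" for m n using that
  proof (induction n rule: dec_induct)
   case (step n)
   have "norm (g (r m) t - g (r (Suc n)) t) <= norm (g (r m) t - g (r n) t) + d n t"
    using norm_triangle_ineq[of "g (r m) t - g (r n) t" "g (r n) t - g (r (Suc n)) t"] by (simp add: d_def)
   thus ?case using step by simp
  qed simp
  have "Cauchy (%i. g (r i) t)"
  proof (rule CauchyI')
   fix e :: real assume "0 < e"
   then obtain N where N: "!!m n. N <= m ==> norm (\<Sum>i=m..<n. d i t) < e" using sm unfolding summable_Cauchy by blast
   show "EX M. ALL m>=M. ALL n>m. dist (g (r m) t) (g (r n) t) < e"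
    using N tele by (intro exI[of _ N]) (metis abs_le_D1 dist_norm le_less_trans less_imp_le real_norm_def abs_ge_self)
  qed
  thus ?case using Cauchy_convergent convergent_def by blast
 qed
 hence "AE t in leb a b. (%i. g (r i) t) ----> (SOME z. (%i. g (r i) t) ----> z)" by eventually_elim (rule someI_ex)
 thus ?thesis by (rule that[OF r(1)])
qed

text \<open>As in Mazur's lemma, elements of almost minimal norm in the shrinking midpoint hulls of the tails form a Cauchy sequence.\<close>

lemma weak_L2_limit:
 fixes F :: "nat => real => 'b" assumes ab: "a <= b" and Fm: "!!n h. (%t. inner h (F n t)) : meas a b"
  and FK: "!!n. AE t in leb a b. norm (F n t) <= K"
  and be: "!!e. 0 < e ==> EX k. ALL n>=k. AE t in leb a b. norm (F n t) <= be t + e"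
  and Ph: "!!s t v. a <= s ==> s <= t ==> t <= b ==> (%n. LI s t (%r. inner (F n r) (j v))) ----> Ph s t v"
 obtains f where "!!h. (%t. inner h (f t)) : meas a b" "AE t in leb a b. norm (f t) <= K" "AE t in leb a b. norm (f t) <= be t"
  "!!s t v. a <= s ==> s <= t ==> t <= b ==> LI s t (%r. inner (f r) (j v)) = Ph s t v"
proof -
 let ?M = "leb a b"
 have mid_le: "norm ((1/2)*.(x + y)) <= c" if "norm x <= c" "norm y <= c" for x y :: 'b and c
  using norm_triangle_ineq[of x y] that by simp
 have hm: "(%t. inner h (g t)) : borel_measurable ?M" if "g : mid_hull F k" for g k h
  using that by (induction rule: mid_hull.induct) (auto simp: Fm inner_add_right)
 have hb: "AE t in ?M. norm (g t) <= ga t" if "g : mid_hull F k" and "!!n. k <= n ==> AE t in ?M. norm (F n t) <= ga t" for g k ga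
  using that(1)
 proof (induction rule: mid_hull.induct)
  case (mid g h)
  from mid.IH show ?case by eventually_elim (rule mid_le)
 qed (rule that(2))
 have hK: "AE t in ?M. norm (g t) <= K" if "g : mid_hull F k" for g k by (rule hb[OF that FK])
 define I where "I g = LI a b (%t. nsq (g t))" for g :: "real => 'b"
 have sqi: "integrable ?M (%t. nsq (g t))" if "!!h. (%t. inner h (g t)) : borel_measurable ?M" "AE t in ?M. norm (g t) <= C" for g :: "real => 'b" and C
 proof (rule intg_bounded)
  show "(%t. nsq (g t)) : borel_measurable ?M" using meas_norm_H[OF that(1)] by simp
  show "AE t in ?M. abs(nsq (g t)) <= C^2" using that(2) by eventually_elim (simp add: power_mono)
 qed
 have hi: "integrable ?M (%t. nsq (g t))" if "g : mid_hull F k" for g k by (rule sqi[OF hm[OF that] hK[OF that]])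
 have I0: "0 <= I g" for g unfolding I_def by (rule integral_nonneg_AE) simp
 have IK: "I g <= K^2*(b - a)" if "g : mid_hull F k" for g k
 proof -
  have "I g <= LI a b (%_. K^2)" unfolding I_def
   by (rule LI_mono_AE[OF hi[OF that]]) (simp, use hK[OF that] in eventually_elim, simp add: power_mono)
  thus ?thesis using ab by (simp add: LI_const mult.commute)
 qed
 define m where "m k = Inf (I ` mid_hull F k)" for k
 have bdd: "bdd_below (I ` mid_hull F k)" for k using I0 by (intro bdd_belowI2)
 have ne: "F k : mid_hull F k" for k by (rule mid_hull.base) simp
 have m_le: "m k <= I g" if "g : mid_hull F k" for k g unfolding m_def by (rule cINF_lower[OF bdd that])
 have m_mono: "m k <= m l" if "k <= l" for k l
  unfolding m_def by (rule cINF_superset_mono[OF _ bdd]) (use ne mid_hull_mono[OF that] in auto)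
 have "EX g:mid_hull F k. I g < m k + 1/real (Suc k)" for k
  using cInf_lessD[of "I ` mid_hull F k" "m k + 1/real (Suc k)"] ne unfolding m_def by auto
 then obtain g where g: "!!k. g k : mid_hull F k" "!!k. I (g k) < m k + 1/real (Suc k)" by metis
 have mconv: "Cauchy m"
 proof -
  have "m k <= K^2*(b - a)" for k using m_le[OF ne] IK[OF ne] order_trans by blast
  hence "bdd_above (range m)" by (intro bdd_aboveI2)
  hence "m ----> (SUP k. m k)" by (intro LIMSEQ_incseq_SUP) (auto simp: incseq_def m_mono)
  thus ?thesis by (rule LIMSEQ_imp_Cauchy)
 qed
 have dm: "(%t. inner h (g k t - g l t)) : borel_measurable ?M" for h k l
  unfolding inner_diff_right by (intro borel_measurable_diff hm[OF g(1)])
 have dK: "AE t in ?M. norm (g k t - g l t) <= 2*K" for k l using hK[OF g(1)[of k]] hK[OF g(1)[of l]]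
 proof eventually_elim
  case (elim t)
  thus ?case using norm_triangle_ineq4[of "g k t" "g l t"] by linarith
 qed
 have para: "LI a b (%t. nsq (g k t - g l t)) <= 2*(m l - m k) + 2/real (Suc k) + 2/real (Suc l)" if kl: "k <= l" for k l
 proof -
  define h where "h t = (1/2)*.(g k t + g l t)" for t
  \<comment> \<open>The midpoint of a late and an earlier element lies in the hull of the earlier
    tail, so its norm is at least the infimum there. By the parallelogram identity the distance is
    controlled by \<open>m l - m k\<close>, and the bounded monotone sequence \<open>m\<close> is
    Cauchy.\<close>
  have h: "h : mid_hull F k" unfolding h_def[abs_def] by (intro mid_hull.mid g(1) mid_hull_mono[OF kl])
  have "nsq (g k t - g l t) = 2*nsq (g k t) + 2*nsq (g l t) - 4*nsq (h t)" for t
   by (simp add: h_def power2_norm_eq_inner inner_diff_left inner_diff_right inner_add_left inner_add_right inner_commute field_simps)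
  hence "LI a b (%t. nsq (g k t - g l t)) = 2*I (g k) + 2*I (g l) - 4*I h"
   unfolding I_def using hi[OF g(1)[of k]] hi[OF g(1)[of l]] hi[OF h] by simp
  thus ?thesis using g(2)[of k] g(2)[of l] m_le[OF h] by simp
 qed
 obtain r f where r: "strict_mono r" "AE t in ?M. (%i. g (r i) t) ----> f t"
 proof (rule L2_Cauchy_subsequence[OF ab hm[OF g(1)] sqi[OF dm dK]])
  fix e :: real assume e: "0 < e"
  obtain N1 where N1: "!!k l. N1 <= k ==> N1 <= l ==> norm (m k - m l) < e/8" using CauchyD[OF mconv, of "e/8"] e by auto
  obtain N2 where N2: "1/real (Suc N2) < e/8" using nat_approx_posE[of "e/8"] e by auto
  show "EX N. ALL k>=N. ALL l>=k. LI a b (%t. nsq (g k t - g l t)) <= e"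
  proof (intro exI[of _ "max N1 N2"] allI impI)
   fix k l assume kl: "max N1 N2 <= k" "k <= l"
   have "1/real (Suc k) <= 1/real (Suc N2)" "1/real (Suc l) <= 1/real (Suc N2)" using kl by (auto intro!: divide_left_mono)
   thus "LI a b (%t. nsq (g k t - g l t)) <= e" using para[OF kl(2)] N1[of k l] N2 kl unfolding real_norm_def abs_less_iff by simp
  qed
 qed blast
 have fm: "(%t. inner h (f t)) : borel_measurable ?M" for h
 proof (rule meas_AE)
  show "(%t. lim (%i. inner h (g (r i) t))) : borel_measurable ?M" by (intro borel_measurable_lim_metric hm[OF g(1)])
  show "AE t in ?M. lim (%i. inner h (g (r i) t)) = inner h (f t)"
   using r(2) by eventually_elim (intro limI tendsto_inner tendsto_const)
 qed simp
 have allK: "AE t in ?M. ALL i. norm (g (r i) t) <= K" using hK[OF g(1)] by (simp add: AE_all_countable)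
 have fK: "AE t in ?M. norm (f t) <= K" using allK r(2) by eventually_elim (rule LIMSEQ_le_const2[OF tendsto_norm], auto)
 \<comment> \<open>The sequence obeys the bound \<open>be\<close> only asymptotically. Hulls of late
   tails obey it up to \<open>1/(i + 1)\<close>, which passes to the limit before \<open>i\<close>
   is sent to infinity.\<close>
 have fbe: "AE t in ?M. norm (f t) <= be t"
 proof -
  have "AE t in ?M. norm (f t) <= be t + 1/real (Suc i)" for i
  proof -
   obtain k where k: "!!n. k <= n ==> AE t in ?M. norm (F n t) <= be t + 1/real (Suc i)" using be[of "1/real (Suc i)"] by auto
   have "AE t in ?M. norm (g (r (n + k)) t) <= be t + 1/real (Suc i)" for n
   proof (rule hb[OF g(1)])
    fix l assume "r (n + k) <= l"
    hence "k <= l" using seq_suble[OF r(1), of "n + k"] by linarith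
    thus "AE t in ?M. norm (F l t) <= be t + 1/real (Suc i)" by (rule k)
   qed
   hence "AE t in ?M. ALL n. norm (g (r (n + k)) t) <= be t + 1/real (Suc i)" by (simp add: AE_all_countable)
   thus ?thesis using r(2)
   proof eventually_elim
    case (elim t)
    have "(%n. norm (g (r (n + k)) t)) ----> norm (f t)"
     using LIMSEQ_ignore_initial_segment[OF tendsto_norm[OF elim(2)], of k] by simp
    thus ?case by (rule LIMSEQ_le_const2) (use elim(1) in blast)
   qed
  qed
  hence "AE t in ?M. ALL i. norm (f t) <= be t + 1/real (Suc i)" by (simp add: AE_all_countable)
  thus ?thesis
  proof eventually_elim
   case (elim t)
   show ?case
   proof (rule field_le_epsilon)
    fix e :: real assume "0 < e"
    then obtain i where "1/real (Suc i) < e" using nat_approx_posE by blast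
    thus "norm (f t) <= be t + e" using elim by (meson add_left_mono less_imp_le order_trans)
   qed
  qed
 qed
 show ?thesis
 proof (rule that[OF fm fK fbe])
  fix s t v assume st: "a <= s" "s <= t" "t <= b"
  have sub: "{s..t} <= {a..b}" using st by auto
  let ?u = "j v"
  have ms: "(%t. inner (z t) ?u) : meas s t" if "!!h. (%t. inner h (z t)) : borel_measurable ?M" for z :: "real => 'b"
   using meas_sub[OF that sub, of ?u] by (simp add: inner_commute)
  have bs: "AE ta in leb s t. abs(inner (z ta) ?u) <= K*norm ?u" if "AE t in ?M. norm (z t) <= K" for z
   using AE_sub[OF that st(1,3)] by eventually_elim (intro order_trans[OF Cauchy_Schwarz_ineq2] mult_right_mono, auto)
  have iz: "intg s t (%ta. inner (z ta) ?u)" if "z : mid_hull F k" for z k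
   by (rule intg_bounded[OF ms[OF hm[OF that]] bs[OF hK[OF that]]])
  have lim1: "(%i. LI s t (%ta. inner (g (r i) ta) ?u)) ----> LI s t (%ta. inner (f ta) ?u)"
  proof (rule integral_dominated_convergence[where w="%_. K*norm ?u"])
   show "AE ta in leb s t. (%i. inner (g (r i) ta) ?u) ----> inner (f ta) ?u"
    using AE_sub[OF r(2) st(1,3)] by eventually_elim (intro tendsto_inner tendsto_const)
   show "AE ta in leb s t. norm (inner (g (r i) ta) ?u) <= K*norm ?u" for i using bs[OF hK[OF g(1)]] by simp
  qed (use ms[OF fm] ms[OF hm[OF g(1)]] in auto)
  have lim2: "(%i. LI s t (%ta. inner (g (r i) ta) ?u)) ----> Ph s t v"
  proof (rule LIMSEQ_I)
   fix e :: real assume e: "0 < e"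
   obtain k where k: "!!n. k <= n ==> norm (LI s t (%r. inner (F n r) ?u) - Ph s t v) < e" using LIMSEQ_D[OF Ph[OF st] e] by blast
   \<comment> \<open>Closeness of the integrals to their limit is a convex condition, so it passes
     from the tail to its midpoints.\<close>
   have hull: "abs(LI s t (%r. inner (z r) ?u) - Ph s t v) < e" if "z : mid_hull F k" for z using that
   proof (induction rule: mid_hull.induct)
    case (mid z1 z2)
    have eq: "LI s t (%ta. inner ((1/2)*.(z1 ta + z2 ta)) ?u) = (LI s t (%ta. inner (z1 ta) ?u) + LI s t (%ta. inner (z2 ta) ?u))/2"
     using iz[OF mid.hyps(1)] iz[OF mid.hyps(2)] by (simp add: inner_add_left)
    have half: "abs((c + d)/2 - P) < e" if "abs(c - P) < e" "abs(d - P) < e" for c d P :: real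
     using that by (auto simp: abs_less_iff field_simps)
    show ?case unfolding eq by (rule half[OF mid.IH])
   qed (use k in simp)
   have "g (r i) : mid_hull F k" if "k <= i" for i
    using that seq_suble[OF r(1), of i] by (intro mid_hull_mono[OF _ g(1)]) linarith
   thus "EX no. ALL n>=no. norm (LI s t (%ta. inner (g (r n) ta) ?u) - Ph s t v) < e" using hull by (intro exI[of _ k]) simp
  qed
  show "LI s t (%r. inner (f r) ?u) = Ph s t v" by (rule LIMSEQ_unique[OF lim1 lim2])
 qed
qed

end

section \<open>A priori bounds, concatenation and compactness of trajectories\<close>

context evolution_operator
begin

text \<open>The Gronwall constant for \<open>1 + S^2\<close>, where \<open>S\<close> is the running
  supremum. Twice the work of the force is at most \<open>2*L*(1 + S)*S\<close>, hence at most
  \<open>4*L*(1 + S^2)\<close>; the rate \<open>4*L + 1\<close> stays positive for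
  \<open>L = 0\<close>. Finally \<open>S\<close> itself is at most \<open>1 + S^2\<close>.\<close>

definition a_priori :: "real => real => (real => 'b) => real" where
 "a_priori L t0 x0 = 2*(1 + (running_sup x0 t0)^2)*exp (2*(4*L + 1)*(T - t0))"

lemma trajectory_bound: assumes tr: "trj L t0 x0 x X X' f" and t0: "0 <= t0" "t0 < T" and L: "0 <= L" and t: "0 <= t" "t <= T"
 shows "norm (x t) <= running_sup x t" "running_sup x t <= a_priori L t0 x0"
proof -
 note D = trajectoryD[OF tr t0 L]
 have c: "cont 0 T x" by (rule paths_continuous[OF D(1)])
 have c0: "cont t0 T x" by (rule solvesD(1)[OF D(3)])
 define S where "S = running_sup x"
 have S: "0 <= S r" "norm (x r) <= S r" if "0 <= r" "r <= T" for r
  using running_sup_nonneg[OF c] norm_le_running_sup[OF c, of r r] that by (auto simp: S_def)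
 have Sc: "cont t0 T S" unfolding S_def by (rule continuous_on_subset[OF running_sup_continuous[OF c]]) (use t0 in auto)
 have S_eq: "S t0 = running_sup x0 t0" unfolding S_def running_sup_def using D(2) by (intro SUP_cong) auto
 define S0 where "S0 = running_sup x0 t0"
 define u where "u r = 1 + (S r)^2" for r
 have uc: "cont t0 T u" unfolding u_def by (intro continuous_intros Sc)
 have ui: "intg t0 T u" by (rule cont_intg[OF uc])
 have sq: "nsq (x s) <= S0^2 + 4*L*LI t0 r u" if sr: "0 <= s" "s <= r" "t0 <= r" "r <= T" for s r
 proof (cases "s <= t0")
  case True
  have "norm (x s) <= S0" using norm_le_running_sup[OF c, of s t0] True sr t0 S_eq by (simp add: S_def S0_def)
  hence "nsq (x s) <= S0^2" by (simp add: power_mono)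
  moreover have "0 <= 4*L*LI t0 r u" using L by (intro mult_nonneg_nonneg integral_nonneg_AE) (auto simp: u_def)
  ultimately show ?thesis by linarith
 next
  case False
  hence s: "t0 <= s" "s <= T" using sr by auto
  have "0 <= LI t0 s (%r. A r (X r) (X r))"
  proof -
   have V: "Vfun t0 s X" by (rule Vfun_subinterval[OF solvesD(2)[OF D(3)]]) (use s in auto)
   have "0 <= c2*LI t0 s (%r. norm (X r) powr p)" using c2 by (simp add: integral_nonneg_AE)
   also have "... <= LI t0 s (%r. A r (X r) (X r))" by (rule coercive_integral[OF V t0(1) s(2)])
   finally show ?thesis .
  qed
  hence "nsq (x s) <= nsq (x t0) + 2*LI t0 s (%r. inner (f r) (x r))"
   using solves_energy[OF D(3) t0 order_refl order_refl s] by linarith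
  also have "LI t0 s (%r. inner (f r) (x r)) <= LI t0 s (%r. 2*L*u r)"
  proof (rule LI_mono_AE)
   show "intg t0 s (%r. inner (f r) (x r))" "intg t0 s (%r. 2*L*u r)" using forced_intg[OF D(3) c0] ui s by (auto intro: intg_sub)
   show "AE r in leb t0 s. inner (f r) (x r) <= 2*L*u r" using AE_sub[OF D(4) order_refl s(2)] AE_space
   proof eventually_elim
    case (elim r)
    hence r: "0 <= r" "r <= T" using s t0 by auto
    have "S r <= 1 + (S r)^2" using zero_le_power2[of "S r - 1"] S(1)[OF r] by (simp add: power2_eq_square algebra_simps)
    have "inner (f r) (x r) <= norm (f r)*norm (x r)" by (rule norm_cauchy_schwarz)
    also have "... <= (L*(1 + S r))*S r" using elim(1) S[OF r] L by (intro mult_mono) (auto simp: S_def)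
    also have "... = L*(S r + (S r)^2)" by (simp add: power2_eq_square algebra_simps)
    also have "... <= L*(2*u r)" using `S r <= 1 + (S r)^2` L by (intro mult_left_mono) (auto simp: u_def)
    finally show ?case by (simp add: mult_ac)
   qed
  qed
  also have "... = 2*L*LI t0 s u" by simp
  also have "... <= 2*L*LI t0 r u"
  proof (intro mult_left_mono LI_mono_subset)
   show "intg t0 r u" using ui sr by (rule_tac intg_sub) auto
  qed (use sr L in "auto simp: u_def")
  finally have "nsq (x s) <= nsq (x t0) + 4*L*LI t0 r u" by simp
  moreover have "norm (x t0) <= S0" using S(2)[of t0] S_eq t0 by (simp add: S0_def)
  hence "nsq (x t0) <= S0^2" by (simp add: power_mono)
  ultimately show ?thesis by linarith
 qed
 have up: "u r <= (1 + S0^2) + (4*L + 1)*LI t0 r u" if r: "r : {t0..T}" for r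
 proof -
  define B where "B = S0^2 + 4*L*LI t0 r u"
  have B: "nsq (x s) <= B" if "0 <= s" "s <= r" for s unfolding B_def using sq[OF that] r by simp
  have "0 <= B" using B[of 0] t0 r zero_le_power2[of "norm (x 0)"] by (metis atLeastAtMost_iff order_refl order_trans)
  have "S r <= sqrt B" unfolding S_def by (rule running_sup_le) (use r t0 B in "auto intro!: real_le_rsqrt")
  hence "(S r)^2 <= (sqrt B)^2" using S(1)[of r] r t0 by (intro power_mono) auto
  hence "(S r)^2 <= B" using `0 <= B` by simp
  moreover have "0 <= LI t0 r u" by (intro integral_nonneg_AE) (auto simp: u_def)
  ultimately show ?thesis by (simp add: u_def[of r] B_def algebra_simps)
 qed
 obtain Bu where Bu: "!!r. r : {t0..T} ==> norm (u r) <= Bu" using Icc_bounded[OF uc] by blast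
 have main: "S r <= a_priori L t0 x0" if "r : {t0..T}" for r
 proof -
  have "u r <= 2*(1 + S0^2)*exp (2*(4*L + 1)*(T - t0))"
  proof (rule Gronwall[OF _ _ ui _ up that])
   show "0 <= u t & u t <= Bu" if "t : {t0..T}" for t using Bu[OF that] by (simp add: u_def)
  qed (use L in auto)
  moreover have "S r <= u r" using zero_le_power2[of "S r - 1"] S(1)[of r] that t0 by (simp add: u_def power2_eq_square algebra_simps)
  ultimately show ?thesis by (simp add: a_priori_def S0_def)
 qed
 show "norm (x t) <= running_sup x t" using S(2)[OF t] by (simp add: S_def)
 show "running_sup x t <= a_priori L t0 x0"
 proof (cases "t0 <= t")
  case True
  thus ?thesis using main[of t] t by (simp add: S_def)
 next
  case False
  hence "S t <= S t0" unfolding S_def using t t0 by (intro running_sup_mono[OF c]) auto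
  thus ?thesis using main[of t0] t0 by (simp add: S_def)
 qed
qed

lemma a_priori_nonneg: "0 <= a_priori L t0 x0" by (simp add: a_priori_def)

lemma trajectory_force_bound: assumes tr: "trj L t0 x0 x X X' f" and t0: "0 <= t0" "t0 < T" and L: "0 <= L"
 shows "AE t in leb t0 T. norm (f t) <= L*(1 + a_priori L t0 x0)" using trajectoryD(4)[OF tr t0 L] AE_space
proof eventually_elim
 case (elim t)
 hence "running_sup x t <= a_priori L t0 x0" using trajectory_bound(2)[OF tr t0 L] t0 by simp
 hence "L*(1 + running_sup x t) <= L*(1 + a_priori L t0 x0)" using L by (intro mult_left_mono) auto
 thus ?case using elim(1) by linarith
qed

lemma trajectory_V_bound: assumes tr: "trj L t0 x0 x X X' f" and t0: "0 <= t0" "t0 < T" and L: "0 <= L"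
 shows "c2*LI t0 T (%t. norm (X t) powr p) <= (a_priori L t0 x0)^2 + L*(1 + a_priori L t0 x0)*a_priori L t0 x0*T"
proof -
 define M where "M = a_priori L t0 x0"
 have M: "0 <= M" by (simp add: M_def a_priori_nonneg)
 note D = trajectoryD[OF tr t0 L]
 have xM: "norm (x t) <= M" if "t : {t0..T}" for t using trajectory_bound[OF tr t0 L, of t] that t0 by (simp add: M_def)
 have "c2*LI t0 T (%t. norm (X t) powr p) <= LI t0 T (%r. A r (X r) (X r))"
  by (rule coercive_integral[OF solvesD(2)[OF D(3)] t0(1) order_refl])
 also have "... <= nsq (x t0)/2 + LI t0 T (%r. inner (f r) (x r))"
  using solves_energy[OF D(3) t0 order_refl order_refl less_imp_le[OF t0(2)] order_refl] zero_le_power2[of "norm (x T)"] by linarith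
 also have "LI t0 T (%r. inner (f r) (x r)) <= LI t0 T (%_. L*(1 + M)*M)"
 proof (rule LI_mono_AE[OF forced_intg[OF D(3) solvesD(1)[OF D(3)]]])
  show "AE r in leb t0 T. inner (f r) (x r) <= L*(1 + M)*M" using trajectory_force_bound[OF tr t0 L, folded M_def] AE_space
  proof eventually_elim
   case (elim r)
   thus ?case using L M xM[of r] by (intro order_trans[OF norm_cauchy_schwarz] mult_mono) auto
  qed
 qed simp
 also have "... = L*(1 + M)*M*(T - t0)" using t0 by (simp add: LI_const)
 also have "... <= L*(1 + M)*M*T" using t0 L M by (intro mult_left_mono) auto
 also have "nsq (x t0)/2 <= M^2"
 proof -
  have "norm (x t0) <= M" using xM[of t0] t0 by simp
  hence "nsq (x t0) <= M^2" by (rule power_mono) simp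
  thus ?thesis using zero_le_power2[of "norm (x t0)"] by linarith
 qed
 finally show ?thesis by (simp add: M_def)
qed

theorem trajectories_nonempty: assumes t0: "0 <= t0" "t0 < T" and L: "0 <= L" and x0: "x0 : paths T"
 obtains x where "x : trjs L t0 x0"
proof -
 interpret E: implicit_Euler j p q T A a1 c1 c2 t0 T "x0 t0" by unfold_locales (use t0 in auto)
 obtain x X where x: "cont t0 T x" "x t0 = x0 t0" "Vfun t0 T X" "AE t in leb t0 T. x t = j (X t)"
  "!!s t v. t0 <= s ==> s <= t ==> t <= T ==> inner (x t - x s) (j v) = - LI s t (%r. A r (X r) v)"
  by (rule E.solution_exists) blast
 obtain z where zp: "z : paths T" and z0: "!!t. t <= t0 ==> z t = x0 t" and zx: "!!t. t : {t0..T} ==> z t = x t"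
  by (rule extend_path[OF x0 x(1,2) t0]) blast
 have c1: "cont t0 T z" by (rule continuous_on_eq[OF x(1)]) (use zx in auto)
 have s: "solves t0 T z X (%_. 0)" unfolding solves_def
 proof (intro conjI allI impI)
  show "AE t in leb t0 T. z t = j (X t)" using x(4) AE_space by eventually_elim (use zx in auto)
  fix s t v assume "t0 <= s" "s <= t" "t <= T"
  thus "inner (z t - z s) (j v) = LI s t (%r. (to_dual j 0 - A r (X r)) v)"
   using x(5)[of s t v] zx by (simp add: blinfun.minus_left)
 qed (use c1 x in auto)
 have "trj L t0 x0 z X (%t. to_dual j 0 - A t (X t)) (%_. 0)"
 proof (rule trajectoryI[OF zp _ s _ t0])
  show "AE t in leb t0 T. norm (0::'b) <= L*(1 + running_sup z t)"
   using L running_sup_nonneg[OF paths_continuous[OF zp]] t0 by (intro AE_I2) simp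
 qed (rule z0)
 thus ?thesis using that unfolding trajectories_def by blast
qed

lemma trajectories_restrict: assumes t0: "0 <= t0" "t0 <= t1" "t1 < T" and L: "0 <= L" and x: "x : trjs L t0 x0"
 shows "x : trjs L t1 x"
proof -
 have t0T: "t0 < T" using t0 by simp
 obtain X X' f where tr: "trj L t0 x0 x X X' f" using x unfolding trajectories_def by blast
 note D = trajectoryD[OF tr t0(1) t0T L]
 have "trj L t1 x x X (%t. to_dual j (f t) - A t (X t)) f"
  by (rule trajectoryI[OF D(1) refl solves_subinterval[OF D(3) t0(2) order_refl] AE_sub[OF D(4) t0(2) order_refl]])
   (use t0 in auto)
 thus ?thesis unfolding trajectories_def by blast
qed

lemma trajectories_glue: assumes t0: "0 <= t0" "t0 <= t1" "t1 < T" and L: "0 <= L" and x: "x : trjs L t0 x0"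
  and y: "y : trjs L t1 x" shows "y : trjs L t0 x0"
proof -
 have t0T: "t0 < T" "0 <= t1" using t0 by auto
 obtain X X' f where tx: "trj L t0 x0 x X X' f" using x unfolding trajectories_def by blast
 obtain Y Y' g where ty: "trj L t1 x y Y Y' g" using y unfolding trajectories_def by blast
 note D = trajectoryD[OF tx t0(1) t0T(1) L] and E = trajectoryD[OF ty t0T(2) t0(3) L]
 define Z where "Z t = (if t <= t1 then X t else Y t)" for t
 define h where "h t = (if t <= t1 then f t else g t)" for t
 have t1: "t0 <= t1" "t1 <= T" using t0 by auto
 have "solves t0 t1 y Z h"
  by (rule solves_cong[OF solves_subinterval[OF D(3) order_refl t1(2)] t0(1) t1(2)]) (use E(2) t0 in "auto simp: Z_def h_def")
 moreover have "AE t in leb t1 T. t ~= t1" using AE_lebesgue_neq[of t1] by (auto simp: AE_on_iff elim: eventually_mono)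
 hence late: "AE t in leb t1 T. Y t = Z t & g t = h t" using AE_space by eventually_elim (auto simp: Z_def h_def)
 have "solves t1 T y Z h" by (rule solves_cong[OF E(3) t0T(2) order_refl refl late])
 ultimately have s: "solves t0 T y Z h" using solves_combine t0(1) t1 by blast
 have "trj L t0 x0 y Z (%t. to_dual j (h t) - A t (Z t)) h"
 proof (rule trajectoryI[OF E(1) _ s interval_combine(1)[OF t1] t0(1) t0T(1)])
  show "y t = x0 t" if "0 <= t" "t <= t0" for t using that E(2)[of t] D(2)[of t] t0 by simp
  show "AE t in leb t0 t1. norm (h t) <= L*(1 + running_sup y t)" using AE_sub[OF D(4) order_refl t1(2)] AE_space
  proof eventually_elim
   case (elim t)
   hence "running_sup y t = running_sup x t" unfolding running_sup_def using E(2) by (intro SUP_cong) auto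
   thus ?case using elim by (simp add: h_def)
  qed
  show "AE t in leb t1 T. norm (h t) <= L*(1 + running_sup y t)" using E(4) late by eventually_elim auto
 qed
 thus ?thesis unfolding trajectories_def by blast
qed

text \<open>The supremum distance of two trajectories with equal start is controlled by their
  \<open>L^1\<close> distance; this upgrades \<open>strong_L1_limit\<close> to uniform
  convergence.\<close>

lemma traj_difference: assumes D: "solves t0 T x X f" "solves t0 T y Y g" and t0: "0 <= t0" "t0 < T" and t: "t0 <= t" "t <= T"
  and K: "AE t in leb t0 T. norm (f t) <= K" "AE t in leb t0 T. norm (g t) <= K"
 shows "nsq (x t - y t) <= nsq (x t0 - y t0) + 4*K*LI t0 t (%r. norm (x r - y r))"
proof -
 have c: "cont t0 T (%r. x r - y r)" by (intro continuous_intros solvesD(1)[OF D(1)] solvesD(1)[OF D(2)])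
 have "nsq (x t - y t) - nsq (x t0 - y t0) <= 2*LI t0 t (%r. inner (f r - g r) (x r - y r))"
  by (rule solves_difference[OF D t0 order_refl order_refl t])
 also have "LI t0 t (%r. inner (f r - g r) (x r - y r)) <= LI t0 t (%r. 2*K*norm (x r - y r))"
 proof (rule LI_mono_AE)
  have "intg t0 T (%r. inner (f r - g r) (x r - y r))"
   unfolding inner_diff_left by (intro intg_diff forced_intg[OF D(1)] forced_intg[OF D(2)] c)
  thus "intg t0 t (%r. inner (f r - g r) (x r - y r))" by (rule intg_sub) (use t in auto)
  have "intg t0 T (%r. 2*K*norm (x r - y r))" by (intro cont_intg continuous_intros c)
  thus "intg t0 t (%r. 2*K*norm (x r - y r))" by (rule intg_sub) (use t in auto)
  show "AE r in leb t0 t. inner (f r - g r) (x r - y r) <= 2*K*norm (x r - y r)"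
   using AE_sub[OF K(1) order_refl t(2)] AE_sub[OF K(2) order_refl t(2)]
  proof eventually_elim
   case (elim r)
   hence "norm (f r - g r) <= 2*K" using norm_triangle_ineq4[of "f r" "g r"] by simp
   thus ?case by (intro order_trans[OF norm_cauchy_schwarz] mult_right_mono) auto
  qed
 qed
 finally show ?thesis by simp
qed

text \<open>Weak compactness gives \<open>L^1\<close> convergence, and
  \<open>traj_difference\<close> makes it uniform. Minty's argument identifies the operator term.
  The limit force comes from \<open>weak_L2_limit\<close>, which preserves the pointwise bound
  relative to the running supremum of the limit.\<close>

theorem trajectories_compact: assumes t0: "0 <= t0" "t0 < T" and L: "0 <= L" and x0: "x0 : paths T"
  and y: "!!n. y n : trjs L t0 x0" obtains r :: "nat => nat" and x where "strict_mono r" "x : trjs L t0 x0"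
  "!!e. 0 < e ==> EX N. ALL n>=N. ALL t:{0..T}. norm (y (r n) t - x t) <= e"
proof -
 have "EX X X' f. trj L t0 x0 (y n) X X' f" for n using y[of n] by (simp add: trajectories_def)
 then obtain X X' f where tr: "!!n. trj L t0 x0 (y n) (X n) (X' n) (f n)" by metis
 note D = trajectoryD[OF tr t0 L]
 define M where "M = a_priori L t0 x0"
 define K where "K = L*(1 + M)"
 have M0: "0 <= M" unfolding M_def by (rule a_priori_nonneg)
 have K0: "0 <= K" using L M0 by (simp add: K_def)
 define CX where "CX = (M^2 + K*M*T) / c2"
 have XC: "LI t0 T (%t. norm (X n t) powr p) <= CX" for n
  using trajectory_V_bound[OF tr t0 L, of n] c2 unfolding CX_def K_def M_def by (simp add: pos_le_divide_eq mult.commute)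
 have yM: "norm (y n t) <= M" if "t : {t0..T}" for n t using trajectory_bound[OF tr t0 L, of t n] that t0 unfolding M_def by simp
 have fK: "AE t in leb t0 T. norm (f n t) <= K" for n using trajectory_force_bound[OF tr t0 L, of n] unfolding K_def M_def .
 have ym: "(%t. inner h (y n t)) : meas t0 T" for n h by (intro meas_intg[OF cont_intg] continuous_intros solvesD(1)[OF D(3)])
 note SD = solves_Dfun[OF D(3) t0(1) order_refl]
 have inc: "inner (y n t - y n s) (j v) = LI s t (%r. rhs (f n) (X n) r v)"
  if "t0 <= s" "s <= t" "t <= T" for n s t v by (rule solvesD(5)[OF D(3) that])
 have start: "y n t0 = x0 t0" for n using D(2)[of t0 n] t0 by simp
 interpret B: bounded_solutions j p q T A a1 c1 c2 t0 T M CX K y X f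
 proof unfold_locales
  show "increments j t0 T y (%n. rhs (f n) (X n)) et" if "0 < et" for et using that inc by simp
  have "2*LI t0 T (%t. A t (X n t) (X n t)) =
    nsq (y n t0) - nsq (y n T) + 2*LI t0 T (%t. inner (f n t) (y n t))" for n
   using solves_energy[OF D(3) t0 order_refl order_refl less_imp_le[OF t0(2)] order_refl, of n] by linarith
  thus "EX n0. ALL n>=n0. 2*LI t0 T (%t. A t (X n t) (X n t))
    <= nsq (y n t0) - nsq (y n T) + 2*LI t0 T (%t. inner (f n t) (y n t)) + et" if "0 < et" for et using that by simp
 qed (use t0 yM fK ym in "simp_all add: solvesD[OF D(3)] XC")
 obtain r1 x Z where r1: "strict_mono r1" and xa: "x t0 = x0 t0"
  and S: "approx_solutions j p q T A a1 c1 c2 t0 T M CX K (%n. y (r1 n)) (%n. X (r1 n)) (%n. f (r1 n)) Z x"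
  using B.limit_exists[OF start] by blast
 interpret lim: approx_solutions j p q T A a1 c1 c2 t0 T M CX K "%n. y (r1 n)" "%n. X (r1 n)" "%n. f (r1 n)" Z x by (rule S)
 define e where "e n = LI t0 T (%t. norm (y (r1 n) t - x t))" for n
 have e: "e ----> 0" unfolding e_def[abs_def] by (rule lim.strong_L1_limit(2))
 have e0: "0 <= e n" for n unfolding e_def by (rule integral_nonneg_AE) simp
 have pair: "nsq (y (r1 n) t - y (r1 m) t) <= 4*K*(e n + e m)" if t: "t : {t0..T}" for n m t
 proof -
  have t': "t0 <= t" "t <= T" using t by auto
  have i: "intg t0 T (%r. norm (y (r1 n) r - y (r1 m) r))" by (intro cont_intg continuous_intros solvesD(1)[OF D(3)])
  have "LI t0 t (%r. norm (y (r1 n) r - y (r1 m) r)) <= LI t0 T (%r. norm (y (r1 n) r - y (r1 m) r))"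
   by (rule LI_mono_subset[OF i]) (use t' in auto)
  also have "... <= LI t0 T (%r. norm (y (r1 n) r - x r) + norm (y (r1 m) r - x r))"
   using lim.strong_L1_limit(1) by (intro LI_mono_AE[OF i] AE_I2) (auto, metis dist_norm dist_triangle3 dist_commute)
  also have "... = e n + e m" unfolding e_def using lim.strong_L1_limit(1) by simp
  finally have "4*K*LI t0 t (%r. norm (y (r1 n) r - y (r1 m) r)) <= 4*K*(e n + e m)" using K0 by (intro mult_left_mono) auto
  thus ?thesis using traj_difference[OF D(3) D(3) t0 t' fK fK, of "r1 n" "r1 m"] by (simp add: start)
 qed
 \<comment> \<open>The second index is sent to infinity inside a scalar product with the difference
   itself, because pointwise convergence is known only weakly.\<close>
 have unif: "norm (y (r1 n) t - x t) <= sqrt (4*K*e n)" if t: "t : {t0..T}" for n t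
 proof -
  define d where "d = y (r1 n) t - x t"
  have "(%m. inner d (y (r1 n) t) - inner d (y (r1 m) t)) ----> inner d (y (r1 n) t) - inner d (x t)"
   by (intro tendsto_diff tendsto_const lim.weak' t)
  hence l1: "(%m. inner d (y (r1 n) t - y (r1 m) t)) ----> norm d*norm d"
   by (simp add: inner_diff_right[symmetric] d_def[symmetric] dot_square_norm power2_eq_square)
  have l2: "(%m. norm d * sqrt (4*K*(e n + e m))) ----> norm d * sqrt (4*K*(e n + 0))" by (intro tendsto_intros e)
  have "norm d*norm d <= norm d * sqrt (4*K*(e n + 0))"
  proof (rule LIMSEQ_le[OF l1 l2], intro exI allI impI)
   fix m
   have "norm (y (r1 n) t - y (r1 m) t) <= sqrt (4*K*(e n + e m))" using pair[OF t] by (rule real_le_rsqrt)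
   thus "inner d (y (r1 n) t - y (r1 m) t) <= norm d * sqrt (4*K*(e n + e m))"
    by (intro order_trans[OF norm_cauchy_schwarz] mult_left_mono) auto
  qed
  hence "norm d <= sqrt (4*K*e n)" using K0 e0[of n] by (cases "norm d = 0") auto
  thus ?thesis by (simp add: d_def)
 qed
 obtain z where zp: "z : paths T" and z0: "!!t. t <= t0 ==> z t = x0 t" and zx: "!!t. t : {t0..T} ==> z t = x t"
  by (rule extend_path[OF x0 lim.x_continuous xa t0]) blast
 have unif': "norm (y (r1 n) t - z t) <= sqrt (4*K*e n)" if "t : {0..T}" for n t
 proof (cases "t <= t0")
  case True
  hence "y (r1 n) t = z t" using D(2)[of t] that by (simp add: z0)
  thus ?thesis using K0 e0 by simp
 next
  case False
  thus ?thesis using unif[of t n] zx[of t] that by simp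
 qed
 have "(%n. sqrt (4*K*e n)) ----> sqrt (4*K*0)" by (intro tendsto_intros e)
 hence s0: "(%n. sqrt (4*K*e n)) ----> 0" by simp
 have conv: "EX N. ALL n>=N. ALL t:{0..T}. norm (y (r1 n) t - z t) <= ep" if "0 < ep" for ep
 proof -
  obtain N where "!!n. N <= n ==> norm (sqrt (4*K*e n) - 0) < ep" using LIMSEQ_D[OF s0 `0 < ep`] by blast
  thus ?thesis using unif' by (intro exI[of _ N]) (metis abs_le_D1 diff_zero less_imp_le order_trans real_norm_def)
 qed
 obtain r2 :: "nat => nat" where r2: "strict_mono r2"
  "!!s t v. t0 <= s ==> s <= t ==> t <= T ==> (%n. LI s t (%r'. A r' (X (r1 (r2 n)) r') v)) ----> LI s t (%r'. A r' (Z r') v)"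
  by (rule lim.operator_limit) blast
 define r where "r n = r1 (r2 n)" for n
 have r: "strict_mono r" unfolding r_def[abs_def] using strict_mono_o[OF r1 r2(1)] by (simp add: comp_def)
 have convr: "EX N. ALL n>=N. ALL t:{0..T}. norm (y (r n) t - z t) <= ep" if "0 < ep" for ep
 proof -
  obtain N where N: "!!n t. N <= n ==> t : {0..T} ==> norm (y (r1 n) t - z t) <= ep" using conv[OF `0 < ep`] by blast
  have "N <= r2 n" if "N <= n" for n using seq_suble[OF r2(1), of n] that by linarith
  thus ?thesis using N unfolding r_def by blast
 qed
 define be where "be t = L*(1 + running_sup z t)" for t
 \<comment> \<open>The limit of the force integrals is read off from the equation: increments and
   operator integrals converge, hence so does what remains. A function with these integrals then
   satisfies the limit equation by construction.\<close>
 define Ph where "Ph s t v = inner (x t - x s) (j v) + LI s t (%r'. A r' (Z r') v)" for s t v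
 obtain g where g: "!!h. (%t. inner h (g t)) : meas t0 T"
  "AE t in leb t0 T. norm (g t) <= K" "AE t in leb t0 T. norm (g t) <= be t"
  "!!s t v. t0 <= s ==> s <= t ==> t <= T ==> LI s t (%r. inner (g r) (j v)) = Ph s t v"
 proof (rule weak_L2_limit[OF less_imp_le[OF t0(2)], where F="%n. f (r n)" and K=K and be=be and Ph=Ph])
  show "(%t. inner h (f (r n) t)) : meas t0 T" for n h by (rule solvesD(4)[OF D(3)])
  show "AE t in leb t0 T. norm (f (r n) t) <= K" for n by (rule fK)
  fix ep :: real assume ep: "0 < ep"
  have "0 < ep/(L + 1)" using ep L by simp
  then obtain N where N: "!!n t. N <= n ==> t : {0..T} ==> norm (y (r n) t - z t) <= ep/(L + 1)" using convr by blast
  have "L*(ep/(L + 1)) <= ep" using ep L by (simp add: field_simps)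
  have "AE t in leb t0 T. norm (f (r n) t) <= be t + ep" if n: "N <= n" for n using D(4)[of "r n"] AE_space
  proof eventually_elim
   case (elim t)
   have "running_sup (y (r n)) t <= running_sup z t + ep/(L + 1)"
    by (rule running_sup_diff_le[OF paths_continuous[OF D(1)] paths_continuous[OF zp]]) (use elim t0 N[OF n] in auto)
   hence "L*(1 + running_sup (y (r n)) t) <= L*(1 + (running_sup z t + ep/(L + 1)))" using L by (intro mult_left_mono) auto
   also have "... <= be t + ep" using `L * (ep / (L + 1)) <= ep` by (simp add: be_def distrib_left)
   finally show ?case using elim(1) by linarith
  qed
  thus "EX k. ALL n>=k. AE t in leb t0 T. norm (f (r n) t) <= be t + ep" by blast
 next
  fix s t v assume st: "t0 <= s" "s <= t" "t <= T"
  have eq: "LI s t (%r. inner (f n r) (j v)) = inner (y n t - y n s) (j v) + LI s t (%r'. A r' (X n r') v)" for n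
  proof -
   have "LI s t (%r. rhs (f n) (X n) r v) = LI s t (%r. to_dual j (f n r) v) - LI s t (%r'. A r' (X n r') v)"
    by (rule LI_Dfun_diff[OF SD(1,2) st(1,3)])
   thus ?thesis using inc[OF st, of n v] by simp
  qed
  have "(%n. inner (j v) (y (r1 n) t) - inner (j v) (y (r1 n) s)) ----> inner (j v) (x t) - inner (j v) (x s)"
   using st by (intro tendsto_diff lim.weak') auto
  from LIMSEQ_subseq_LIMSEQ[OF this r2(1)]
  have "(%n. inner (y (r n) t - y (r n) s) (j v)) ----> inner (x t - x s) (j v)"
   unfolding inner_commute[of _ "j v"] inner_diff_right by (simp add: comp_def r_def)
  thus "(%n. LI s t (%r'. inner (f (r n) r') (j v))) ----> Ph s t v"
   unfolding eq Ph_def by (rule tendsto_add) (use r2(2)[OF st, of v] in "simp add: r_def")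
 qed blast
 have sol: "solves t0 T z Z g" unfolding solves_def
 proof (intro conjI allI impI)
  show "AE t in leb t0 T. z t = j (Z t)" using lim.xX' AE_space by eventually_elim (use zx in auto)
  fix s t v assume st: "t0 <= s" "s <= t" "t <= T"
  have "LI s t (%r. rhs g Z r v) = LI s t (%r. to_dual j (g r) v) - LI s t (%r'. A r' (Z r') v)"
   by (rule LI_Dfun_diff[OF to_dual_Dfun(1)[OF g(1,2)] lim.AX_Dfun st(1,3)])
  thus "inner (z t - z s) (j v) = LI s t (%r. rhs g Z r v)" using g(4)[OF st, of v] zx[of s] zx[of t] st by (simp add: Ph_def)
 next
  show "cont t0 T z" by (rule continuous_on_eq[OF lim.x_continuous]) (use zx in auto)
 qed (use lim.X' g in blast)+
 have "trj L t0 x0 z Z (%t. to_dual j (g t) - A t (Z t)) g" by (rule trajectoryI[OF zp _ sol g(3)[unfolded be_def] t0]) (rule z0)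
 hence "z : trjs L t0 x0" unfolding trajectories_def by blast
 thus ?thesis using that[OF r _ convr] by blast
qed

end

section \<open>Test functions and maxima\<close>

lemma d_infty_pair_ge:
 fixes x y x' y' :: "real => 'b::real_normed_vector"
 assumes p: "x : paths T" "y : paths T" "x' : paths T" "y' : paths T" and ts: "t : {0..T}" "s : {0..T}"
 defines "d == d_infty_pair T (t, x, y) (s, x', y')" shows "abs(t - s) <= d" "norm (x t - x' s) <= d" "norm (y t - y' s) <= d"
proof -
 define D where "D r = norm ((x (min r t), y (min r t)) - (x' (min r s), y' (min r s)))" for r
 have cm: "cont 0 T (%r. z (min r u))" if "z : paths T" "u : {0..T}" for z :: "real => 'b" and u
  by (rule continuous_on_compose2[OF paths_continuous[OF that(1)]]) (use that in "auto intro!: continuous_intros")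
 have "cont 0 T D" unfolding D_def by (intro continuous_intros cm p ts)
 then obtain B where B: "!!r. r : {0..T} ==> norm (D r) <= B" using Icc_bounded by blast
 have bdd: "bdd_above (D ` {0..T})" using B by (intro bdd_aboveI2[where M=B]) (auto simp: D_def)
 have d: "d = abs(t - s) + (SUP r\<in>{0..T}. D r)" by (simp add: d_def d_infty_pair_def d_infty_def D_def)
 have DT: "D T <= (SUP r\<in>{0..T}. D r)" by (rule cSUP_upper[OF _ bdd]) (use ts in auto)
 have T: "D T = norm (x t - x' s, y t - y' s)" using ts by (simp add: D_def)
 have n: "norm u <= norm (u, v)" "norm v <= norm (u, v)" for u v :: 'b using norm_fst_le[of u v] norm_snd_le[of v u] by auto
 have "0 <= (SUP r\<in>{0..T}. D r)" by (rule order_trans[OF _ DT]) (simp add: D_def)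
 thus "abs(t - s) <= d" using d by simp
 show "norm (x t - x' s) <= d" "norm (y t - y' s) <= d"
  using d DT n(1)[of "x t - x' s" "y t - y' s"] n(2)[of "y t - y' s" "x t - x' s"] unfolding T by linarith+
qed

lemma d_infty_pair_le:
 fixes x y x' y' :: "real => 'b::real_normed_vector"
 assumes T: "0 <= T" and b: "!!r. r : {0..T} ==> norm (x (min r t) - x' (min r s)) <= e" "!!r. r : {0..T} ==> norm (y (min r t) - y' (min r s)) <= e"
 shows "d_infty_pair T (t, x, y) (s, x', y') <= abs(t - s) + 2*e"
proof -
 have "(SUP r\<in>{0..T}. norm ((x (min r t), y (min r t)) - (x' (min r s), y' (min r s)))) <= 2*e"
 proof (rule cSUP_least)
  fix r assume r: "r : {0..T}"
  show "norm ((x (min r t), y (min r t)) - (x' (min r s), y' (min r s))) <= 2*e"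
   using b[OF r] norm_Pair_le[of "x (min r t) - x' (min r s)" "y (min r t) - y' (min r s)"] by simp
 qed (use T in auto)
 thus ?thesis by (simp add: d_infty_pair_def d_infty_def)
qed

lemma pm_continuous_evaluation:
 fixes Ps :: "real \<times> 'b::real_normed_vector \<times> 'b => 'c::metric_space"
 assumes Ps: "continuous_on UNIV Ps" and t': "0 <= t'"
 shows "pm_continuous_on (d_infty_pair T) ({t'..T} \<times> paths T \<times> paths T) (%(t, x, y). Ps (t, x t, y t))"
 unfolding pm_continuous_on_def
proof (clarify)
 fix t ep :: real and x y :: "real => 'b"
 assume t: "t : {t'..T}" and xy: "x : paths T" "y : paths T" and ep: "0 < ep"
 obtain de where de: "0 < de" "!!z. dist z (t, x t, y t) < de ==> dist (Ps z) (Ps (t, x t, y t)) < ep"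
  using Ps ep unfolding continuous_on_iff by (metis UNIV_I)
 show "EX de>0. ALL b:{t'..T} \<times> paths T \<times> paths T. d_infty_pair T (t, x, y) b < de -->
  dist (case b of (t, x, y) => Ps (t, x t, y t)) (Ps (t, x t, y t)) < ep"
 proof (intro exI[of _ "de/3"] conjI ballI impI)
  fix b assume b: "b : {t'..T} \<times> paths T \<times> paths T" "d_infty_pair T (t, x, y) b < de/3"
  obtain s x' y' where b': "b = (s, x', y')" using prod_cases3 by blast
  have "s : {0..T}" "t : {0..T}" "x' : paths T" "y' : paths T" using b b' t t' by auto
  note ge = d_infty_pair_ge[OF xy this(3,4,2,1)]
  have "dist (s, x' s, y' s) (t, x t, y t) <= dist s t + (dist (x' s) (x t) + dist (y' s) (y t))"
   unfolding dist_norm using norm_Pair_le[of "s - t" "(x' s - x t, y' s - y t)"] norm_Pair_le[of "x' s - x t" "y' s - y t"] by simp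
  also have "... < de" using ge b(2) unfolding b' by (simp add: dist_norm norm_minus_commute)
  finally show "dist (case b of (t, x, y) => Ps (t, x t, y t)) (Ps (t, x t, y t)) < ep" using de(2) by (simp add: b')
 qed (use de in simp)
qed

context evolution_exponents
begin

lemma quadratic_chain_rule: assumes W: "W_pq j p q a T X X'" and aT: "a < T" and x: "cont a T x"
  and xX: "AE t in lebesgue_on {a<..<T}. x t = j (X t)" and t: "a <= t" "t <= T"
 shows "has_bochner_integral (leb a t) (%s. X' s (in_V j ((2*ka)*.x s + j nu)))
  (ka*(nsq (x t) - nsq (x a)) + inner (x t - x a) (j nu))"
proof -
 note D = W_pqD[OF W aT]
 note inc = D(3)[OF x xX]
 have xX': "AE t in leb a T. x t = j (X t)" using xX by (simp add: AE_open_iff)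
 have V: "Vfun a T (%s. (2*ka)*.X s + nu)" by (intro Vfun_add Vfun_scaleR Vfun_const D(1))
 have eq: "AE s in leb a t. X' s ((2*ka)*.X s + nu) = X' s (in_V j ((2*ka)*.x s + j nu))"
  using AE_sub[OF xX' order_refl t(2)] by eventually_elim (simp flip: blinfun.add_right blinfun.scaleR_right)
 have i: "intg a t (%s. X' s ((2*ka)*.X s + nu))" by (rule intg_sub[OF pair_intg[OF D(2) V] order_refl t(2)])
 have m: "(%s. X' s (in_V j ((2*ka)*.x s + j nu))) : meas a t" by (rule meas_AE[OF meas_intg[OF i] _ eq]) simp
 have i2: "intg a t (%s. X' s (X s))" "intg a t (%s. X' s nu)"
  by (rule intg_sub[OF _ order_refl t(2)], rule pair_intg[OF D(2,1)] Dfun_apply[OF D(2)])+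
 have "LI a t (%s. X' s ((2*ka)*.X s + nu)) = 2*ka*LI a t (%s. X' s (X s)) + LI a t (%s. X' s nu)"
  using i2 by (simp add: blinfun.add_right blinfun.scaleR_right)
 also have "... = ka*(nsq (x t) - nsq (x a)) + inner (x t - x a) (j nu)"
  using chain_rule_square[OF aT D(1) xX' D(2) x inc order_refl t] inc[OF order_refl t] by simp
 finally have "has_bochner_integral (leb a t) (%s. X' s ((2*ka)*.X s + nu))
  (ka*(nsq (x t) - nsq (x a)) + inner (x t - x a) (j nu))" using i by (simp add: has_bochner_integral_iff)
 thus ?thesis using has_bochner_integral_cong_AE[OF meas_intg[OF i] m eq] by simp
qed

text \<open>A sum of functions of one path each: the gradient \<open>(2*ka)*.x t + j nu\<close> lies
  in \<open>V\<close> as soon as \<open>x t\<close> does, independently of \<open>y\<close>. The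
  linear part carries the midpoint, \<open>be\<close> is the slope in time and \<open>al\<close>
  adjusts the value at the touching point.\<close>

definition quad_test :: "real => real => real => 'a => real => (real => 'b) => (real => 'b) => real" where
 "quad_test al be ka nu t x y = al + be*t + ka*(nsq (x t) + nsq (y t)) + inner (x t + y t) (j nu)"

lemma quad_test_derivatives: assumes t': "0 <= t'" shows "path_derivatives T p q j t' (quad_test al be ka nu) (%_ _ _. be)
  (%t x y. (2*ka)*.x t + j nu) (%t x y. (2*ka)*.y t + j nu)" unfolding path_derivatives_def Let_def
proof (intro conjI ballI allI impI)
 have c: "continuous_on UNIV (%z::real \<times> 'b \<times> 'b. be)" "continuous_on UNIV (%z::real \<times> 'b \<times> 'b. (2*ka)*.fst (snd z) + j nu)"
  "continuous_on UNIV (%z::real \<times> 'b \<times> 'b. (2*ka)*.snd (snd z) + j nu)" by (intro continuous_intros)+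
 show "pm_continuous_on (d_infty_pair T) ({t'..T} \<times> paths T \<times> (paths T :: (real => 'b) set)) (%(t, x, y). be)"
  "pm_continuous_on (d_infty_pair T) ({t'..T} \<times> paths T \<times> paths T) (%(t, x, y). (2*ka)*.x t + j nu)"
  "pm_continuous_on (d_infty_pair T) ({t'..T} \<times> paths T \<times> paths T) (%(t, x, y). (2*ka)*.y t + j nu)"
  using c[THEN pm_continuous_evaluation, OF t', of T] by simp_all
 show "AE t in lebesgue_on {t'<..<T}. (x t : range j --> (2*ka)*.x t + j nu : range j) \<and>
   (y t : range j --> (2*ka)*.y t + j nu : range j)" for x y
  by (rule AE_I2) (auto simp flip: blinfun.add_right blinfun.scaleR_right)
 fix t0 x0 y0 x y X X' Y Y' t
 assume t0: "t0 : {t'..<T}" and xy: "x : paths T" "y : paths T" and t: "t : {t0..T}"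
  and A: "W_pq j p q t0 T X X' & W_pq j p q t0 T Y Y' & (ALL t:{0..t0}. x t = x0 t & y t = y0 t) \<and>
   (AE t in lebesgue_on {t0<..<T}. x t = j (X t)) & (AE t in lebesgue_on {t0<..<T}. y t = j (Y t))"
 have c: "cont t0 T x" "cont t0 T y" by (rule continuous_on_subset[OF paths_continuous]; use xy t0 t' in auto)+
 have eq: "x t0 = x0 t0" "y t0 = y0 t0" using A t0 t' by auto
 have "has_bochner_integral (leb t0 t) (%s. be) (be*(t - t0))"
  using t by (simp add: has_bochner_integral_iff LI_const mult.commute)
 moreover have "has_bochner_integral (leb t0 t) (%s. X' s (in_V j ((2*ka)*.x s + j nu)))
  (ka*(nsq (x t) - nsq (x t0)) + inner (x t - x t0) (j nu))" by (rule quadratic_chain_rule[where X=X]) (use A t0 t c in auto)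
 moreover have "has_bochner_integral (leb t0 t) (%s. Y' s (in_V j ((2*ka)*.y s + j nu)))
  (ka*(nsq (y t) - nsq (y t0)) + inner (y t - y t0) (j nu))" by (rule quadratic_chain_rule[where X=Y]) (use A t0 t c in auto)
 ultimately have "has_bochner_integral (leb t0 t) (%s. be + X' s (in_V j ((2*ka)*.x s + j nu)) + Y' s (in_V j ((2*ka)*.y s + j nu)))
  (be*(t - t0) + (ka*(nsq (x t) - nsq (x t0)) + inner (x t - x t0) (j nu)) + (ka*(nsq (y t) - nsq (y t0)) + inner (y t - y t0) (j nu)))"
  by (intro has_bochner_integral_add)
 moreover have "be*(t - t0) + (ka*(nsq (x t) - nsq (x t0)) + inner (x t - x t0) (j nu)) + (ka*(nsq (y t) - nsq (y t0)) + inner (y t - y t0) (j nu))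
  = quad_test al be ka nu t x y - quad_test al be ka nu t0 x0 y0"
  unfolding quad_test_def eq[symmetric] by (simp add: algebra_simps inner_diff_left inner_add_left)
 ultimately show "has_bochner_integral (leb t0 t) (%s. be + X' s (in_V j ((2*ka)*.x s + j nu)) + Y' s (in_V j ((2*ka)*.y s + j nu)))
  (quad_test al be ka nu t x y - quad_test al be ka nu t0 x0 y0)" by simp
qed

lemma quad_test_C11V: assumes t': "0 <= t'" shows "quad_test al be ka nu : C11V T p q j t'"
proof -
 have "continuous_on UNIV (%z::real \<times> 'b \<times> 'b. al + be*fst z + ka*(nsq (fst (snd z)) + nsq (snd (snd z))) + inner (fst (snd z) + snd (snd z)) (j nu))"
  by (intro continuous_intros)
 from pm_continuous_evaluation[OF this t', of T]
 have "pm_continuous_on (d_infty_pair T) ({t'..T} \<times> paths T \<times> paths T) (%(t, x, y). quad_test al be ka nu t x y)"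
  by (simp add: quad_test_def)
 thus ?thesis using quad_test_derivatives[OF t'] unfolding C11V_def by blast
qed

end

lemma positive_scale:
 fixes c e :: real assumes "0 <= c" "0 < e" obtains d where "0 < d" "d <= 1" "d * c <= e"
proof (rule that[of "min 1 (e/(c + 1))"])
 have "min 1 (e/(c + 1)) * c <= e/(c + 1) * c" using assms by (intro mult_right_mono) auto
 also have "... <= e" using assms by (simp add: field_simps)
 finally show "min 1 (e/(c + 1)) * c <= e" .
qed (use assms in auto)

section \<open>The operator terms at an interior maximum\<close>

context evolution_operator
begin

text \<open>The monotone operator is compared with its value at a fixed vector \<open>v\<close> close to \<open>m\<close>, and that value with an
 element \<open>h\<close> of \<open>H\<close>; the coercivity carried by \<open>l\<close> absorbs the errors that grow with \<open>X\<close> and \<open>Y\<close>.\<close>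

lemma A_pointwise:
 fixes B :: "'a => 'a dual" and h :: 'b assumes B: "monotone_op al c1 c2 B" and al: "0 <= al" and k: "0 < k"
  and D: "0 <= D" "!!x y. 0 <= x ==> 0 <= y ==> x*y <= th*x powr p + D*y powr q"
  and d: "norm (v - m) <= d" "d <= 1" and small: "2*k*th <= l * c2" "2*k*d * c1 <= l * c2"
 defines "n == norm (B v - to_dual j h)" and "V1 == (norm m + 1) powr (p - 1)" and "nu == - (2*k)*.m"
 shows "- B X ((2*(k + l))*.X + nu) - B Y ((2*(k + l))*.Y + nu) <=
  2*k*th*(2*norm m) powr p + 6*k*D*n powr q + 2*k*abs(inner h (j X + j Y - 2*.j m)) +
  2*k*d*(4*al + 2 * c1*V1 + 2 * c1)"
proof -
 define P where "P u = norm u powr p" for u :: 'a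
 have P0: "0 <= P u" for u by (simp add: P_def)
 have d0: "0 <= d" using d(1) norm_ge_zero order_trans by blast
 \<comment> \<open>Monotonicity is applied at \<open>v\<close>, where information on the operator is
   available, whereas the gradient points away from \<open>m\<close>; the mismatch costs
   \<open>norm (B u)*d\<close>.\<close>
 have lower: "B v (u - v) - norm (B u)*d <= B u (u - m)" for u
 proof -
  have "0 <= (B u - B v) (u - v)" by (rule monotone_opD(1)[OF B])
  moreover have "abs(B u (v - m)) <= norm (B u)*d"
   using norm_blinfun[of "B u" "v - m"] mult_left_mono[OF d(1) norm_ge_zero[of "B u"]] by simp
  ultimately show ?thesis by (simp add: bl_diff_left bl_diff_right abs_le_iff)
 qed
 have gr: "norm (B u) <= al + c1 + c1*P u" for u
 proof -
  have "norm u powr (p - 1) <= 1 + P u"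
  proof (cases "norm u <= 1")
   case True
   hence "norm u powr (p - 1) <= 1" using p1 by (intro powr_le1) auto
   thus ?thesis using P0[of u] by linarith
  next
   case False
   hence "norm u powr (p - 1) <= norm u powr p" by (intro powr_mono) auto
   thus ?thesis by (simp add: P_def)
  qed
  hence "c1*norm u powr (p - 1) <= c1*(1 + P u)" using c1 by (intro mult_left_mono)
  thus ?thesis using monotone_opD(3)[OF B, of u] by (simp add: algebra_simps)
 qed
 have gv: "norm (B v) <= al + c1*V1"
 proof -
  have "norm v <= norm m + 1" using norm_triangle_sub[of v m] d by linarith
  hence "norm v powr (p - 1) <= V1" unfolding V1_def using p1 by (intro powr_mono2) auto
  thus ?thesis using monotone_opD(3)[OF B, of v] mult_left_mono[OF _ c1] by fastforce
 qed
 have Bv: "- (th*(P X + P Y + (2*norm m) powr p) + 3*D*n powr q) - abs(inner h (j X + j Y - 2*.j m)) - 2*d*(al + c1*V1)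
   <= B v (X - v) + B v (Y - v)"
 proof -
  \<comment> \<open>The two linear terms combine to a pairing with \<open>X + Y - 2*.m\<close>,
    whose image in \<open>H\<close> vanishes as the touching time is approached. Since
    \<open>B v\<close> acts on \<open>V\<close> alone, it is first replaced by the element
    \<open>h\<close> of \<open>H\<close>.\<close>
  have "B v (X - v) + B v (Y - v) = (B v - to_dual j h) (X + Y - 2*.m) + inner h (j X + j Y - 2*.j m) - 2*B v (v - m)"
   by (simp add: bl_diff_left bl_diff_right blinfun.add_right blinfun.scaleR_right inner_diff_right inner_add_right)
  moreover have "abs((B v - to_dual j h) (X + Y - 2*.m)) <= th*(P X + P Y + (2*norm m) powr p) + 3*D*n powr q"
  proof -
   have "abs((B v - to_dual j h) (X + Y - 2*.m)) <= n*norm (X + Y - 2*.m)"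
    using norm_blinfun[of "B v - to_dual j h" "X + Y - 2*.m"] by (simp add: n_def)
   also have "... <= n*(norm X + norm Y + 2*norm m)"
    using norm_triangle_ineq4[of "X + Y" "2*.m"] norm_triangle_ineq[of X Y] by (intro mult_left_mono) (auto simp: n_def)
   also have "... = norm X*n + norm Y*n + (2*norm m)*n" by (simp add: algebra_simps)
   also have "... <= (th*P X + D*n powr q) + (th*P Y + D*n powr q) + (th*(2*norm m) powr p + D*n powr q)"
    unfolding P_def by (intro add_mono D) (auto simp: n_def)
   finally show ?thesis by (simp add: algebra_simps)
  qed
  moreover have "abs(B v (v - m)) <= d*(al + c1*V1)"
  proof -
   have "abs(B v (v - m)) <= norm (B v)*norm (v - m)" using norm_blinfun[of "B v" "v - m"] by simp
   also have "... <= (al + c1*V1)*d" using gv d al c1 by (intro mult_mono) (auto simp: V1_def)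
   finally show ?thesis by (simp add: mult.commute)
  qed
  ultimately show ?thesis by linarith
 qed
 define R where "R = th*(2*norm m) powr p + 3*D*n powr q + abs(inner h (j X + j Y - 2*.j m)) + d*(4*al + 2 * c1*V1 + 2 * c1)"
 have "norm (B X)*d + norm (B Y)*d <= d*(2*al + 2 * c1) + d * c1*(P X + P Y)"
  using mult_right_mono[OF gr[of X] d0] mult_right_mono[OF gr[of Y] d0] by (simp add: algebra_simps)
 hence "- (th*(P X + P Y) + d * c1*(P X + P Y) + R) <= B X (X - m) + B Y (Y - m)"
  using Bv lower[of X] lower[of Y] unfolding R_def by (simp add: algebra_simps)
 hence "(2*k) * - (th*(P X + P Y) + d * c1*(P X + P Y) + R) <= (2*k)*(B X (X - m) + B Y (Y - m))"
  using k by (intro mult_left_mono) auto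
 moreover have "(2*k*th)*(P X + P Y) <= (l * c2)*(P X + P Y)" "(2*k*d * c1)*(P X + P Y) <= (l * c2)*(P X + P Y)"
  using small P0 by (auto intro!: mult_right_mono add_nonneg_nonneg)
 moreover have "2*l * c2*(P X + P Y) <= 2*l*(B X X + B Y Y)"
 proof -
  have "0 <= l * c2"
  proof (rule order_trans[OF _ small(2)])
   show "0 <= 2*k*d * c1" using k d0 c1 by simp
  qed
  hence "0 <= l" using c2 by (simp add: zero_le_mult_iff)
  thus ?thesis using monotone_opD(4)[OF B, of X] monotone_opD(4)[OF B, of Y] mult_left_mono[of "c2*(P X + P Y)" "B X X + B Y Y" "2*l"]
   by (simp add: P_def algebra_simps)
 qed
 moreover have "- B X ((2*(k + l))*.X + nu) - B Y ((2*(k + l))*.Y + nu) =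
   - ((2*k)*(B X (X - m) + B Y (Y - m))) - 2*l*(B X X + B Y Y)"
  unfolding nu_def by (simp add: bl_diff_right blinfun.add_right blinfun.scaleR_right blinfun.minus_right algebra_simps)
 moreover have "(2*k) * - (th*(P X + P Y) + d * c1*(P X + P Y) + R) = - ((2*k*th)*(P X + P Y)) - (2*k*d * c1)*(P X + P Y) - 2*k*R"
  by (simp add: algebra_simps)
 moreover have "2*l * c2*(P X + P Y) = 2*((l * c2)*(P X + P Y))" by simp
 ultimately have "- B X ((2*(k + l))*.X + nu) - B Y ((2*(k + l))*.Y + nu) <= 2*k*R" by linarith
 also have "... = 2*k*th*(2*norm m) powr p + 6*k*D*n powr q + 2*k*abs(inner h (j X + j Y - 2*.j m)) +
  2*k*d*(4*al + 2 * c1*V1 + 2 * c1)" by (simp add: R_def algebra_simps)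
 finally show ?thesis .
qed

text \<open>The bound of \<open>A_pointwise\<close> is averaged over a shrinking interval. The
  parameters are chosen in the order \<open>th\<close>, \<open>v\<close> close to \<open>m\<close>,
  \<open>h\<close> close to \<open>A t1 v\<close>; then continuity of the paths handles the pairing
  with \<open>h\<close>, and the Lebesgue points handle the averages of \<open>a1\<close> and of the
  distance of \<open>A t v\<close> from \<open>h\<close>. Taking \<open>v\<close> and
  \<open>h\<close> from countable dense sets lets the exceptional times be fixed in advance.\<close>

lemma A_terms: assumes s: "solves t1 T x X f" "solves t1 T y Y g" and t1: "0 <= t1" "t1 < T" and xy: "x t1 + y t1 = 2*.j m"
  and pos: "0 < k" "0 < l" "0 < et" and DV: "closure DV = UNIV" and DH: "closure (to_dual j ` DH) = UNIV"
  and leb: "((%d. LI t1 (t1 + d) a1/d) \<longlongrightarrow> a1 t1) (at_right 0)"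
   "!!v h. v : DV ==> h : DH ==> ((%d. LI t1 (t1 + d) (%t. norm (A t v - to_dual j h) powr q)/d) \<longlongrightarrow> norm (A t1 v - to_dual j h) powr q) (at_right 0)"
 defines "z == %x t. (2*(k + l))*.x t + j (- (2*k)*.m)"
 shows "\<forall>\<^sub>F d in at_right 0. 1/d*LI t1 (t1 + d) (%t. - A t (X t) (in_V j (z x t)) - A t (Y t) (in_V j (z y t))) <= et"
proof -
 define V1 where "V1 = (norm m + 1) powr (p - 1)"
 have lc: "0 < l * c2" using pos c2 by simp
 obtain th where th: "0 < th" "th*(2*k*((2*norm m) powr p + 1)) <= min (et/8) (l * c2)"
  using positive_scale[of "2*k*((2*norm m) powr p + 1)" "min (et/8) (l * c2)"] pos lc by auto
 hence th2: "2*k*th <= l * c2" "2*k*th*(2*norm m) powr p <= et/8"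
 proof -
  have "0 <= 2*k*th*(2*norm m) powr p" "0 <= 2*k*th" using th pos by auto
  thus "2*k*th <= l * c2" "2*k*th*(2*norm m) powr p <= et/8" using th(2) by (auto simp: algebra_simps)
 qed
 obtain D where D: "0 <= D" "!!x y. 0 <= x ==> 0 <= y ==> x*y <= th*x powr p + D*y powr q"
  using Young_scaled[OF q1 p1 qp th(1)] by blast
 \<comment> \<open>The term \<open>3 * c1\<close> serves two smallness conditions on
   \<open>de\<close>: \<open>2 * c1\<close> belongs to the error bound, and one more
   \<open>c1\<close> to the absorption by the coercive term.\<close>
 define Z where "Z = 2*k*(4*a1 t1 + 2 * c1*V1 + 3 * c1)"
 have Z0: "0 <= Z" unfolding Z_def V1_def using pos a1_nonneg[of t1] c1 by (intro mult_nonneg_nonneg add_nonneg_nonneg) auto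
 obtain de where de: "0 < de" "de <= 1" "de*Z <= min (et/8) (l * c2)" using positive_scale[OF Z0, of "min (et/8) (l * c2)"] pos lc by auto
 have de2: "2*k*de * c1 <= l * c2" "2*k*de*(4*a1 t1 + 2 * c1*V1 + 2 * c1) <= et/8"
 proof -
  have n: "0 <= 2*k*de * c1" "0 <= 2*k*de*(4*a1 t1 + 2 * c1*V1 + 2 * c1)"
   using de pos c1 a1_nonneg[of t1] by (auto simp: V1_def intro!: mult_nonneg_nonneg add_nonneg_nonneg)
  have eq: "de*Z = 2*k*de*(4*a1 t1 + 2 * c1*V1 + 2 * c1) + 2*k*de * c1" by (simp add: Z_def algebra_simps)
  show "2*k*de * c1 <= l * c2" "2*k*de*(4*a1 t1 + 2 * c1*V1 + 2 * c1) <= et/8"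
   using n de(3) unfolding eq min.bounded_iff by linarith+
 qed
 obtain v where v: "v : DV" "dist v m < de" using DV de(1) by (metis UNIV_I closure_approachable)
 have vm: "norm (v - m) <= de" using v(2) by (simp add: dist_norm)
 obtain rh where rh: "0 < rh" "rh <= 1" "rh*(6*k*D) <= et/8" using positive_scale[of "6*k*D" "et/8"] pos D(1) by auto
 have "A t1 v : closure (to_dual j ` DH)" using DH by simp
 then obtain h where h: "h : DH" "dist (to_dual j h) (A t1 v) < rh" using rh(1) unfolding closure_approachable by blast
 define n where "n t = norm (A t v - to_dual j h)" for t
 have n1: "6*k*D*n t1 powr q <= et/8"
 proof -
  have "n t1 <= rh" using h(2) by (simp add: n_def dist_norm norm_minus_commute)
  hence "n t1 powr q <= rh powr q" using q0 by (intro powr_mono2) (auto simp: n_def)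
  also have "... <= rh powr 1" using rh q1 by (intro powr_mono') auto
  finally have "6*k*D*n t1 powr q <= 6*k*D*rh" using rh(1) pos D(1) by (intro mult_left_mono) auto
  thus ?thesis using rh(3) by (metis mult.commute order_trans)
 qed
 define u where "u t = abs(inner h (x t + y t - 2*.j m))" for t
 have uc: "cont t1 T u" unfolding u_def by (intro continuous_intros solvesD(1)[OF s(1)] solvesD(1)[OF s(2)])
 have u1: "u t1 = 0" using xy by (simp add: u_def)
 have "0 < et/(16*k)" using pos by simp
 then obtain r where r: "0 < r" "!!t. t : {t1..T} ==> dist t t1 < r ==> dist (u t) (u t1) < et/(16*k)"
  using uc t1 unfolding continuous_on_iff by (metis atLeastAtMost_iff less_imp_le order_refl)
 have ur: "2*k*u t <= et/8" if "t : {t1..T}" "t < t1 + r" for t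
  using r(2)[of t] that u1 pos by (simp add: dist_real_def u_def field_simps)
 define E where "E = et/8 + et/8 + 2*k*de*(2 * c1*V1 + 2 * c1)"
 define W where "W t = E + 6*k*D*n t powr q + 2*k*de*4*a1 t" for t
 define lhs where "lhs t = - A t (X t) (in_V j (z x t)) - A t (Y t) (in_V j (z y t))" for t
 define rs where "rs t = - A t (X t) ((2*(k + l))*.X t + - (2*k)*.m) - A t (Y t) ((2*(k + l))*.Y t + - (2*k)*.m)" for t
 have xX: "AE t in leb t1 T. x t = j (X t) & y t = j (Y t)" using solvesD(3)[OF s(1)] solvesD(3)[OF s(2)] by eventually_elim simp
 have eq: "AE t in leb t1 T. rs t = lhs t"
  using xX by eventually_elim (simp add: rs_def lhs_def z_def flip: blinfun.add_right blinfun.scaleR_right)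
 have Vs: "Vfun t1 T (%t. (2*(k + l))*.X t + - (2*k)*.m)" "Vfun t1 T (%t. (2*(k + l))*.Y t + - (2*k)*.m)"
  by (intro Vfun_add Vfun_scaleR Vfun_const solvesD(2)[OF s(1)] solvesD(2)[OF s(2)])+
 have ri: "intg t1 T rs" unfolding rs_def[abs_def] by (intro intg_diff Bochner_Integration.integrable_minus pair_intg Vs
    solves_Dfun(2)[OF s(1) t1(1) order_refl] solves_Dfun(2)[OF s(2) t1(1) order_refl])
 have lm: "lhs : meas t1 T" by (rule meas_AE[OF meas_intg[OF ri] _ eq]) simp
 have le: "AE t in leb t1 T. t < t1 + r --> rs t <= W t" using xX A_monotone_on[OF t1(1) order_refl] AE_space
 proof eventually_elim
  case (elim t)
  note pw = A_pointwise[OF elim(2) a1_nonneg pos(1) D vm de(2) th2(1) de2(1), where h=h and X="X t" and Y="Y t", folded V1_def]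
  have "2*k*abs(inner h (j (X t) + j (Y t) - 2*.j m)) <= et/8" if "t < t1 + r" using ur[of t] that elim by (simp add: u_def)
  thus ?case using pw th2(2) unfolding rs_def W_def E_def n_def by (auto simp: algebra_simps)
 qed
 have ni: "intg t1 T (%t. n t powr q)" unfolding n_def
 proof (rule Dfun_intg[OF Dfun_diff[OF A_const_Dfun to_dual_Dfun(1)]])
  show "AE t in leb t1 T. norm h <= norm h" by simp
 qed (use t1 in auto)
 have ai: "intg t1 T a1" by (rule a1_integrable1[OF t1(1) order_refl])
 have "((%d. E + 6*k*D*(LI t1 (t1 + d) (%t. n t powr q)/d) + 2*k*de*4*(LI t1 (t1 + d) a1/d))
   \<longlongrightarrow> E + 6*k*D*n t1 powr q + 2*k*de*4*a1 t1) (at_right 0)" unfolding n_def by (intro tendsto_intros leb v h)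
 moreover have "E + 6*k*D*n t1 powr q + 2*k*de*4*a1 t1 < et" using n1 de2(2) pos unfolding E_def by (simp add: algebra_simps)
 ultimately have ev: "\<forall>\<^sub>F d in at_right 0. E + 6*k*D*(LI t1 (t1 + d) (%t. n t powr q)/d) + 2*k*de*4*(LI t1 (t1 + d) a1/d) < et"
  by (rule order_tendstoD(2))
 have "\<forall>\<^sub>F d in at_right 0. d : {0<..<min r (T - t1)}" by (rule eventually_at_right_real) (use r t1 in simp)
 with ev show ?thesis
 proof eventually_elim
  case (elim d)
  hence d: "0 < d" "d < r" "t1 + d <= T" by auto
  have i: "intg t1 (t1 + d) rs" "intg t1 (t1 + d) (%t. n t powr q)" "intg t1 (t1 + d) a1"
   by (rule intg_sub[OF _ order_refl d(3)], rule ri ni ai)+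
  have "LI t1 (t1 + d) lhs = LI t1 (t1 + d) rs"
  proof (rule integral_cong_AE)
   show "lhs : meas t1 (t1 + d)" by (rule meas_sub[OF lm]) (use d in auto)
   show "AE t in leb t1 (t1 + d). lhs t = rs t" using AE_sub[OF eq order_refl d(3)] by eventually_elim simp
  qed (use i in auto)
  also have "... <= LI t1 (t1 + d) W"
  proof (rule LI_mono_AE[OF i(1)])
   show "intg t1 (t1 + d) W" unfolding W_def[abs_def] using i by simp
   show "AE t in leb t1 (t1 + d). rs t <= W t" using AE_sub[OF le order_refl d(3)] AE_space by eventually_elim (use d in auto)
  qed
  also have "... = d*E + 6*k*D*LI t1 (t1 + d) (%t. n t powr q) + 2*k*de*4*LI t1 (t1 + d) a1" unfolding W_def using i d by simp
  finally have "1/d*LI t1 (t1 + d) lhs <= 1/d*(d*E + 6*k*D*LI t1 (t1 + d) (%t. n t powr q) + 2*k*de*4*LI t1 (t1 + d) a1)"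
   using d by (intro mult_left_mono) auto
  also have "... = E + 6*k*D*(LI t1 (t1 + d) (%t. n t powr q)/d) + 2*k*de*4*(LI t1 (t1 + d) a1/d)"
   using d by (simp add: field_simps)
  finally show ?case using elim(1) unfolding lhs_def[abs_def] by linarith
 qed
qed

end

text \<open>The clock adds up the measures of the parts below \<open>t\<close> of open
  neighbourhoods \<open>U k\<close> of \<open>N\<close> with summable measures. To the right of a
  point of \<open>N\<close>, each of the first \<open>n\<close> neighbourhoods contributes slope one
  on a short interval, so the slope exceeds any bound; the geometric series keeps the total below
  \<open>e\<close>.\<close>

lemma steep_clock:
 fixes N :: "real set" assumes N: "N : null_sets lebesgue" and e: "0 < e"
 obtains sg :: "real => real" where "cont 0 T sg" "!!s t. s <= t ==> sg s <= sg t" "!!t. 0 <= sg t" "!!t. sg t <= e"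
  "!!t1 C. t1 : N ==> 0 <= t1 ==> EX d>0. ALL t:{t1..t1 + d}. C*(t - t1) <= sg t - sg t1"
proof -
 have Nm: "N : lmeasurable" "measure lebesgue N = 0" using N by (auto simp: fmeasurable_def null_setsD1 null_setsD2 measure_eq_0_null_sets)
 have "EX U. open U & N <= U & U : lmeasurable & measure lebesgue U < e*(1/2) ^ Suc k" for k
 proof -
  have e': "0 < e*(1/2) ^ Suc k" using e by simp
  obtain U where U: "open U" "N <= U" "U - N : lmeasurable" "emeasure lebesgue (U - N) < ennreal (e*(1/2) ^ Suc k)"
   using sets_lebesgue_outer_open[OF fmeasurableD[OF Nm(1)] e'] by blast
  have "measure lebesgue (U - N) < e*(1/2) ^ Suc k"
   using U(4) unfolding emeasure_eq_measure2[OF U(3)] by (simp add: ennreal_less_iff)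
  moreover have "U = (U - N) Un N" using U(2) by blast
  moreover have "(U - N) Un N : lmeasurable" by (rule fmeasurable.Un[OF U(3) Nm(1)])
  moreover have "measure lebesgue ((U - N) Un N) <= measure lebesgue (U - N) + measure lebesgue N"
   by (rule measure_Un_le) (use U(3) Nm(1) in auto)
  ultimately show ?thesis using U(1,2) Nm(2) by (intro exI[of _ U]) auto
 qed
 then obtain U where U: "!!k. open (U k)" "!!k. N <= U k" "!!k. U k : lmeasurable" "!!k::nat. measure lebesgue (U k) < e*(1/2) ^ Suc k" by metis
 define m where "m k t = measure lebesgue (U k Int {0..t})" for k t
 have fm: "U k Int {a..b} : lmeasurable" "U k Int {a<..b} : lmeasurable" for k a b by (auto intro!: fmeasurable_Int_fmeasurable U)
 have mle: "m k t <= e*(1/2) ^ Suc k" for k t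
  unfolding m_def using measure_mono_fmeasurable[of "U k Int {0..t}" "U k" lebesgue] U(3,4)[of k] fm(1)[of k 0 t] by (simp add: fmeasurableD)
 have m0: "0 <= m k t" for k t by (simp add: m_def)
 have inc: "m k t = m k s + measure lebesgue (U k Int {s<..t})" if "0 <= s" "s <= t" for k s t
 proof -
  have "U k Int {0..t} = (U k Int {0..s}) Un (U k Int {s<..t})" using that by auto
  moreover have "(U k Int {0..s}) Int (U k Int {s<..t}) = {}" by auto
  ultimately show ?thesis unfolding m_def using measure_Un3[OF fm(1)[of k 0 s] fm(2)[of k s t]] by simp
 qed
 have mono: "m k s <= m k t" if "s <= t" for k s t
  unfolding m_def using that fm by (intro measure_mono_fmeasurable) (auto intro: fmeasurableD)
 have sm: "summable (%k. m k t)" for t by (rule summable_comparison_test'[where g="%k. e*(1/2) ^ Suc k" and N=0])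
   (use mle m0 in "auto intro!: summable_mult summable_geometric simp: summable_Suc_iff")
 define sg where "sg t = (\<Sum>k. m k t)" for t
 have mc: "cont 0 T (m k)" for k
 proof -
  have "abs(m k t - m k s) <= abs(t - s)" if "s : {0..T}" "t : {0..T}" for s t
  proof -
   have le: "abs(m k t - m k s) <= t - s" if "0 <= s" "s <= t" for s t
   proof -
    have "measure lebesgue (U k Int {s<..t}) <= measure lebesgue {s<..t}"
     using fm(2)[of k s t] bounded_set_imp_lmeasurable[of "{s<..t}"] by (intro measure_mono_fmeasurable) (auto intro: fmeasurableD)
    thus ?thesis using inc[OF that] that by simp
   qed
   show ?thesis using le[of s t] le[of t s] that by (cases "s <= t") (auto simp: abs_minus_commute)
  qed
  thus ?thesis unfolding continuous_on_iff dist_real_def by (meson le_less_trans)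
 qed
 show ?thesis
 proof (rule that[of sg])
  have "uniform_limit {0..T} (%n t. \<Sum>k<n. m k t) sg sequentially" unfolding sg_def
   by (rule Weierstrass_m_test[where M="%k. e*(1/2) ^ Suc k"])
    (use mle m0 in "auto intro!: summable_mult summable_geometric simp: summable_Suc_iff")
  thus "cont 0 T sg" by (rule uniform_limit_theorem[rotated]) (auto intro!: always_eventually continuous_on_sum mc)
  show "sg s <= sg t" if "s <= t" for s t unfolding sg_def by (intro suminf_le sm mono that)
  show "0 <= sg t" for t unfolding sg_def by (intro suminf_nonneg sm m0)
  have "(%k. e*(1/2) ^ Suc k) sums e" using sums_mult[OF power_half_series, of e] by simp
  thus "sg t <= e" for t unfolding sg_def by (metis mle sm suminf_le sums_iff)
  fix t1 C assume t1: "t1 : N" "0 <= t1"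
  obtain n :: nat where n: "C <= real n" using real_arch_simple by blast
  have "open (\<Inter>k<n. U k)" "t1 : (\<Inter>k<n. U k)" using U t1 by auto
  then obtain d where d: "0 < d" "cball t1 d <= (\<Inter>k<n. U k)" unfolding open_contains_cball by blast
  have "C*(t - t1) <= sg t - sg t1" if t: "t : {t1..t1 + d}" for t
  proof -
   have "C*(t - t1) <= real n*(t - t1)" using n t by (intro mult_right_mono) auto
   also have "... = (\<Sum>k<n. m k t - m k t1)"
   proof -
    have "m k t - m k t1 = t - t1" if "k < n" for k
    proof -
     have "U k Int {t1<..t} = {t1<..t}" using d(2) t that by (auto simp: subset_eq dist_real_def)
     thus ?thesis using inc[of t1 t k] t t1 by simp
    qed
    thus ?thesis by simp
   qed
   also have "... <= (\<Sum>k. m k t - m k t1)" using t mono by (intro sum_le_suminf summable_diff sm) auto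
   also have "... = sg t - sg t1" unfolding sg_def by (intro suminf_diff[symmetric] sm)
   finally show ?thesis .
  qed
  thus "EX d>0. ALL t:{t1..t1 + d}. C*(t - t1) <= sg t - sg t1" using d(1) by blast
 qed
qed

section \<open>Uniform limits of paths and existence of maxima\<close>

definition path_limit :: "real => (nat => real => 'b::real_normed_vector) => (real => 'b) => bool" where
 "path_limit T xn x <-> (ALL e>0. EX N. ALL n>=N. ALL t:{0..T}. norm (xn n t - x t) <= e)"

lemma path_limit_subseq: assumes "path_limit T xn x" "strict_mono r" shows "path_limit T (%n. xn (r n)) x"
 unfolding path_limit_def
proof (intro allI impI)
 fix e :: real assume "0 < e"
 then obtain N where N: "!!n t. N <= n ==> t : {0..T} ==> norm (xn n t - x t) <= e" using assms(1) unfolding path_limit_def by blast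
 have "N <= r n" if "N <= n" for n using seq_suble[OF assms(2), of n] that by linarith
 thus "EX N. ALL n>=N. ALL t:{0..T}. norm (xn (r n) t - x t) <= e" using N by blast
qed

lemma path_limit_diff: assumes "path_limit T xn x" "path_limit T yn y"
 shows "path_limit T (%n t. xn n t - yn n t) (%t. x t - y t)" unfolding path_limit_def
proof (intro allI impI)
 fix e :: real assume e: "0 < e"
 obtain N1 N2 where N: "!!n t. N1 <= n ==> t : {0..T} ==> norm (xn n t - x t) <= e/2"
  "!!n t. N2 <= n ==> t : {0..T} ==> norm (yn n t - y t) <= e/2" using assms half_gt_zero[OF e] unfolding path_limit_def by metis
 show "EX N. ALL n>=N. ALL t:{0..T}. norm (xn n t - yn n t - (x t - y t)) <= e"
 proof (intro exI[of _ "max N1 N2"] allI impI ballI)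
  fix n t assume n: "max N1 N2 <= n" "t : {0..T}"
  have eq: "xn n t - yn n t - (x t - y t) = (xn n t - x t) - (yn n t - y t)" by simp
  show "norm (xn n t - yn n t - (x t - y t)) <= e"
   using N(1)[of n t] N(2)[of n t] n norm_triangle_ineq4[of "xn n t - x t" "yn n t - y t"] unfolding eq by auto
 qed
qed

lemma path_limit_eval: assumes pl: "path_limit T xn x" and x: "cont 0 T x" and t: "!!n. tn n : {0..T}" "t : {0..T}" "tn ----> t"
 shows "(%n. xn n (tn n)) ----> x t"
proof -
 have "(%n. xn n (tn n) - x (tn n)) ----> 0"
 proof (rule LIMSEQ_I)
  fix e :: real assume e: "0 < e"
  then obtain N where "!!n t. N <= n ==> t : {0..T} ==> norm (xn n t - x t) <= e/2"
   using pl half_gt_zero[OF e] unfolding path_limit_def by metis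
  hence "norm (xn n (tn n) - x (tn n)) <= e/2" if "N <= n" for n using t that by blast
  thus "EX no. ALL n>=no. norm (xn n (tn n) - x (tn n) - 0) < e" using e by (intro exI[of _ N]) fastforce
 qed
 moreover have "(%n. x (tn n)) ----> x t" by (rule continuous_on_tendsto_compose[OF x t(3,2)]) (use t in auto)
 ultimately show ?thesis using tendsto_add by fastforce
qed

lemma path_limit_d_infty:
 fixes x y :: "real => 'b::real_normed_vector"
 assumes pl: "path_limit T xn x" "path_limit T yn y" and xy: "cont 0 T x" "cont 0 T y"
  and t: "!!n. tn n : {0..T}" "t : {0..T}" "tn ----> t" and e: "0 < e"
 shows "EVN n. d_infty_pair T (t, x, y) (tn n, xn n, yn n) < e"
proof -
 have key: "EVN n. ALL r:{0..T}. norm (z (min r t) - zn n (min r (tn n))) <= e/8"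
  if pl: "path_limit T zn z" and z: "cont 0 T z" for z :: "real => 'b" and zn
 proof -
  have "uniformly_continuous_on {0..T} z" by (rule compact_uniformly_continuous[OF z compact_Icc])
  then obtain d where d: "0 < d" "!!r s. r : {0..T} ==> s : {0..T} ==> dist r s < d ==> dist (z r) (z s) < e/16"
   unfolding uniformly_continuous_on_def using e by (metis zero_less_divide_iff zero_less_numeral)
  obtain N where N: "!!n t. N <= n ==> t : {0..T} ==> norm (zn n t - z t) <= e/16"
   using pl e unfolding path_limit_def by (metis zero_less_divide_iff zero_less_numeral)
  have "EVN n. dist (tn n) t < d" using tendstoD[OF t(3) d(1)] .
  moreover have "EVN n. N <= n" by (rule eventually_ge_at_top)
  ultimately show ?thesis
  proof eventually_elim
   case (elim n)
   show ?case
   proof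
    fix r assume r: "r : {0..T}"
    have m: "min r t : {0..T}" "min r (tn n) : {0..T}" using r t(1)[of n] t(2) by auto
    have "dist (min r t) (min r (tn n)) < d" using elim d(1) by (auto simp: dist_real_def min_def abs_if split: if_splits)
    hence "norm (z (min r t) - z (min r (tn n))) < e/16" using d(2)[OF m] by (simp add: dist_norm)
    moreover have "norm (z (min r (tn n)) - zn n (min r (tn n))) <= e/16" using N[OF elim(2) m(2)] by (simp add: norm_minus_commute)
    ultimately show "norm (z (min r t) - zn n (min r (tn n))) <= e/8"
     using norm_triangle_ineq[of "z (min r t) - z (min r (tn n))" "z (min r (tn n)) - zn n (min r (tn n))"] by simp
   qed
  qed
 qed
 have "EVN n. dist (tn n) t < e/2" using tendstoD[OF t(3) half_gt_zero[OF e]] .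
 from this key[OF pl(1) xy(1)] key[OF pl(2) xy(2)] show ?thesis
 proof eventually_elim
  case (elim n)
  have "d_infty_pair T (t, x, y) (tn n, xn n, yn n) <= abs(t - tn n) + 2*(e/8)" by (rule d_infty_pair_le) (use elim t in auto)
  thus ?case using elim(1) e by (simp add: dist_real_def abs_minus_commute)
 qed
qed

locale doubled_equation = evolution_operator +
 fixes L :: real and F :: "real => (real => 'b::{real_inner, complete_space}) => 'b => real" and Om :: "(real => 'b) set"
  and w :: "real => (real => 'b) => (real => 'b) => real" and t0 :: real and x0 :: "real => 'b"
 assumes L0: "0 <= L" and hamiltonian: "admissible_hamiltonian T p q j A F" and Om_paths: "Om <= paths T"
  and Om_closed: "ALL s:{0..<T}. ALL x:Om. trajectories T p q j A L s x <= Om"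
  and subsolution: "viscosity_subsolution T p q j A F L Om w" and t0: "0 <= t0" "t0 < T" and x0: "x0 : Om"
begin

abbreviation "traj == trjs L"
abbreviation "K == trjs L t0 x0"

lemma x0_path: "x0 : paths T" using x0 Om_paths by blast

lemma in_time: "t : {t0..T} ==> t : {0..T}" using t0 by simp

lemma K_Om: "K <= Om" using Om_closed t0 x0 by auto

lemma K_continuous: "x : K ==> cont 0 T x" using K_Om Om_paths paths_continuous by blast

lemma w_limsup: assumes pl: "path_limit T xn x" "path_limit T yn y" and xy: "x : Om" "y : Om" "!!n. xn n : Om" "!!n. yn n : Om"
  and t: "!!n. tn n : {0..T}" "t : {0..T}" "tn ----> t" and e: "0 < e" shows "EVN n. w (tn n) (xn n) (yn n) < w t x y + e"
proof -
 have "pm_usc_on (d_infty_pair T) ({0..T} \<times> Om \<times> Om) (%(t, x, y). w t x y)"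
  using subsolution by (simp add: viscosity_subsolution_def)
 moreover have "(t, x, y) : {0..T} \<times> Om \<times> Om" using t xy by simp
 ultimately obtain d where d: "0 < d" "ALL b:{0..T} \<times> Om \<times> Om. d_infty_pair T (t, x, y) b < d -->
   (case b of (t, x, y) => w t x y) < (case (t, x, y) of (t, x, y) => w t x y) + e" unfolding pm_usc_on_def using e by blast
 have c: "cont 0 T x" "cont 0 T y" using xy Om_paths paths_continuous by blast+
 from path_limit_d_infty[OF pl c t d(1)] show ?thesis
 proof eventually_elim
  case (elim n)
  have "(tn n, xn n, yn n) : {0..T} \<times> Om \<times> Om" using t xy by simp
  thus ?case using d(2) elim by fastforce
 qed
qed

lemma K_compact:
 fixes tn :: "nat => real" assumes "!!n. tn n : {t0..T}" "!!n. xn n : K" "!!n. yn n : K"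
 obtains r :: "nat => nat" and t x y where "strict_mono r" "t : {t0..T}" "x : K" "y : K"
  "(%n. tn (r n)) ----> t" "path_limit T (%n. xn (r n)) x" "path_limit T (%n. yn (r n)) y"
proof -
 have "seq_compact {t0..T}" by (simp add: compact_imp_seq_compact)
 then obtain t r1 where r1: "t : {t0..T}" "strict_mono r1" "(tn \<circ> r1) ----> t"
  using assms(1) unfolding seq_compact_def by blast
 obtain r2 :: "nat => nat" and x where r2: "strict_mono r2" "x : K" "path_limit T (%n. xn (r1 (r2 n))) x"
  using trajectories_compact[OF t0 L0 x0_path, of "%n. xn (r1 n)"] assms(2) unfolding path_limit_def by metis
 obtain r3 :: "nat => nat" and y where r3: "strict_mono r3" "y : K" "path_limit T (%n. yn (r1 (r2 (r3 n)))) y"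
  using trajectories_compact[OF t0 L0 x0_path, of "%n. yn (r1 (r2 n))"] assms(3) unfolding path_limit_def by metis
 have r23: "strict_mono (%n. r2 (r3 n))" using strict_mono_o[OF r2(1) r3(1)] by (simp add: comp_def)
 show ?thesis
 proof (rule that[of "%n. r1 (r2 (r3 n))" t x y])
  show "strict_mono (%n. r1 (r2 (r3 n)))" using strict_mono_o[OF r1(2) r23] by (simp add: comp_def)
  show "(%n. tn (r1 (r2 (r3 n)))) ----> t" using LIMSEQ_subseq_LIMSEQ[OF r1(3) r23] by (simp add: comp_def)
  show "path_limit T (%n. xn (r1 (r2 (r3 n)))) x" by (rule path_limit_subseq[OF r2(3) r3(1)])
 qed (use r1 r2 r3 in auto)
qed

text \<open>Upper semicontinuity along uniformly convergent trajectories and compactness of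
  \<open>K\<close> give both boundedness and attainment. The perturbation \<open>P\<close> is tested
  along such sequences only, which suits a penalty that contains an integral with a moving
  endpoint.\<close>

lemma maximum_exists:
 assumes P: "!!(tn :: nat => real) xn yn t x y. \<lbrakk>!!n. tn n : {t0..T}; !!n. xn n : K; !!n. yn n : K; t : {t0..T}; x : K; y : K;
   tn ----> t; path_limit T xn x; path_limit T yn y\<rbrakk> \<Longrightarrow> (%n. P (tn n) (xn n) (yn n)) ----> (P t x y :: real)"
 obtains t1 x1 y1 where "t1 : {t0..T}" "x1 : K" "y1 : K"
  "!!t x y. t : {t0..T} ==> x : K ==> y : K ==> w t x y + P t x y <= w t1 x1 y1 + P t1 x1 y1"
proof -
 define Q where "Q z = (case z of (t, x, y) => w t x y + P t x y)" for z
 define S where "S = {t0..T} \<times> K \<times> K"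
 have lim: "EX z:S. EX r. strict_mono r & (ALL e>0. EVN n. Q (zn (r n)) < Q z + e)" if zn: "!!n. zn n : S" for zn :: "nat => real \<times> (real => 'b) \<times> (real => 'b)"
 proof -
  define tn where "tn n = fst (zn n)" for n
  define xn where "xn n = fst (snd (zn n))" for n
  define yn where "yn n = snd (snd (zn n))" for n
  have mem: "tn n : {t0..T}" "xn n : K" "yn n : K" for n using zn[of n] by (auto simp: tn_def xn_def yn_def S_def)
  obtain r :: "nat => nat" and t x y where r: "strict_mono r" "t : {t0..T}" "x : K" "y : K"
   "(%n. tn (r n)) ----> t" "path_limit T (%n. xn (r n)) x" "path_limit T (%n. yn (r n)) y"
   by (rule K_compact[of tn xn yn, OF mem]) blast
  have "EVN n. Q (zn (r n)) < Q (t, x, y) + e" if e: "0 < e" for e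
  proof -
   have "EVN n. w (tn (r n)) (xn (r n)) (yn (r n)) < w t x y + e/2"
    by (rule w_limsup[OF r(6,7) _ _ _ _ in_time[OF mem(1)] in_time[OF r(2)] r(5)]) (use r mem K_Om e in auto)
   moreover have "EVN n. P (tn (r n)) (xn (r n)) (yn (r n)) < P t x y + e/2"
    by (rule order_tendstoD(2)[OF P[OF mem r(2-7)]]) (use e in simp)
   ultimately show ?thesis
   proof eventually_elim
    case (elim n)
    have "zn (r n) = (tn (r n), xn (r n), yn (r n))" by (simp add: tn_def xn_def yn_def)
    thus ?case using elim by (simp add: Q_def)
   qed
  qed
  moreover have "(t, x, y) : S" using r by (simp add: S_def)
  ultimately show ?thesis using r(1) by blast
 qed
 obtain z where "z : K" using trajectories_nonempty[OF t0 L0 x0_path] by blast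
 hence ne: "S ~= {}" using t0 by (auto simp: S_def)
 have bdd: "bdd_above (Q ` S)"
 proof (rule ccontr)
  assume "~ bdd_above (Q ` S)"
  hence "ALL n::nat. EX z:S. real n < Q z" unfolding bdd_above_def by (simp add: not_le)
  then obtain zn where zn: "!!n. zn n : S" "!!n. real n < Q (zn n)" by metis
  obtain z r where z: "strict_mono (r::nat => nat)" "!!e. 0 < e ==> EVN n. Q (zn (r n)) < Q z + e"
   using lim[of zn, OF zn(1)] by blast
  obtain N where N: "!!n. N <= n ==> Q (zn (r n)) < Q z + 1" using z(2)[of 1] by (auto simp: eventually_sequentially)
  obtain m where m: "Q z + 1 <= real m" using real_arch_simple by blast
  have "real (max N m) <= real (r (max N m))" using seq_suble[OF z(1)] by (simp only: of_nat_le_iff)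
  thus False using N[of "max N m"] zn(2)[of "r (max N m)"] m by simp
 qed
 define s where "s = (SUP z\<in>S. Q z)"
 have "EX z:S. s - 1/real (Suc n) < Q z" for n using less_cSUP_iff[OF ne bdd, of "s - 1/real (Suc n)"] by (simp add: s_def)
 then obtain zn where zn: "!!n. zn n : S" "!!n. s - 1/real (Suc n) < Q (zn n)" by metis
 obtain z r where z: "z : S" "strict_mono (r::nat => nat)" "!!e. 0 < e ==> EVN n. Q (zn (r n)) < Q z + e"
  using lim[of zn, OF zn(1)] by blast
 have "s <= Q z"
 proof (rule field_le_epsilon)
  fix e :: real assume e: "0 < e"
  obtain m where m: "1/real (Suc m) < e/2" using nat_approx_posE[of "e/2"] e by auto
  obtain N where N: "!!n. N <= n ==> Q (zn (r n)) < Q z + e/2" using z(3)[of "e/2"] e by (auto simp: eventually_sequentially)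
  define n where "n = max N m"
  have "m <= r n" using seq_suble[OF z(2), of n] by (simp add: n_def)
  hence "1/real (Suc (r n)) <= 1/real (Suc m)" by (intro divide_left_mono) auto
  thus "s <= Q z + e" using zn(2)[of "r n"] N[of n] m by (simp add: n_def)
 qed
 hence max: "Q u <= Q z" if "u : S" for u using cSUP_upper[OF that bdd] by (simp add: s_def)
 obtain t1 x1 y1 where z1: "z = (t1, x1, y1)" using prod_cases3 by blast
 show ?thesis
 proof (rule that[of t1 x1 y1])
  show "w t x y + P t x y <= w t1 x1 y1 + P t1 x1 y1" if "t : {t0..T}" "x : K" "y : K" for t x y
   using max[of "(t, x, y)"] that by (simp add: S_def Q_def z1)
 qed (use z(1) in "auto simp: z1 S_def")
qed

end

section \<open>Growth estimates along trajectories and the viscosity inequality\<close>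

context doubled_equation
begin

definition M :: real where "M = a_priori L t0 x0"

text \<open>Forces are bounded by \<open>L*(1 + M)\<close> and differences of paths by
  \<open>2*M\<close>; with the factor 4 of \<open>traj_difference\<close> this gives 8. The same
  constant also covers the growth of the energy of a single path.\<close>

definition C1 :: real where "C1 = 8*(L*(1 + M))*M"

lemma M0: "0 <= M" and C10: "0 <= C1" using L0 by (auto simp: M_def C1_def a_priori_nonneg)

lemma K_bound: "x : K ==> 0 <= t ==> t <= T ==> norm (x t) <= M"
 using trajectory_bound[OF _ t0 L0, of x0 x] unfolding trajectories_def M_def by fastforce

lemma K_running_sup: "x : K ==> 0 <= t ==> t <= T ==> running_sup x t <= M"
 using trajectory_bound[OF _ t0 L0, of x0 x] unfolding trajectories_def M_def by blast

lemma K_continues: "t0 <= t1 ==> t1 < T ==> x : K ==> x : traj t1 x"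
 and K_glue: "t0 <= t1 ==> t1 < T ==> x : K ==> traj t1 x <= K"
 using trajectories_restrict[OF t0(1) _ _ L0] trajectories_glue[OF t0(1) _ _ L0] by blast+

lemma force_le: assumes tr: "trj L t1 x1 x X X' f" and x: "x : K" and t1: "0 <= t1" "t1 < T"
 shows "AE t in leb t1 T. norm (f t) <= L*(1 + M)" using trajectoryD(4)[OF tr t1 L0] AE_space
proof eventually_elim
 case (elim t)
 hence "L*(1 + running_sup x t) <= L*(1 + M)" using K_running_sup[OF x, of t] t1 L0 by (intro mult_left_mono) auto
 thus ?case using elim(1) by linarith
qed

lemma K_difference:
 assumes t1: "t0 <= t1" "t1 < T" and K1: "x1 : K" "y1 : K" and xy: "x : traj t1 x1" "y : traj t1 y1" and t: "t1 <= t" "t <= T"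
 shows "nsq (x t - y t) <= nsq (x1 t1 - y1 t1) + C1*(t - t1)"
proof -
 obtain X X' f where tx: "trj L t1 x1 x X X' f" using xy unfolding trajectories_def by blast
 obtain Y Y' g where ty: "trj L t1 y1 y Y Y' g" using xy unfolding trajectories_def by blast
 have t1': "0 <= t1" using t1 t0 by simp
 note D = trajectoryD[OF tx t1' t1(2) L0] and E = trajectoryD[OF ty t1' t1(2) L0]
 have K: "x : K" "y : K" using K_glue[OF t1] K1 xy by blast+
 define k where "k = L*(1 + M)"
 have k: "0 <= k" using L0 M0 by (simp add: k_def)
 have i: "intg t1 t (%r. norm (x r - y r))"
  by (intro cont_intg continuous_intros continuous_on_subset[OF solvesD(1)[OF D(3)]] continuous_on_subset[OF solvesD(1)[OF E(3)]])
   (use t in auto)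
 have "LI t1 t (%r. norm (x r - y r)) <= LI t1 t (%_. 2*M)"
 proof (rule LI_mono_AE[OF i intg_const AE_I2])
  fix r assume "r : space (leb t1 t)"
  hence r: "0 <= r" "r <= T" using t1' t by auto
  show "norm (x r - y r) <= 2*M" using norm_triangle_ineq4[of "x r" "y r"] K_bound[OF K(1) r] K_bound[OF K(2) r] by simp
 qed
 hence "4*k*LI t1 t (%r. norm (x r - y r)) <= 4*k*(2*M*(t - t1))" using t k by (intro mult_left_mono) (auto simp: LI_const algebra_simps)
 hence "nsq (x t - y t) <= nsq (x t1 - y t1) + C1*(t - t1)"
  using traj_difference[OF D(3) E(3) t1' t1(2) t force_le[OF tx K(1) t1' t1(2), folded k_def] force_le[OF ty K(2) t1' t1(2), folded k_def]]
  unfolding C1_def k_def[symmetric] by (simp add: algebra_simps)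
 thus ?thesis using D(2)[of t1] E(2)[of t1] t1' by simp
qed

lemma K_energy: assumes t1: "t0 <= t1" "t1 < T" and K1: "x1 : K" and tx: "trj L t1 x1 x X X' f" and t: "t1 <= t" "t <= T"
 shows "nsq (x t) + 2 * c2*LI t1 t (%r. norm (X r) powr p) <= nsq (x1 t1) + C1*(t - t1)"
proof -
 have t1': "0 <= t1" using t1 t0 by simp
 note D = trajectoryD[OF tx t1' t1(2) L0]
 have "x : traj t1 x1" using tx unfolding trajectories_def by blast
 hence K: "x : K" using K_glue[OF t1 K1] by blast
 define k where "k = L*(1 + M)"
 have k: "0 <= k" using L0 M0 by (simp add: k_def)
 have "c2*LI t1 t (%r. norm (X r) powr p) <= LI t1 t (%r. A r (X r) (X r))"
  by (rule coercive_integral[OF Vfun_subinterval[OF solvesD(2)[OF D(3)] order_refl t(2)] t1' t(2)])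
 moreover have "LI t1 t (%r. inner (f r) (x r)) <= LI t1 t (%_. k*M)"
 proof (rule LI_mono_AE)
  show "intg t1 t (%r. inner (f r) (x r))" by (rule intg_sub[OF forced_intg[OF D(3) solvesD(1)[OF D(3)]] order_refl t(2)])
  show "AE r in leb t1 t. inner (f r) (x r) <= k*M" using AE_sub[OF force_le[OF tx K t1' t1(2)] order_refl t(2)] AE_space
  proof eventually_elim
   case (elim r)
   thus ?case using K_bound[OF K, of r] t1' t k by (intro order_trans[OF norm_cauchy_schwarz] mult_mono) (auto simp: k_def)
  qed
 qed simp
 moreover have "LI t1 t (%_. k*M) = k*M*(t - t1)" using t by (simp add: LI_const)
 moreover have "2*(k*M*(t - t1)) <= C1*(t - t1)" unfolding C1_def k_def[symmetric] using k M0 t by simp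
 moreover have "nsq (x t) - nsq (x1 t1) = 2*LI t1 t (%r. inner (f r) (x r)) - 2*LI t1 t (%r. A r (X r) (X r))"
  using solves_energy[OF D(3) t1' t1(2) order_refl order_refl t] D(2)[of t1] t1' by simp
 ultimately show ?thesis by linarith
qed

text \<open>The subsolution property yields some pair of trajectories without further information on
  it, so the bound on the averaged operator terms is required for all pairs. The constant
  \<open>al\<close> makes the test function touch \<open>w\<close>.\<close>

lemma touching_inequality:
 assumes t1: "0 <= t1" "t1 < T" and xy: "x1 : Om" "y1 : Om" "x1 : traj t1 x1" "y1 : traj t1 y1" and d: "0 < d" "t1 + d <= T"
  and le: "!!t x y. t1 <= t ==> t <= t1 + d ==> x : traj t1 x1 ==> y : traj t1 y1 ==>
   w t x y + quad_test 0 be ka nu t1 x1 y1 <= w t1 x1 y1 + quad_test 0 be ka nu t x y"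
  and avg: "!!x X X' f y Y Y' g. trj L t1 x1 x X X' f ==> trj L t1 y1 y Y Y' g ==>
   \<forall>\<^sub>F d in at_right 0. 1/d*LI t1 (t1 + d) (%t. - A t (X t) (in_V j ((2*ka)*.x t + j nu))
    - A t (Y t) (in_V j ((2*ka)*.y t + j nu))) <= et"
 shows "0 <= be + et + (F t1 x1 ((2*ka)*.x1 t1 + j nu) - F t1 y1 (- ((2*ka)*.y1 t1 + j nu)))"
proof -
 define al where "al = w t1 x1 y1 - quad_test 0 be ka nu t1 x1 y1"
 have al: "quad_test al be ka nu t x y = al + quad_test 0 be ka nu t x y" for t x y by (simp add: quad_test_def)
 have start: "quad_test al be ka nu t1 x1 y1 - w t1 x1 y1 = 0" unfolding al by (simp add: al_def)
 have "(INF (t, x, y)\<in>{t1..t1 + d} \<times> traj t1 x1 \<times> traj t1 y1. ereal (quad_test al be ka nu t x y - w t x y)) = 0"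
 proof (rule antisym)
  have "(t1, x1, y1) : {t1..t1 + d} \<times> traj t1 x1 \<times> traj t1 y1" using d xy by simp
  thus "(INF (t, x, y)\<in>{t1..t1 + d} \<times> traj t1 x1 \<times> traj t1 y1. ereal (quad_test al be ka nu t x y - w t x y)) <= 0"
   by (rule INF_lower2) (use start in simp)
  show "0 <= (INF (t, x, y)\<in>{t1..t1 + d} \<times> traj t1 x1 \<times> traj t1 y1. ereal (quad_test al be ka nu t x y - w t x y))"
  proof (rule INF_greatest)
   fix z assume "z : {t1..t1 + d} \<times> traj t1 x1 \<times> traj t1 y1"
   then obtain t x y where z: "z = (t, x, y)" "t1 <= t" "t <= t1 + d" "x : traj t1 x1" "y : traj t1 y1" by auto
   show "0 <= (case z of (t, x, y) => ereal (quad_test al be ka nu t x y - w t x y))"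
    using le[OF z(2-)] unfolding z(1) al by (simp add: al_def)
  qed
 qed
 moreover have "t1 + d : {t1<..T}" using d by simp
 ultimately have "quad_test al be ka nu : touching_functions T p q j A L w t1 x1 y1"
  using quad_test_C11V[OF t1(1)] start unfolding touching_functions_def by blast
 moreover have "t1 : {0..<T}" using t1 by simp
 ultimately obtain x X X' f y Y Y' g where tr: "trj L t1 x1 x X X' f" "trj L t1 y1 y Y Y' g"
  and ineq: "0 <= ereal be + Limsup (at_right 0) (%d. ereal (1/d*(LI t1 (t1 + d) (%t. - A t (X t) (in_V j ((2*ka)*.x t + j nu))
    - A t (Y t) (in_V j ((2*ka)*.y t + j nu)))))) + ereal (F t1 x1 ((2*ka)*.x1 t1 + j nu) - F t1 y1 (- ((2*ka)*.y1 t1 + j nu)))"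
  using subsolution quad_test_derivatives[OF t1(1), of T al be ka nu] xy(1,2) unfolding viscosity_subsolution_def by blast
 have "Limsup (at_right 0) (%d. ereal (1/d*(LI t1 (t1 + d) (%t. - A t (X t) (in_V j ((2*ka)*.x t + j nu))
    - A t (Y t) (in_V j ((2*ka)*.y t + j nu)))))) <= ereal et" by (rule Limsup_bounded) (use avg[OF tr] in eventually_elim, simp)
 hence "0 <= ereal be + ereal et + ereal (F t1 x1 ((2*ka)*.x1 t1 + j nu) - F t1 y1 (- ((2*ka)*.y1 t1 + j nu)))"
  by (intro order_trans[OF ineq] add_mono) auto
 thus ?thesis by simp
qed

text \<open>A function of time alone with slope \<open>- (D + 1)\<close> would touch
  \<open>w\<close>. Its gradients vanish, so the operator terms disappear and the Hamiltonian
  contributes exactly \<open>D\<close>, which leaves \<open>0 <= - 1\<close>.\<close>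

lemma no_fast_decrease: assumes t1: "t0 <= t1" "t1 < T" and K1: "x1 : K" "y1 : K"
  and dec: "!!C. EX d>0. t1 + d <= T & (ALL t:{t1..t1 + d}. ALL x:traj t1 x1. ALL y:traj t1 y1. w t x y <= w t1 x1 y1 - C*(t - t1))"
 shows False
proof -
 define D where "D = F t1 x1 0 - F t1 y1 0"
 have t1': "0 <= t1" using t1 t0 by simp
 obtain d where d: "0 < d" "t1 + d <= T" "ALL t:{t1..t1 + d}. ALL x:traj t1 x1. ALL y:traj t1 y1. w t x y <= w t1 x1 y1 - (D + 1)*(t - t1)"
  using dec by blast
 have i0: "in_V j 0 = 0" using in_V_j[of 0] by simp
 have "0 <= - (D + 1) + 0 + (F t1 x1 ((2*0)*.x1 t1 + j 0) - F t1 y1 (- ((2*0)*.y1 t1 + j 0)))"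
 proof (rule touching_inequality[OF t1' t1(2) _ _ K_continues[OF t1 K1(1)] K_continues[OF t1 K1(2)] d(1,2)])
  show "w t x y + quad_test 0 (- (D + 1)) 0 0 t1 x1 y1 <= w t1 x1 y1 + quad_test 0 (- (D + 1)) 0 0 t x y"
   if "t1 <= t" "t <= t1 + d" "x : traj t1 x1" "y : traj t1 y1" for t x y
   using d(3)[rule_format, of t x y] that by (simp add: quad_test_def algebra_simps)
 qed (use K1 K_Om i0 in auto)
 thus False by (simp add: D_def)
qed

text \<open>If the energy failed to drop at rate \<open>C\<close> on arbitrarily short intervals,
  the energy estimate would give times tending to \<open>t1\<close> at which the
  \<open>V\<close>-norms stay bounded. By compactness of the trajectories the states there converge
  to \<open>x1 t1\<close>, and weak closedness of balls would put it into \<open>V\<close>.\<close>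

lemma outside_V: assumes t1: "t0 <= t1" "t1 < T" and K1: "x1 : K" and out: "x1 t1 ~: range j"
 shows "EX d>0. t1 + d <= T & (ALL t:{t1..t1 + d}. ALL x:traj t1 x1. nsq (x t) <= nsq (x1 t1) - C*(t - t1))"
proof (rule ccontr)
 assume neg: "~ ?thesis"
 have t1': "0 <= t1" using t1 t0 by simp
 define de where "de n = (T - t1)*inverse (real (Suc n))" for n
 have de: "0 < de n" "t1 + de n <= T" for n
 proof -
  show "0 < de n" using t1 by (simp add: de_def)
  have "de n <= (T - t1)*1" unfolding de_def using t1 by (intro mult_left_mono) (auto simp: field_simps)
  thus "t1 + de n <= T" by simp
 qed
 have "EX t x. t : {t1..t1 + de n} & x : traj t1 x1 & nsq (x1 t1) - C*(t - t1) < nsq (x t)" for n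
  using neg de[of n] by (meson not_less)
 then obtain tn xn where tx: "!!n. tn n : {t1..t1 + de n}" "!!n. xn n : traj t1 x1"
  "!!n. nsq (x1 t1) - C*(tn n - t1) < nsq (xn n (tn n))" by metis
 have "EX X X' f. trj L t1 x1 (xn n) X X' f" for n using tx(2) by (simp add: trajectories_def)
 then obtain X X' f where tr: "!!n. trj L t1 x1 (xn n) (X n) (X' n) (f n)" by metis
 \<comment> \<open>The mean of the \<open>p\<close>-th powers that the energy estimate permits when
   the energy drops more slowly than at rate \<open>C\<close>; a lower bound \<open>B + 1\<close>
   throughout the interval contradicts it.\<close>
 define B where "B = (C1 + C)/(2 * c2)"
 have "EX s:{t1..tn n}. xn n s = j (X n s) & norm (X n s) powr p <= B + 1" for n
 proof (rule ccontr)
  assume no: "~ (EX s:{t1..tn n}. xn n s = j (X n s) & norm (X n s) powr p <= B + 1)"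
  note D = trajectoryD[OF tr[of n] t1' t1(2) L0]
  have tT: "tn n <= T" "t1 <= tn n" using tx(1)[of n] de[of n] by auto
  have "xn n t1 = x1 t1" using D(2)[of t1] t1' by simp
  hence lt: "t1 < tn n" using tx(3)[of n] tT by (cases "tn n = t1") auto
  have "LI t1 (tn n) (%_. B + 1) <= LI t1 (tn n) (%r. norm (X n r) powr p)"
  proof (rule LI_mono_AE)
   show "intg t1 (tn n) (%r. norm (X n r) powr p)"
    by (rule Vfun_intg[OF Vfun_subinterval[OF solvesD(2)[OF D(3)] order_refl tT(1)]])
   show "AE r in leb t1 (tn n). B + 1 <= norm (X n r) powr p"
    using AE_sub[OF solvesD(3)[OF D(3)] order_refl tT(1)] AE_space by eventually_elim (use no in auto)
  qed simp
  hence "(B + 1)*(tn n - t1) <= LI t1 (tn n) (%r. norm (X n r) powr p)" using tT by (simp add: LI_const mult.commute)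
  hence "2 * c2*((B + 1)*(tn n - t1)) <= 2 * c2*LI t1 (tn n) (%r. norm (X n r) powr p)" using c2 by (intro mult_left_mono) auto
  moreover have "2 * c2*((B + 1)*(tn n - t1)) = (C1 + C)*(tn n - t1) + 2 * c2*(tn n - t1)"
   using c2 by (simp add: B_def field_simps)
  moreover have "0 < 2 * c2*(tn n - t1)" using c2 lt by simp
  ultimately show False using K_energy[OF t1 K1 tr[of n] tT(2,1)] tx(3)[of n] unfolding distrib_right by linarith
 qed
 then obtain s where s: "!!n. s n : {t1..tn n}" "!!n. xn n (s n) = j (X n (s n))" "!!n. norm (X n (s n)) powr p <= B + 1" by metis
 obtain r :: "nat => nat" and x where r: "strict_mono r" "x : traj t1 x1" "path_limit T (%n. xn (r n)) x"
  using trajectories_compact[OF t1' t1(2) L0, of x1 xn] tx(2) K1 K_Om Om_paths unfolding path_limit_def by blast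
 have xK: "x : K" using K_glue[OF t1 K1] r by blast
 have x1: "x t1 = x1 t1" using r(2) trajectoryD(2)[OF _ t1' t1(2) L0, of x1 x] t1' unfolding trajectories_def by fastforce
 have "de ----> (T - t1)*0" unfolding de_def by (intro tendsto_mult tendsto_const LIMSEQ_inverse_real_of_nat)
 hence "(%n. t1 + de n) ----> t1 + 0" by (intro tendsto_add tendsto_const) simp
 hence u: "(%n. t1 + de n) ----> t1" by simp
 have "s ----> t1"
 proof (rule tendsto_sandwich[OF _ _ tendsto_const u])
  show "EVN n. t1 <= s n" using s(1) by (intro always_eventually) auto
  show "EVN n. s n <= t1 + de n"
  proof (intro always_eventually allI)
   fix n show "s n <= t1 + de n" using s(1)[of n] tx(1)[of n] by auto
  qed
 qed
 hence sr: "(%n. s (r n)) ----> t1" using LIMSEQ_subseq_LIMSEQ[OF _ r(1)] by (simp add: comp_def)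
 have sT: "s n : {0..T}" for n using s(1)[of n] tx(1)[of n] de(2)[of n] t1' by auto
 have "(%n. xn (r n) (s (r n))) ----> x t1" by (rule path_limit_eval[OF r(3) K_continuous[OF xK] sT _ sr]) (use t1 t1' in auto)
 hence lim: "(%n. j (X (r n) (s (r n)))) ----> x1 t1" by (simp add: s(2) x1)
 have "norm (X (r n) (s (r n))) <= (B + 1) powr (1/p)" for n
 proof -
  have "(norm (X (r n) (s (r n))) powr p) powr (1/p) <= (B + 1) powr (1/p)" using s(3) p0 by (intro powr_mono2) auto
  thus ?thesis using p0 by (simp add: powr_powr)
 qed
 then obtain v where "j v = x1 t1" using weak_limit_in_range[of "%n. X (r n) (s (r n))", OF _ lim] by blast
 thus False using out by (metis rangeI)
qed

end

text \<open>An indicator on the whole line absorbs the moving endpoint, so dominated convergence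
  applies; the limit endpoint itself is a null set.\<close>

lemma LI_path_limit:
 fixes d :: "real => 'b::real_normed_vector"
 assumes pl: "path_limit T dn d" and c: "cont 0 T d" "!!n. cont 0 T (dn n)" and a: "0 <= a"
  and B: "!!n s. s : {0..T} ==> norm (dn n s) <= B" and t: "!!n. tn n : {a..T}" "t : {a..T}" "tn ----> t"
 shows "(%n. LI a (tn n) (%s. nsq (dn n s))) ----> LI a t (%s. nsq (d s))"
proof -
 have ind: "LI a u g = lint lebesgue (%s. indicator {a..u} s*.g s)" for u and g :: "real => real"
  by (simp add: integral_restrict_space)
 have m: "(%s. indicator {a..u} s*.nsq (z s)) : borel_measurable lebesgue"
  if "cont 0 T z" "u : {a..T}" for z :: "real => 'b" and u
 proof -
  have "(%s. nsq (z s)) : meas a u"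
   by (intro meas_intg[OF cont_intg] continuous_intros continuous_on_subset[OF that(1)]) (use that a in auto)
  thus ?thesis by (simp add: borel_measurable_restrict_space_iff)
 qed
 show ?thesis unfolding ind
 proof (rule integral_dominated_convergence[where w="%s. indicator {a..T} s*.B^2"])
  show "integrable lebesgue (%s. indicator {a..T} s*.B^2)"
   by (intro integrable_scaleR_left integrable_real_indicator) (auto simp: emeasure_lborel_Icc_eq)
  show "AE s in lebesgue. norm (indicator {a..tn n} s*.nsq (dn n s)) <= indicator {a..T} s*.B^2" for n
   by (rule AE_I2) (use t(1)[of n] a B in "auto simp: indicator_def power_mono")
  show "AE s in lebesgue. (%n. indicator {a..tn n} s*.nsq (dn n s)) ----> indicator {a..t} s*.nsq (d s)"
   using AE_lebesgue_neq[of t]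
  proof eventually_elim
   case (elim s)
   consider "s : {a..T}" "s < t" | "s < a" | "t < s" using elim t(2) by force
   thus ?case
   proof cases
    case 1
    have "(%n. nsq (dn n s)) ----> nsq (d s)" by (intro tendsto_intros path_limit_eval[OF pl c(1)]) (use 1 a in auto)
    moreover have "EVN n. s < tn n" by (rule order_tendstoD(1)[OF t(3) 1(2)])
    ultimately show ?thesis using 1 by (auto simp: indicator_def elim!: Lim_transform_eventually eventually_mono)
   next
    case 3
    have "EVN n. tn n < s" by (rule order_tendstoD(2)[OF t(3) 3])
    hence "EVN n. indicator {a..tn n} s*.nsq (dn n s) = 0" by eventually_elim simp
    thus ?thesis using 3 by (simp add: tendsto_eventually)
   qed simp
  qed
 qed (use m c t in auto)
qed

section \<open>The penalised maximum and the comparison argument\<close>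

context doubled_equation
begin

abbreviation "I == %t x y. LI t0 t (%s. nsq (x s - y s))"

text \<open>The squared distance controls the gradients, and its time integral forces limit paths to
  coincide on the whole past. The \<open>l\<close>-term supplies coercivity, the slope
  \<open>c\<close> the strict inequality, and \<open>sg\<close> excludes the bad times.\<close>

definition penalty :: "real => real => real => (real => real) => real => (real => 'b) => (real => 'b) => real" where
 "penalty k l c sg t x y = - k*(nsq (x t - y t) + I t x y) - l*(nsq (x t) + nsq (y t)) + c*t + sg t"

lemma w_nonanticipating: assumes t: "t : {0..T}" and xy: "x : Om" "y : Om" "x' : Om" "y' : Om"
  and eq: "!!s. 0 <= s ==> s <= t ==> x s = x' s & y s = y' s" shows "w t x y <= w t x' y'"
proof (rule field_le_epsilon)
 fix e :: real assume e: "0 < e"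
 have d: "d_infty_pair T (t, x', y') (t, x, y) <= 0"
  using d_infty_pair_le[where T=T and t=t and s=t and x=x' and x'=x and y=y' and y'=y and e=0] T0 eq t by (auto simp: min_def)
 have u: "pm_usc_on (d_infty_pair T) ({0..T} \<times> Om \<times> Om) (%(t, x, y). w t x y)"
  using subsolution by (simp add: viscosity_subsolution_def)
 have m: "(t, x', y') : {0..T} \<times> Om \<times> Om" "(t, x, y) : {0..T} \<times> Om \<times> Om" using t xy by auto
 obtain de where de: "0 < de" "!!b. b : {0..T} \<times> Om \<times> Om ==> d_infty_pair T (t, x', y') b < de ==>
   (case b of (t, x, y) => w t x y) < (case (t, x', y') of (t, x, y) => w t x y) + e"
  using u[unfolded pm_usc_on_def, rule_format, OF m(1) e] by blast
 have "d_infty_pair T (t, x', y') (t, x, y) < de" using d de(1) by linarith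
 from de(2)[OF m(2) this] show "w t x y <= w t x' y' + e" by simp
qed

text \<open>At an interior maximum the squared distance is split at the midpoint \<open>m\<close> of the two endpoints, because only functions of
 one path at a time have a \<open>V\<close>-valued gradient; endpoints outside of \<open>V\<close> and times in \<open>N\<close> are excluded by
 test functions of time alone.\<close>

lemma no_interior_maximum: assumes t1: "t0 <= t1" "t1 < T" and K1: "x1 : K" "y1 : K" and pos: "0 < k" "0 < l" "0 < c"
  and max: "!!t x y. t : {t0..T} ==> x : K ==> y : K ==> w t x y + penalty k l c sg t x y <= w t1 x1 y1 + penalty k l c sg t1 x1 y1"
  and sg: "!!s t. s <= t ==> sg s <= sg t" "!!C. t1 : N ==> EX d>0. ALL t:{t1..t1 + d}. C*(t - t1) <= sg t - sg t1"
  and DV: "closure DV = UNIV" and DH: "closure (to_dual j ` DH) = UNIV"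
  and leb: "t1 ~: N ==> ((%d. LI t1 (t1 + d) a1/d) \<longlongrightarrow> a1 t1) (at_right 0)"
   "!!v h. t1 ~: N ==> v : DV ==> h : DH ==> ((%d. LI t1 (t1 + d) (%t. norm (A t v - to_dual j h) powr q)/d) \<longlongrightarrow> norm (A t1 v - to_dual j h) powr q) (at_right 0)"
  and close: "k*nsq (x1 t1 - y1 t1) <= c/4" and F: "F t1 x1 ((2*k)*.(x1 t1 - y1 t1)) - F t1 y1 ((2*k)*.(x1 t1 - y1 t1)) <= c/8"
  and lip: "!!x z z'. x : paths T ==> abs(F t1 x z - F t1 x z') <= Lz*(1 + running_sup x t1)*norm (z - z')" "0 <= Lz" "4*Lz*(1 + M)*l*M <= c/8"
 shows False
proof -
 have t1': "0 <= t1" using t1 t0 by simp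
 define a where "a = x1 t1"
 define b where "b = y1 t1"
 have ab: "norm a <= M" "norm b <= M" using K_bound K1 t1 t1' by (auto simp: a_def b_def)
 have abM: "nsq (a - b) <= 4*M^2"
 proof -
  have "norm (a - b) <= 2*M" using norm_triangle_ineq4[of a b] ab by simp
  hence "nsq (a - b) <= (2*M)^2" by (rule power_mono) simp
  thus ?thesis by (simp add: power_mult_distrib)
 qed
 define S where "S t = sg t - sg t1" for t
 \<comment> \<open>The maximum property restricted to continuations from \<open>t1\<close>. The
   integral term enters through the growth bound \<open>K_difference\<close>, so that afterwards
   only values at time \<open>t\<close> remain.\<close>
 have G: "w t x y <= w t1 x1 y1 + k*(nsq (x t - y t) - nsq (a - b)) + k*(nsq (a - b) + C1*(t - t1))*(t - t1)
   + l*(nsq (x t) - nsq a) + l*(nsq (y t) - nsq b) - c*(t - t1) - S t"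
  if t: "t1 <= t" "t <= T" and xy: "x : traj t1 x1" "y : traj t1 y1" for t x y
 proof -
  have K: "x : K" "y : K" using K_glue[OF t1] K1 xy by blast+
  have eq: "x s = x1 s" "y s = y1 s" if "0 <= s" "s <= t1" for s
   using xy trajectoryD(2)[OF _ t1' t1(2) L0, of x1 x _ _ _ s] trajectoryD(2)[OF _ t1' t1(2) L0, of y1 y _ _ _ s] that
   unfolding trajectories_def by blast+
  have c: "cont 0 T (%s. nsq (x s - y s))" by (intro continuous_intros K_continuous K)
  have i: "intg u v (%s. nsq (x s - y s))" if "0 <= u" "v <= T" for u v
   by (intro cont_intg continuous_on_subset[OF c]) (use that in auto)
  have "I t x y = I t1 x y + LI t1 t (%s. nsq (x s - y s))" by (rule LI_combine[symmetric, OF i]) (use t t1 t0 in auto)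
  moreover have "I t1 x y = I t1 x1 y1" by (rule LI_cong) (use eq t0 in auto)
  moreover have "LI t1 t (%s. nsq (x s - y s)) <= LI t1 t (%_. nsq (a - b) + C1*(t - t1))"
  proof (rule LI_mono_AE[OF i[OF t1' t(2)] intg_const], rule AE_I2)
   fix s assume "s : space (leb t1 t)"
   hence s: "t1 <= s" "s <= t" "s <= T" using t by auto
   have "C1*(s - t1) <= C1*(t - t1)" using s C10 by (intro mult_left_mono) auto
   thus "nsq (x s - y s) <= nsq (a - b) + C1*(t - t1)" using K_difference[OF t1 K1 xy s(1,3)] by (simp add: a_def b_def)
  qed
  moreover have "LI t1 t (%_. nsq (a - b) + C1*(t - t1)) = (nsq (a - b) + C1*(t - t1))*(t - t1)" by (rule LI_const[OF t(1)])
  ultimately have "I t x y - I t1 x1 y1 <= (nsq (a - b) + C1*(t - t1))*(t - t1)" by linarith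
  hence "k*(I t x y - I t1 x1 y1) <= k*((nsq (a - b) + C1*(t - t1))*(t - t1))" using pos by (intro mult_left_mono) auto
  moreover have "w t x y + penalty k l c sg t x y <= w t1 x1 y1 + penalty k l c sg t1 x1 y1" using max[of t x y] K t t1 by simp
  ultimately show ?thesis unfolding penalty_def a_def b_def S_def by (simp add: algebra_simps)
 qed
 define B where "B = k*C1 + k*(4*M^2 + C1*T)"
 have xK: "nsq (x t) <= nsq (z t1) + C1*(t - t1)" if z: "z : K" "x : traj t1 z" "t1 <= t" "t <= T" for x z t
 proof -
  obtain X X' f where tx: "trj L t1 z x X X' f" using z(2) unfolding trajectories_def by blast
  have "0 <= 2 * c2*LI t1 t (%r. norm (X r) powr p)" using c2 by (simp add: integral_nonneg_AE)
  thus ?thesis using K_energy[OF t1 z(1) tx z(3,4)] by linarith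
 qed
 have G': "w t x y <= w t1 x1 y1 + (k*C1 + k*(4*M^2 + C1*T))*(t - t1) + l*(nsq (x t) - nsq a) + l*(nsq (y t) - nsq b) - S t"
  if t: "t1 <= t" "t <= T" and xy: "x : traj t1 x1" "y : traj t1 y1" for t x y
 proof -
  have "k*(nsq (x t - y t) - nsq (a - b)) <= k*(C1*(t - t1))"
   using K_difference[OF t1 K1 xy t] pos by (intro mult_left_mono) (auto simp: a_def b_def)
  moreover have "k*(nsq (a - b) + C1*(t - t1))*(t - t1) <= k*(4*M^2 + C1*T)*(t - t1)"
   using abM t t1' C10 pos by (intro mult_right_mono mult_left_mono add_mono) auto
  moreover have "0 <= c*(t - t1)" using pos t by simp
  ultimately show ?thesis using G[OF t xy] unfolding distrib_right by linarith
 qed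
 have lx: "l*(nsq (x t) - nsq (z t1)) <= l*C1*(t - t1)" if "z : K" "x : traj t1 z" "t1 <= t" "t <= T" for x z t
  using mult_left_mono[OF xK[OF that], of l] pos by (simp add: algebra_simps)
 have S0: "0 <= S t" if "t1 <= t" for t using sg(1)[OF that] by (simp add: S_def)
 \<comment> \<open>All terms of \<open>G\<close> except the \<open>l\<close>-energies and the clock
   grow at most linearly, with the rate \<open>B\<close>. If these exceptional terms fall faster
   than every linear function, so does \<open>w\<close>, which \<open>no_fast_decrease\<close>
   excludes.\<close>
 have fast: False if dec: "!!C. EX d>0. t1 + d <= T & (ALL t:{t1..t1 + d}. ALL x:traj t1 x1. ALL y:traj t1 y1.
   l*(nsq (x t) - nsq a) + l*(nsq (y t) - nsq b) - S t <= - C*(t - t1))"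
 proof (rule no_fast_decrease[OF t1 K1])
  fix C
  obtain d where d: "0 < d" "t1 + d <= T" "ALL t:{t1..t1 + d}. ALL x:traj t1 x1. ALL y:traj t1 y1.
   l*(nsq (x t) - nsq a) + l*(nsq (y t) - nsq b) - S t <= - (C + B)*(t - t1)" using dec by blast
  have "w t x y <= w t1 x1 y1 - C*(t - t1)" if t: "t : {t1..t1 + d}" and xy: "x : traj t1 x1" "y : traj t1 y1" for t x y
   using d(2) d(3)[rule_format, OF t xy] G'[of t x y] t xy by (simp add: B_def algebra_simps)
  thus "EX d>0. t1 + d <= T & (ALL t:{t1..t1 + d}. ALL x:traj t1 x1. ALL y:traj t1 y1. w t x y <= w t1 x1 y1 - C*(t - t1))"
   using d(1,2) by blast
 qed
 have out: "EX d>0. t1 + d <= T & (ALL t:{t1..t1 + d}. ALL x:traj t1 z. l*(nsq (x t) - nsq (z t1)) <= - (C + l*C1)*(t - t1))"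
  if z: "z : K" "z t1 ~: range j" for z C
 proof -
  obtain d where d: "0 < d" "t1 + d <= T" "ALL t:{t1..t1 + d}. ALL x:traj t1 z. nsq (x t) <= nsq (z t1) - (C + l*C1)/l*(t - t1)"
   using outside_V[OF t1 z] by blast
  have "l*(nsq (x t) - nsq (z t1)) <= l*(- ((C + l*C1)/l*(t - t1)))" if "t : {t1..t1 + d}" "x : traj t1 z" for t x
   using d(3)[rule_format, OF that] pos by (intro mult_left_mono) linarith+
  moreover have "l*(- ((C + l*C1)/l*(t - t1))) = - (C + l*C1)*(t - t1)" for t using pos by (simp, simp add: algebra_simps)
  ultimately show ?thesis using d(1,2) by metis
 qed
 show False
 proof (cases "t1 : N")
  case True
  show False
  proof (rule fast)
   fix C
   obtain d where d: "0 < d" "!!t. t : {t1..t1 + d} ==> (C + 2*(l*C1))*(t - t1) <= S t" using sg(2)[OF True] unfolding S_def by blast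
   have "l*(nsq (x t) - nsq a) + l*(nsq (y t) - nsq b) - S t <= - C*(t - t1)"
    if "t : {t1..t1 + min d (T - t1)}" "x : traj t1 x1" "y : traj t1 y1" for t x y
   proof -
    have "t1 <= t" "t <= T" "t : {t1..t1 + d}" using that(1) by auto
    thus ?thesis using lx[OF K1(1) that(2)] lx[OF K1(2) that(3)] d(2) unfolding a_def b_def by (fastforce simp: algebra_simps)
   qed
   thus "EX d>0. t1 + d <= T & (ALL t:{t1..t1 + d}. ALL x:traj t1 x1. ALL y:traj t1 y1.
     l*(nsq (x t) - nsq a) + l*(nsq (y t) - nsq b) - S t <= - C*(t - t1))"
    using d(1) t1 by (intro exI[of _ "min d (T - t1)"]) auto
  qed
 next
  case N: False
  show False
  proof (cases "a : range j & b : range j")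
   case False
   show False
   proof (rule fast)
    fix C
    obtain d where d: "0 < d" "t1 + d <= T" and dec: "(ALL t:{t1..t1 + d}. ALL x:traj t1 x1. l*(nsq (x t) - nsq a) <= - (C + l*C1)*(t - t1)) |
     (ALL t:{t1..t1 + d}. ALL y:traj t1 y1. l*(nsq (y t) - nsq b) <= - (C + l*C1)*(t - t1))"
     using False out[OF K1(1), of C] out[OF K1(2), of C] unfolding a_def b_def by blast
    have "l*(nsq (x t) - nsq a) + l*(nsq (y t) - nsq b) - S t <= - C*(t - t1)"
     if t: "t : {t1..t1 + d}" and xy: "x : traj t1 x1" "y : traj t1 y1" for t x y
    proof -
     have t': "t1 <= t" "t <= T" using t d by auto
     have "- (C + l*C1)*(t - t1) = - C*(t - t1) - l*C1*(t - t1)" by (simp add: algebra_simps)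
     thus ?thesis using dec t xy lx[OF K1(1) xy(1) t'] lx[OF K1(2) xy(2) t'] S0[OF t'(1)] unfolding a_def b_def by fastforce
    qed
    thus "EX d>0. t1 + d <= T & (ALL t:{t1..t1 + d}. ALL x:traj t1 x1. ALL y:traj t1 y1.
     l*(nsq (x t) - nsq a) + l*(nsq (y t) - nsq b) - S t <= - C*(t - t1))" using d by blast
   qed
  next
   case True
   then obtain va vb where v: "a = j va" "b = j vb" by blast
   define m where "m = (1/2)*.(va + vb)"
   have m: "a + b = 2*.j m" by (simp add: m_def v blinfun.scaleR_right blinfun.add_right)
   \<comment> \<open>With this \<open>nu\<close> and \<open>ka = 2*k + l\<close> the gradients at
     \<open>t1\<close> are \<open>2*k\<close> times \<open>a - b\<close> and its negative, up to the
     \<open>l\<close>-terms: the penalty's own gradients, reproduced by functions of one path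
     each.\<close>
   define nu where "nu = - (2*(2*k))*.m"
   have jnu: "j nu = - (2*k)*.(a + b)" unfolding m by (simp add: nu_def blinfun.minus_right blinfun.scaleR_right)
   define ka where "ka = 2*k + l"
   obtain d where d: "0 < d" "d <= 1" "d*(k*C1) <= c/4" using positive_scale[of "k*C1" "c/4"] pos C10 by auto
   define d' where "d' = min d (T - t1)"
   have d': "0 < d'" "t1 + d' <= T" using d t1 by (auto simp: d'_def)
   \<comment> \<open>Half of the slope \<open>c\<close> pays for the integral term of the penalty.
     The operator terms cost \<open>c/8\<close>, the modulus of \<open>F\<close> and the Lipschitz
     bound for the \<open>l\<close>-terms \<open>c/8\<close> each, and the remaining
     \<open>- c/8\<close> is the contradiction.\<close>
   have "0 <= - (c/2) + c/8 + (F t1 x1 ((2*ka)*.x1 t1 + j nu) - F t1 y1 (- ((2*ka)*.y1 t1 + j nu)))"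
   proof (rule touching_inequality[OF t1' t1(2) _ _ K_continues[OF t1 K1(1)] K_continues[OF t1 K1(2)] d'])
    show "x1 : Om" "y1 : Om" using K1 K_Om by auto
    fix t x y assume t: "t1 <= t" "t <= t1 + d'" and xy: "x : traj t1 x1" "y : traj t1 y1"
    have tT: "t <= T" "t - t1 <= d" using t d' by (auto simp: d'_def)
    have "k*(C1*(t - t1)) <= k*(C1*d)" using tT(2) pos C10 by (intro mult_left_mono) auto
    hence "k*(nsq (a - b) + C1*(t - t1)) <= c/2" using close d(3) by (simp add: a_def b_def algebra_simps)
    hence "k*(nsq (a - b) + C1*(t - t1))*(t - t1) <= c/2*(t - t1)" using t by (intro mult_right_mono) auto
    moreover have "k*(nsq (x t - y t) - nsq (a - b)) <=
     2*k*(nsq (x t) + nsq (y t) - nsq a - nsq b) + inner (x t + y t - (a + b)) (j nu)"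
    proof -
     \<comment> \<open>By the parallelogram identity this square is exactly the difference of the
       two sides.\<close>
     have "0 <= k*nsq (x t + y t - (a + b))" using pos by simp
     thus ?thesis unfolding jnu power2_norm_eq_inner
      by (simp add: inner_diff_left inner_diff_right inner_add_left inner_add_right inner_commute algebra_simps)
    qed
    ultimately show "w t x y + quad_test 0 (- (c/2)) ka nu t1 x1 y1 <= w t1 x1 y1 + quad_test 0 (- (c/2)) ka nu t x y"
     using G[OF t(1) tT(1) xy] S0[OF t(1)] unfolding quad_test_def ka_def a_def[symmetric] b_def[symmetric]
     by (simp add: algebra_simps inner_diff_left inner_add_left)
   next
    fix x X X' f y Y Y' g
    assume tr: "trj L t1 x1 x X X' f" "trj L t1 y1 y Y Y' g"
    note D = trajectoryD[OF tr(1) t1' t1(2) L0] and E = trajectoryD[OF tr(2) t1' t1(2) L0]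
    have "x t1 + y t1 = 2*.j m" using D(2)[of t1] E(2)[of t1] t1' m by (simp add: a_def b_def)
    thus "\<forall>\<^sub>F d in at_right 0. 1/d*LI t1 (t1 + d) (%t. - A t (X t) (in_V j ((2*ka)*.x t + j nu)) - A t (Y t) (in_V j ((2*ka)*.y t + j nu))) <= c/8"
     unfolding nu_def ka_def using pos
     by (intro A_terms[OF D(3) E(3) t1' t1(2) _ _ pos(2) _ DV DH leb(1)[OF N] leb(2)[OF N]]) auto
   qed
   moreover have "F t1 x1 ((2*ka)*.x1 t1 + j nu) - F t1 y1 (- ((2*ka)*.y1 t1 + j nu)) <= c/8 + c/8"
   proof -
    define z where "z = (2*k)*.(a - b)"
    have e1: "(2*ka)*.a + j nu = z + (2*l)*.a" "- ((2*ka)*.b + j nu) = z - (2*l)*.b"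
     unfolding jnu ka_def z_def by (simp_all add: algebra_simps flip: scaleR_add_left)
    have bd: "Lz*(1 + running_sup x t1)*norm ((2*l)*.u) <= Lz*(1 + M)*(2*l*M)" if "x : K" "norm u <= M" for x u
     using that K_running_sup[OF that(1), of t1] running_sup_nonneg[OF K_continuous[OF that(1)], of t1] t1 t1' lip(2) pos M0
     by (intro mult_mono mult_nonneg_nonneg) auto
    have xp: "x1 : paths T" "y1 : paths T" using K1 K_Om Om_paths by auto
    have "abs(F t1 x1 (z + (2*l)*.a) - F t1 x1 z) <= Lz*(1 + M)*(2*l*M)"
     using order_trans[OF lip(1)[OF xp(1), of "z + (2*l)*.a" z]] bd[OF K1(1) ab(1)] by simp
    moreover have "abs(F t1 y1 z - F t1 y1 (z - (2*l)*.b)) <= Lz*(1 + M)*(2*l*M)"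
     using order_trans[OF lip(1)[OF xp(2), of z "z - (2*l)*.b"]] bd[OF K1(2) ab(2)] by simp
    moreover have "Lz*(1 + M)*(2*l*M) + Lz*(1 + M)*(2*l*M) = 4*Lz*(1 + M)*l*M" by (simp add: algebra_simps)
    ultimately show ?thesis using F lip(3) unfolding a_def[symmetric] b_def[symmetric] e1 z_def[symmetric] by linarith
   qed
   ultimately show False using pos by simp
  qed
 qed
qed

lemma penalty_continuous:
 assumes sg: "cont 0 T sg" and mem: "!!n. tn n : {t0..T}" "!!n. xn n : K" "!!n. yn n : K" "t : {t0..T}" "x : K" "y : K"
  and lim: "tn ----> t" "path_limit T xn x" "path_limit T yn y"
 shows "(%n. nsq (xn n (tn n) - yn n (tn n)) + I (tn n) (xn n) (yn n)) ----> nsq (x t - y t) + I t x y"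
  and "(%n. - l*(nsq (xn n (tn n)) + nsq (yn n (tn n))) + c*tn n + sg (tn n)) ----> - l*(nsq (x t) + nsq (y t)) + c*t + sg t"
  and "(%n. penalty k l c sg (tn n) (xn n) (yn n)) ----> penalty k l c sg t x y"
proof -
 have e: "(%n. xn n (tn n)) ----> x t" "(%n. yn n (tn n)) ----> y t"
  by (rule path_limit_eval[OF lim(2) K_continuous[OF mem(5)] in_time[OF mem(1)] in_time[OF mem(4)] lim(1)]
    path_limit_eval[OF lim(3) K_continuous[OF mem(6)] in_time[OF mem(1)] in_time[OF mem(4)] lim(1)])+
 have "(%n. I (tn n) (xn n) (yn n)) ----> I t x y"
  by (rule LI_path_limit[OF path_limit_diff[OF lim(2,3)] _ _ t0(1) _ mem(1,4) lim(1), of "M + M"])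
   (intro continuous_on_diff K_continuous mem order_trans[OF norm_triangle_ineq4 add_mono[OF K_bound K_bound]]; auto)+
 thus 1: "(%n. nsq (xn n (tn n) - yn n (tn n)) + I (tn n) (xn n) (yn n)) ----> nsq (x t - y t) + I t x y"
  by (intro tendsto_intros e)
 have s: "(%n. sg (tn n)) ----> sg t"
  by (rule continuous_on_tendsto_compose[OF sg lim(1) in_time[OF mem(4)]]) (intro always_eventually allI in_time mem(1))
 show 2: "(%n. - l*(nsq (xn n (tn n)) + nsq (yn n (tn n))) + c*tn n + sg (tn n)) ----> - l*(nsq (x t) + nsq (y t)) + c*t + sg t"
  by (intro tendsto_intros e s lim(1))
 show "(%n. penalty k l c sg (tn n) (xn n) (yn n)) ----> penalty k l c sg t x y"
  using tendsto_add[OF tendsto_mult[OF tendsto_const 1, of "- k"] 2] unfolding penalty_def by (simp add: algebra_simps)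
qed

text \<open>Countability of the two dense sets keeps the union of the exceptional sets null; its
  complement consists of the times at which \<open>A_terms\<close> applies.\<close>

lemma regular_times:
 fixes DV :: "'a set" and DH :: "'b set" assumes "countable DV" "countable DH" obtains N where "N : null_sets lebesgue"
  "!!t. t : {0..T} ==> t ~: N ==> ((%d. LI t (t + d) a1/d) \<longlongrightarrow> a1 t) (at_right 0)"
  "!!t v h. t : {0..T} ==> t ~: N ==> v : DV ==> h : DH ==>
   ((%d. LI t (t + d) (%s. norm (A s v - to_dual j h) powr q)/d) \<longlongrightarrow> norm (A t v - to_dual j h) powr q) (at_right 0)"
proof -
 define P where "P t <-> ((%d. LI t (t + d) a1/d) \<longlongrightarrow> a1 t) (at_right 0) \<and>
  (ALL v:DV. ALL h:DH. ((%d. LI t (t + d) (%s. norm (A s v - to_dual j h) powr q)/d) \<longlongrightarrow> norm (A t v - to_dual j h) powr q) (at_right 0))" for t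
 have i: "intg 0 T (%s. norm (A s v - to_dual j h) powr q)" for v h
 proof (rule Dfun_intg[OF Dfun_diff[OF A_const_Dfun to_dual_Dfun(1)]])
  show "AE t in leb 0 T. norm h <= norm h" by simp
 qed auto
 have ai: "intg 0 T a1" by (rule a1_integrable1) auto
 have "AE t in leb 0 T. ALL v:DV. ALL h:DH. ((%d. LI t (t + d) (%s. norm (A s v - to_dual j h) powr q)/d) \<longlongrightarrow> norm (A t v - to_dual j h) powr q) (at_right 0)"
  unfolding AE_ball_countable[OF assms(1)] AE_ball_countable[OF assms(2)] using Lebesgue_diff[OF i] by blast
 with Lebesgue_diff[OF ai] have "AE t in leb 0 T. P t" unfolding P_def by eventually_elim blast
 hence "AE t in lebesgue. t : {0..T} --> P t" by (simp add: AE_on_iff)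
 then obtain N where N: "{t : space lebesgue. ~ (t : {0..T} --> P t)} <= N" "emeasure lebesgue N = 0" "N : sets lebesgue"
  by (rule AE_E)
 have "P t" if "t : {0..T}" "t ~: N" for t using N(1) that by auto
 thus ?thesis using that[of N] N(2,3) unfolding P_def by blast
qed

theorem diagonal_nonpositive: assumes terminal: "!!x. x : Om ==> w T x x <= 0" shows "w t0 x0 x0 <= 0"
proof (rule ccontr)
 define g where "g = w t0 x0 x0"
 assume "~ w t0 x0 x0 <= 0"
 hence g: "0 < g" by (simp add: g_def)
 \<comment> \<open>The slope term and the clock may each use \<open>g/4\<close>, and the
   \<open>l\<close>-term costs at most \<open>g/4\<close> at the starting point, so a quarter of
   \<open>g\<close> is left in \<open>base\<close>.\<close>
 define c where "c = g/(4*T)"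
 have c: "0 < c" "c*T = g/4" using g T0 by (auto simp: c_def)
 obtain Lz where Lz: "0 <= Lz" "!!t x z z'. t : {0..T} ==> x : paths T ==> abs(F t x z - F t x z') <= Lz*(1 + running_sup x t)*norm (z - z')"
  using hamiltonian unfolding admissible_hamiltonian_def by blast
 have t0': "t0 : {0..<T}" using t0 by simp
 have "EX m. modulus_of_continuity m & (ALL ep>0. ALL t:{t0..T}. ALL x:K. ALL y:K.
   F t x ((1/ep)*.(x t - y t)) - F t y ((1/ep)*.(x t - y t)) <= m (nsq (x t - y t)/ep + running_sup (%s. x s - y s) t))"
  using hamiltonian[unfolded admissible_hamiltonian_def, THEN conjunct2, THEN conjunct2, THEN spec, THEN mp, OF L0, THEN bspec, OF t0', THEN bspec, OF x0_path] .
 then obtain m where m: "modulus_of_continuity m" "!!ep t x y. 0 < ep ==> t : {t0..T} ==> x : K ==> y : K ==>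
   F t x ((1/ep)*.(x t - y t)) - F t y ((1/ep)*.(x t - y t)) <= m (nsq (x t - y t)/ep + running_sup (%s. x s - y s) t)" by blast
 have lpos: "0 <= 2*M^2 + 4*Lz*(1 + M)*M" using Lz(1) M0 by simp
 have lmin: "0 < min (g/4) (c/8)" using g c by simp
 obtain l where l: "0 < l" "l*(2*M^2 + 4*Lz*(1 + M)*M) <= min (g/4) (c/8)" using positive_scale[OF lpos lmin] by blast
 have l1: "2*l*M^2 <= g/4" and l2: "4*Lz*(1 + M)*l*M <= c/8"
 proof -
  have "0 <= 2*l*M^2" "0 <= 4*Lz*(1 + M)*l*M" using l(1) Lz(1) M0 by auto
  moreover have "l*(2*M^2 + 4*Lz*(1 + M)*M) = 2*l*M^2 + 4*Lz*(1 + M)*l*M" by (simp add: algebra_simps)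
  ultimately show "2*l*M^2 <= g/4" "4*Lz*(1 + M)*l*M <= c/8" using l(2) by linarith+
 qed
 obtain DV :: "'a set" where DV: "countable DV" "closure DV = UNIV" by (rule countable_dense_V)
 obtain DH :: "'b set" where DH: "countable DH" "closure (to_dual j ` DH) = UNIV" by (rule countable_dense_dual)
 obtain N where N: "N : null_sets lebesgue"
  "!!t. t : {0..T} ==> t ~: N ==> ((%d. LI t (t + d) a1/d) \<longlongrightarrow> a1 t) (at_right 0)"
  "!!t v h. t : {0..T} ==> t ~: N ==> v : DV ==> h : DH ==>
   ((%d. LI t (t + d) (%s. norm (A s v - to_dual j h) powr q)/d) \<longlongrightarrow> norm (A t v - to_dual j h) powr q) (at_right 0)"
  using regular_times[OF DV(1) DH(1)] by blast
 have g4: "0 < g/4" using g by simp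
 obtain sg :: "real => real" where sg: "cont 0 T sg" "!!s t. s <= t ==> sg s <= sg t" "!!t. 0 <= sg t" "!!t. sg t <= g/4"
  "!!t1 C. t1 : N ==> 0 <= t1 ==> EX d>0. ALL t:{t1..t1 + d}. C*(t - t1) <= sg t - sg t1" by (rule steep_clock[OF N(1) g4]) blast
 have "EX t1 x1 y1. t1 : {t0..T} & x1 : K & y1 : K & (ALL t:{t0..T}. ALL x:K. ALL y:K.
   w t x y + penalty k l c sg t x y <= w t1 x1 y1 + penalty k l c sg t1 x1 y1)" for k
  by (rule maximum_exists[of "penalty k l c sg"], (rule penalty_continuous(3)[OF sg(1)]; assumption), blast)
 then obtain tn xn yn where mem: "!!k. tn k : {t0..T}" "!!k. xn k : K" "!!k. yn k : K"
  and max: "!!k t x y. t : {t0..T} ==> x : K ==> y : K ==>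
   w t x y + penalty k l c sg t x y <= w (tn k) (xn k) (yn k) + penalty k l c sg (tn k) (xn k) (yn k)" by metis
 obtain r :: "nat => nat" and ts x y where r: "strict_mono r" "ts : {t0..T}" "x : K" "y : K"
  and lim: "(%n. tn (real (Suc (r n)))) ----> ts" "path_limit T (%n. xn (real (Suc (r n)))) x" "path_limit T (%n. yn (real (Suc (r n)))) y"
  using K_compact[of "%n. tn (real (Suc n))" "%n. xn (real (Suc n))" "%n. yn (real (Suc n))", OF mem] by blast
 define k where "k n = real (Suc (r n))" for n
 define p where "p n = nsq (xn (k n) (tn (k n)) - yn (k n) (tn (k n))) + I (tn (k n)) (xn (k n)) (yn (k n))" for n
 define R where "R n = - l*(nsq (xn (k n) (tn (k n))) + nsq (yn (k n) (tn (k n)))) + c*tn (k n) + sg (tn (k n))" for n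
 define W where "W = w ts x y"
 note lim' = lim[folded k_def]
 have pen: "penalty (k n) l c sg (tn (k n)) (xn (k n)) (yn (k n)) = - k n*p n + R n" for n by (simp add: penalty_def p_def R_def)
 have k0: "0 < k n" for n by (simp add: k_def)
 have I0: "0 <= I t x y" for t x y by (rule integral_nonneg_AE) simp
 have p0: "0 <= p n" for n by (simp add: p_def I0)
 have wl: "EVN n. w (tn (k n)) (xn (k n)) (yn (k n)) < W + e" if "0 < e" for e
  unfolding W_def by (rule w_limsup[OF lim'(2,3) _ _ _ _ in_time[OF mem(1)] in_time[OF r(2)] lim'(1) that]) (use r mem K_Om in auto)
 have Rle: "R n <= g/2" for n
 proof -
  have "c*tn (k n) <= c*T" using mem(1)[of "k n"] c(1) by (intro mult_left_mono) auto
  moreover have "0 <= l*(nsq (xn (k n) (tn (k n))) + nsq (yn (k n) (tn (k n))))" using l(1) by simp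
  ultimately show ?thesis using c(2) sg(4)[of "tn (k n)"] unfolding R_def by simp
 qed
 obtain z where z: "z : K" using trajectories_nonempty[OF t0 L0 x0_path] by blast
 have base: "k n*p n + g/4 <= w (tn (k n)) (xn (k n)) (yn (k n))" for n
 proof -
  \<comment> \<open>The maximum is compared with the diagonal point \<open>(t0, z, z)\<close>, where
    the penalty in \<open>k\<close> vanishes. Up to \<open>t0\<close> the trajectory
    \<open>z\<close> agrees with \<open>x0\<close>, so \<open>w\<close> has the value
    \<open>g\<close> there at least.\<close>
  have eq: "z s = x0 s" if "0 <= s" "s <= t0" for s
   using z trajectoryD(2)[OF _ t0 L0, of x0 z _ _ _ s] that unfolding trajectories_def by blast
  have "g <= w t0 z z" unfolding g_def by (rule w_nonanticipating) (use x0 z K_Om t0 eq in auto)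
  moreover have "- (g/4) <= penalty (k n) l c sg t0 z z"
  proof -
   have "nsq (z t0) <= M^2" using K_bound[OF z, of t0] t0 by (intro power_mono) auto
   hence "l*(nsq (z t0) + nsq (z t0)) <= l*(2*M^2)" using l(1) by (intro mult_left_mono) auto
   moreover have "0 <= c*t0" using c(1) t0 by simp
   ultimately show ?thesis using l1 sg(3)[of t0] by (simp add: penalty_def)
  qed
  moreover have "w t0 z z + penalty (k n) l c sg t0 z z <= w (tn (k n)) (xn (k n)) (yn (k n)) + (- k n*p n + R n)"
   using max[of t0 z z "k n"] z t0 unfolding pen by simp
  ultimately show ?thesis using Rle[of n] by linarith
 qed
 have "nsq (x ts - y ts) + I ts x y <= 0"
 proof (rule tendsto_le[OF sequentially_bot])
  show "p ----> nsq (x ts - y ts) + I ts x y" unfolding p_def[abs_def] by (rule penalty_continuous(1)[OF sg(1) mem r(2-4) lim'])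
  have "(%n. (abs(W) + 1)*inverse (real (Suc n))) ----> (abs(W) + 1)*0" by (intro tendsto_mult tendsto_const LIMSEQ_inverse_real_of_nat)
  thus "(%n. (abs(W) + 1)*inverse (real (Suc n))) ----> 0" by simp
  have "EVN n. w (tn (k n)) (xn (k n)) (yn (k n)) < W + 1" by (rule wl) simp
  thus "EVN n. p n <= (abs(W) + 1)*inverse (real (Suc n))"
  proof eventually_elim
   case (elim n)
   have "real (Suc n)*p n <= k n*p n" unfolding k_def using seq_suble[OF r(1), of n] p0 by (intro mult_right_mono) auto
   hence "real (Suc n)*p n <= abs(W) + 1" using base[of n] elim g by linarith
   thus ?case by (simp add: field_simps)
  qed
 qed
 hence "nsq (x ts - y ts) = 0" "I ts x y = 0" using I0[of ts x y] zero_le_power2[of "norm (x ts - y ts)"] by linarith+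
 hence pz: "norm (x ts - y ts) = 0" "I ts x y = 0" by simp_all
 have xy: "x s = y s" if s: "0 <= s" "s <= ts" for s
 proof (cases "s <= t0")
  case True
  thus ?thesis using r(3,4) trajectoryD(2)[OF _ t0 L0, of x0 x _ _ _ s] trajectoryD(2)[OF _ t0 L0, of x0 y _ _ _ s] s(1)
   unfolding trajectories_def by fastforce
 next
  case False
  have cc: "cont t0 ts (%s. nsq (x s - y s))"
   by (intro continuous_intros continuous_on_subset[OF K_continuous[OF r(3)]] continuous_on_subset[OF K_continuous[OF r(4)]]) (use r(2) t0 in auto)
  have "integral {t0..ts} (%s. nsq (x s - y s)) = 0" using pz(2) LI_eq_integral[OF cont_intg[OF cc]] by simp
  hence "ALL s:{t0..ts}. nsq (x s - y s) = 0" using integral_eq_0_iff[OF cc] False s by simp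
  thus ?thesis using False s by simp
 qed
 have W: "W <= w ts x x" unfolding W_def by (rule w_nonanticipating) (use r in_time K_Om xy in auto)
 have tsT: "ts < T"
 proof (rule ccontr)
  assume "~ ts < T"
  hence "ts = T" using r(2) by simp
  hence "W <= 0" using W terminal[of x] r(3) K_Om by auto
  moreover obtain n where "w (tn (k n)) (xn (k n)) (yn (k n)) < W + g/8" using eventually_happens[OF wl[of "g/8"]] g by auto
  moreover have "0 <= k n*p n" using k0[of n] p0[of n] by simp
  ultimately show False using base[of n] g by linarith
 qed
 have "(m \<longlongrightarrow> 0) (at_right 0)" "m 0 = 0" using m(1) by (auto simp: modulus_of_continuity_def)
 hence "\<forall>\<^sub>F s in at_right 0. m s < c/8" using c(1) by (intro order_tendstoD(2)) auto
 then obtain rh where rh: "0 < rh" "!!s. 0 < s ==> s < rh ==> m s < c/8" unfolding eventually_at_right_field by blast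
 have mrh: "m s <= c/8" if "0 <= s" "s < rh" for s using rh(2)[of s] that `m 0 = 0` c(1) by (cases "s = 0") auto
 \<comment> \<open>The argument of the modulus will be at most \<open>3*e\<close>, hence below
   \<open>rh\<close>; the bound \<open>c/4\<close> is the closeness required by
   \<open>no_interior_maximum\<close>.\<close>
 define e where "e = min (rh/4) (c/4)"
 have e: "0 < e" "4*e <= rh" "e <= c/4" using rh c by (auto simp: e_def)
 \<comment> \<open>Comparison with the diagonal point \<open>(ts, x, x)\<close>: the penalised
   maxima cannot exceed its value in the limit, by upper semicontinuity, so the whole penalty in
   \<open>k\<close> tends to zero and not only \<open>p\<close>.\<close>
 have ev1: "EVN n. k n*p n < e"
 proof -
  have Rl: "R ----> - l*(nsq (x ts) + nsq (y ts)) + c*ts + sg ts" unfolding R_def[abs_def]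
   by (rule penalty_continuous(2)[OF sg(1) mem r(2-4) lim'])
  have "EVN n. R n < - l*(nsq (x ts) + nsq (y ts)) + c*ts + sg ts + e/2" by (rule order_tendstoD(2)[OF Rl]) (use e in simp)
  with wl[OF half_gt_zero[OF e(1)]] show ?thesis
  proof eventually_elim
   case (elim n)
   have "penalty (k n) l c sg ts x x = - l*(nsq (x ts) + nsq (y ts)) + c*ts + sg ts"
    using xy[of ts] r(2) t0 by (simp add: penalty_def)
   moreover have "w ts x x + penalty (k n) l c sg ts x x <= w (tn (k n)) (xn (k n)) (yn (k n)) + (- k n*p n + R n)"
    using max[OF r(2,3,3), of "k n"] unfolding pen .
   ultimately show ?case using elim W by linarith
  qed
 qed
 have ev2: "EVN n. running_sup (%s. xn (k n) s - yn (k n) s) (tn (k n)) <= e"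
 proof -
  define d where "d s = x s - y s" for s
  have dc: "cont 0 T d" unfolding d_def by (intro continuous_on_diff K_continuous r)
  obtain de where de: "0 < de" "!!s. s : {0..T} ==> dist s ts < de ==> dist (d s) (d ts) < e/2"
   using dc in_time[OF r(2)] half_gt_zero[OF e(1)] unfolding continuous_on_iff by metis
  have dts: "d ts = 0" using pz(1) by (simp add: d_def)
  obtain N where N: "!!n s. N <= n ==> s : {0..T} ==> norm (xn (k n) s - yn (k n) s - d s) <= e/2"
   using path_limit_diff[OF lim'(2,3)] half_gt_zero[OF e(1)] unfolding path_limit_def d_def by metis
  have "EVN n. dist (tn (k n)) ts < de" using tendstoD[OF lim'(1) de(1)] .
  moreover have "EVN n. N <= n" by (rule eventually_ge_at_top)
  ultimately show ?thesis
  proof eventually_elim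
   case (elim n)
   have tT: "0 <= tn (k n)" "tn (k n) <= T" using mem(1)[of "k n"] t0 by auto
   show ?case
   proof (rule running_sup_le[OF tT(1)])
    fix s assume s: "0 <= s" "s <= tn (k n)"
    have "norm (d s) <= e/2"
    proof (cases "s <= ts")
     case True
     thus ?thesis using xy[of s] s e by (simp add: d_def)
    next
     case False
     hence "dist s ts < de" using elim(1) s by (simp add: dist_real_def)
     thus ?thesis using de(2)[of s] s tT dts by (simp add: dist_norm)
    qed
    thus "norm (xn (k n) s - yn (k n) s) <= e"
     using N[OF elim(2), of s] s tT norm_triangle_sub[of "xn (k n) s - yn (k n) s" "d s"] by simp
   qed
  qed
 qed
 have ev3: "EVN n. tn (k n) < T" by (rule order_tendstoD(2)[OF lim'(1) tsT])
 have "EVN n. k n*p n < e & running_sup (%s. xn (k n) s - yn (k n) s) (tn (k n)) <= e & tn (k n) < T"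
  using ev1 ev2 ev3 by eventually_elim blast
 then obtain n where n: "k n*p n < e" "running_sup (%s. xn (k n) s - yn (k n) s) (tn (k n)) <= e" "tn (k n) < T"
  using eventually_happens'[OF sequentially_bot] by blast
 define t1 where "t1 = tn (k n)"
 define x1 where "x1 = xn (k n)"
 define y1 where "y1 = yn (k n)"
 have K1: "x1 : K" "y1 : K" "t0 <= t1" "t1 < T" "t1 : {t0..T}" using mem[of "k n"] n(3) by (auto simp: t1_def x1_def y1_def)
 have kp: "k n*nsq (x1 t1 - y1 t1) <= e"
 proof -
  have "nsq (x1 t1 - y1 t1) <= p n" using I0[of t1 x1 y1] by (simp add: p_def t1_def x1_def y1_def)
  hence "k n*nsq (x1 t1 - y1 t1) <= k n*p n" using k0[of n] by (intro mult_left_mono) auto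
  thus ?thesis using n(1) by simp
 qed
 have F: "F t1 x1 ((2*k n)*.(x1 t1 - y1 t1)) - F t1 y1 ((2*k n)*.(x1 t1 - y1 t1)) <= c/8"
 proof -
  \<comment> \<open>The structure condition on \<open>F\<close> is used with the parameter
    \<open>1/(2*k n)\<close>, which matches the gradient \<open>2*k n\<close> times the
    difference.\<close>
  define s where "s = nsq (x1 t1 - y1 t1)/(1/(2*k n)) + running_sup (%s. x1 s - y1 s) t1"
  have "0 <= running_sup (%s. x1 s - y1 s) t1"
   by (rule running_sup_nonneg[OF continuous_on_diff[OF K_continuous[OF K1(1)] K_continuous[OF K1(2)]]]) (use K1 t0 in auto)
  moreover have "s = 2*(k n*nsq (x1 t1 - y1 t1)) + running_sup (%s. x1 s - y1 s) t1" by (simp add: s_def)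
  moreover have "0 <= k n*nsq (x1 t1 - y1 t1)" using k0[of n] by simp
  ultimately have "0 <= s" "s < rh" using kp n(2)[folded t1_def x1_def y1_def] e by linarith+
  hence "m s <= c/8" by (rule mrh)
  moreover have "0 < 1/(2*k n)" using k0[of n] by simp
  ultimately show ?thesis using m(2)[of "1/(2*k n)" t1 x1 y1] K1 unfolding s_def by simp
 qed
 have t1T: "t1 : {0..T}" using in_time[OF K1(5)] .
 show False
  by (rule no_interior_maximum[OF K1(3,4,1,2) k0 l(1) c(1) max[of _ _ _ "k n", folded t1_def x1_def y1_def] sg(2) sg(5) DV(2) DH(2) N(2)[OF t1T] N(3)[OF t1T] order_trans[OF kp e(3)] F Lz(2)[OF t1T] Lz(1) l2])
   (use t1T in auto)
qed

end

theorem theorem4p2: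
  fixes T p q L :: real
    and j :: "'v::{banach, second_countable_topology} \<Rightarrow>\<^sub>L 'h::{real_inner, complete_space}"
    and A :: "real \<Rightarrow> 'v \<Rightarrow> 'v \<Rightarrow>\<^sub>L real"
    and F :: "real \<Rightarrow> (real \<Rightarrow> 'h) \<Rightarrow> 'h \<Rightarrow> real"
    and xs :: 'h
    and \<Omega> :: "(real \<Rightarrow> 'h) set"
    and w :: "real \<Rightarrow> (real \<Rightarrow> 'h) \<Rightarrow> (real \<Rightarrow> 'h) \<Rightarrow> real"
  assumes "0 < T" and "2 \<le> p" and "1 < q" and "1 / p + 1 / q = 1"
    and "reflexive_space TYPE('v)"
    and "dense_compact_embedding j"
    and "admissible_operator T p q A"
    and "admissible_hamiltonian T p q j A F"
    and "0 \<le> L"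
    and "trajectories T p q j A L 0 (restrict (\<lambda>_. xs) {0..T}) \<subseteq> \<Omega>"
    and "\<Omega> \<subseteq> paths T"
    and "\<forall>t\<^sub>0\<in>{0..<T}. \<forall>x\<^sub>0\<in>\<Omega>. trajectories T p q j A L t\<^sub>0 x\<^sub>0 \<subseteq> \<Omega>"
    and "viscosity_subsolution T p q j A F L \<Omega> w"
    and "\<forall>x\<in>\<Omega>. w T x x \<le> 0"
  shows "\<forall>t\<in>{0..T}. \<forall>x\<in>\<Omega>. w t x x \<le> 0"
proof (intro ballI)
 fix t x assume t: "t : {0..T}" and x: "x : \<Omega>"
 interpret E: evolution_exponents j p q by unfold_locales (use assms in auto)
 obtain b1 c1 c2 where A:
  "!!x v. (%t. A t x v) : meas 0 T"
  "AE t in leb 0 T. ALL x y. 0 <= (A t x - A t y) (x - y)"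
  "AE t in leb 0 T. ALL x y v. continuous_on {0..1} (%s::real. A t (x + s*.y) v)"
  "(b1 :: real => real) : Lp q {0..T}" "0 <= c1"
  "AE t in leb 0 T. ALL x. norm (A t x) <= b1 t + c1 * norm x powr (p - 1)"
  "0 < c2" "AE t in leb 0 T. ALL x. c2 * norm x powr p <= A t x x"
  using assms(7) unfolding admissible_operator_def by blast
 \<comment> \<open>The growth bound \<open>b1\<close> may take negative values; its absolute value
   is an equally valid bound and satisfies \<open>a1_nonneg\<close>.\<close>
 have mono: "AE t in leb 0 T. E.monotone_op \<bar>b1 t\<bar> c1 c2 (A t)"
  using A(2,3,6,8)
 proof eventually_elim
  case (elim t)
  have "norm (A t x) <= \<bar>b1 t\<bar> + c1 * norm x powr (p - 1)" for x using elim(3) abs_ge_self[of "b1 t"] by (meson add_right_mono order_trans)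
  thus ?case using elim unfolding E.monotone_op_def by blast
 qed
 have b: "strongly_measurable {0..T} b1" "intg 0 T (%t. norm (b1 t) powr q)" using A(4) by (auto simp: Lp_def)
 have bm: "b1 : meas 0 T" by (rule strongly_measurable_imp_borel[OF b(1)]) simp
 show "w t x x <= 0"
 proof (cases "t = T")
  case True
  thus ?thesis using assms(14) x by blast
 next
  case False
  then interpret D: doubled_equation j p q T A "%t. \<bar>b1 t\<bar>" c1 c2 L F \<Omega> w t x
   by unfold_locales (use assms A mono b bm t x in auto)
  show ?thesis by (rule D.diagonal_nonpositive) (use assms(14) in blast)
 qed
qed

end
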